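(* Let $n\ge 1$, let $\beta'$ be a positive $n$-braid of length $c$, and let $\beta=\Delta_n^2\,\beta'\in B_n$, where $\Delta_n^2$ is the positive full twist. Let $N\ge 0$ be an integer. Then there exist polynomials $p_N(\overline\beta;t)$, $q_N(\overline\beta;t)$ and $\tilde q_N(\overline\beta;t)$ in $t$ such that $$J_{N+1}(\overline\beta;t)=(-1)^{N(n+c+1)}t^{\frac{N((n-1)^2+c-1)}{2}}\left(\frac{1+t^{nN+1}p_N(\overline\beta;t)}{1-t}\right)=(-1)^{N(n+c+1)}t^{\frac{N((n-1)^2+c-1)}{2}}\left(\sum_{i=0}^{nN}t^i+t^{nN+1}q_N(\overline\beta;t)\right)$$ and $$J'_{N+1}(\overline\beta;t)=(-1)^{N(n+c+1)}t^{\frac{N((n-1)^2+c)}{2}}\left(\frac{1+t^{nN+1}p_N(\overline\beta;t)}{1-t^{N+1}}\right)=(-1)^{N(n+c+1)}t^{\frac{N((n-1)^2+c)}{2}}\left(\sum_{i=0}^{n-1}t^{i(N+1)}+t^{nN+1}\tilde q_N(\overline\beta;t)\right),$$ where the same $p_N$ appears in both displays.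
   Context: $B_n$ is the braid group with standard generators $\sigma_i$ (positive crossings when strands are oriented in parallel); a positive braid of length $c$ is a product of $c$ generators $\sigma_i$ (no inverses). $\Delta_n^2=(\sigma_1\cdots\sigma_{n-1})^n$; $\overline\beta$ is the closure of $\beta$, with all strands oriented in parallel. Colored Jones polynomial: $J_N(L;t)$ is the colored Jones polynomial of the oriented link $L$, with every component colored by the $N$-dimensional irreducible representation of $\mathfrak{sl}_2(\mathbb C)$, normalized so that $J_2(L;t)=(t^{1/2}+t^{-1/2})V_L(t)$ and $J_N(\bigcirc;t)=[N]:=\frac{t^{N/2}-t^{-N/2}}{t^{1/2}-t^{-1/2}}$. Here $V_L$ is the Jones polynomial with $t^{-1}V_{L_+}-tV_{L_-}=(t^{1/2}-t^{-1/2})V_{L_0}$, $V_\bigcirc=1$. The normalized version is $J'_N(L;t)=J_N(L;t)/[N]$. Explicitly, let $D$ be a diagram of $L$ with writhe $w(D)$, and let $\langle\cdot\rangle$ be the Kauffman bracket: $\langle\text{crossing}\rangle=A\langle A\text{-smoothing}\rangle+A^{-1}\langle B\text{-smoothing}\rangle$, $\langle E\sqcup\bigcirc\rangle=\delta\langle E\rangle$, $\delta=-A^2-A^{-2}$, $\langle\bigcirc\rangle=1$, $\langle\emptyset\rangle=\delta^{-1}$, with conventions such that $V_L(A^{-4})=(-A^3)^{-w(D)}\langle D\rangle$ (with $t^{1/2}=A^{-2}$). Then $$J_{N+1}(L;A^{-4})=\bigl((-1)^NA^{N^2+2N}\bigr)^{-w(D)}(-1)^{N-1}(A^2+A^{-2})\,\langle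 S_N(D)\rangle .$$ Here $S_N(x)=\sum_{j=0}^{\lfloor N/2\rfloor}(-1)^j\binom{N-j}{j}x^{N-2j}$, and $S_N(D)$ is the linear combination of blackboard cablings of $D$ obtained by replacing each component by the combination $S_N$ of its parallel blackboard cables, where $x^r$ means $r$ parallel copies; this is extended multilinearly over the components. For a knot diagram, $S_N(D)=\sum_{j}(-1)^j\binom{N-j}{j}D^{(N-2j)}$, where $D^{(r)}$ is the blackboard $r$-cable. *)

theory Defs
  imports
    "HOL-Library.FuncSet"
    "HOL-Combinatorics.Orbits"
    "HOL-Combinatorics.Transposition"
    "HOL-Computational_Algebra.Polynomial"
    "HOL-Computational_Algebra.Fraction_Field"
begin

text \<open>
  Elements of the braid group on \<open>n\<close> strands are given by words in the generators
  \<open>Sig i\<close> and their inverses \<open>SigInv i\<close>, where \<open>1 \<le> i < n\<close>. The letter of index \<open>i\<close>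
  is a crossing between the strands in positions \<open>i\<close> and \<open>i + 1\<close>; positions are
  numbered \<open>1, \<dots>, n\<close>. Two words represent the same braid iff they are related
  by \<open>braid_eq n\<close>, the congruence of Artin's presentation.
\<close>

datatype braid_letter = Sig nat | SigInv nat

type_synonym braid_word = "braid_letter list"

inductive braid_step :: "nat \<Rightarrow> braid_word \<Rightarrow> braid_word \<Rightarrow> bool" for n :: nat where
  cancel_right: "1 \<le> i \<Longrightarrow> i < n \<Longrightarrow> braid_step n (u @ [Sig i, SigInv i] @ v) (u @ v)"
| cancel_left: "1 \<le> i \<Longrightarrow> i < n \<Longrightarrow> braid_step n (u @ [SigInv i, Sig i] @ v) (u @ v)"
| far_comm: "1 \<le> i \<Longrightarrow> i + 2 \<le> j \<Longrightarrow> j < n \<Longrightarrow>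
    braid_step n (u @ [Sig i, Sig j] @ v) (u @ [Sig j, Sig i] @ v)"
| braid_rel: "1 \<le> i \<Longrightarrow> i + 1 < n \<Longrightarrow>
    braid_step n (u @ [Sig i, Sig (i + 1), Sig i] @ v) (u @ [Sig (i + 1), Sig i, Sig (i + 1)] @ v)"

definition braid_eq :: "nat \<Rightarrow> braid_word \<Rightarrow> braid_word \<Rightarrow> bool" where
  "braid_eq n = equivclp (braid_step n)"

definition full_twist :: "nat \<Rightarrow> braid_word" where
  "full_twist n = concat (replicate n (map Sig [1..<n]))"

text \<open>All strands of a closed braid are oriented in parallel, so \<open>Sig i\<close> is a positive
  and \<open>SigInv i\<close> a negative crossing.\<close>

fun crossing_sign :: "braid_letter \<Rightarrow> int" where
  "crossing_sign (Sig i) = 1"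
| "crossing_sign (SigInv i) = -1"

definition writhe :: "braid_word \<Rightarrow> int" where
  "writhe w = sum_list (map crossing_sign w)"

text \<open>The strand that starts in position \<open>i\<close> ends in position \<open>strand_perm w i\<close>, so the
  components of the closure are the orbits of \<open>strand_perm w\<close> on the positions.\<close>

fun letter_index :: "braid_letter \<Rightarrow> nat" where
  "letter_index (Sig i) = i"
| "letter_index (SigInv i) = i"

fun strand_perm :: "braid_word \<Rightarrow> nat \<Rightarrow> nat" where
  "strand_perm [] = id"
| "strand_perm (g # w) = strand_perm w \<circ> transpose (letter_index g) (letter_index g + 1)"

definition component :: "braid_word \<Rightarrow> nat \<Rightarrow> nat set" where
  "component w i = orbit (strand_perm w) i"

definition components :: "nat \<Rightarrow> braid_word \<Rightarrow> nat set set" where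
  "components n w = component w ` {1..n}"

text \<open>
  \<open>cable r w\<close> is the word obtained by replacing the strand starting in position \<open>i\<close> by
  \<open>r i\<close> parallel strands; it is a word on \<open>\<Sum>i=1..n. r i\<close> strands. If \<open>r\<close> is constant on
  components then its closure is the blackboard cable of the closure of \<open>w\<close>. A crossing of
  \<open>a\<close> by \<open>b\<close> parallel strands with \<open>d\<close> strands to the left of it becomes a grid of
  \<open>a * b\<close> crossings of the same kind: the \<open>b\<close> strands on the right are moved in turn, from
  left to right, across the \<open>a\<close> strands on the left.
\<close>

definition block_crossing :: "nat \<Rightarrow> nat \<Rightarrow> nat \<Rightarrow> nat list" where
  "block_crossing d a b = concat (map (\<lambda>q. rev [d + q + 1..<d + q + a + 1]) [0..<b])"

definition cable_indices :: "(nat \<Rightarrow> nat) \<Rightarrow> nat \<Rightarrow> nat list" where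
  "cable_indices r i = block_crossing (\<Sum>j\<in>{1..<i}. r j) (r i) (r (i + 1))"

fun cable :: "(nat \<Rightarrow> nat) \<Rightarrow> braid_word \<Rightarrow> braid_word" where
  "cable r [] = []"
| "cable r (Sig i # w) = map Sig (cable_indices r i) @ cable (r \<circ> transpose i (i + 1)) w"
| "cable r (SigInv i # w) = map SigInv (cable_indices r i) @ cable (r \<circ> transpose i (i + 1)) w"

text \<open>All invariants take values in the field of rational functions \<open>\<rat>(A)\<close>, realised as
  the fraction field of \<open>\<int>[A]\<close>; \<open>A_var\<close>, \<open>t_half\<close> and \<open>t_var\<close> are the elements \<open>A\<close>,
  \<open>t^(1/2) = A powi (-2)\<close> and \<open>t = A powi (-4)\<close>.\<close>

type_synonym ratfun = "int poly fract"

definition A_var :: ratfun where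
  "A_var = Fract [:0, 1:] 1"

definition loop_value :: ratfun where
  "loop_value = - (A_var ^ 2) - A_var powi (-2)"

text \<open>
  A crossingless diagram is given by a list of hooks \<open>h\<close>: the \<open>k\<close>-th hook, at \<open>i = h ! k\<close>,
  connects the positions \<open>i\<close> and \<open>i + 1\<close> by a cap on level \<open>k\<close> and by a cup on level
  \<open>k + 1\<close>; all other positions run straight from level \<open>k\<close> to level \<open>k + 1\<close>. The closure joins
  the last level to level 0. The circles of the closed diagram are the connected components
  of the resulting graph, whose vertices all have degree 2.
\<close>

definition hook_points :: "nat \<Rightarrow> nat list \<Rightarrow> (nat \<times> nat) set" where
  "hook_points m h = {0..length h} \<times> {1..m}"

definition hook_arcs :: "nat \<Rightarrow> nat list \<Rightarrow> ((nat \<times> nat) \<times> (nat \<times> nat)) set" where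
  "hook_arcs m h =
     {((k, h ! k), (k, h ! k + 1)) | k. k < length h} \<union>
     {((k + 1, h ! k), (k + 1, h ! k + 1)) | k. k < length h} \<union>
     {((k, p), (k + 1, p)) | k p. k < length h \<and> p \<in> {1..m} - {h ! k, h ! k + 1}} \<union>
     {((length h, p), (0, p)) | p. p \<in> {1..m}}"

definition circles :: "nat \<Rightarrow> nat list \<Rightarrow> nat" where
  "circles m h = card (hook_points m h // (hook_arcs m h \<union> (hook_arcs m h)\<inverse>)\<^sup>*)"

text \<open>
  \<open>bracket_aux m h w\<close> is the bracket of the closure of the hooks \<open>h\<close> followed by the braid
  word \<open>w\<close>, on \<open>m\<close> strands. The \<open>A\<close>-smoothing of the positive crossing \<open>Sig i\<close> is the pair of
  straight strands and its \<open>B\<close>-smoothing is the hook; for \<open>SigInv i\<close> it is the other way round.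
  This is the convention under which the Jones polynomial, normalised by
  \<open>t\<inverse> V(L\<^sub>+) - t V(L\<^sub>-) = (t^(1/2) - t^(-1/2)) V(L\<^sub>0)\<close>, is \<open>(- A ^ 3) powi (- writhe w)\<close> times the
  bracket at \<open>t = A powi (-4)\<close>, \<open>t^(1/2) = A powi (-2)\<close>.
  The exponent \<open>-1\<close> occurs only for the empty diagram.
\<close>

fun bracket_aux :: "nat \<Rightarrow> nat list \<Rightarrow> braid_word \<Rightarrow> ratfun" where
  "bracket_aux m h [] = loop_value powi (int (circles m h) - 1)"
| "bracket_aux m h (Sig i # w) =
     A_var * bracket_aux m h w + inverse A_var * bracket_aux m (h @ [i]) w"
| "bracket_aux m h (SigInv i # w) =
     A_var * bracket_aux m (h @ [i]) w + inverse A_var * bracket_aux m h w"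

definition kauffman_bracket :: "nat \<Rightarrow> braid_word \<Rightarrow> ratfun" where
  "kauffman_bracket m w = bracket_aux m [] w"

text \<open>The bracket of \<open>S\<^sub>N(D)\<close>, for \<open>D\<close> the closure of \<open>w\<close> and
  \<open>S\<^sub>N(x) = (\<Sum>j\<le>N div 2. (-1) ^ j * ((N - j) choose j) * x ^ (N - 2 * j))\<close>, expanded multilinearly:
  the function \<open>f\<close> chooses one term of \<open>S\<^sub>N\<close> for each component.\<close>

definition S_bracket :: "nat \<Rightarrow> nat \<Rightarrow> braid_word \<Rightarrow> ratfun" where
  "S_bracket N n w =
     (\<Sum>f \<in> components n w \<rightarrow>\<^sub>E {0..N div 2}.
        (\<Prod>K\<in>components n w. (-1) ^ f K * of_nat ((N - f K) choose f K)) *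
        (let r = (\<lambda>i. N - 2 * f (component w i))
         in kauffman_bracket (\<Sum>i=1..n. r i) (cable r w)))"

text \<open>\<open>colored_jones k n w\<close> is the invariant \<open>J\<^sub>k\<close> of the closure of the \<open>n\<close>-braid \<open>w\<close>, for the
  \<open>k\<close>-dimensional representation (\<open>k \<ge> 1\<close>), as a function of \<open>A\<close>, where \<open>t = A powi (-4)\<close>.\<close>

definition colored_jones :: "nat \<Rightarrow> nat \<Rightarrow> braid_word \<Rightarrow> ratfun" where
  "colored_jones k n w =
     (let N = k - 1 in
       ((-1) ^ N * A_var ^ (N ^ 2 + 2 * N)) powi (- writhe w) *
       (-1) powi (int N - 1) * (A_var ^ 2 + A_var powi (-2)) * S_bracket N n w)"

definition t_half :: ratfun where
  "t_half = A_var powi (-2)"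

definition t_var :: ratfun where
  "t_var = A_var powi (-4)"

definition quantum_int :: "nat \<Rightarrow> ratfun" where
  "quantum_int k = (t_half powi int k - t_half powi (- int k)) / (t_half - inverse t_half)"

definition colored_jones_normalized :: "nat \<Rightarrow> nat \<Rightarrow> braid_word \<Rightarrow> ratfun" where
  "colored_jones_normalized k n w = colored_jones k n w / quantum_int k"

definition at_t :: "int poly \<Rightarrow> ratfun" where
  "at_t p = poly (map_poly of_int p) t_var"

end

theory Submission
  imports Defs
begin

text \<open>
  In the two-dimensional representation of the Temperley--Lieb algebra the colored Jones polynomial of
  a closed braid is, up to a unit, the quantum trace of \<open>P * R\<close>. Here \<open>R\<close> is the operator of the
  \<open>N\<close>-cable of the braid, and \<open>P\<close> is the product of the Jones--Wenzl projectors on the cables of all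
  strands. On the image of \<open>P\<close> the cable of the full twist agrees, up to a power of \<open>A\<close>, with the full
  twist on \<open>m = n * N\<close> strands. Write \<open>1 = J + (\<Sum>i. U i * Y i)\<close> with the projector \<open>J\<close> on \<open>m\<close> strands.
  The full twist acts on \<open>J\<close> by a power of \<open>A\<close> and on each \<open>U
  i\<close> by \<open>t ^ m\<close> times that power and an operator that factors through \<open>m -
  2\<close> strands. Up to a unit the trace is therefore \<open>(\<Sum>j\<le>m. t ^ j) + t ^ (m + 1)
  * y\<close>, where \<open>y\<close> is a quotient of polynomials in \<open>t\<close> whose
  denominator has constant term 1. Both the trace and its quotient by the trace of one projector are
  Laurent polynomials in \<open>A\<close>, so \<open>y\<close> and its normalized analogue are
  polynomials in \<open>t\<close>.
\<close>

subsection \<open>Operators on states\<close>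

text \<open>The power \<open>t ^ (m + 1)\<close> has two sources. Pushing a cup through the full
  twist on \<open>m\<close> strands leaves two kinks and the full twist on \<open>m - 2\<close>
  strands; compared with the eigenvalue on \<open>J\<close> this gives exactly \<open>t ^ m\<close>.
  The last factor \<open>t\<close> comes from the quantum trace: an operator that begins with a cup
  has no diagonal entry at the all-\<open>False\<close> state, and the weight of every other state
  carries at least one extra factor \<open>t\<close>. The obstacle is integrality. The projectors
  have denominators \<open>1 - t ^ k\<close> and half-integral powers of \<open>t\<close>, so their
  traces are a priori only rational functions. Two independent controls are combined: regularity at
  \<open>t = 0\<close>, kept by a parity grading, and the Laurent property, obtained by evaluating
  traces in a basis of the image of \<open>P\<close> in which no projector occurs. For the
  normalized invariant all cells but the first are closed; the projector kills every nonempty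
  Temperley--Lieb word, so the result is a scalar multiple of the projector.\<close>

text \<open>A state assigns a sign to each of infinitely many positions, of which only \<open>1, \<dots>, m\<close> matter for
  diagrams on \<open>m\<close> strands. In this way the operators for all \<open>m\<close> live in a single ring, and cups and
  caps, which change the number of strands, are elements of the same ring.\<close>

type_synonym state = "nat \<Rightarrow> bool"

typedef (overloaded) ('a::comm_ring_1) linear_op =
  "{F :: (state \<Rightarrow> 'a) \<Rightarrow> state \<Rightarrow> 'a.
     (\<forall>u v. F (\<lambda>x. u x + v x) = (\<lambda>x. F u x + F v x)) \<and>
     (\<forall>k v. F (\<lambda>x. k * v x) = (\<lambda>x. k * F v x))}"
  morphisms ap Abs_linear_op
  by (rule exI[of _ "\<lambda>v. v"]) auto

setup_lifting type_definition_linear_op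

lemma ap_add: "ap F (\<lambda>x. u x + v x) y = ap F u y + ap F v y"
  using ap[of F] by simp

lemma ap_scale: "ap F (\<lambda>x. k * v x) y = k * ap F v y"
  using ap[of F] by simp

lemma ap_zero [simp]: "ap F (\<lambda>x. 0) y = 0"
  using ap_scale[of F 0 "\<lambda>x. 0"] by simp

lemma ap_diff: "ap F (\<lambda>x. u x - v x) y = ap F u y - ap F v y"
  using ap_add[of F u "\<lambda>x. (-1) * v x" y] by (simp only: ap_scale) simp

lemma ap_sum: "ap F (\<lambda>x. \<Sum>i\<in>I. u i x) y = (\<Sum>i\<in>I. ap F (u i) y)"
proof (cases "finite I")
  case True
  then show ?thesis
    by (induction I rule: finite_induct) (auto simp: ap_add)
qed simp

lemma linear_op_eqI: "(\<And>v x. ap F v x = ap G v x) \<Longrightarrow> F = G"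
  by (metis ap_inject ext)

instantiation linear_op :: (comm_ring_1) ring_1
begin

lift_definition zero_linear_op :: "'a linear_op" is "\<lambda>v x. 0" by simp
lift_definition one_linear_op :: "'a linear_op" is "\<lambda>v. v" by simp
lift_definition plus_linear_op :: "'a linear_op \<Rightarrow> 'a linear_op \<Rightarrow> 'a linear_op" is "\<lambda>F G v x. F v x + G v x"
  by (simp add: algebra_simps)
lift_definition minus_linear_op :: "'a linear_op \<Rightarrow> 'a linear_op \<Rightarrow> 'a linear_op" is "\<lambda>F G v x. F v x - G v x"
  by (simp add: algebra_simps)
lift_definition uminus_linear_op :: "'a linear_op \<Rightarrow> 'a linear_op" is "\<lambda>F v x. - F v x"
  by simp
lift_definition times_linear_op :: "'a linear_op \<Rightarrow> 'a linear_op \<Rightarrow> 'a linear_op" is "\<lambda>F G v. F (G v)"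
  by simp

instance
proof
  fix a b c :: "'a linear_op"
  show "a * b * c = a * (b * c)" by transfer simp
  show "1 * a = a" by transfer simp
  show "a * 1 = a" by transfer simp
  show "a + b + c = a + (b + c)" by transfer (simp add: add.assoc)
  show "a + b = b + a" by transfer (simp add: add.commute)
  show "0 + a = a" by transfer simp
  show "- a + a = 0" by transfer simp
  show "a - b = a + - b" by transfer simp
  show "(a + b) * c = a * c + b * c" by transfer simp
  show "a * (b + c) = a * b + a * c" by transfer simp
  show "(0::'a linear_op) \<noteq> 1"
  proof
    assume "(0::'a linear_op) = 1"
    then have "ap (0::'a linear_op) (\<lambda>_. 1) (\<lambda>_. False) = ap 1 (\<lambda>_. 1) (\<lambda>_. False)" by simp
    then show False by (simp add: zero_linear_op.rep_eq one_linear_op.rep_eq)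
  qed
qed

end

text \<open>Scalars are embedded as central elements of the operator ring, so linear combinations of
  diagrams become ordinary ring expressions; \<open>scal_left\<close> then moves a scalar out of a
  product.\<close>

lift_definition scal :: "'a::comm_ring_1 \<Rightarrow> 'a linear_op" is "\<lambda>k v x. k * v x"
  by (simp add: algebra_simps)

lemma ap_plus [simp]: "ap (F + G) v x = ap F v x + ap G v x" by (simp add: plus_linear_op.rep_eq)
lemma ap_minus [simp]: "ap (F - G) v x = ap F v x - ap G v x" by (simp add: minus_linear_op.rep_eq)
lemma ap_uminus [simp]: "ap (- F) v x = - ap F v x" by (simp add: uminus_linear_op.rep_eq)
lemma ap_times [simp]: "ap (F * G) v = ap F (ap G v)" by (simp add: times_linear_op.rep_eq)
lemma ap_one [simp]: "ap 1 v = v" by (simp add: one_linear_op.rep_eq)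
lemma ap_zero_op [simp]: "ap 0 v x = 0" by (simp add: zero_linear_op.rep_eq)
lemma ap_scal [simp]: "ap (scal k) v x = k * v x" by (simp add: scal.rep_eq)
lemma scal_comm: "F * scal k = scal k * F"
proof (rule linear_op_eqI)
  fix v x
  have "ap (scal k) v = (\<lambda>x. k * v x)" for v by (rule ext) simp
  then show "ap (F * scal k) v x = ap (scal k * F) v x"
    by (simp add: ap_scale)
qed

lemma scal_mult: "scal (k * l) = scal k * scal l" by (rule linear_op_eqI) (simp add: mult.assoc)
lemma scal_add: "scal (k + l) = scal k + scal l" by (rule linear_op_eqI) (simp add: algebra_simps)
lemma scal_uminus: "scal (- k) = - scal k" by (rule linear_op_eqI) simp
lemma scal_1 [simp]: "scal 1 = 1" by (rule linear_op_eqI) simp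
lemma scal_0 [simp]: "scal 0 = 0" by (rule linear_op_eqI) simp
lemma scal_left: "F * (scal k * G) = scal k * (F * G)"
  by (metis mult.assoc scal_comm)

section \<open>Cups and caps as operators on functions of states\<close>

definition del :: "nat \<Rightarrow> state \<Rightarrow> state" where
  "del i x = (\<lambda>j. if j < i then x j else x (j + 2))"

definition ins :: "nat \<Rightarrow> bool \<Rightarrow> bool \<Rightarrow> state \<Rightarrow> state" where
  "ins i a b x = (\<lambda>j. if j < i then x j else if j = i then a else if j = i + 1 then b else x (j - 2))"

text \<open>Operators act on functions of states, so creating two strands at \<open>i\<close> means
  deleting two positions from the argument. The entries of the form are a parameter because two
  different representations are used below.\<close>

lift_definition cup :: "(bool \<Rightarrow> bool \<Rightarrow> 'a::comm_ring_1) \<Rightarrow> nat \<Rightarrow> 'a linear_op" is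
  "\<lambda>c i v x. c (x i) (x (i + 1)) * v (del i x)"
  by (simp add: algebra_simps)

lift_definition cap :: "(bool \<Rightarrow> bool \<Rightarrow> 'a::comm_ring_1) \<Rightarrow> nat \<Rightarrow> 'a linear_op" is
  "\<lambda>c i v x. (\<Sum>a\<in>UNIV. \<Sum>b\<in>UNIV. c a b * v (ins i a b x))"
  by (simp add: UNIV_bool algebra_simps)

lemma ap_cup: "ap (cup c i) v x = c (x i) (x (i + 1)) * v (del i x)"
  by (simp add: cup.rep_eq)
lemma ap_cap: "ap (cap c i) v x = (\<Sum>a\<in>UNIV. \<Sum>b\<in>UNIV. c a b * v (ins i a b x))"
  by (simp add: cap.rep_eq)

lemma ins_at [simp]: "ins i a b x i = a" "ins i a b x (Suc i) = b"
  by (auto simp: ins_def)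
lemma ins_less: "k < i \<Longrightarrow> ins i a b x k = x k"
  by (simp add: ins_def)
lemma ins_greater: "i + 2 \<le> k \<Longrightarrow> ins i a b x k = x (k - 2)"
  by (simp add: ins_def)
lemma del_ins [simp]: "del i (ins i a b x) = x"
  by (rule ext) (auto simp: del_def ins_def)
lemma del_ins_far: "j \<ge> i + 2 \<Longrightarrow> del i (ins j a b x) = ins (j - 2) a b (del i x)"
proof (rule ext)
  fix k assume "j \<ge> i + 2"
  then obtain l where l: "j = l + 2" "i \<le> l" by (intro that[of "j - 2"]) auto
  have "k \<ge> l + 2 \<Longrightarrow> \<exists>k'. k = k' + 2 \<and> l \<le> k'" by (intro exI[of _ "k - 2"]) auto
  then show "del i (ins j a b x) k = ins (j - 2) a b (del i x) k"
    unfolding l(1) using l(2)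
    by (cases "k \<ge> l + 2"; cases "k < i") (auto simp: del_def ins_def not_le less_Suc_eq)
qed
lemma del_ins_far': "j \<ge> i \<Longrightarrow> del (j+2) (ins i a b x) = ins i a b (del j x)"
proof (rule ext)
  fix k assume "j \<ge> i"
  moreover have "k > Suc i \<Longrightarrow> \<exists>l. k = l + 2 \<and> l \<ge> i" by (intro exI[of _ "k - 2"]) auto
  ultimately show "del (j+2) (ins i a b x) k = ins i a b (del j x) k"
    by (cases "k > Suc i") (auto simp: del_def ins_def not_less le_Suc_eq)
qed
lemma del_del: "j \<ge> i \<Longrightarrow> del i (del (j + 2) x) = del j (del i x)"
  by (rule ext) (auto simp: del_def)
lemma ins_ins:
  assumes "j \<ge> i"
  shows "ins (j+2) a b (ins i a' b' x) = ins i a' b' (ins j a b x)"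
proof (rule ext)
  fix k
  consider "k < i" | "k = i" | "k = Suc i" | l where "k = Suc (Suc l)" "l \<ge> i"
    by (metis Suc_le_D Suc_le_mono linorder_neqE_nat not_less_eq_eq Suc_leI)
  then show "ins (j+2) a b (ins i a' b' x) k = ins i a' b' (ins j a b x) k"
  proof cases
    case (4 l)
    show ?thesis
    proof (cases "l < j")
      case True
      with 4 show ?thesis by (simp add: ins_def)
    next
      case False
      consider "l = j" | "l = Suc j" | h where "l = Suc (Suc h)" "h \<ge> j"
        using False by (metis Suc_le_D Suc_le_mono linorder_neqE_nat not_less_eq_eq Suc_leI)
      then show ?thesis
        using 4 assms by cases (simp_all add: ins_def)
    qed
  qed (use assms in \<open>simp_all add: ins_def\<close>)
qed

lemma ins_fun_upd: "ins i a b (del i x) = x(i := a, Suc i := b)"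
proof (rule ext)
  fix k
  have "k > Suc i \<Longrightarrow> \<exists>l. k = l + 2 \<and> l \<ge> i" by (intro exI[of _ "k - 2"]) auto
  then show "ins i a b (del i x) k = (x(i := a, Suc i := b)) k"
    by (cases "k > Suc i") (auto simp: del_def ins_def not_less le_Suc_eq)
qed

lemma sum_bool: "(\<Sum>a\<in>UNIV. f a) = f False + f (True)" for f :: "bool \<Rightarrow> 'a::comm_monoid_add"
  by (simp add: UNIV_bool)

text \<open>Planar isotopy of disjoint arcs. An index changes by 2 because the arc further to the
  left adds or removes two positions.\<close>

lemma cap_cup_far: "i + 2 \<le> j \<Longrightarrow> cap c j * cup c' i = cup c' i * cap c (j - 2)"
proof (rule linear_op_eqI)
  fix v x assume "i + 2 \<le> j"
  then have "ins j a b x i = x i" "ins j a b x (Suc i) = x (Suc i)"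
    "del i (ins j a b x) = ins (j - 2) a b (del i x)" for a b
    by (simp_all add: ins_less del_ins_far)
  then show "ap (cap c j * cup c' i) v x = ap (cup c' i * cap c (j - 2)) v x"
    by (simp add: ap_cap ap_cup sum_bool algebra_simps)
qed

lemma cap_cup_far': "i \<le> j \<Longrightarrow> cap c i * cup c' (j + 2) = cup c' j * cap c i"
proof (rule linear_op_eqI)
  fix v x assume "i \<le> j"
  then have "ins i a b x (j + 2) = x j" "ins i a b x (j + 2 + 1) = x (j + 1)"
    "del (j + 2) (ins i a b x) = ins i a b (del j x)" for a b
    using del_ins_far'[of i j a b x] by (auto simp: ins_greater)
  then show "ap (cap c i * cup c' (j + 2)) v x = ap (cup c' j * cap c i) v x"
    by (simp only: ap_times ap_cap ap_cup sum_bool) (simp add: algebra_simps)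
qed

lemma cup_cup_far: "i \<le> j \<Longrightarrow> cup c (j + 2) * cup c' i = cup c' i * cup c j"
proof (rule linear_op_eqI)
  fix v x assume "i \<le> j"
  then have "del (j + 2) x i = x i" "del (j + 2) x (i + 1) = x (i + 1)"
    "del i x j = x (j + 2)" "del i x (j + 1) = x (j + 2 + 1)"
    "del i (del (j + 2) x) = del j (del i x)"
    using del_del[of i j x] by (auto simp: del_def[of _ x])
  then show "ap (cup c (j + 2) * cup c' i) v x = ap (cup c' i * cup c j) v x"
    by (simp only: ap_times ap_cup) (simp add: algebra_simps)
qed

lemma cap_cap_far: "i \<le> j \<Longrightarrow> cap c i * cap c' (j + 2) = cap c' j * cap c i"
proof (rule linear_op_eqI)
  fix v x assume "i \<le> j"
  then have "ins (j + 2) a b (ins i a' b' x) = ins i a' b' (ins j a b x)" for a b a' b'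
    by (rule ins_ins)
  then show "ap (cap c i * cap c' (j + 2)) v x = ap (cap c' j * cap c i) v x"
    by (simp only: ap_times ap_cap sum_bool) (simp add: algebra_simps)
qed

subsection \<open>Temperley--Lieb operators\<close>

text \<open>A representation of the Temperley--Lieb category: \<open>zz1\<close> and
  \<open>zz2\<close> straighten a zigzag, \<open>loop\<close> is the value of a circle,
  \<open>close\<close> says that closing the right strand of a hook leaves a straight strand,
  \<open>mu_sum\<close> that closing a free strand gives the loop value, and \<open>bal\<close>,
  \<open>bal'\<close> that cups and caps respect the weights. One instance counts labellings, the
  other computes the bracket.\<close>

locale zigzag =
  fixes c c' :: "bool \<Rightarrow> bool \<Rightarrow> 'a::comm_ring_1" and \<mu> :: "bool \<Rightarrow> 'a" and \<delta> :: 'a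
  assumes zz1: "(\<Sum>b\<in>UNIV. c a b * c' b d) = (if a = d then 1 else 0)"
    and zz2: "(\<Sum>b\<in>UNIV. c' a b * c b d) = (if a = d then 1 else 0)"
    and loop: "(\<Sum>a\<in>UNIV. \<Sum>b\<in>UNIV. c' a b * c a b) = \<delta>"
    and close: "(\<Sum>b\<in>UNIV. \<mu> b * c a b * c' d b) = (if a = d then 1 else 0)"
    and bal: "c a b * (\<mu> a * \<mu> b) = c a b"
    and bal': "c' a b * (\<mu> a * \<mu> b) = c' a b"
    and mu_sum: "(\<Sum>b\<in>UNIV. \<mu> b) = \<delta>"
begin

abbreviation "cu \<equiv> cup c"
abbreviation "ca \<equiv> cap c'"
definition U :: "nat \<Rightarrow> 'a linear_op" where "U i = cu i * ca i"

lemma ca_cu_loop: "ca i * cu i = scal \<delta>"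
  by (rule linear_op_eqI) (simp add: ap_cap ap_cup loop[symmetric] sum_bool algebra_simps)

lemma ca_cu_Suc: "ca (Suc i) * cu i = 1"
proof (rule linear_op_eqI)
  fix v x
  have d: "del i (ins (Suc i) a b x) = x(i := b)" for a b
    by (rule ext) (auto simp: del_def ins_def)
  have e: "ins (Suc i) a b x i = x i" for a b by (simp add: ins_def)
  have "ap (ca (Suc i) * cu i) v x
      = (\<Sum>b\<in>UNIV. (\<Sum>a\<in>UNIV. c (x i) a * c' a b) * v (x(i := b)))"
    by (simp add: ap_cap ap_cup d e sum_bool algebra_simps)
  also have "\<dots> = v x" unfolding zz1 by (cases "x i") (auto simp: sum_bool fun_upd_idem)
  finally show "ap (ca (Suc i) * cu i) v x = ap 1 v x" by simp
qed

lemma ca_Suc_cu: "ca i * cu (Suc i) = 1"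
proof (rule linear_op_eqI)
  fix v x
  have d: "del (Suc i) (ins i a b x) = x(i := a)" for a b
    by (rule ext) (auto simp: del_def ins_def)
  have e: "ins i a b x (Suc (Suc i)) = x i" for a b by (simp add: ins_def)
  have "ap (ca i * cu (Suc i)) v x
      = (\<Sum>b\<in>UNIV. (\<Sum>a\<in>UNIV. c' b a * c a (x i)) * v (x(i := b)))"
    by (simp add: ap_cap ap_cup d e sum_bool algebra_simps)
  also have "\<dots> = v x" unfolding zz2 by (cases "x i") (auto simp: sum_bool fun_upd_idem)
  finally show "ap (ca i * cu (Suc i)) v x = ap 1 v x" by simp
qed

lemma U_sq: "U i * U i = scal \<delta> * U i"
proof -
  have "U i * U i = cu i * (ca i * cu i) * ca i" by (simp add: U_def mult.assoc)
  also have "\<dots> = scal \<delta> * U i" by (simp add: ca_cu_loop U_def scal_comm mult.assoc)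
  finally show ?thesis .
qed

lemma U_zz: "U i * U (Suc i) * U i = U i"
proof -
  have "U i * U (Suc i) * U i = cu i * (ca i * cu (Suc i)) * (ca (Suc i) * cu i) * ca i"
    by (simp add: U_def mult.assoc)
  then show ?thesis by (simp add: ca_cu_Suc ca_Suc_cu U_def)
qed

lemma U_zz': "U (Suc i) * U i * U (Suc i) = U (Suc i)"
proof -
  have "U (Suc i) * U i * U (Suc i) = cu (Suc i) * (ca (Suc i) * cu i) * (ca i * cu (Suc i)) * ca (Suc i)"
    by (simp add: U_def mult.assoc)
  then show ?thesis by (simp add: ca_cu_Suc ca_Suc_cu U_def)
qed

lemma U_cu_far: "j \<ge> i \<Longrightarrow> U (j + 2) * cu i = cu i * U j"
proof -
  assume a: "j \<ge> i"
  have "U (j + 2) * cu i = cu (j + 2) * (ca (j + 2) * cu i)" by (simp add: U_def mult.assoc)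
  also have "ca (j + 2) * cu i = cu i * ca j" using cap_cup_far[of i "j + 2" c' c] a by simp
  also have "cu (j + 2) * (cu i * ca j) = (cu (j + 2) * cu i) * ca j" by (simp only: mult.assoc)
  also have "cu (j + 2) * cu i = cu i * cu j" by (rule cup_cup_far[OF a])
  finally show ?thesis by (simp add: U_def mult.assoc)
qed

lemma U_cu_near: "i + 2 \<le> j \<Longrightarrow> U i * cu j = cu j * U i"
proof -
  assume "i + 2 \<le> j"
  then obtain k where k: "j = k + 2" "k \<ge> i" by (intro that[of "j - 2"]) auto
  have "U i * cu (k + 2) = cu i * (ca i * cu (k + 2))" by (simp only: U_def mult.assoc)
  also have "\<dots> = (cu i * cu k) * ca i" by (simp only: cap_cup_far'[OF k(2)] mult.assoc)
  also have "\<dots> = cu (k + 2) * U i" by (simp only: cup_cup_far[OF k(2), symmetric] U_def mult.assoc)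
  finally show ?thesis by (simp only: k(1))
qed

lemma ca_U_far: "j \<ge> i \<Longrightarrow> ca i * U (j + 2) = U j * ca i"
proof -
  assume a: "j \<ge> i"
  have "ca i * U (j + 2) = (ca i * cu (j + 2)) * ca (j + 2)" by (simp add: U_def mult.assoc)
  also have "ca i * cu (j + 2) = cu j * ca i" by (rule cap_cup_far'[OF a])
  also have "cu j * ca i * ca (j + 2) = cu j * (ca i * ca (j + 2))" by (simp only: mult.assoc)
  also have "ca i * ca (j + 2) = ca j * ca i" by (rule cap_cap_far[OF a])
  finally show ?thesis by (simp add: U_def mult.assoc)
qed

lemma ca_U_near: "i + 2 \<le> j \<Longrightarrow> ca j * U i = U i * ca j"
proof -
  assume a: "i + 2 \<le> j"
  then obtain k where k: "j = k + 2" "k \<ge> i" by (intro that[of "j - 2"]) auto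
  have e: "ca (k + 2) * cu i = cu i * ca k"
    using cap_cup_far[of i "k + 2" c' c] k by simp
  have "ca (k + 2) * U i = (ca (k + 2) * cu i) * ca i" by (simp only: U_def mult.assoc)
  also have "\<dots> = cu i * (ca k * ca i)" by (simp only: e mult.assoc)
  also have "\<dots> = U i * ca (k + 2)" by (simp only: cap_cap_far[OF k(2), symmetric] U_def mult.assoc)
  finally show ?thesis by (simp only: k(1))
qed

lemma U_far: "i + 2 \<le> j \<Longrightarrow> U i * U j = U j * U i"
proof -
  assume a: "i + 2 \<le> j"
  have "U i * U j = (U i * cu j) * ca j" by (simp add: U_def[of j] mult.assoc)
  also have "\<dots> = cu j * (U i * ca j)" by (simp only: U_cu_near[OF a] mult.assoc)
  also have "\<dots> = U j * U i" by (simp only: ca_U_near[OF a, symmetric] U_def[of j] mult.assoc)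
  finally show ?thesis .
qed

lemma ap_U: "ap (U i) v x = c (x i) (x (Suc i)) * (\<Sum>a\<in>UNIV. \<Sum>b\<in>UNIV. c' a b * v (x(i := a, Suc i := b)))"
  by (simp add: U_def ap_cup ap_cap ins_fun_upd)

end

subsection \<open>Weighted traces\<close>

definition states :: "nat \<Rightarrow> state set" where
  "states m = {x. \<forall>j. j \<notin> {1..m} \<longrightarrow> \<not> x j}"

lemma states_0: "states 0 = {\<lambda>_. False}"
  by (auto simp: states_def)

lemma states_upd: "x \<in> states m \<Longrightarrow> x(Suc m := b) \<in> states (Suc m)"
  by (auto simp: states_def)

lemma states_Suc: "states (Suc m) = states m \<union> (\<lambda>x. x(Suc m := True)) ` states m"
proof (intro equalityI subsetI)
  fix x assume x: "x \<in> states (Suc m)"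
  show "x \<in> states m \<union> (\<lambda>x. x(Suc m := True)) ` states m"
  proof (cases "x (Suc m)")
    case True
    then have "x = (x(Suc m := False))(Suc m := True)" by (simp add: fun_upd_idem)
    moreover have "x(Suc m := False) \<in> states m" using x by (auto simp: states_def le_Suc_eq)
    ultimately show ?thesis by blast
  next
    case False
    then have "x \<in> states m" using x by (auto simp: states_def) (metis le_Suc_eq)
    then show ?thesis by blast
  qed
qed (auto simp: states_def le_Suc_eq split: if_splits)

lemma finite_states [simp]: "finite (states m)"
  by (induction m) (auto simp: states_0 states_Suc)

lemma states_at_Suc [simp]: "x \<in> states m \<Longrightarrow> x (Suc m) = False"
  by (auto simp: states_def)

lemma states_upd_False: "x \<in> states m \<Longrightarrow> x(Suc m := False) = x"
  by (auto simp: fun_eq_iff)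

lemma inj_states_upd: "inj_on (\<lambda>x. x(Suc m := b)) (states m)"
  by (rule inj_onI) (metis states_upd_False fun_upd_upd)

lemma sum_states_Suc: "(\<Sum>x\<in>states (Suc m). f x) = (\<Sum>x\<in>states m. \<Sum>b\<in>UNIV. f (x(Suc m := b)))"
  for f :: "state \<Rightarrow> 'a::comm_monoid_add"
proof -
  have "states m \<inter> (\<lambda>x. x(Suc m := True)) ` states m = {}"
    by (auto dest: states_at_Suc)
  then have "(\<Sum>x\<in>states (Suc m). f x) = (\<Sum>x\<in>states m. f x) + (\<Sum>x\<in>states m. f (x(Suc m := True)))"
    unfolding states_Suc by (subst sum.union_disjoint) (auto simp: sum.reindex[OF inj_states_upd])
  also have "\<dots> = (\<Sum>x\<in>states m. f (x(Suc m := False)) + f (x(Suc m := True)))"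
    by (simp add: sum.distrib states_upd_False)
  finally show ?thesis by (simp add: sum_bool)
qed

definition point_fun :: "state \<Rightarrow> state \<Rightarrow> 'a::comm_ring_1" where
  "point_fun y x = (if x = y then 1 else 0)"

definition weight :: "(bool \<Rightarrow> 'a::comm_ring_1) \<Rightarrow> nat \<Rightarrow> state \<Rightarrow> 'a" where
  "weight \<mu> m x = (\<Prod>i=1..m. \<mu> (x i))"

text \<open>The first condition says that the operator restricts to a map from \<open>m\<close> to \<open>n\<close> strands; the second,
  that it commutes with the weights, is what makes the weighted trace cyclic.\<close>

definition hom :: "(bool \<Rightarrow> 'a::comm_ring_1) \<Rightarrow> nat \<Rightarrow> nat \<Rightarrow> 'a linear_op \<Rightarrow> bool" where
  "hom \<mu> m n F \<longleftrightarrow> (\<forall>v. (\<forall>y\<in>states m. v y = 0) \<longrightarrow> (\<forall>x\<in>states n. ap F v x = 0)) \<and>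
     (\<forall>v. \<forall>x\<in>states n. ap F (\<lambda>y. weight \<mu> m y * v y) x = weight \<mu> n x * ap F v x)"

lemma hom_eq:
  assumes "hom \<mu> m n F" "\<And>y. y \<in> states m \<Longrightarrow> u y = v y" "x \<in> states n"
  shows "ap F u x = ap F v x"
proof -
  have "ap F (\<lambda>y. u y - v y) x = 0" using assms unfolding hom_def by simp
  then show ?thesis by (simp add: ap_diff)
qed

lemma hom_expand:
  assumes "hom \<mu> m n F" "x \<in> states n"
  shows "ap F v x = (\<Sum>y\<in>states m. v y * ap F (point_fun y) x)"
proof -
  have "ap F v x = ap F (\<lambda>z. \<Sum>y\<in>states m. v y * point_fun y z) x"
    by (rule hom_eq[OF assms(1) _ assms(2)]) (simp add: point_fun_def if_distrib[of "(*) _"] sum.delta cong: if_cong)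
  then show ?thesis by (simp add: ap_sum ap_scale)
qed

lemma hom_balanced:
  assumes "hom \<mu> m n F" "x \<in> states n" "y \<in> states m"
  shows "weight \<mu> m y * ap F (point_fun y) x = weight \<mu> n x * ap F (point_fun y) x"
proof -
  have "weight \<mu> m y * ap F (point_fun y) x = ap F (\<lambda>z. weight \<mu> m y * point_fun y z) x" by (simp add: ap_scale)
  also have "\<dots> = ap F (\<lambda>z. weight \<mu> m z * point_fun y z) x"
    by (rule arg_cong[of _ _ "\<lambda>v. ap F v x"]) (auto simp: point_fun_def)
  also have "\<dots> = weight \<mu> n x * ap F (point_fun y) x" using assms unfolding hom_def by blast
  finally show ?thesis .
qed

lemma hom_mult:
  assumes "hom \<mu> l m G" "hom \<mu> m n F" shows "hom \<mu> l n (F * G)"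
  unfolding hom_def
proof (intro conjI allI impI ballI)
  fix v :: "state \<Rightarrow> 'a" and x assume v: "\<forall>y\<in>states l. v y = 0" and x: "x \<in> states n"
  show "ap (F * G) v x = 0" using assms v x unfolding hom_def by simp
next
  fix v :: "state \<Rightarrow> 'a" and x assume x: "x \<in> states n"
  have "ap (F * G) (\<lambda>y. weight \<mu> l y * v y) x = ap F (\<lambda>y. weight \<mu> m y * ap G v y) x"
    using assms(1) unfolding ap_times by (intro hom_eq[OF assms(2) _ x]) (auto simp: hom_def)
  also have "\<dots> = weight \<mu> n x * ap (F * G) v x" using assms(2) x by (auto simp: hom_def)
  finally show "ap (F * G) (\<lambda>y. weight \<mu> l y * v y) x = weight \<mu> n x * ap (F * G) v x" .
qed

lemma hom_add: "hom \<mu> m n F \<Longrightarrow> hom \<mu> m n G \<Longrightarrow> hom \<mu> m n (F + G)"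
  by (auto simp: hom_def algebra_simps)
lemma hom_uminus: "hom \<mu> m n F \<Longrightarrow> hom \<mu> m n (- F)"
  by (auto simp: hom_def)
lemma hom_1: "hom \<mu> m m 1"
  by (auto simp: hom_def)
lemma hom_0: "hom \<mu> m n 0"
  by (auto simp: hom_def)
lemma hom_scal: "hom \<mu> m m (scal k)"
  by (auto simp: hom_def)
lemma hom_prod_list: "(\<And>F. F \<in> set Fs \<Longrightarrow> hom \<mu> m m F) \<Longrightarrow> hom \<mu> m m (prod_list Fs)"
  by (induction Fs) (auto intro: hom_1 hom_mult)
lemma hom_power: "hom \<mu> m m F \<Longrightarrow> hom \<mu> m m (F ^ k)"
  by (induction k) (auto intro: hom_1 hom_mult)

definition Tr :: "(bool \<Rightarrow> 'a::comm_ring_1) \<Rightarrow> nat \<Rightarrow> 'a linear_op \<Rightarrow> 'a" where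
  "Tr \<mu> m F = (\<Sum>x\<in>states m. weight \<mu> m x * ap F (point_fun x) x)"

text \<open>By \<open>hom_balanced\<close> a matrix entry between \<open>x\<close> and
  \<open>y\<close> gives the same product with either of the two weights. This moves the weight from
  one end to the other, so the trace is cyclic also for maps between different numbers of
  strands.\<close>

lemma Tr_comm:
  assumes F: "hom \<mu> a b F" and G: "hom \<mu> b a G"
  shows "Tr \<mu> b (F * G) = Tr \<mu> a (G * F)"
proof -
  have "Tr \<mu> b (F * G) = (\<Sum>x\<in>states b. \<Sum>y\<in>states a. weight \<mu> b x * ap F (point_fun y) x * ap G (point_fun x) y)"
    unfolding Tr_def
  proof (rule sum.cong[OF refl])
    fix x assume x: "x \<in> states b"
    show "weight \<mu> b x * ap (F * G) (point_fun x) x = (\<Sum>y\<in>states a. weight \<mu> b x * ap F (point_fun y) x * ap G (point_fun x) y)"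
      unfolding ap_times hom_expand[OF F x, of "ap G (point_fun x)"] by (simp add: sum_distrib_left mult_ac)
  qed
  also have "\<dots> = (\<Sum>x\<in>states b. \<Sum>y\<in>states a. weight \<mu> a y * ap F (point_fun y) x * ap G (point_fun x) y)"
    by (intro sum.cong refl) (simp add: hom_balanced[OF F])
  also have "\<dots> = (\<Sum>y\<in>states a. \<Sum>x\<in>states b. weight \<mu> a y * ap F (point_fun y) x * ap G (point_fun x) y)"
    by (rule sum.swap)
  also have "\<dots> = Tr \<mu> a (G * F)"
    unfolding Tr_def
  proof (rule sum.cong[OF refl])
    fix x assume x: "x \<in> states a"
    show "(\<Sum>y\<in>states b. weight \<mu> a x * ap F (point_fun x) y * ap G (point_fun y) x) = weight \<mu> a x * ap (G * F) (point_fun x) x"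
      unfolding ap_times hom_expand[OF G x, of "ap F (point_fun x)"] by (simp add: sum_distrib_left mult_ac)
  qed
  finally show ?thesis .
qed

lemma Tr_add: "Tr \<mu> m (F + G) = Tr \<mu> m F + Tr \<mu> m G"
  by (simp add: Tr_def sum.distrib algebra_simps)
lemma Tr_0: "Tr \<mu> m 0 = 0"
  by (simp add: Tr_def)
lemma Tr_scal: "Tr \<mu> m (scal k * F) = k * Tr \<mu> m F"
  by (simp add: Tr_def sum_distrib_left algebra_simps)
lemma Tr_sum: "Tr \<mu> m (\<Sum>i\<in>I. F i) = (\<Sum>i\<in>I. Tr \<mu> m (F i))"
  by (induction I rule: infinite_finite_induct) (auto simp: Tr_0 Tr_add)

text \<open>Partial quantum trace over position \<open>k\<close>. The inner function is
  \<open>v\<close> tensored with the basis vector \<open>b\<close> at position \<open>k\<close>;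
  \<open>v\<close> itself is read at states whose entry at \<open>k\<close> is \<open>False\<close>,
  in agreement with \<open>states\<close>.\<close>

lift_definition ptr1 :: "(bool \<Rightarrow> 'a::comm_ring_1) \<Rightarrow> nat \<Rightarrow> 'a linear_op \<Rightarrow> 'a linear_op" is
  "\<lambda>\<mu> k F v x. \<Sum>b\<in>UNIV. \<mu> b * F (\<lambda>z. if z k = b then v (z(k := False)) else 0) (x(k := b))"
proof (intro conjI allI)
  fix \<mu> :: "bool \<Rightarrow> 'a" and k and F :: "(state \<Rightarrow> 'a) \<Rightarrow> state \<Rightarrow> 'a"
  assume F: "(\<forall>u v. F (\<lambda>x. u x + v x) = (\<lambda>x. F u x + F v x)) \<and> (\<forall>k v. F (\<lambda>x. k * v x) = (\<lambda>x. k * F v x))"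
  {
    fix u v :: "state \<Rightarrow> 'a"
    have "F (\<lambda>z. if z k = b then u (z(k := False)) + v (z(k := False)) else 0)
        = (\<lambda>x. F (\<lambda>z. if z k = b then u (z(k := False)) else 0) x
               + F (\<lambda>z. if z k = b then v (z(k := False)) else 0) x)" for b
      using F[THEN conjunct1, rule_format, of "\<lambda>z. if z k = b then u (z(k := False)) else 0"
          "\<lambda>z. if z k = b then v (z(k := False)) else 0", symmetric]
      by (simp add: if_distrib cong: if_cong)
    then show "(\<lambda>x. \<Sum>b\<in>UNIV. \<mu> b * F (\<lambda>z. if z k = b then u (z(k := False)) + v (z(k := False)) else 0) (x(k := b)))
      = (\<lambda>x. (\<Sum>b\<in>UNIV. \<mu> b * F (\<lambda>z. if z k = b then u (z(k := False)) else 0) (x(k := b)))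
           + (\<Sum>b\<in>UNIV. \<mu> b * F (\<lambda>z. if z k = b then v (z(k := False)) else 0) (x(k := b))))"
      by (simp add: sum_bool algebra_simps)
  next
    fix l and v :: "state \<Rightarrow> 'a"
    have "F (\<lambda>z. if z k = b then l * v (z(k := False)) else 0)
        = (\<lambda>x. l * F (\<lambda>z. if z k = b then v (z(k := False)) else 0) x)" for b
      using F[THEN conjunct2, rule_format, of l "\<lambda>z. if z k = b then v (z(k := False)) else 0", symmetric]
      by (simp add: if_distrib[of "(*) l"] cong: if_cong)
    then show "(\<lambda>x. \<Sum>b\<in>UNIV. \<mu> b * F (\<lambda>z. if z k = b then l * v (z(k := False)) else 0) (x(k := b)))
      = (\<lambda>x. l * (\<Sum>b\<in>UNIV. \<mu> b * F (\<lambda>z. if z k = b then v (z(k := False)) else 0) (x(k := b))))"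
      by (simp add: sum_bool algebra_simps)
  }
qed

lemma ap_ptr1: "ap (ptr1 \<mu> k F) v x =
    (\<Sum>b\<in>UNIV. \<mu> b * ap F (\<lambda>z. if z k = b then v (z(k := False)) else 0) (x(k := b)))"
  by (simp add: ptr1.rep_eq)

lemma ap_ptr1_point_fun:
  assumes "y \<in> states m"
  shows "ap (ptr1 \<mu> (Suc m) F) (point_fun y) x = (\<Sum>b\<in>UNIV. \<mu> b * ap F (point_fun (y(Suc m := b))) (x(Suc m := b)))"
proof -
  have "(\<lambda>z. if z (Suc m) = b then point_fun y (z(Suc m := False)) else 0) = (point_fun (y(Suc m := b)) :: state \<Rightarrow> 'a)" for b
  proof (rule ext)
    fix z
    show "(if z (Suc m) = b then point_fun y (z(Suc m := False)) else 0) = (point_fun (y(Suc m := b)) z :: 'a)"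
    proof (cases "z (Suc m) = b")
      case True
      have "z(Suc m := False) = y \<longleftrightarrow> z = y(Suc m := b)"
      proof
        assume "z(Suc m := False) = y"
        then have "y(Suc m := b) = z(Suc m := b)" by (metis fun_upd_upd)
        then show "z = y(Suc m := b)" using True by (simp add: fun_upd_idem)
      next
        assume "z = y(Suc m := b)"
        then show "z(Suc m := False) = y" using states_upd_False[OF assms] by simp
      qed
      with True show ?thesis by (simp add: point_fun_def)
    next
      case False
      then have "z \<noteq> y(Suc m := b)" by (metis fun_upd_same)
      with False show ?thesis by (simp add: point_fun_def)
    qed
  qed
  then show ?thesis by (simp add: ap_ptr1)
qed

lemma ptr1_cong:
  assumes "\<And>v x. x \<in> states (Suc m) \<Longrightarrow> ap F v x = ap G v x" "x \<in> states m"
  shows "ap (ptr1 \<mu> (Suc m) F) v x = ap (ptr1 \<mu> (Suc m) G) v x"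
  by (simp add: ap_ptr1 assms(1)[OF states_upd[OF assms(2)]])

lemma ptr1_add: "ptr1 \<mu> k (F + G) = ptr1 \<mu> k F + ptr1 \<mu> k G"
  by (rule linear_op_eqI) (simp add: ap_ptr1 sum_bool algebra_simps)
lemma ptr1_scal: "ptr1 \<mu> k (scal l * F) = scal l * ptr1 \<mu> k F"
  by (rule linear_op_eqI) (simp add: ap_ptr1 sum_bool algebra_simps)

fun ptr :: "(bool \<Rightarrow> 'a::comm_ring_1) \<Rightarrow> nat \<Rightarrow> nat \<Rightarrow> 'a linear_op \<Rightarrow> 'a linear_op" where
  "ptr \<mu> N 0 F = F"
| "ptr \<mu> N (Suc d) F = ptr \<mu> N d (ptr1 \<mu> (Suc (N + d)) F)"

lemma ptr_cong:
  assumes "\<And>v x. x \<in> states (N + d) \<Longrightarrow> ap F v x = ap G v x" "x \<in> states N"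
  shows "ap (ptr \<mu> N d F) v x = ap (ptr \<mu> N d G) v x"
  using assms
proof (induction d arbitrary: F G)
  case (Suc d)
  show ?case unfolding ptr.simps
    by (rule Suc.IH[OF ptr1_cong Suc.prems(2)]) (use Suc.prems(1) in auto)
qed simp

lemma ptr_add: "ptr \<mu> N d (F + G) = ptr \<mu> N d F + ptr \<mu> N d G"
  by (induction d arbitrary: F G) (auto simp: ptr1_add)
lemma ptr_scal: "ptr \<mu> N d (scal l * F) = scal l * ptr \<mu> N d F"
  by (induction d arbitrary: F) (auto simp: ptr1_scal)

lemma weight_Suc: "weight \<mu> (Suc m) x = weight \<mu> m x * \<mu> (x (Suc m))"
  by (simp add: weight_def)

lemma weight_upd [simp]: "weight \<mu> m (x(Suc m := b)) = weight \<mu> m x"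
  by (simp add: weight_def)

lemma Tr_ptr1: "Tr \<mu> (Suc m) F = Tr \<mu> m (ptr1 \<mu> (Suc m) F)"
  unfolding Tr_def sum_states_Suc
  by (intro sum.cong refl) (simp add: ap_ptr1_point_fun weight_Suc sum_distrib_left mult.assoc)

lemma Tr_ptr: "Tr \<mu> (N + d) F = Tr \<mu> N (ptr \<mu> N d F)"
  by (induction d arbitrary: F) (auto simp: Tr_ptr1)

text \<open>A diagonal entry of a partial trace is the weighted sum over all extensions of the state
  to the closed positions. It later yields, from a single entry, the scalar by which a partial trace
  acts.\<close>

lemma ptr_diag:
  assumes "y \<in> states N"
  shows "ap (ptr \<mu> N d F) (point_fun y) y =
    (\<Sum>x | x \<in> states (N + d) \<and> (\<forall>i\<le>N. x i = y i). (\<Prod>i=Suc N..N+d. \<mu> (x i)) * ap F (point_fun x) x)"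
proof (induction d arbitrary: F)
  case 0
  have "{x \<in> states N. \<forall>i\<le>N. x i = y i} = {y}"
  proof -
    have "x = y" if "x \<in> states N" "\<forall>i\<le>N. x i = y i" for x
    proof
      fix i show "x i = y i" using that assms by (cases "i \<le> N") (auto simp: states_def)
    qed
    then show ?thesis using assms by auto
  qed
  then show ?case by simp
next
  case (Suc d)
  let ?k = "Suc (N + d)"
  define f where "f x = (if \<forall>i\<le>N. x i = y i then (\<Prod>i=Suc N..N+Suc d. \<mu> (x i)) * ap F (point_fun x) x else 0)" for x
  have "ap (ptr \<mu> N (Suc d) F) (point_fun y) y =
    (\<Sum>x | x \<in> states (N + d) \<and> (\<forall>i\<le>N. x i = y i). (\<Prod>i=Suc N..N+d. \<mu> (x i)) * ap (ptr1 \<mu> ?k F) (point_fun x) x)"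
    by (simp add: Suc.IH)
  also have "\<dots> = (\<Sum>x\<in>states (N + d). if \<forall>i\<le>N. x i = y i then (\<Prod>i=Suc N..N+d. \<mu> (x i)) * ap (ptr1 \<mu> ?k F) (point_fun x) x else 0)"
    by (simp add: sum.inter_filter)
  also have "\<dots> = (\<Sum>x\<in>states (N + d). \<Sum>b\<in>UNIV. f (x(?k := b)))"
  proof (rule sum.cong[OF refl])
    fix x assume x: "x \<in> states (N + d)"
    have 1: "(\<forall>i\<le>N. (x(?k := b)) i = y i) \<longleftrightarrow> (\<forall>i\<le>N. x i = y i)" for b by auto
    have 2: "(\<Prod>i=Suc N..N+Suc d. \<mu> ((x(?k := b)) i)) = (\<Prod>i=Suc N..N+d. \<mu> (x i)) * \<mu> b" for b
      by (simp add: atLeastAtMostSuc_conv mult.commute)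
    show "(if \<forall>i\<le>N. x i = y i then (\<Prod>i=Suc N..N+d. \<mu> (x i)) * ap (ptr1 \<mu> ?k F) (point_fun x) x else 0)
        = (\<Sum>b\<in>UNIV. f (x(?k := b)))"
      unfolding f_def 1 2
    proof (cases "\<forall>i\<le>N. x i = y i")
      case True
      show "(if \<forall>i\<le>N. x i = y i then (\<Prod>i=Suc N..N+d. \<mu> (x i)) * ap (ptr1 \<mu> ?k F) (point_fun x) x else 0)
        = (\<Sum>b\<in>UNIV. if \<forall>i\<le>N. x i = y i then (\<Prod>i=Suc N..N+d. \<mu> (x i)) * \<mu> b * ap F (point_fun (x(?k := b))) (x(?k := b)) else 0)"
        unfolding if_P[OF True] ap_ptr1_point_fun[OF x] by (simp only: sum_distrib_left mult.assoc)
    next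
      case False
      show "(if \<forall>i\<le>N. x i = y i then (\<Prod>i=Suc N..N+d. \<mu> (x i)) * ap (ptr1 \<mu> ?k F) (point_fun x) x else 0)
        = (\<Sum>b\<in>UNIV. if \<forall>i\<le>N. x i = y i then (\<Prod>i=Suc N..N+d. \<mu> (x i)) * \<mu> b * ap F (point_fun (x(?k := b))) (x(?k := b)) else 0)"
        unfolding if_not_P[OF False] by simp
    qed
  qed
  also have "\<dots> = (\<Sum>x\<in>states (N + Suc d). f x)" by (simp add: sum_states_Suc)
  also have "\<dots> = (\<Sum>x | x \<in> states (N + Suc d) \<and> (\<forall>i\<le>N. x i = y i). (\<Prod>i=Suc N..N+Suc d. \<mu> (x i)) * ap F (point_fun x) x)"
    unfolding f_def by (simp only: sum.inter_filter[OF finite_states])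
  finally show ?case .
qed

text \<open>The operator is the identity at position \<open>k\<close>, expressed without tensor
  factors: it commutes with overwriting the entry at \<open>k\<close>.\<close>

definition inert :: "nat \<Rightarrow> 'a::comm_ring_1 linear_op \<Rightarrow> bool" where
  "inert k F \<longleftrightarrow> (\<forall>v b x. ap F v (x(k := b)) = ap F (\<lambda>z. v (z(k := b))) x)"

lemma inert_1: "inert k 1" by (simp add: inert_def)

lemma inert_mult:
  assumes "inert k F" "inert k G" shows "inert k (F * G)"
  unfolding inert_def
proof (intro allI)
  fix v b x
  have "ap (F * G) v (x(k := b)) = ap F (\<lambda>z. ap G v (z(k := b))) x"
    using assms(1) by (simp add: inert_def)
  also have "(\<lambda>z. ap G v (z(k := b))) = ap G (\<lambda>z. v (z(k := b)))"
    using assms(2) by (auto simp: inert_def)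
  finally show "ap (F * G) v (x(k := b)) = ap (F * G) (\<lambda>z. v (z(k := b))) x" by (simp only: ap_times)
qed

lemma inert_prod_list: "(\<And>F. F \<in> set Fs \<Longrightarrow> inert k F) \<Longrightarrow> inert k (prod_list Fs)"
  by (induction Fs) (auto intro: inert_1 inert_mult)

subsection \<open>Reduction of Temperley--Lieb words\<close>

text \<open>The number of loops removed from a word is recorded independently of the loop value, so that the
  reduction of one word can be evaluated in different representations.\<close>

inductive tl_red :: "nat list \<Rightarrow> nat \<Rightarrow> nat list \<Rightarrow> bool" where
  tl_refl: "tl_red h 0 h"
| tl_trans: "tl_red h j h' \<Longrightarrow> tl_red h' k h'' \<Longrightarrow> tl_red h (j + k) h''"
| tl_ctx: "tl_red h j h' \<Longrightarrow> tl_red (u @ h @ v) j (u @ h' @ v)"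
| tl_loop: "tl_red [i, i] 1 [i]"
| tl_zz: "tl_red [i, Suc i, i] 0 [i]"
| tl_zz': "tl_red [Suc i, i, Suc i] 0 [Suc i]"
| tl_far: "i + 2 \<le> j \<Longrightarrow> tl_red [j, i] 0 [i, j]"
| tl_far': "i + 2 \<le> j \<Longrightarrow> tl_red [i, j] 0 [j, i]"

lemma tl_trans0: "tl_red h 0 h' \<Longrightarrow> tl_red h' k h'' \<Longrightarrow> tl_red h k h''"
  using tl_trans[of h 0] by simp
lemma tl_far_word: "\<forall>i\<in>set x. i + 2 \<le> M \<Longrightarrow> tl_red (M # x) 0 (x @ [M])"
proof (induction x)
  case (Cons i x)
  have "tl_red ([] @ [M, i] @ x) 0 ([] @ [i, M] @ x)" using Cons.prems by (intro tl_ctx tl_far) auto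
  moreover have "tl_red ([i] @ (M # x) @ []) 0 ([i] @ (x @ [M]) @ [])" using Cons by (intro tl_ctx Cons.IH) auto
  ultimately show ?case using tl_trans0 by fastforce
qed (simp add: tl_refl)

lemma tl_far_word': "\<forall>i\<in>set x. i + 2 \<le> M \<Longrightarrow> tl_red (x @ [M]) 0 (M # x)"
proof (induction x)
  case (Cons i x)
  have "tl_red ([i] @ (x @ [M]) @ []) 0 ([i] @ (M # x) @ [])" using Cons by (intro tl_ctx Cons.IH) auto
  moreover have "tl_red ([] @ [i, M] @ x) 0 ([] @ [M, i] @ x)" using Cons.prems by (intro tl_ctx tl_far') auto
  ultimately show ?case using tl_trans0 by fastforce
qed (simp add: tl_refl)

text \<open>Jones's argument: by induction the word between two consecutive occurrences of the
  largest index contains the next smaller index at most once. Without it the two letters meet and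
  form a loop; with one occurrence the zigzag relation merges them. Either way the number of
  occurrences of the largest index drops.\<close>

lemma tl_normal_form:
  assumes "set h \<subseteq> {1..m}"
  shows "\<exists>j h'. tl_red h j h' \<and> (set h' \<subseteq> {1..<m} \<or>
    (\<exists>u v. h' = u @ m # v \<and> set u \<subseteq> {1..<m} \<and> set v \<subseteq> {1..<m}))"
  using assms
proof (induction m arbitrary: h)
  case 0
  then show ?case using tl_refl by fastforce
next
  case (Suc m)
  let ?M = "Suc m"
  show ?case using Suc.prems
  proof (induction "count_list h ?M" arbitrary: h rule: less_induct)
    case less
    show ?case
    proof (cases "?M \<in> set h")
      case False
      then have "set h \<subseteq> {1..<?M}" using less.prems by (force simp: less_Suc_eq_le le_Suc_eq)
      then show ?thesis using tl_refl by blast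
    next
      case True
      then obtain u r where h: "h = u @ ?M # r" "?M \<notin> set u" by (meson split_list_first)
      show ?thesis
      proof (cases "?M \<in> set r")
        case False
        then have "set u \<subseteq> {1..<?M}" "set r \<subseteq> {1..<?M}"
          using less.prems h by (force simp: less_Suc_eq_le le_Suc_eq)+
        then show ?thesis using h(1) tl_refl by blast
      next
        case True
        then obtain x v where r: "r = x @ ?M # v" "?M \<notin> set x" by (meson split_list_first)
        have x: "set x \<subseteq> {1..m}" using less.prems h r by (force simp: le_Suc_eq)
        from Suc.IH[OF x] obtain j x' where x': "tl_red x j x'"
          "set x' \<subseteq> {1..<m} \<or> (\<exists>u v. x' = u @ m # v \<and> set u \<subseteq> {1..<m} \<and> set v \<subseteq> {1..<m})"
          by blast
        have red: "tl_red h j (u @ ?M # x' @ ?M # v)"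
          using tl_ctx[OF x'(1), of "u @ [?M]" "?M # v"] h r by simp
        have "\<exists>k y. tl_red (?M # x' @ [?M]) k y \<and> count_list y ?M < 2 \<and> set y \<subseteq> {1..?M}"
          using x'(2)
        proof
          assume a: "set x' \<subseteq> {1..<m}"
          have "tl_red ([] @ (?M # x') @ [?M]) 0 ([] @ (x' @ [?M]) @ [?M])"
            using a by (intro tl_ctx tl_far_word) auto
          moreover have "tl_red (x' @ [?M, ?M] @ []) 1 (x' @ [?M] @ [])" by (intro tl_ctx tl_loop)
          ultimately have "tl_red (?M # x' @ [?M]) 1 (x' @ [?M])" using tl_trans0 by fastforce
          moreover have "count_list (x' @ [?M]) ?M < 2"
            using a by (subst count_list_append) (auto simp: count_list_0_iff)
          ultimately show ?thesis using a by (intro exI[of _ 1] exI[of _ "x' @ [?M]"]) auto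
        next
          assume "\<exists>u v. x' = u @ m # v \<and> set u \<subseteq> {1..<m} \<and> set v \<subseteq> {1..<m}"
          then obtain y z where yz: "x' = y @ m # z" "set y \<subseteq> {1..<m}" "set z \<subseteq> {1..<m}" by blast
          have 1: "tl_red ([] @ (?M # y) @ (m # z @ [?M])) 0 ([] @ (y @ [?M]) @ (m # z @ [?M]))"
            using yz by (intro tl_ctx tl_far_word) auto
          have 2: "tl_red (z @ [?M]) 0 (?M # z)"
            using yz by (intro tl_far_word') auto
          have 3: "tl_red ((y @ [?M, m]) @ (z @ [?M]) @ []) 0 ((y @ [?M, m]) @ (?M # z) @ [])"
            by (intro tl_ctx 2)
          have 4: "tl_red (y @ [?M, m, ?M] @ z) 0 (y @ [?M] @ z)" by (intro tl_ctx tl_zz')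
          have "tl_red (?M # x' @ [?M]) 0 (y @ [?M] @ z)"
            using tl_trans0[OF 1[simplified] tl_trans0[OF 3[simplified] 4[simplified]]] yz(1) by simp
          moreover have "count_list (y @ [?M] @ z) ?M < 2"
            using yz by (subst count_list_append) (auto simp: count_list_0_iff)
          ultimately show ?thesis using yz by (intro exI[of _ 0] exI[of _ "y @ [?M] @ z"]) auto
        qed
        then obtain k y where y: "tl_red (?M # x' @ [?M]) k y" "count_list y ?M < 2" "set y \<subseteq> {1..?M}" by blast
        have red2: "tl_red h (j + k) (u @ y @ v)"
          using tl_trans[OF red] tl_ctx[OF y(1), of u v] by simp
        have "count_list (u @ y @ v) ?M < count_list h ?M" using y(2) h r by (simp add: count_list_append)
        moreover have "set (u @ y @ v) \<subseteq> {1..?M}" using y(3) less.prems h r by auto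
        ultimately show ?thesis using less.hyps[of "u @ y @ v"] red2 tl_trans by blast
      qed
    qed
  qed
qed

lemma del_states: "x \<in> states (m + 2) \<Longrightarrow> 1 \<le> i \<Longrightarrow> i \<le> Suc m \<Longrightarrow> del i x \<in> states m"
  by (auto simp: states_def del_def)

lemma ins_states: "x \<in> states m \<Longrightarrow> 1 \<le> i \<Longrightarrow> i \<le> Suc m \<Longrightarrow> ins i a b x \<in> states (m + 2)"
  unfolding states_def
proof (intro CollectI allI impI)
  fix j assume a: "x \<in> {x. \<forall>j. j \<notin> {1..m} \<longrightarrow> \<not> x j}" "1 \<le> i" "i \<le> Suc m" "j \<notin> {1..m + 2}"
  then have "j < i \<and> j \<notin> {1..m} \<or> j \<ge> i + 2 \<and> j - 2 \<notin> {1..m}" by auto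
  with a(1) show "\<not> ins i a b x j" by (auto simp: ins_less ins_greater)
qed

lemma weight_del:
  assumes "1 \<le> i" "i \<le> Suc m"
  shows "weight \<mu> (m + 2) x = \<mu> (x i) * \<mu> (x (Suc i)) * weight \<mu> m (del i x)"
proof -
  have "weight \<mu> (m + 2) x = (\<Prod>j\<in>{1..<m + 3}. \<mu> (x j))"
    unfolding weight_def by (rule prod.cong) auto
  also have "\<dots> = (\<Prod>j\<in>{1..<i}. \<mu> (x j)) * (\<Prod>j\<in>{i..<m + 3}. \<mu> (x j))"
    using assms by (subst prod.atLeastLessThan_concat) auto
  also have "(\<Prod>j\<in>{i..<m + 3}. \<mu> (x j)) = \<mu> (x i) * (\<mu> (x (Suc i)) * (\<Prod>j\<in>{i+2..<(Suc m)+2}. \<mu> (x j)))"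
    using assms by (subst prod.atLeast_Suc_lessThan, simp, subst prod.atLeast_Suc_lessThan) (auto simp: numeral_3_eq_3)
  also have "(\<Prod>j\<in>{i+2..<(Suc m)+2}. \<mu> (x j)) = (\<Prod>j\<in>{i..<Suc m}. \<mu> (del i x j))"
    by (subst prod.shift_bounds_nat_ivl) (auto simp: del_def intro!: prod.cong)
  also have "(\<Prod>j\<in>{1..<i}. \<mu> (x j)) = (\<Prod>j\<in>{1..<i}. \<mu> (del i x j))"
    by (auto simp: del_def intro!: prod.cong)
  finally have "weight \<mu> (m + 2) x = \<mu> (x i) * \<mu> (x (Suc i)) *
     ((\<Prod>j\<in>{1..<i}. \<mu> (del i x j)) * (\<Prod>j\<in>{i..<Suc m}. \<mu> (del i x j)))"
    by (simp only: mult_ac)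
  also have "(\<Prod>j\<in>{1..<i}. \<mu> (del i x j)) * (\<Prod>j\<in>{i..<Suc m}. \<mu> (del i x j)) = (\<Prod>j\<in>{1..<Suc m}. \<mu> (del i x j))"
    using assms by (subst prod.atLeastLessThan_concat) auto
  also have "\<dots> = weight \<mu> m (del i x)"
    unfolding weight_def by (rule prod.cong) auto
  finally show ?thesis .
qed

lemma weight_ins:
  assumes "1 \<le> i" "i \<le> Suc m"
  shows "weight \<mu> (m + 2) (ins i a b x) = \<mu> a * \<mu> b * weight \<mu> m x"
  using weight_del[OF assms, of \<mu> "ins i a b x"] by simp

context zigzag
begin

lemma hom_cu:
  assumes "1 \<le> i" "i \<le> Suc m" shows "hom \<mu> m (m + 2) (cu i)"
  unfolding hom_def
proof (intro conjI allI impI ballI)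
  fix v :: "state \<Rightarrow> 'a" and x assume "\<forall>y\<in>states m. v y = 0" "x \<in> states (m + 2)"
  then show "ap (cu i) v x = 0" using del_states[OF _ assms] by (simp add: ap_cup)
next
  fix v :: "state \<Rightarrow> 'a" and x assume "x \<in> states (m + 2)"
  have "weight \<mu> (m + 2) x * ap (cu i) v x
      = (c (x i) (x (Suc i)) * (\<mu> (x i) * \<mu> (x (Suc i)))) * (weight \<mu> m (del i x) * v (del i x))"
    unfolding ap_cup weight_del[OF assms] by (simp add: mult_ac)
  then show "ap (cu i) (\<lambda>y. weight \<mu> m y * v y) x = weight \<mu> (m + 2) x * ap (cu i) v x"
    unfolding bal ap_cup by simp
qed

lemma hom_ca:
  assumes "1 \<le> i" "i \<le> Suc m" shows "hom \<mu> (m + 2) m (ca i)"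
  unfolding hom_def
proof (intro conjI allI impI ballI)
  fix v :: "state \<Rightarrow> 'a" and x assume "\<forall>y\<in>states (m + 2). v y = 0" "x \<in> states m"
  then show "ap (ca i) v x = 0" using ins_states[OF _ assms] by (simp add: ap_cap)
next
  fix v :: "state \<Rightarrow> 'a" and x assume "x \<in> states m"
  have "c' a b * (\<mu> a * \<mu> b * weight \<mu> m x * z) = weight \<mu> m x * (c' a b * z)" for a b z
  proof -
    have "c' a b * (\<mu> a * \<mu> b * weight \<mu> m x * z) = (c' a b * (\<mu> a * \<mu> b)) * (weight \<mu> m x * z)" by (simp only: mult_ac)
    then show ?thesis by (simp only: bal') (simp only: mult_ac)
  qed
  then show "ap (ca i) (\<lambda>y. weight \<mu> (m + 2) y * v y) x = weight \<mu> m x * ap (ca i) v x"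
    unfolding ap_cap weight_ins[OF assms] by (simp add: sum_distrib_left)
qed

lemma hom_U:
  assumes "1 \<le> i" "i < m" shows "hom \<mu> m m (U i)"
proof -
  obtain k where k: "m = k + 2" using assms by (intro that[of "m - 2"]) auto
  show ?thesis unfolding U_def k
    by (rule hom_mult[OF hom_ca hom_cu]) (use assms k in auto)
qed

definition U_word :: "nat list \<Rightarrow> 'a linear_op" where "U_word h = prod_list (map U h)"

lemma U_word_simps [simp]: "U_word [] = 1" "U_word (i # h) = U i * U_word h" "U_word (u @ v) = U_word u * U_word v"
  by (simp_all add: U_word_def)

lemma tl_red_sound: "tl_red h j h' \<Longrightarrow> U_word h = scal (\<delta> ^ j) * U_word h'"
proof (induction rule: tl_red.induct)
  case (tl_trans h j h' k h'')
  then show ?case by (simp add: power_add scal_mult mult.assoc)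
next
  case (tl_ctx h j h' u v)
  then show ?case by (simp add: mult.assoc scal_left)
next
  case (tl_zz i)
  then show ?case using U_zz[of i] by (simp add: mult.assoc)
next
  case (tl_zz' i)
  then show ?case using U_zz'[of i] by (simp add: mult.assoc)
next
  case (tl_far i j)
  then show ?case using U_far[of i j] by simp
next
  case (tl_far' i j)
  then show ?case using U_far[of i j] by simp
qed (simp_all add: U_sq)

lemma inert_U: "k \<noteq> i \<Longrightarrow> k \<noteq> Suc i \<Longrightarrow> inert k (U i)"
  unfolding inert_def
proof (intro allI)
  fix v b and x :: state assume "k \<noteq> i" "k \<noteq> Suc i"
  then have "(x(k := b)) i = x i" "(x(k := b)) (Suc i) = x (Suc i)"
    "(x(k := b))(i := a, Suc i := b') = (x(i := a, Suc i := b'))(k := b)" for a b'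
    by (auto simp: fun_eq_iff)
  then show "ap (U i) v (x(k := b)) = ap (U i) (\<lambda>z. v (z(k := b))) x"
    by (simp only: ap_U)
qed

lemma inert_U_word: "set h \<subseteq> {1..<m} \<Longrightarrow> inert (Suc m) (U_word h)"
  unfolding U_word_def by (rule inert_prod_list) (force intro!: inert_U)

lemma ptr1_inert:
  assumes "inert k F" "\<not> x k"
  shows "ap (ptr1 \<mu> k F) v x = \<delta> * ap F v x"
proof -
  have l: "ap F w (x(k := b)) = ap F (\<lambda>z. w (z(k := b))) x" for w b
    using assms(1) unfolding inert_def by blast
  have "x = x(k := False)" using assms(2) by (simp add: fun_upd_idem)
  then have e: "ap F (\<lambda>z. v (z(k := False))) x = ap F v x" using l[of v False] by simp
  have "ap (ptr1 \<mu> k F) v x = (\<Sum>b\<in>UNIV. \<mu> b * ap F (\<lambda>z. v (z(k := False))) x)"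
    unfolding ap_ptr1 l by simp
  also have "\<dots> = \<delta> * ap F v x"
    unfolding e by (simp add: sum_distrib_right[symmetric] mu_sum)
  finally show ?thesis .
qed

text \<open>The hook at \<open>m\<close> is the only contact with the strand \<open>m + 1\<close>,
  so closing that strand straightens the hook to the identity; \<open>close\<close> performs this
  summation. \<open>wG\<close> expresses that \<open>G\<close> passes the value stored at
  \<open>Suc m\<close> through unchanged.\<close>

lemma ptr1_U:
  assumes F: "inert (Suc m) F" and G: "inert (Suc m) G" and x: "\<not> x (Suc m)"
  shows "ap (ptr1 \<mu> (Suc m) (F * U m * G)) v x = ap (F * G) v x"
proof -
  let ?k = "Suc m"
  define w where "w b z = (if z ?k = b then v (z(?k := False)) else 0)" for b z
  define v' where "v' z = v (z(?k := False))" for z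
  have lG: "ap G u (y(?k := b)) = ap G (\<lambda>z. u (z(?k := b))) y" for u b y
    using G by (simp add: inert_def)
  have lF: "ap F u (y(?k := b)) = ap F (\<lambda>z. u (z(?k := b))) y" for u b y
    using F by (simp add: inert_def)
  have wG: "ap G (w b) (y(?k := b')) = (if b = b' then ap G v' y else 0)" for b b' y
  proof -
    have "(\<lambda>z. w b (z(?k := b'))) = (if b = b' then v' else (\<lambda>z. 0))"
      by (auto simp: w_def v'_def)
    then show ?thesis unfolding lG by simp
  qed
  have UG: "ap (U m) (ap G (w b)) (z(?k := b)) = (\<Sum>a\<in>UNIV. c (z m) b * c' a b * ap G v' (z(m := a)))" for b z
  proof -
    have "(z(?k := b))(m := a, ?k := b') = (z(m := a))(?k := b')" for a b' by (auto simp: fun_eq_iff)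
    then have "ap (U m) (ap G (w b)) (z(?k := b)) =
        c (z m) b * (\<Sum>a\<in>UNIV. \<Sum>b'\<in>UNIV. c' a b' * ap G (w b) ((z(m := a))(?k := b')))"
      unfolding ap_U by simp
    also have "\<dots> = (\<Sum>a\<in>UNIV. c (z m) b * c' a b * ap G v' (z(m := a)))"
      unfolding wG by (cases b) (simp_all add: sum_bool algebra_simps)
    finally show ?thesis .
  qed
  have "ap (ptr1 \<mu> ?k (F * U m * G)) v x =
      (\<Sum>b\<in>UNIV. \<mu> b * ap F (\<lambda>z. \<Sum>a\<in>UNIV. c (z m) b * c' a b * ap G v' (z(m := a))) x)"
    unfolding ap_ptr1 ap_times w_def[symmetric] lF UG ..
  also have "\<dots> = ap F (\<lambda>z. \<Sum>b\<in>UNIV. \<mu> b * (\<Sum>a\<in>UNIV. c (z m) b * c' a b * ap G v' (z(m := a)))) x"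
    by (simp add: ap_sum ap_scale)
  also have "(\<lambda>z. \<Sum>b\<in>UNIV. \<mu> b * (\<Sum>a\<in>UNIV. c (z m) b * c' a b * ap G v' (z(m := a)))) = ap G v'"
  proof (rule ext)
    fix z
    have "(\<Sum>b\<in>UNIV. \<mu> b * (\<Sum>a\<in>UNIV. c (z m) b * c' a b * ap G v' (z(m := a))))
      = (\<Sum>a\<in>UNIV. (\<Sum>b\<in>UNIV. \<mu> b * c (z m) b * c' a b) * ap G v' (z(m := a)))"
      by (simp add: sum_bool algebra_simps)
    also have "\<dots> = ap G v' (z(m := z m))"
      unfolding close by (cases "z m") (auto simp: sum_bool)
    finally show "(\<Sum>b\<in>UNIV. \<mu> b * (\<Sum>a\<in>UNIV. c (z m) b * c' a b * ap G v' (z(m := a)))) = ap G v' z"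
      by simp
  qed
  also have "ap F (ap G v') x = ap (F * G) v x"
  proof -
    have "x = x(?k := False)" using x by (simp add: fun_upd_idem)
    moreover have "ap (F * G) v (x(?k := False)) = ap (F * G) v' x"
      using inert_mult[OF F G] unfolding inert_def v'_def by blast
    ultimately show ?thesis by (simp only: ap_times)
  qed
  finally show ?thesis .
qed

end

text \<open>Strands are closed from the right. After reduction to normal form the last strand is
  either free and closes to a loop, or is attached by a single hook, which disappears. A derivation
  depends on the word alone, so its count is valid in every representation.\<close>

inductive tl_close :: "nat \<Rightarrow> nat \<Rightarrow> nat list \<Rightarrow> nat \<Rightarrow> nat list \<Rightarrow> bool" for N where
  close_base: "tl_close N 0 h 0 h"
| close_drop: "tl_red h j h' \<Longrightarrow> set h' \<subseteq> {1..<N + d} \<Longrightarrow> tl_close N d h' k h'' \<Longrightarrow>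
    tl_close N (Suc d) h (j + 1 + k) h''"
| close_merge: "tl_red h j (u @ (N + d) # v) \<Longrightarrow> set u \<subseteq> {1..<N + d} \<Longrightarrow> set v \<subseteq> {1..<N + d} \<Longrightarrow>
    tl_close N d (u @ v) k h'' \<Longrightarrow> tl_close N (Suc d) h (j + k) h''"

lemma tl_close_exists:
  "set h \<subseteq> {1..<N + d} \<Longrightarrow> \<exists>k h'. tl_close N d h k h' \<and> set h' \<subseteq> {1..<N}"
proof (induction d arbitrary: h)
  case 0
  then show ?case using close_base[of N h] by (intro exI[of _ 0] exI[of _ h]) simp
next
  case (Suc d)
  then have hs: "set h \<subseteq> {1..N + d}" by auto
  obtain j h' where h': "tl_red h j h'" "set h' \<subseteq> {1..<N + d} \<or>
    (\<exists>u v. h' = u @ (N + d) # v \<and> set u \<subseteq> {1..<N + d} \<and> set v \<subseteq> {1..<N + d})"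
    using tl_normal_form[OF hs] by (elim exE conjE) (rule that)
  from h'(2) show ?case
  proof
    assume a: "set h' \<subseteq> {1..<N + d}"
    obtain k h'' where "tl_close N d h' k h''" "set h'' \<subseteq> {1..<N}" using Suc.IH[OF a] by blast
    with close_drop[OF h'(1) a] show ?thesis by blast
  next
    assume "\<exists>u v. h' = u @ (N + d) # v \<and> set u \<subseteq> {1..<N + d} \<and> set v \<subseteq> {1..<N + d}"
    then obtain u v where uv: "h' = u @ (N + d) # v" "set u \<subseteq> {1..<N + d}" "set v \<subseteq> {1..<N + d}" by blast
    have "set (u @ v) \<subseteq> {1..<N + d}" using uv by auto
    then obtain k h'' where "tl_close N d (u @ v) k h''" "set h'' \<subseteq> {1..<N}" using Suc.IH by blast
    with close_merge[OF h'(1)[unfolded uv(1)] uv(2,3)] show ?thesis by blast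
  qed
qed

context zigzag
begin

lemma tl_close_sound:
  assumes "tl_close N d h k h'" "x \<in> states N"
  shows "ap (ptr \<mu> N d (U_word h)) v x = \<delta> ^ k * ap (U_word h') v x"
  using assms
proof (induction arbitrary: v)
  case (close_drop h j h' d k h'')
  have "ap (ptr \<mu> N (Suc d) (U_word h)) v x = ap (ptr \<mu> N d (scal (\<delta> ^ (j + 1)) * U_word h')) v x"
    unfolding ptr.simps
  proof (rule ptr_cong[OF _ close_drop.prems])
    fix v x assume "x \<in> states (N + d)"
    then show "ap (ptr1 \<mu> (Suc (N + d)) (U_word h)) v x = ap (scal (\<delta> ^ (j + 1)) * U_word h') v x"
      by (simp add: tl_red_sound[OF close_drop.hyps(1)] ptr1_scal ptr1_inert[OF inert_U_word[OF close_drop.hyps(2)]])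
  qed
  then show ?case using close_drop.IH[OF close_drop.prems]
    by (simp add: ptr_scal power_add)
next
  case (close_merge h j u d v' k h'')
  have "ap (ptr \<mu> N (Suc d) (U_word h)) v x = ap (ptr \<mu> N d (scal (\<delta> ^ j) * U_word (u @ v'))) v x"
    unfolding ptr.simps
  proof (rule ptr_cong[OF _ close_merge.prems])
    fix v x assume "x \<in> states (N + d)"
    then show "ap (ptr1 \<mu> (Suc (N + d)) (U_word h)) v x = ap (scal (\<delta> ^ j) * U_word (u @ v')) v x"
      using ptr1_U[OF inert_U_word[OF close_merge.hyps(2)] inert_U_word[OF close_merge.hyps(3)], of x v]
      by (simp add: tl_red_sound[OF close_merge.hyps(1)] ptr1_scal mult.assoc)
  qed
  then show ?case using close_merge.IH[OF close_merge.prems]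
    by (simp add: ptr_scal power_add)
qed simp

lemma Tr_U_word:
  assumes "tl_close 0 m h k []"
  shows "Tr \<mu> m (U_word h) = \<delta> ^ k"
proof -
  have "Tr \<mu> m (U_word h) = Tr \<mu> 0 (ptr \<mu> 0 m (U_word h))" using Tr_ptr[of \<mu> 0 m] by simp
  also have "\<dots> = ap (ptr \<mu> 0 m (U_word h)) (point_fun (\<lambda>_. False)) (\<lambda>_. False)"
    by (simp add: Tr_def states_0 weight_def)
  also have "\<dots> = \<delta> ^ k"
    by (subst tl_close_sound[OF assms]) (simp_all add: states_0 point_fun_def)
  finally show ?thesis .
qed

end

subsection \<open>Circles of closed hook diagrams\<close>

text \<open>With the symmetric form and loop value 2, the trace of a word counts the labellings of the closed
  diagram that are constant on circles. This identifies the number of removed loops with the number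
  of circles, and hence evaluates the trace in every other representation.\<close>

definition eq_form :: "bool \<Rightarrow> bool \<Rightarrow> 'a::comm_ring_1" where
  "eq_form a b = (if a = b then 1 else 0)"

interpretation brauer: zigzag eq_form eq_form "\<lambda>_. 1" "2 :: 'a::comm_ring_1"
  by unfold_locales (auto simp: eq_form_def sum_bool)

definition hook_step :: "nat \<Rightarrow> state \<Rightarrow> state \<Rightarrow> bool" where
  "hook_step i x y \<longleftrightarrow> x i = x (Suc i) \<and> (\<exists>a. y = x(i := a, Suc i := a))"

text \<open>A path lists the labels of all levels of the hook diagram, one state per level; at a
  hook the ends of the cap must agree and the ends of the cup receive a new common label.\<close>

fun paths :: "nat list \<Rightarrow> state \<Rightarrow> state \<Rightarrow> state list set" where
  "paths [] x y = (if x = y then {[x]} else {})"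
| "paths (i # h) x y = (if x i = x (Suc i) then (\<Union>a. (#) x ` paths h (x(i := a, Suc i := a)) y) else {})"

lemma paths_hd: "xs \<in> paths h x y \<Longrightarrow> xs \<noteq> [] \<and> hd xs = x"
  by (cases h) (auto split: if_splits)

lemma finite_paths [simp]: "finite (paths h x y)"
  by (induction h arbitrary: x) auto

lemma fun_upd2_eq_iff: "x(i := a, Suc i := a) = x(i := b, Suc i := b) \<longleftrightarrow> a = b"
  by (metis fun_upd_same)

lemma paths_count: "ap (brauer.U_word h) (point_fun y) x = (of_nat (card (paths h x y)) :: 'a::comm_ring_1)"
proof (induction h arbitrary: x)
  case (Cons i h)
  show ?case
  proof (cases "x i = x (Suc i)")
    case True
    let ?x = "\<lambda>a. x(i := a, Suc i := a)"
    have 1: "card (\<Union>a. (#) x ` paths h (?x a) y) = (\<Sum>a\<in>UNIV. card ((#) x ` paths h (?x a) y))"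
    proof (rule card_UN_disjoint)
      show "\<forall>a\<in>UNIV. \<forall>b\<in>UNIV. a \<noteq> b \<longrightarrow> (#) x ` paths h (?x a) y \<inter> (#) x ` paths h (?x b) y = {}"
      proof (intro ballI impI)
        fix a b :: bool assume "a \<noteq> b"
        then have "?x a \<noteq> ?x b" by (simp add: fun_upd2_eq_iff)
        then show "(#) x ` paths h (?x a) y \<inter> (#) x ` paths h (?x b) y = {}"
          by (auto dest!: paths_hd)
      qed
    qed auto
    have 2: "card ((#) x ` paths h (?x a) y) = card (paths h (?x a) y)" for a
      by (rule card_image) simp
    have "ap (brauer.U_word (i # h)) (point_fun y) x = (\<Sum>a\<in>UNIV. ap (brauer.U_word h) (point_fun y) (?x a) :: 'a)"
      using True by (simp add: brauer.ap_U eq_form_def sum_bool)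
    also have "\<dots> = of_nat (card (paths (i # h) x y))"
      unfolding paths.simps if_P[OF True] 1 2 by (simp only: sum_bool Cons.IH of_nat_add)
    finally show ?thesis .
  next
    case False
    then have "eq_form (x i) (x (Suc i)) = (0::'a)" by (simp add: eq_form_def)
    then have "ap (brauer.U_word (i # h)) (point_fun y) x = (0::'a)" by (simp add: brauer.ap_U)
    then show ?thesis using False by simp
  qed
qed (simp add: point_fun_def eq_commute)

lemma paths_iff: "xs \<in> paths h x y \<longleftrightarrow> length xs = Suc (length h) \<and> xs ! 0 = x \<and> xs ! length h = y \<and>
   (\<forall>k<length h. hook_step (h ! k) (xs ! k) (xs ! Suc k))"
proof (induction h arbitrary: x xs)
  case Nil
  show ?case by (cases xs) auto
next
  case (Cons i h)
  show ?case
  proof (cases xs)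
    case (Cons z zs)
    have "xs \<in> paths (i # h) x y \<longleftrightarrow> z = x \<and> x i = x (Suc i) \<and> (\<exists>a. zs \<in> paths h (x(i := a, Suc i := a)) y)"
      using Cons by auto
    also have "\<dots> \<longleftrightarrow> z = x \<and> length zs = Suc (length h) \<and> hook_step i x (zs ! 0) \<and> zs ! length h = y \<and>
      (\<forall>k<length h. hook_step (h ! k) (zs ! k) (zs ! Suc k))"
      unfolding Cons.IH hook_step_def by auto
    also have "\<dots> \<longleftrightarrow> length xs = Suc (length (i # h)) \<and> xs ! 0 = x \<and> xs ! length (i # h) = y \<and>
      (\<forall>k<length (i # h). hook_step ((i # h) ! k) (xs ! k) (xs ! Suc k))"
      unfolding local.Cons by (auto simp: less_Suc_eq_0_disj)
    finally show ?thesis .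
  qed auto
qed

lemma hook_step_states:
  assumes "hook_step i x y" "x \<in> states m" "1 \<le> i" "i < m" shows "y \<in> states m"
  using assms by (auto simp: hook_step_def states_def)

definition closed_paths :: "nat \<Rightarrow> nat list \<Rightarrow> state list set" where
  "closed_paths m h = (\<Union>x\<in>states m. paths h x x)"

lemma brauer_Tr: "Tr (\<lambda>_. 1) m (brauer.U_word h) = of_nat (card (closed_paths m h))"
proof -
  have "Tr (\<lambda>_. 1) m (brauer.U_word h) = of_nat (\<Sum>x\<in>states m. card (paths h x x))"
    by (simp add: Tr_def weight_def paths_count)
  also have "(\<Sum>x\<in>states m. card (paths h x x)) = card (closed_paths m h)"
    unfolding closed_paths_def
    by (rule card_UN_disjoint[symmetric]) (auto dest!: paths_hd)
  finally show ?thesis .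
qed

text \<open>A closed path is a two-valued labelling of the points of the closed diagram that is
  constant along every arc, hence a function on the connected components. \<open>\<Phi>\<close>
  turns such a function into the list of levels, with \<open>False\<close> outside
  \<open>1, \<dots>, m\<close> as \<open>states\<close> demands.\<close>

lemma card_closed_paths:
  assumes h: "set h \<subseteq> {1..<m}"
  shows "card (closed_paths m h) = 2 ^ circles m h"
proof -
  define X where "X = hook_points m h"
  define R where "R = (hook_arcs m h \<union> (hook_arcs m h)\<inverse>)\<^sup>*"
  have X: "(k, p) \<in> X \<longleftrightarrow> k \<le> length h \<and> 1 \<le> p \<and> p \<le> m" for k p
    by (auto simp: X_def hook_points_def)
  have finX: "finite X" by (simp add: X_def hook_points_def)
  have finXR: "finite (X // R)" unfolding quotient_def using finX by auto
  have equiv: "equiv UNIV R"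
    unfolding R_def by (intro equivI refl_rtrancl trans_rtrancl sym_rtrancl) (auto simp: sym_def)
  have cls: "R `` {u} = R `` {v}" if "(u, v) \<in> hook_arcs m h" for u v
    by (rule equiv_class_eq[OF equiv]) (use that in \<open>auto simp: R_def\<close>)
  have arcs: "R `` {(k, h ! k)} = R `` {(k, Suc (h ! k))}"
    "R `` {(Suc k, h ! k)} = R `` {(Suc k, Suc (h ! k))}"
    "p \<in> {1..m} \<Longrightarrow> p \<noteq> h ! k \<Longrightarrow> p \<noteq> Suc (h ! k) \<Longrightarrow> R `` {(k, p)} = R `` {(Suc k, p)}"
    if "k < length h" for k p
    by (rule cls; use that in \<open>force simp: hook_arcs_def\<close>)+
  have arc0: "R `` {(length h, p)} = R `` {(0, p)}" if "p \<in> {1..m}" for p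
    by (rule cls) (use that in \<open>force simp: hook_arcs_def\<close>)
  have hk: "1 \<le> h ! k" "Suc (h ! k) \<le> m" if "k < length h" for k
    using subsetD[OF h nth_mem[OF that]] by auto
  define lab where "lab g k p = (1 \<le> p \<and> p \<le> m \<and> g (R `` {(k, p)}))" for g :: "(nat \<times> nat) set \<Rightarrow> bool" and k p
  define \<Phi> where "\<Phi> g = map (lab g) [0..<Suc (length h)]" for g
  have \<Phi>_nth: "\<Phi> g ! k = lab g k" if "k \<le> length h" for g k
    using that by (simp add: \<Phi>_def del: upt_Suc)
  have len: "length (\<Phi> g) = Suc (length h)" for g by (simp add: \<Phi>_def)
  have bij: "bij_betw \<Phi> ((X // R) \<rightarrow>\<^sub>E UNIV) (closed_paths m h)"
    unfolding bij_betw_def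
  proof (intro conjI inj_onI subset_antisym subsetI)
    fix g g' assume g: "g \<in> (X // R) \<rightarrow>\<^sub>E UNIV" "g' \<in> (X // R) \<rightarrow>\<^sub>E UNIV" and eq: "\<Phi> g = \<Phi> g'"
    show "g = g'"
    proof (rule PiE_ext[OF g])
      fix K assume "K \<in> X // R"
      then obtain k p where kp: "(k, p) \<in> X" "K = R `` {(k, p)}" by (auto elim!: quotientE)
      then have "lab g k p = lab g' k p" using \<Phi>_nth[of k] eq X by metis
      then show "g K = g' K" using kp X by (simp add: lab_def)
    qed
  next
    fix xs assume "xs \<in> \<Phi> ` ((X // R) \<rightarrow>\<^sub>E UNIV)"
    then obtain g where xs: "xs = \<Phi> g" by blast
    have "lab g 0 \<in> states m" by (auto simp: states_def lab_def)
    moreover have "\<Phi> g \<in> paths h (lab g 0) (lab g 0)"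
      unfolding paths_iff
    proof (intro conjI allI impI)
      show "\<Phi> g ! length h = lab g 0" using arc0 by (force simp: \<Phi>_nth lab_def fun_eq_iff)
      fix k assume k: "k < length h"
      show "hook_step (h ! k) (\<Phi> g ! k) (\<Phi> g ! Suc k)"
        unfolding hook_step_def
      proof (intro conjI exI[of _ "lab g (Suc k) (h ! k)"] ext)
        show "(\<Phi> g ! k) (h ! k) = (\<Phi> g ! k) (Suc (h ! k))"
          using k hk[OF k] arcs(1)[OF k] by (simp add: \<Phi>_nth lab_def)
        fix p
        show "(\<Phi> g ! Suc k) p = ((\<Phi> g ! k)(h ! k := lab g (Suc k) (h ! k), Suc (h ! k) := lab g (Suc k) (h ! k))) p"
        proof (cases "p = h ! k \<or> p = Suc (h ! k)")
          case True
          then show ?thesis using k hk[OF k] arcs(2)[OF k] by (auto simp: \<Phi>_nth lab_def)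
        next
          case False
          then show ?thesis using k arcs(3)[OF k, of p] by (auto simp: \<Phi>_nth lab_def)
        qed
      qed
    qed (simp_all add: len \<Phi>_nth)
    ultimately show "xs \<in> closed_paths m h" unfolding closed_paths_def xs by blast
  next
    fix xs assume "xs \<in> closed_paths m h"
    then obtain x where x: "x \<in> states m" "xs \<in> paths h x x" by (auto simp: closed_paths_def)
    have P: "length xs = Suc (length h)" "xs ! 0 = x" "xs ! length h = x"
      "\<And>k. k < length h \<Longrightarrow> hook_step (h ! k) (xs ! k) (xs ! Suc k)"
      using x(2) unfolding paths_iff by auto
    have inS: "xs ! k \<in> states m" if "k \<le> length h" for k
      using that
    proof (induction k)
      case 0 then show ?case using x P by simp
    next
      case (Suc k)
      then show ?case using hook_step_states[OF P(4)[of k]] hk[of k] by auto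
    qed
    define f where "f = (\<lambda>(k, p). (xs ! k) p)"
    have f_arc: "f u = f v" if "(u, v) \<in> hook_arcs m h" for u v
      using that unfolding hook_arcs_def
    proof (elim UnE CollectE exE conjE)
      fix k assume k: "(u, v) = ((k, h ! k), (k, h ! k + 1))" "k < length h"
      then show "f u = f v" using P(4)[OF k(2)] by (auto simp: f_def hook_step_def)
    next
      fix k assume k: "(u, v) = ((k + 1, h ! k), (k + 1, h ! k + 1))" "k < length h"
      then show "f u = f v" using P(4)[OF k(2)] by (auto simp: f_def hook_step_def)
    next
      fix k p assume k: "(u, v) = ((k, p), (k + 1, p))" "k < length h" "p \<in> {1..m} - {h ! k, h ! k + 1}"
      then show "f u = f v" using P(4)[OF k(2)] by (auto simp: f_def hook_step_def)
    next
      fix p assume "(u, v) = ((length h, p), (0, p))"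
      then show "f u = f v" using P by (simp add: f_def)
    qed
    have f_R: "f u = f v" if "(u, v) \<in> R" for u v
      using that unfolding R_def by (induction rule: rtrancl_induct) (auto dest: f_arc)
    \<comment> \<open>Any representative of a component may be chosen: by \<open>f_R\<close> the
      label does not depend on it.\<close>
    define g where "g = (\<lambda>K\<in>X // R. f (SOME u. u \<in> K))"
    have g: "g (R `` {u}) = f u" if "u \<in> X" for u
    proof -
      have "(SOME v. v \<in> R `` {u}) \<in> R `` {u}"
        by (rule someI[of _ u]) (auto simp: R_def)
      then have "f (SOME v. v \<in> R `` {u}) = f u" using f_R by auto
      then show ?thesis using that by (simp add: g_def quotientI)
    qed
    have "xs = \<Phi> g"
    proof (rule nth_equalityI)
      fix k assume "k < length xs"
      then have k: "k \<le> length h" using P by simp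
      have "(xs ! k) p = lab g k p" for p
      proof (cases "1 \<le> p \<and> p \<le> m")
        case True
        then show ?thesis using g[of "(k, p)"] k X by (simp add: lab_def f_def)
      next
        case False
        then show ?thesis using inS[OF k] by (auto simp: lab_def states_def)
      qed
      then show "xs ! k = \<Phi> g ! k" using k by (auto simp: \<Phi>_nth)
    qed (simp add: P len)
    moreover have "g \<in> (X // R) \<rightarrow>\<^sub>E UNIV" by (simp add: g_def)
    ultimately show "xs \<in> \<Phi> ` ((X // R) \<rightarrow>\<^sub>E UNIV)" by blast
  qed
  have "card (closed_paths m h) = card ((X // R) \<rightarrow>\<^sub>E (UNIV :: bool set))"
    using bij_betw_same_card[OF bij] by simp
  also have "\<dots> = 2 ^ card (X // R)"
    using finXR by (simp add: card_PiE)
  finally show ?thesis by (simp add: circles_def X_def R_def)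
qed

text \<open>Both numbers are exponents of 2 in the same trace over the integers, where they can be
  compared. No geometry of the diagram has to be followed through the reductions.\<close>

lemma circles_unique:
  assumes "tl_close 0 m h k []" "set h \<subseteq> {1..<m}"
  shows "circles m h = k"
proof -
  have "(2::int) ^ circles m h = of_nat (card (closed_paths m h))"
    by (simp add: card_closed_paths[OF assms(2)])
  also have "\<dots> = 2 ^ k" using brauer_Tr[of m h] brauer.Tr_U_word[OF assms(1)] by metis
  finally show ?thesis by simp
qed

lemma (in zigzag) Tr_U_word_circles:
  assumes "set h \<subseteq> {1..<m}"
  shows "Tr \<mu> m (U_word h) = \<delta> ^ circles m h"
proof -
  obtain k h' where "tl_close 0 m h k h'" "set h' \<subseteq> {1..<0}"
    using tl_close_exists[of h 0 m] assms by auto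
  then have "tl_close 0 m h k []" by simp
  then show ?thesis using circles_unique[OF _ assms] Tr_U_word by blast
qed

subsection \<open>Laurent polynomials in \<open>A\<close> and the local ring at \<open>t = 0\<close>\<close>

definition eval_at :: "'a::comm_ring_1 \<Rightarrow> int poly \<Rightarrow> 'a" where
  "eval_at x p = poly (map_poly of_int p) x"

lemma eval_at_0 [simp]: "eval_at x 0 = 0" by (simp add: eval_at_def)
lemma eval_at_pCons [simp]: "eval_at x (pCons a p) = of_int a + x * eval_at x p"
  by (simp add: eval_at_def map_poly_pCons)
lemma eval_at_1 [simp]: "eval_at x 1 = 1"
  by (simp add: one_pCons)
lemma eval_at_add: "eval_at x (p + q) = eval_at x p + eval_at x q"
  by (induction p q rule: poly_induct2) (auto simp: algebra_simps)
lemma eval_at_uminus: "eval_at x (- p) = - eval_at x p"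
  using eval_at_add[of x p "- p"] by (simp add: eq_neg_iff_add_eq_0 add.commute)
lemma eval_at_diff: "eval_at x (p - q) = eval_at x p - eval_at x q"
  using eval_at_add[of x p "- q"] by (simp add: eval_at_uminus)
lemma eval_at_smult: "eval_at x (smult a p) = of_int a * eval_at x p"
  by (induction p) (auto simp: algebra_simps)
lemma eval_at_mult: "eval_at x (p * q) = eval_at x p * eval_at x q"
  by (induction p) (auto simp: algebra_simps eval_at_add eval_at_smult)
lemma eval_at_monom: "eval_at x (monom a n) = of_int a * x ^ n"
  by (induction n) (auto simp: monom_Suc monom_0 algebra_simps)
lemma eval_at_pcompose: "eval_at x (pcompose p q) = eval_at (eval_at x q) p"
  by (induction p) (auto simp: pcompose_pCons eval_at_add eval_at_mult)

lemma at_t_eval_at: "at_t p = eval_at t_var p"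
  by (simp add: at_t_def eval_at_def)

lemma of_int_ratfun: "(of_int a :: ratfun) = Fract [:a:] 1"
proof -
  have n: "(of_nat n :: ratfun) = Fract [:int n:] 1" for n
    by (induction n) (auto simp: Zero_fract_def One_fract_def one_pCons)
  obtain m n where "a = int m - int n" by (rule int_diff_cases)
  then show ?thesis by (simp add: n)
qed

lemma eval_at_A_var: "eval_at A_var p = Fract p 1"
  by (induction p) (auto simp: Zero_fract_def of_int_ratfun A_var_def)

lemma eval_at_A_var_eq_0_iff: "eval_at A_var p = 0 \<longleftrightarrow> p = 0"
  by (simp add: eval_at_A_var Zero_fract_def eq_fract)

lemma of_int_ratfun_eq_0_iff: "(of_int a :: ratfun) = 0 \<longleftrightarrow> a = 0"
  by (simp add: of_int_ratfun Zero_fract_def eq_fract)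

lemma A_var_nonzero [simp]: "A_var \<noteq> 0"
  using eval_at_A_var_eq_0_iff[of "[:0, 1:]"] by simp

text \<open>A power of \<open>A\<close> turns the value at \<open>1/A\<close> into the value of the
  reflected polynomial at the indeterminate \<open>A\<close>.\<close>

lemma eval_at_inverse_A_eq_0_iff: "eval_at (inverse A_var) p = 0 \<longleftrightarrow> p = 0"
proof
  assume 0: "eval_at (inverse A_var) p = 0"
  have deg: "degree (map_poly of_int p :: ratfun poly) = degree p"
    by (cases "p = 0") (simp_all add: map_poly_degree_eq of_int_ratfun_eq_0_iff)
  have "(map_poly of_int (reflect_poly p) :: ratfun poly) = reflect_poly (map_poly of_int p)"
    by (rule poly_eqI) (simp add: coeff_map_poly coeff_reflect_poly deg)
  then have "eval_at A_var (reflect_poly p) = A_var ^ degree p * eval_at (inverse A_var) p"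
    by (simp add: eval_at_def poly_reflect_poly_nz deg)
  then show "p = 0" using 0 by (simp add: eval_at_A_var_eq_0_iff)
qed simp

text \<open>The substitution \<open>t = B ^ 4\<close> with \<open>B = inverse A_var\<close>. It
  embeds polynomials in \<open>t\<close> into polynomials in \<open>B\<close>, where coefficients
  can be compared.\<close>

definition t_poly :: "int poly \<Rightarrow> int poly" where
  "t_poly p = pcompose p (monom 1 4)"

lemma t_var_eq: "t_var = inverse A_var ^ 4"
  by (simp add: t_var_def power_int_minus power_inverse)
lemma t_half_eq: "t_half = inverse A_var ^ 2"
  by (simp add: t_half_def power_int_minus power_inverse)
lemma t_var_half: "t_var = t_half ^ 2"
  by (simp add: t_var_eq t_half_eq power_mult[symmetric])

lemma eval_at_t_poly: "eval_at (inverse A_var) (t_poly p) = eval_at t_var p"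
  by (simp add: t_poly_def eval_at_pcompose eval_at_monom t_var_eq)

lemma coeff_monom_4_mult: "coeff (monom 1 4 * q) k = (if k < 4 then 0 else coeff q (k - 4))"
  for q :: "int poly"
  by (simp add: coeff_monom_mult not_less)

lemma coeff_t_poly: "coeff (t_poly p) k = (if 4 dvd k then coeff p (k div 4) else 0)"
proof (induction p arbitrary: k)
  case 0
  then show ?case by (simp add: t_poly_def)
next
  case (pCons a p)
  have "t_poly (pCons a p) = [:a:] + monom 1 4 * t_poly p" by (simp add: t_poly_def pcompose_pCons)
  then have "coeff (t_poly (pCons a p)) k = coeff [:a:] k + (if k < 4 then 0 else coeff (t_poly p) (k - 4))"
    by (simp add: coeff_monom_4_mult)
  also have "\<dots> = (if 4 dvd k then coeff (pCons a p) (k div 4) else 0)"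
  proof (cases "k < 4")
    case True
    then have "4 dvd k \<longleftrightarrow> k = 0" by (auto dest: dvd_imp_le)
    then show ?thesis using True by (auto simp: coeff_pCons split: nat.splits)
  next
    case False
    then obtain l where "k = 4 + l" by (metis le_Suc_ex not_less)
    then show ?thesis by (simp add: pCons.IH coeff_pCons)
  qed
  finally show ?case .
qed

lemma t_poly_eq_0: "t_poly p = 0 \<Longrightarrow> p = 0"
  by (rule poly_eqI) (metis coeff_0 coeff_t_poly dvd_triv_left nonzero_mult_div_cancel_left zero_neq_numeral)

lemma eval_at_t_var_eq_0_iff: "eval_at t_var p = 0 \<longleftrightarrow> p = 0"
  by (metis eval_at_t_poly eval_at_inverse_A_eq_0_iff t_poly_eq_0 eval_at_0)

lemma one_plus_t_nonzero: "1 + t_var \<noteq> 0"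
  using eval_at_t_var_eq_0_iff[of "[:1, 1:]"] by simp

lemma one_minus_t_power_nonzero: "1 - t_var ^ Suc k \<noteq> 0"
proof
  assume "1 - t_var ^ Suc k = 0"
  then have "eval_at t_var (1 - monom 1 (Suc k)) = 0" by (simp add: eval_at_diff eval_at_monom)
  then have "coeff (1 - monom 1 (Suc k) :: int poly) 0 = 0" by (simp add: eval_at_t_var_eq_0_iff)
  then show False by simp
qed

lemma loop_value_eq: "loop_value = - (A_var ^ 2) * (1 + t_var)"
  by (simp add: loop_value_def t_var_eq power_int_minus field_simps power_add[symmetric])

lemma loop_value_nonzero: "loop_value \<noteq> 0"
  by (simp add: loop_value_eq one_plus_t_nonzero)

text \<open>Every Laurent polynomial in \<open>A\<close> is a power of \<open>A\<close> times a
  polynomial in \<open>inverse A_var\<close>. This side is chosen because \<open>t\<close> is a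
  positive power of \<open>inverse A_var\<close>.\<close>

definition laurent :: "ratfun \<Rightarrow> bool" where
  "laurent x \<longleftrightarrow> (\<exists>k p. x = A_var ^ k * eval_at (inverse A_var) p)"

text \<open>The quotients of integer polynomials in \<open>t\<close> whose denominator has constant
  term 1, a subring of the power series in \<open>t\<close> that contains the coefficients of the
  rescaled projectors.\<close>

definition t_local :: "ratfun \<Rightarrow> bool" where
  "t_local x \<longleftrightarrow> (\<exists>p q. coeff q 0 = 1 \<and> x * eval_at t_var q = eval_at t_var p)"

lemma laurent_add: assumes "laurent x" "laurent y" shows "laurent (x + y)"
proof -
  obtain k p l q where "x = A_var ^ k * eval_at (inverse A_var) p" "y = A_var ^ l * eval_at (inverse A_var) q"
    using assms by (auto simp: laurent_def)
  then have "x + y = A_var ^ (k + l) * eval_at (inverse A_var) (monom 1 l * p + monom 1 k * q)"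
    by (simp add: eval_at_add eval_at_mult eval_at_monom power_add power_inverse field_simps)
  then show ?thesis unfolding laurent_def by blast
qed

lemma laurent_mult: assumes "laurent x" "laurent y" shows "laurent (x * y)"
proof -
  obtain k p l q where "x = A_var ^ k * eval_at (inverse A_var) p" "y = A_var ^ l * eval_at (inverse A_var) q"
    using assms by (auto simp: laurent_def)
  then have "x * y = A_var ^ (k + l) * eval_at (inverse A_var) (p * q)"
    by (simp add: eval_at_mult power_add)
  then show ?thesis unfolding laurent_def by blast
qed

lemma laurent_of_int [simp]: "laurent (of_int a)"
  unfolding laurent_def by (rule exI[of _ 0], rule exI[of _ "[:a:]"]) simp
lemma laurent_0 [simp]: "laurent 0" using laurent_of_int[of 0] by simp
lemma laurent_1 [simp]: "laurent 1" using laurent_of_int[of 1] by simp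
lemma laurent_uminus: "laurent x \<Longrightarrow> laurent (- x)"
  using laurent_mult[OF laurent_of_int[of "-1"], of x] by simp
lemma laurent_diff: "laurent x \<Longrightarrow> laurent y \<Longrightarrow> laurent (x - y)"
  using laurent_add[of x "- y"] laurent_uminus by simp
lemma laurent_A [simp]: "laurent A_var"
  unfolding laurent_def by (rule exI[of _ 1], rule exI[of _ 1]) simp
lemma laurent_inverse_A [simp]: "laurent (inverse A_var)"
  unfolding laurent_def by (rule exI[of _ 0], rule exI[of _ "[:0, 1:]"]) simp
lemma laurent_power: "laurent x \<Longrightarrow> laurent (x ^ k)"
  by (induction k) (auto intro: laurent_mult)
lemma laurent_sum: "(\<And>i. i \<in> I \<Longrightarrow> laurent (f i)) \<Longrightarrow> laurent (sum f I)"
  by (induction I rule: infinite_finite_induct) (auto intro: laurent_add)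
lemma laurent_prod: "(\<And>i. i \<in> I \<Longrightarrow> laurent (f i)) \<Longrightarrow> laurent (prod f I)"
  by (induction I rule: infinite_finite_induct) (auto intro: laurent_mult)
lemma laurent_t [simp]: "laurent t_var" "laurent t_half"
  by (auto simp: t_var_eq t_half_eq intro!: laurent_power)
lemma t_local_add: assumes "t_local x" "t_local y" shows "t_local (x + y)"
proof -
  obtain p q p' q' where *: "coeff q 0 = 1" "x * eval_at t_var q = eval_at t_var p" "coeff q' 0 = 1" "y * eval_at t_var q' = eval_at t_var p'"
    using assms by (auto simp: t_local_def)
  have "coeff (q * q') 0 = 1" using * by (simp add: coeff_mult_0)
  moreover have "(x + y) * eval_at t_var (q * q') = (x * eval_at t_var q) * eval_at t_var q' + (y * eval_at t_var q') * eval_at t_var q"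
    by (simp add: eval_at_mult algebra_simps)
  then have "(x + y) * eval_at t_var (q * q') = eval_at t_var (p * q' + p' * q)"
    unfolding * by (simp add: eval_at_mult eval_at_add)
  ultimately show ?thesis unfolding t_local_def by blast
qed

lemma t_local_mult: assumes "t_local x" "t_local y" shows "t_local (x * y)"
proof -
  obtain p q p' q' where *: "coeff q 0 = 1" "x * eval_at t_var q = eval_at t_var p" "coeff q' 0 = 1" "y * eval_at t_var q' = eval_at t_var p'"
    using assms by (auto simp: t_local_def)
  have "coeff (q * q') 0 = 1" using * by (simp add: coeff_mult_0)
  moreover have "(x * y) * eval_at t_var (q * q') = (x * eval_at t_var q) * (y * eval_at t_var q')"
    by (simp add: eval_at_mult algebra_simps)
  then have "(x * y) * eval_at t_var (q * q') = eval_at t_var (p * p')"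
    unfolding * by (simp add: eval_at_mult)
  ultimately show ?thesis unfolding t_local_def by blast
qed

lemma t_local_eval_at [simp]: "t_local (eval_at t_var p)"
  unfolding t_local_def by (rule exI[of _ p], rule exI[of _ 1]) simp
lemma t_local_0 [simp]: "t_local 0" using t_local_eval_at[of 0] by simp
lemma t_local_1 [simp]: "t_local 1" using t_local_eval_at[of 1] by simp
lemma t_local_t [simp]: "t_local t_var" using t_local_eval_at[of "[:0, 1:]"] by simp
lemma t_local_uminus: "t_local x \<Longrightarrow> t_local (- x)"
  using t_local_mult[OF t_local_eval_at[of "-1"], of x] by (simp add: eval_at_uminus)
lemma t_local_diff: "t_local x \<Longrightarrow> t_local y \<Longrightarrow> t_local (x - y)"
  using t_local_add[of x "- y"] t_local_uminus by simp
lemma t_local_power: "t_local x \<Longrightarrow> t_local (x ^ k)"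
  by (induction k) (auto intro: t_local_mult)
lemma t_local_sum: "(\<And>i. i \<in> I \<Longrightarrow> t_local (f i)) \<Longrightarrow> t_local (sum f I)"
  by (induction I rule: infinite_finite_induct) (auto intro: t_local_add)
lemma t_local_inverse: "t_local (1 / (1 - t_var ^ Suc k))"
  unfolding t_local_def
  by (rule exI[of _ 1], rule exI[of _ "1 - monom 1 (Suc k)"])
     (use one_minus_t_power_nonzero[of k] in \<open>simp add: eval_at_diff eval_at_monom\<close>)

text \<open>With \<open>x = A ^ k * F(B)\<close>, \<open>B = 1/A\<close> and
  \<open>x * Q = P\<close> one gets \<open>F * Q(B ^ 4) = B ^ k * P(B ^ 4)\<close> as polynomials in
  \<open>B\<close>. Since \<open>Q\<close> has constant term 1, \<open>F\<close> is the power series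
  quotient of the right side by \<open>Q(B ^ 4)\<close>, so only exponents \<open>k + 4 * i\<close>
  occur, and \<open>B ^ k\<close> cancels \<open>A ^ k\<close>.\<close>

lemma laurent_t_local:
  assumes "laurent x" "t_local x"
  shows "\<exists>p. x = eval_at t_var p"
proof -
  let ?B = "inverse A_var"
  obtain k F where x: "x = A_var ^ k * eval_at ?B F" using assms(1) by (auto simp: laurent_def)
  obtain P Q where Q: "coeff Q 0 = 1" and PQ: "x * eval_at t_var Q = eval_at t_var P"
    using assms(2) by (auto simp: t_local_def)
  have "?B ^ k * A_var ^ k = 1" by (simp add: power_mult_distrib[symmetric])
  then have "?B ^ k * (A_var ^ k * eval_at ?B F * eval_at t_var Q) = eval_at ?B F * eval_at t_var Q"
    by (simp add: mult.assoc[symmetric])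
  then have "eval_at ?B (F * t_poly Q) = ?B ^ k * (x * eval_at t_var Q)"
    by (simp add: eval_at_mult eval_at_t_poly x)
  also have "\<dots> = eval_at ?B (monom 1 k * t_poly P)" by (simp add: PQ eval_at_mult eval_at_monom eval_at_t_poly)
  finally have "eval_at ?B (F * t_poly Q - monom 1 k * t_poly P) = 0" by (simp add: eval_at_diff)
  then have eq: "F * t_poly Q = monom 1 k * t_poly P" by (simp add: eval_at_inverse_A_eq_0_iff)
  have Q0: "coeff (t_poly Q) 0 = 1" using Q by (simp add: coeff_t_poly)
  have conv: "coeff (F * t_poly Q) n = coeff F n + (\<Sum>i<n. coeff F i * coeff (t_poly Q) (n - i))" for n
    by (simp add: coeff_mult Q0 lessThan_Suc_atMost[symmetric])
  \<comment> \<open>The convolution with \<open>Q(B ^ 4)\<close> expresses a coefficient by earlier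
    ones whose exponents are congruent modulo 4, so strong induction applies.\<close>
  have F0: "coeff F n = 0" if "n < k \<or> \<not> 4 dvd (n - k)" for n
    using that
  proof (induction n rule: less_induct)
    case (less n)
    have "coeff (F * t_poly Q) n = 0"
      using less.prems unfolding eq by (auto simp: coeff_monom_mult coeff_t_poly)
    moreover have "coeff F i * coeff (t_poly Q) (n - i) = 0" if i: "i < n" for i
    proof (cases "4 dvd (n - i)")
      case True
      have "i < k \<or> \<not> 4 dvd (i - k)"
      proof (rule ccontr)
        assume "\<not> (i < k \<or> \<not> 4 dvd (i - k))"
        then have "n \<ge> k" "4 dvd ((n - i) + (i - k))" using True i dvd_add[OF True, of "i - k"] by auto
        moreover have "(n - i) + (i - k) = n - k" using i \<open>\<not> (i < k \<or> \<not> 4 dvd (i - k))\<close> by auto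
        ultimately show False using less.prems by auto
      qed
      then show ?thesis using less.IH[OF i] by simp
    qed (simp add: coeff_t_poly)
    ultimately show ?case unfolding conv by simp
  qed
  define p where "p = Abs_poly (\<lambda>i. coeff F (k + 4 * i))"
  have cp: "coeff p i = coeff F (k + 4 * i)" for i
    unfolding p_def by (subst coeff_Abs_poly[where n = "degree F"]) (auto intro!: coeff_eq_0)
  have "F = monom 1 k * t_poly p"
  proof (rule poly_eqI)
    fix n
    show "coeff F n = coeff (monom 1 k * t_poly p) n"
      using F0[of n] by (auto simp: coeff_monom_mult coeff_t_poly cp not_less)
  qed
  then have "x = eval_at t_var p"
    by (simp add: x eval_at_mult eval_at_monom eval_at_t_poly power_inverse)
  then show ?thesis by blast
qed

subsection \<open>The bracket as a trace\<close>

text \<open>The usual choice takes the same matrix for cup and cap, with entries \<open>A\<close>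
  and \<open>- 1/A\<close> times a square root of -1. The relations multiply a cup entry by a cap
  entry, so the root can be traded for opposite signs of \<open>kauff_cup\<close> and
  \<open>kauff_cap\<close>.\<close>

definition kauff_cup :: "bool \<Rightarrow> bool \<Rightarrow> ratfun" where
  "kauff_cup a b = (if a = b then 0 else if b then A_var else - inverse A_var)"
definition kauff_cap :: "bool \<Rightarrow> bool \<Rightarrow> ratfun" where
  "kauff_cap a b = (if a = b then 0 else if b then - A_var else inverse A_var)"
text \<open>The weights are \<open>- A ^ 2\<close> and \<open>- A powi (-2)\<close>, whose sum is
  the loop value. With \<open>- A ^ 2\<close> factored out, a state with \<open>k\<close> marked
  positions has weight \<open>t ^ k\<close> relative to the empty one.\<close>

definition kauff_weight :: "bool \<Rightarrow> ratfun" where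
  "kauff_weight a = - (A_var ^ 2) * (if a then t_var else 1)"

interpretation kauff: zigzag kauff_cup kauff_cap kauff_weight loop_value
proof
  have A4: "A_var ^ 4 * t_var = 1" by (simp add: t_var_eq power_inverse)
  have mu: "kauff_weight True = - (inverse A_var ^ 2)"
    by (simp add: kauff_weight_def t_var_eq power_inverse field_simps power_add[symmetric])
  show "(\<Sum>b\<in>UNIV. kauff_cup a b * kauff_cap b d) = (if a = d then 1 else 0)" for a d
    by (cases a; cases d) (auto simp: kauff_cup_def kauff_cap_def sum_bool)
  show "(\<Sum>b\<in>UNIV. kauff_cap a b * kauff_cup b d) = (if a = d then 1 else 0)" for a d
    by (cases a; cases d) (auto simp: kauff_cup_def kauff_cap_def sum_bool)
  show "(\<Sum>a\<in>UNIV. \<Sum>b\<in>UNIV. kauff_cap a b * kauff_cup a b) = loop_value"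
    by (simp add: kauff_cup_def kauff_cap_def sum_bool loop_value_def power2_eq_square power_int_minus)
  show "(\<Sum>b\<in>UNIV. kauff_weight b * kauff_cup a b * kauff_cap d b) = (if a = d then 1 else 0)" for a d
    by (cases a; cases d) (auto simp: kauff_cup_def kauff_cap_def sum_bool mu kauff_weight_def[of False] power2_eq_square field_simps)
  show "kauff_cup a b * (kauff_weight a * kauff_weight b) = kauff_cup a b" for a b
    by (cases a; cases b) (auto simp: kauff_cup_def mu kauff_weight_def[of False] power2_eq_square field_simps)
  show "kauff_cap a b * (kauff_weight a * kauff_weight b) = kauff_cap a b" for a b
    by (cases a; cases b) (auto simp: kauff_cap_def mu kauff_weight_def[of False] power2_eq_square field_simps)
  show "(\<Sum>b\<in>UNIV. kauff_weight b) = loop_value"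
    by (simp add: sum_bool kauff_weight_def loop_value_eq algebra_simps)
qed

abbreviation "kU \<equiv> kauff.U"
abbreviation "ktr \<equiv> Tr kauff_weight"

fun letter_op :: "braid_letter \<Rightarrow> ratfun linear_op" where
  "letter_op (Sig i) = scal A_var + scal (inverse A_var) * kU i"
| "letter_op (SigInv i) = scal (inverse A_var) + scal A_var * kU i"

definition braid_op :: "braid_word \<Rightarrow> ratfun linear_op" where
  "braid_op w = prod_list (map letter_op w)"

lemma braid_op_simps [simp]: "braid_op [] = 1" "braid_op (g # w) = letter_op g * braid_op w"
  "braid_op (u @ v) = braid_op u * braid_op v"
  by (simp_all add: braid_op_def)

text \<open>The bracket gives a single circle the value 1, the trace gives it the loop value; this
  accounts for the factor on the left. Smoothing a crossing is the expansion of its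
  operator.\<close>

lemma bracket_aux_trace:
  assumes "set h \<subseteq> {1..<m}" "letter_index ` set w \<subseteq> {1..<m}"
  shows "loop_value * bracket_aux m h w = ktr m (kauff.U_word h * braid_op w)"
  using assms
proof (induction m h w rule: bracket_aux.induct)
  case (1 m h)
  have "loop_value * loop_value powi (int (circles m h) - 1) = loop_value powi (1 + (int (circles m h) - 1))"
    by (subst power_int_add) (auto simp: loop_value_nonzero)
  then show ?case using 1 by (simp add: kauff.Tr_U_word_circles)
next
  case (2 m h i w)
  then have IH: "loop_value * bracket_aux m h w = ktr m (kauff.U_word h * braid_op w)"
    "loop_value * bracket_aux m (h @ [i]) w = ktr m (kauff.U_word (h @ [i]) * braid_op w)" by auto
  have "kauff.U_word h * braid_op (Sig i # w) = scal A_var * (kauff.U_word h * braid_op w) +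
      scal (inverse A_var) * (kauff.U_word (h @ [i]) * braid_op w)"
    by (simp add: algebra_simps scal_left)
  then have "ktr m (kauff.U_word h * braid_op (Sig i # w)) = A_var * (loop_value * bracket_aux m h w)
      + inverse A_var * (loop_value * bracket_aux m (h @ [i]) w)"
    by (simp only: Tr_add Tr_scal IH)
  then show ?case by (simp add: algebra_simps)
next
  case (3 m h i w)
  then have IH: "loop_value * bracket_aux m h w = ktr m (kauff.U_word h * braid_op w)"
    "loop_value * bracket_aux m (h @ [i]) w = ktr m (kauff.U_word (h @ [i]) * braid_op w)" by auto
  have "kauff.U_word h * braid_op (SigInv i # w) = scal (inverse A_var) * (kauff.U_word h * braid_op w) +
      scal A_var * (kauff.U_word (h @ [i]) * braid_op w)"
    by (simp add: algebra_simps scal_left)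
  then have "ktr m (kauff.U_word h * braid_op (SigInv i # w)) = inverse A_var * (loop_value * bracket_aux m h w)
      + A_var * (loop_value * bracket_aux m (h @ [i]) w)"
    by (simp only: Tr_add Tr_scal IH)
  then show ?case by (simp add: algebra_simps)
qed

lemma kauffman_bracket_trace:
  assumes "letter_index ` set w \<subseteq> {1..<m}"
  shows "loop_value * kauffman_bracket m w = ktr m (braid_op w)"
  using bracket_aux_trace[of "[]" m w] assms by (simp add: kauffman_bracket_def)

subsection \<open>Cabled braids\<close>

text \<open>\<open>X d a b\<close> is the crossing of \<open>a\<close> by \<open>b\<close> parallel strands with \<open>d\<close> strands to the left of it.\<close>

locale braided =
  fixes g :: "nat \<Rightarrow> 'a::monoid_mult"
  assumes far: "i + 2 \<le> j \<Longrightarrow> g i * g j = g j * g i"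
    and yb: "g i * g (Suc i) * g i = g (Suc i) * g i * g (Suc i)"
begin

definition W :: "nat list \<Rightarrow> 'a" where "W h = prod_list (map g h)"

lemma W_simps [simp]: "W [] = 1" "W (i # h) = g i * W h" "W (u @ v) = W u * W v"
  by (simp_all add: W_def)

lemma comm_W: "(\<And>i. i \<in> set h \<Longrightarrow> i + 2 \<le> l \<or> l + 2 \<le> i) \<Longrightarrow> g l * W h = W h * g l"
proof (induction h)
  case (Cons i h)
  have "g l * g i = g i * g l" using Cons.prems[of i] far[of i l] far[of l i] by auto
  then have "g l * W (i # h) = g i * (g l * W h)" by (simp add: mult.assoc[symmetric])
  then show ?case using Cons by (simp add: mult.assoc)
qed simp

text \<open>One strand crosses \<open>a\<close> parallel ones: in \<open>dn\<close> it moves from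
  position \<open>k + a\<close> to the left, in \<open>up\<close> from position \<open>k\<close> to
  the right.\<close>

definition dn :: "nat \<Rightarrow> nat \<Rightarrow> 'a" where "dn k a = W (rev [k..<k+a])"
definition up :: "nat \<Rightarrow> nat \<Rightarrow> 'a" where "up k a = W [k..<k+a]"

lemma dn_0 [simp]: "dn k 0 = 1" and dn_Suc: "dn k (Suc a) = g (k + a) * dn k a"
  by (simp_all add: dn_def)
lemma up_0 [simp]: "up k 0 = 1" and up_Suc: "up k (Suc a) = up k a * g (k + a)"
  by (simp_all add: up_def)

lemma comm_dn: "l + 2 \<le> k \<or> k + a + 1 \<le> l \<Longrightarrow> g l * dn k a = dn k a * g l"
  unfolding dn_def by (rule comm_W) auto
lemma comm_up: "l + 2 \<le> k \<or> k + a + 1 \<le> l \<Longrightarrow> g l * up k a = up k a * g l"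
  unfolding up_def by (rule comm_W) auto

lemma dn_slide: "k \<le> j \<Longrightarrow> j + 1 < k + a \<Longrightarrow> g j * dn k a = dn k a * g (Suc j)"
proof (induction a)
  case (Suc a)
  show ?case
  proof (cases "j + 1 < k + a")
    case True
    then have "g j * dn k (Suc a) = g (k + a) * (g j * dn k a)"
      using far[of j "k + a"] by (simp add: dn_Suc mult.assoc[symmetric])
    then show ?thesis using Suc.IH True Suc.prems by (simp add: dn_Suc mult.assoc)
  next
    case False
    then have ka: "k + a = Suc j" using Suc.prems by simp
    then obtain a' where a': "a = Suc a'" using Suc.prems by (cases a) auto
    then have j: "k + a' = j" using ka by simp
    have d: "dn k (Suc a) = g (Suc j) * g j * dn k a'"
      using a' j by (simp add: dn_Suc[of k "Suc a'"] dn_Suc[of k a'] mult.assoc)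
    have c: "g (Suc j) * dn k a' = dn k a' * g (Suc j)" by (rule comm_dn) (use j in simp)
    have "g j * dn k (Suc a) = (g j * g (Suc j) * g j) * dn k a'" unfolding d by (simp only: mult.assoc)
    also have "\<dots> = g (Suc j) * g j * (g (Suc j) * dn k a')" unfolding yb by (simp only: mult.assoc)
    also have "\<dots> = dn k (Suc a) * g (Suc j)" unfolding c d by (simp only: mult.assoc)
    finally show ?thesis .
  qed
qed simp

text \<open>Here the sliding crossing is that of two strands which move one after the other across
  the same \<open>a\<close> strands.\<close>

lemma dn2_slide: "g (k + a) * (dn k a * dn (Suc k) a) = dn k a * dn (Suc k) a * g k"
proof (induction a)
  case (Suc a)
  let ?p = "g (k + a)" and ?q = "g (Suc (k + a))"
  have c: "?q * dn k a = dn k a * ?q" by (rule comm_dn) simp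
  have "g (k + Suc a) * (dn k (Suc a) * dn (Suc k) (Suc a)) = ?q * ?p * (dn k a * ?q) * dn (Suc k) a"
    by (simp add: dn_Suc mult.assoc)
  also have "\<dots> = (?q * ?p * ?q) * (dn k a * dn (Suc k) a)" by (simp only: c[symmetric] mult.assoc)
  also have "\<dots> = (?p * ?q * ?p) * (dn k a * dn (Suc k) a)" by (simp only: yb)
  also have "\<dots> = ?p * ?q * (?p * (dn k a * dn (Suc k) a))" by (simp only: mult.assoc)
  also have "\<dots> = ?p * (?q * dn k a) * dn (Suc k) a * g k" by (simp only: Suc.IH mult.assoc)
  also have "\<dots> = dn k (Suc a) * dn (Suc k) (Suc a) * g k" by (simp only: c dn_Suc mult.assoc add_Suc)
  finally show ?case .
qed simp

fun X :: "nat \<Rightarrow> nat \<Rightarrow> nat \<Rightarrow> 'a" where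
  "X d a 0 = 1"
| "X d a (Suc b) = X d a b * dn (Suc (d + b)) a"

lemma W_block: "W (block_crossing d a b) = X d a b"
  by (induction b) (simp_all add: block_crossing_def dn_def)

lemma X_add: "X d a (b + c) = X d a b * X (d + b) a c"
  by (induction c) (simp_all add: mult.assoc add.assoc)

lemma comm_X: "l + 1 \<le> d \<or> d + a + b + 1 \<le> l \<Longrightarrow> g l * X d a b = X d a b * g l"
proof (induction b)
  case (Suc b)
  have "g l * dn (Suc (d + b)) a = dn (Suc (d + b)) a * g l" by (rule comm_dn) (use Suc.prems in auto)
  then have "X d a b * (g l * dn (Suc (d + b)) a) = X d a (Suc b) * g l" by (simp add: mult.assoc)
  moreover have "g l * X d a b = X d a b * g l" using Suc by auto
  ultimately show ?case by (simp add: mult.assoc[symmetric])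
qed simp

lemma X_slide_left: "1 \<le> j \<Longrightarrow> j < a \<Longrightarrow> g (d + j) * X d a b = X d a b * g (d + b + j)"
proof (induction b)
  case (Suc b)
  have "g (d + b + j) * dn (Suc (d + b)) a = dn (Suc (d + b)) a * g (Suc (d + b + j))"
    by (rule dn_slide) (use Suc.prems in auto)
  then have "X d a b * g (d + b + j) * dn (Suc (d + b)) a = X d a (Suc b) * g (d + Suc b + j)"
    by (simp add: mult.assoc)
  then show ?case using Suc by (simp add: mult.assoc[symmetric])
qed simp

lemma X_split:
  assumes "1 \<le> j" "j < b"
  shows "X d a b = X d a (j - 1) * (dn (d + j) a * dn (Suc (d + j)) a) * X (d + j + 1) a (b - j - 1)"
proof -
  obtain i where i: "j = Suc i" using assms by (cases j) auto
  have "b = (i + 2) + (b - j - 1)" using assms i by simp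
  then have "X d a b = X d a (i + 2) * X (d + (i + 2)) a (b - j - 1)" by (metis X_add)
  then show ?thesis using i by (simp add: mult.assoc)
qed

lemma X_slide_right:
  assumes "1 \<le> j" "j < b" shows "g (d + a + j) * X d a b = X d a b * g (d + j)"
proof -
  let ?P = "X d a (j - 1)" and ?M = "dn (d + j) a * dn (Suc (d + j)) a" and ?R = "X (d + j + 1) a (b - j - 1)"
  have 1: "g (d + a + j) * ?P = ?P * g (d + a + j)" by (rule comm_X) (use assms in auto)
  have 2: "g (d + a + j) * ?M = ?M * g (d + j)" using dn2_slide[of "d + j" a] by (simp add: add_ac)
  have 3: "g (d + j) * ?R = ?R * g (d + j)" by (rule comm_X) simp
  have "g (d + a + j) * X d a b = (g (d + a + j) * ?P) * ?M * ?R" unfolding X_split[OF assms] by (simp only: mult.assoc)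
  also have "\<dots> = ?P * (g (d + a + j) * ?M) * ?R" by (simp only: 1 mult.assoc)
  also have "\<dots> = ?P * ?M * (g (d + j) * ?R)" by (simp only: 2 mult.assoc)
  also have "\<dots> = X d a b * g (d + j)" unfolding X_split[OF assms] by (simp only: 3 mult.assoc)
  finally show ?thesis .
qed

lemma X_slide_word: "set h \<subseteq> {1..<b} \<Longrightarrow> W (map ((+) (d + a)) h) * X d a b = X d a b * W (map ((+) d) h)"
proof (induction h)
  case (Cons j h)
  have "W (map ((+) (d + a)) (j # h)) * X d a b = g (d + a + j) * (X d a b * W (map ((+) d) h))"
    using Cons by (simp add: mult.assoc)
  also have "\<dots> = (g (d + a + j) * X d a b) * W (map ((+) d) h)" by (simp only: mult.assoc)
  also have "\<dots> = X d a b * W (map ((+) d) (j # h))"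
    using Cons.prems by (subst X_slide_right) (simp_all add: mult.assoc)
  finally show ?case .
qed simp

end

lemma block_crossing_shift: "block_crossing d a b = map ((+) d) (block_crossing 0 a b)"
proof -
  have "map ((+) d) [i..<j] = [d + i..<d + j]" for i j
    by (induction j) auto
  then have "map ((+) d) (rev [q + 1..<q + a + 1]) = rev [d + q + 1..<d + q + a + 1]" for q
    by (simp add: rev_map[symmetric] add_ac del: upt_Suc)
  then show ?thesis by (simp add: block_crossing_def map_concat comp_def del: upt_Suc)
qed

lemma set_block_crossing: "set (block_crossing d a b) \<subseteq> {d + 1..<d + a + b}"
  by (auto simp: block_crossing_def)

context braided
begin

text \<open>The crossing of the blocks \<open>b\<close> and \<open>c\<close> is itself a word in
  generators, and it slides through the crossing of \<open>a\<close> with all \<open>b + c\<close>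
  strands by \<open>X_slide_word\<close>. Splitting that crossing with \<open>X_add\<close> in both
  orders gives the relation for blocks.\<close>

lemma X_yang_baxter: "X (d + a) b c * X d a c * X (d + c) a b = X d a b * X (d + b) a c * X d b c"
proof -
  have s: "set (block_crossing 0 b c) \<subseteq> {1..<b + c}" using set_block_crossing[of 0 b c] by simp
  have "X (d + a) b c * X d a (c + b) = X d a (b + c) * X d b c"
    using X_slide_word[OF s, of d a]
    by (simp add: block_crossing_shift[symmetric] W_block add.commute)
  moreover have "X d a (c + b) = X d a c * X (d + c) a b" by (rule X_add)
  moreover have "X d a (b + c) = X d a b * X (d + b) a c" by (rule X_add)
  ultimately show ?thesis by (simp only: mult.assoc)
qed

lemma X_commute:
  assumes "d + a + b \<le> d'"
  shows "X d a b * X d' a' b' = X d' a' b' * X d a b"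
proof -
  have "W h * X d' a' b' = X d' a' b' * W h" if "set h \<subseteq> {d + 1..<d + a + b}" for h
    using that
  proof (induction h)
    case (Cons i h)
    have "g i * X d' a' b' = X d' a' b' * g i" by (rule comm_X) (use Cons.prems assms in auto)
    then show ?case using Cons by (simp add: mult.assoc) (simp add: mult.assoc[symmetric])
  qed simp
  from this[OF set_block_crossing] show ?thesis by (simp add: W_block)
qed

text \<open>The grid is defined strand by strand in the right block. Here and in
  \<open>X_Suc_left'\<close> it is decomposed by strands of the left block: the rightmost one,
  respectively the leftmost one, is split off.\<close>

lemma X_Suc_left: "X d (Suc a) b = up (d + a + 1) b * X d a b"
proof (induction b)
  case (Suc b)
  have c: "g (Suc (d + b) + a) * X d a b = X d a b * g (Suc (d + b) + a)" by (rule comm_X) simp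
  have "X d (Suc a) (Suc b) = up (d + a + 1) b * (X d a b * g (Suc (d + b) + a)) * dn (Suc (d + b)) a"
    by (simp add: Suc.IH dn_Suc mult.assoc)
  also have "\<dots> = up (d + a + 1) b * (g (Suc (d + b) + a) * X d a b) * dn (Suc (d + b)) a"
    by (simp only: c)
  also have "\<dots> = up (d + a + 1) (Suc b) * X d a (Suc b)"
    by (simp add: up_Suc mult.assoc add_ac)
  finally show ?case .
qed simp

lemma X_Suc_left': "X d (Suc a) b = X (Suc d) a b * up (d + 1) b"
proof (induction a)
  case 0
  have "X d 0 b = 1" for d by (induction b) simp_all
  then show ?case using X_Suc_left[of d 0 b] by simp
next
  case (Suc a)
  have "X d (Suc (Suc a)) b = up (Suc d + a + 1) b * (X (Suc d) a b * up (d + 1) b)"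
    using X_Suc_left[of d "Suc a" b] Suc.IH by simp
  also have "\<dots> = X (Suc d) (Suc a) b * up (d + 1) b"
    by (simp only: X_Suc_left[of "Suc d"] mult.assoc)
  finally show ?case .
qed

lemma up_add: "up k (a + b) = up k a * up (k + a) b"
  by (induction b) (simp_all add: up_Suc mult.assoc add.assoc)

text \<open>Each factor on the left carries one strand across all others. As long as at most
  \<open>N\<close> strands have moved, what happens among the first \<open>N\<close> strands
  separates from the crossings with the other \<open>M\<close>. For \<open>k = N\<close> the first
  factor is the full twist on \<open>N\<close> strands and the second a crossing of blocks; this is
  how the full twist on all strands is compared with the cabled one.\<close>

lemma up_power: "k \<le> N \<Longrightarrow> up 1 (N - 1 + M) ^ k = up 1 (N - 1) ^ k * X (N - k) k M"
proof (induction k)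
  case 0
  have "X N 0 M = 1" by (induction M) simp_all
  then show ?case by simp
next
  case (Suc k)
  define d where "d = N - Suc k"
  have N: "N = Suc (d + k)" using Suc.prems by (simp add: d_def)
  \<comment> \<open>The Coxeter element on the right is cut into three pieces: the first acts left
    of the grid and commutes with it, the second enlarges the grid by one strand, the third slides
    back through the grid to the \<open>Suc k\<close> strands of its left block.\<close>
  have com: "X (Suc d) k M * up 1 e = up 1 e * X (Suc d) k M" if "e \<le> d" for e
    using that
  proof (induction e)
    case (Suc e)
    have "g (1 + e) * X (Suc d) k M = X (Suc d) k M * g (1 + e)"
      by (rule comm_X) (use Suc.prems in simp)
    then show ?case using Suc by (simp add: up_Suc mult.assoc) (simp add: mult.assoc[symmetric])
  qed simp
  have slide: "X d (Suc k) M * up (Suc (d + M)) e = up (Suc d) e * X d (Suc k) M" if "e \<le> k" for e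
    using that
  proof (induction e)
    case (Suc e)
    have "g (d + Suc e) * X d (Suc k) M = X d (Suc k) M * g (d + M + Suc e)"
      by (rule X_slide_left) (use Suc.prems in auto)
    then show ?case using Suc by (simp add: up_Suc mult.assoc) (simp add: mult.assoc[symmetric])
  qed simp
  have "up 1 (N - 1 + M) = up 1 d * up (Suc d) (M + k)"
    using up_add[of 1 d "M + k"] N by (simp add: add_ac)
  also have "up (Suc d) (M + k) = up (Suc d) M * up (Suc (d + M)) k"
    using up_add[of "Suc d" M k] by simp
  finally have "X (Suc d) k M * up 1 (N - 1 + M) = (X (Suc d) k M * up 1 d) * up (Suc d) M * up (Suc (d + M)) k"
    by (simp only: mult.assoc)
  also have "\<dots> = up 1 d * (X (Suc d) k M * up (d + 1) M) * up (Suc (d + M)) k"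
    by (simp only: com[OF order_refl]) (simp add: mult.assoc)
  also have "\<dots> = up 1 d * (X d (Suc k) M * up (Suc (d + M)) k)"
    by (simp only: X_Suc_left' mult.assoc)
  also have "\<dots> = (up 1 d * up (1 + d) k) * X d (Suc k) M"
    by (simp add: slide mult.assoc)
  also have "\<dots> = up 1 (N - 1) * X d (Suc k) M"
    using up_add[of 1 d k] N by simp
  finally have step: "X (Suc d) k M * up 1 (N - 1 + M) = up 1 (N - 1) * X d (Suc k) M" .
  have "N - k = Suc d" using N by simp
  then have "up 1 (N - 1 + M) ^ k = up 1 (N - 1) ^ k * X (Suc d) k M" using Suc by simp
  then have "up 1 (N - 1 + M) ^ Suc k = up 1 (N - 1) ^ k * (X (Suc d) k M * up 1 (N - 1 + M))"
    by (simp only: power_Suc2 mult.assoc)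
  then show ?case unfolding step by (simp only: power_Suc2 mult.assoc d_def)
qed

end

text \<open>The blocks have exchanged places after the first grid, hence the exchanged widths in the
  second. Strand by strand, what \<open>dn\<close> moves across \<open>a\<close> others is moved
  back by \<open>up\<close>.\<close>

lemma X_inverse:
  assumes "braided g" "braided g'" "\<And>i. g i * g' i = 1"
  shows "braided.X g d a b * braided.X g' d b a = 1"
proof -
  interpret g: braided g by fact
  interpret g': braided g' by fact
  have "g.dn k a * g'.up k a = 1" for k a
  proof (induction a)
    case (Suc a)
    have "g.dn k (Suc a) * g'.up k (Suc a) = g (k + a) * (g.dn k a * g'.up k a) * g' (k + a)"
      by (simp add: g.dn_Suc g'.up_Suc mult.assoc)
    then show ?case using Suc assms(3) by simp
  qed simp
  note du = this
  show ?thesis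
  proof (induction b)
    case 0
    show ?case by (induction a) simp_all
  next
    case (Suc b)
    have "g.X d a (Suc b) * g'.X d (Suc b) a = g.X d a b * (g.dn (Suc (d + b)) a * g'.up (Suc (d + b)) a) * g'.X d b a"
      by (simp add: g'.X_Suc_left mult.assoc)
    then show ?case by (simp add: du Suc.IH)
  qed
qed

section \<open>The crossing operators and their inverses\<close>

definition sg :: "nat \<Rightarrow> ratfun linear_op" where "sg i = letter_op (Sig i)"
definition sgi :: "nat \<Rightarrow> ratfun linear_op" where "sgi i = letter_op (SigInv i)"

lemma ap_fun_add: "ap F (\<lambda>x. u x + v x) = (\<lambda>x. ap F u x + ap F v x)"
  by (rule ext) (rule ap_add)
lemma ap_fun_scale: "ap F (\<lambda>x. k * v x) = (\<lambda>x. k * ap F v x)"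
  by (rule ext) (rule ap_scale)
lemma ap_sg: "ap (sg i) v = (\<lambda>x. A_var * v x + inverse A_var * ap (kU i) v x)"
  by (rule ext) (simp add: sg_def)
lemma ap_sgi: "ap (sgi i) v = (\<lambda>x. inverse A_var * v x + A_var * ap (kU i) v x)"
  by (rule ext) (simp add: sgi_def)

lemma loop_rel: "loop_value = - (A_var * A_var) - inverse A_var * inverse A_var"
  by (simp add: loop_value_def power_int_minus power2_eq_square)

lemma ap_kU_sq: "ap (kU i) (ap (kU i) v) = (\<lambda>x. loop_value * ap (kU i) v x)"
  using arg_cong[OF kauff.U_sq[of i], of "\<lambda>F. ap F v"] by (simp add: fun_eq_iff)
lemma ap_kU_zz: "ap (kU i) (ap (kU (Suc i)) (ap (kU i) v)) = ap (kU i) v"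
  using arg_cong[OF kauff.U_zz[of i], of "\<lambda>F. ap F v"] by simp
lemma ap_kU_zz': "ap (kU (Suc i)) (ap (kU i) (ap (kU (Suc i)) v)) = ap (kU (Suc i)) v"
  using arg_cong[OF kauff.U_zz'[of i], of "\<lambda>F. ap F v"] by simp
lemma ap_kU_far: "i + 2 \<le> j \<Longrightarrow> ap (kU i) (ap (kU j) v) = ap (kU j) (ap (kU i) v)"
  using arg_cong[OF kauff.U_far[of i j], of "\<lambda>F. ap F v"] by simp

lemma A_inv: "A_var * inverse A_var = 1" "A_var * (inverse A_var * z) = z" "inverse A_var * (A_var * z) = z"
  by (simp_all add: mult.assoc[symmetric])

interpretation sg: braided sg
proof
  show "sg i * sg j = sg j * sg i" if "i + 2 \<le> j" for i j
    by (rule linear_op_eqI, simp only: ap_times ap_sg ap_fun_add ap_fun_scale ap_kU_far[OF that]) (simp add: algebra_simps)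
  show "sg i * sg (Suc i) * sg i = sg (Suc i) * sg i * sg (Suc i)" for i
    by (rule linear_op_eqI, simp only: ap_times ap_sg ap_fun_add ap_fun_scale ap_kU_sq ap_kU_zz ap_kU_zz' loop_rel)
       (simp add: algebra_simps A_inv)
qed

interpretation sgi: braided sgi
proof
  show "sgi i * sgi j = sgi j * sgi i" if "i + 2 \<le> j" for i j
    by (rule linear_op_eqI, simp only: ap_times ap_sgi ap_fun_add ap_fun_scale ap_kU_far[OF that]) (simp add: algebra_simps)
  show "sgi i * sgi (Suc i) * sgi i = sgi (Suc i) * sgi i * sgi (Suc i)" for i
    by (rule linear_op_eqI, simp only: ap_times ap_sgi ap_fun_add ap_fun_scale ap_kU_sq ap_kU_zz ap_kU_zz' loop_rel)
       (simp add: algebra_simps A_inv)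
qed

lemma sg_sgi: "sg i * sgi i = 1"
  by (rule linear_op_eqI, simp only: ap_times ap_one ap_sg ap_sgi ap_fun_add ap_fun_scale ap_kU_sq loop_rel) (simp add: algebra_simps A_inv)
lemma sgi_sg: "sgi i * sg i = 1"
  by (rule linear_op_eqI, simp only: ap_times ap_one ap_sg ap_sgi ap_fun_add ap_fun_scale ap_kU_sq loop_rel) (simp add: algebra_simps A_inv)

lemma braid_op_Sig: "braid_op (map Sig h) = sg.W h"
  by (induction h) (simp_all add: sg_def[symmetric] del: letter_op.simps)
lemma braid_op_SigInv: "braid_op (map SigInv h) = sgi.W h"
  by (induction h) (simp_all add: sgi_def[symmetric] del: letter_op.simps)


section \<open>Cables of braid words and invariance under the braid relations\<close>

fun recolor :: "(nat \<Rightarrow> nat) \<Rightarrow> braid_word \<Rightarrow> nat \<Rightarrow> nat" where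
  "recolor r [] = r"
| "recolor r (x # w) = recolor (r \<circ> transpose (letter_index x) (letter_index x + 1)) w"

lemma recolor_append: "recolor r (u @ v) = recolor (recolor r u) v"
  by (induction u arbitrary: r) auto

lemma cable_Cons: "cable r (x # w) = cable r [x] @ cable (r \<circ> transpose (letter_index x) (letter_index x + 1)) w"
  by (cases x) auto

lemma cable_append: "cable r (u @ v) = cable r u @ cable (recolor r u) v"
proof (induction u arbitrary: r)
  case (Cons x u)
  show ?case
    by (simp only: append_Cons cable_Cons[of r x "u @ v"] cable_Cons[of r x u] Cons recolor.simps append_assoc)
qed simp

lemma strand_perm_append: "strand_perm (u @ v) = strand_perm v \<circ> strand_perm u"
  by (induction u) (auto simp: comp_assoc)

lemma recolor_perm: "recolor r w (strand_perm w i) = r i"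
  by (induction w arbitrary: r i) simp_all

text \<open>The strands replacing position \<open>i\<close> occupy the places
  \<open>offset r i + 1\<close> to \<open>offset r i + r i\<close> of the cable.\<close>

definition offset :: "(nat \<Rightarrow> nat) \<Rightarrow> nat \<Rightarrow> nat" where "offset r i = (\<Sum>j\<in>{1..<i}. r j)"

lemma offset_Suc: "1 \<le> i \<Longrightarrow> offset r (Suc i) = offset r i + r i"
  by (simp add: offset_def)

lemma offset_mono: "i \<le> j \<Longrightarrow> offset r i \<le> offset r j"
  unfolding offset_def by (rule sum_mono2) auto

lemma offset_Suc_le: "1 \<le> i \<Longrightarrow> i < j \<Longrightarrow> offset r i + r i \<le> offset r j"
  using offset_Suc[of i r] offset_mono[of "Suc i" j r] by simp

lemma offset_transpose:
  assumes "1 \<le> i"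
  shows "offset (r \<circ> transpose i (Suc i)) j = (if j = Suc i then offset r i + r (Suc i) else offset r j)"
proof -
  define r' where "r' = r \<circ> transpose i (Suc i)"
  have r': "r' i = r (Suc i)" "r' (Suc i) = r i" "\<And>k. k \<noteq> i \<Longrightarrow> k \<noteq> Suc i \<Longrightarrow> r' k = r k"
    by (simp_all add: r'_def transpose_def)
  have low: "offset r' j = offset r j" if "j \<le> i" for j
    unfolding offset_def by (rule sum.cong) (use that r' in auto)
  have mid: "offset r' (Suc i) = offset r i + r (Suc i)"
    using offset_Suc[OF assms, of r'] low[of i] r' by simp
  have hi: "offset r' (Suc (Suc i) + k) = offset r (Suc (Suc i) + k)" for k
  proof (induction k)
    case 0
    show ?case using mid r' offset_Suc[of "Suc i" r'] offset_Suc[of "Suc i" r] offset_Suc[OF assms, of r] by simp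
  next
    case (Suc k)
    show ?case using Suc r'(3)[of "Suc (Suc i) + k"] offset_Suc[of "Suc (Suc i) + k" r'] offset_Suc[of "Suc (Suc i) + k" r] by simp
  qed
  have "offset r' j = offset r j" if "j > Suc i"
  proof -
    have "Suc (Suc i) + (j - Suc (Suc i)) = j" using that by simp
    then show ?thesis using hi[of "j - Suc (Suc i)"] by (simp only:)
  qed
  then have "offset r' j = (if j = Suc i then offset r i + r (Suc i) else offset r j)"
    using low[of j] mid by (cases "j \<le> i"; cases "j = Suc i") auto
  then show ?thesis by (simp only: r'_def)
qed

lemma sum_offset: "(\<Sum>i=1..n. r i) = offset r (Suc n)"
  by (simp add: offset_def atLeastLessThanSuc_atLeastAtMost)

definition valid :: "nat \<Rightarrow> braid_word \<Rightarrow> bool" where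
  "valid n w \<longleftrightarrow> letter_index ` set w \<subseteq> {1..<n}"

lemma valid_simps [simp]: "valid n []" "valid n (x # w) \<longleftrightarrow> letter_index x \<in> {1..<n} \<and> valid n w"
  "valid n (u @ v) \<longleftrightarrow> valid n u \<and> valid n v"
  by (auto simp: valid_def)

lemma valid_map: "valid n (map Sig h) \<longleftrightarrow> set h \<subseteq> {1..<n}" "valid n (map SigInv h) \<longleftrightarrow> set h \<subseteq> {1..<n}"
  by (simp_all add: valid_def image_image)

lemma cable_indices_offset: "cable_indices r i = block_crossing (offset r i) (r i) (r (Suc i))"
  by (simp add: cable_indices_def offset_def)

lemma cable_indices_valid:
  assumes "1 \<le> i" "i < n" shows "set (cable_indices r i) \<subseteq> {1..<offset r (Suc n)}"
proof -
  have "offset r (Suc (Suc i)) \<le> offset r (Suc n)" using assms by (intro offset_mono) auto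
  then have "offset r i + r i + r (Suc i) \<le> offset r (Suc n)"
    using offset_Suc[of i r] offset_Suc[of "Suc i" r] assms by simp
  then show ?thesis unfolding cable_indices_offset using set_block_crossing by fastforce
qed

lemma cable_valid: "valid n w \<Longrightarrow> valid (offset r (Suc n)) (cable r w)"
proof (induction w arbitrary: r)
  case (Cons x w)
  define r' where "r' = r \<circ> transpose (letter_index x) (letter_index x + 1)"
  have "offset r' (Suc n) = offset r (Suc n)" using Cons.prems offset_transpose[of "letter_index x" r "Suc n"] by (auto simp: r'_def)
  then have 1: "valid (offset r (Suc n)) (cable r' w)" using Cons.IH[of r'] Cons.prems by simp
  have "valid (offset r (Suc n)) (cable r [x])"
    using Cons.prems cable_indices_valid[of "letter_index x" n r] by (cases x) (simp_all add: valid_map)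
  then show ?case using 1 unfolding cable_Cons[of r x w] r'_def[symmetric] by simp
qed simp

lemma braid_op_cable_Sig: "braid_op (cable r [Sig i]) = sg.X (offset r i) (r i) (r (Suc i))"
  by (simp add: braid_op_Sig cable_indices_offset sg.W_block)

lemma braid_op_cable_SigInv: "braid_op (cable r [SigInv i]) = sgi.X (offset r i) (r i) (r (Suc i))"
  by (simp add: braid_op_SigInv cable_indices_offset sgi.W_block)

lemma cable2: "cable r [x, y] = cable r [x] @ cable (r \<circ> transpose (letter_index x) (letter_index x + 1)) [y]"
  by (rule cable_Cons)

lemma cable3: "cable r [x, y, z] = cable r [x] @ cable (r \<circ> transpose (letter_index x) (letter_index x + 1)) [y]
   @ cable (r \<circ> transpose (letter_index x) (letter_index x + 1) \<circ> transpose (letter_index y) (letter_index y + 1)) [z]"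
  by (simp only: cable_Cons[of _ x "[y, z]"] cable_Cons[of _ y "[z]"])

text \<open>The operators are compared for every coloring \<open>r\<close>, and colors and
  permutation at the lower end must agree, because a relation applied inside a longer word is cabled
  with the colors arriving there. This makes \<open>word_equiv\<close> stable under
  contexts.\<close>

definition word_equiv :: "braid_word \<Rightarrow> braid_word \<Rightarrow> bool" where
  "word_equiv x y \<longleftrightarrow> strand_perm x = strand_perm y \<and> (\<forall>r. recolor r x = recolor r y \<and>
     braid_op (cable r x) = braid_op (cable r y)) \<and> writhe x = writhe y"

lemma word_equiv_cancel:
  assumes "1 \<le> i"
  shows "word_equiv [Sig i, SigInv i] []"
  unfolding word_equiv_def
proof (intro conjI allI)
  fix r
  show "braid_op (cable r [Sig i, SigInv i]) = braid_op (cable r [])"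
    unfolding cable2 braid_op_simps braid_op_cable_Sig braid_op_cable_SigInv
    using X_inverse[OF sg.braided_axioms sgi.braided_axioms sg_sgi]
    by (simp add: offset_transpose[OF assms])
qed (simp_all add: writhe_def comp_assoc)

lemma word_equiv_cancel':
  assumes "1 \<le> i"
  shows "word_equiv [SigInv i, Sig i] []"
  unfolding word_equiv_def
proof (intro conjI allI)
  fix r
  show "braid_op (cable r [SigInv i, Sig i]) = braid_op (cable r [])"
    unfolding cable2 braid_op_simps braid_op_cable_Sig braid_op_cable_SigInv
    using X_inverse[OF sgi.braided_axioms sg.braided_axioms sgi_sg]
    by (simp add: offset_transpose[OF assms])
qed (simp_all add: writhe_def comp_assoc)

lemma word_equiv_far:
  assumes "1 \<le> i" "i + 2 \<le> j"
  shows "word_equiv [Sig i, Sig j] [Sig j, Sig i]"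
  unfolding word_equiv_def
proof (intro conjI allI)
  have sw: "transpose j (j + 1) \<circ> transpose i (i + 1) = transpose i (i + 1) \<circ> transpose j (j + 1)"
    using assms by (auto simp: fun_eq_iff transpose_def)
  show "strand_perm [Sig i, Sig j] = strand_perm [Sig j, Sig i]" using sw by simp
  fix r
  show "recolor r [Sig i, Sig j] = recolor r [Sig j, Sig i]" using sw by (simp add: comp_assoc)
  have t: "transpose i (Suc i) j = j" "transpose i (Suc i) (Suc j) = Suc j" "transpose j (Suc j) i = i" "transpose j (Suc j) (Suc i) = Suc i"
    using assms by (auto simp: transpose_def)
  have "offset r i + r i + r (Suc i) \<le> offset r j"
    using offset_mono[of "Suc (Suc i)" j r] offset_Suc[of i r] offset_Suc[of "Suc i" r] assms by simp
  from sg.X_commute[OF this]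
  show "braid_op (cable r [Sig i, Sig j]) = braid_op (cable r [Sig j, Sig i])"
    unfolding cable2 braid_op_simps braid_op_cable_Sig
    using assms by (simp add: offset_transpose t)
qed (simp add: writhe_def)

lemma word_equiv_braid:
  assumes "1 \<le> i"
  shows "word_equiv [Sig i, Sig (i + 1), Sig i] [Sig (i + 1), Sig i, Sig (i + 1)]"
  unfolding word_equiv_def
proof (intro conjI allI)
  have sw: "transpose i (i + 1) \<circ> (transpose (i + 1) (i + 2) \<circ> transpose i (i + 1))
     = transpose (i + 1) (i + 2) \<circ> (transpose i (i + 1) \<circ> transpose (i + 1) (i + 2))"
    by (auto simp: fun_eq_iff transpose_def)
  show "strand_perm [Sig i, Sig (i + 1), Sig i] = strand_perm [Sig (i + 1), Sig i, Sig (i + 1)]"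
    using sw by (simp add: comp_assoc)
  fix r
  show "recolor r [Sig i, Sig (i + 1), Sig i] = recolor r [Sig (i + 1), Sig i, Sig (i + 1)]"
    using sw by (simp add: comp_assoc)
  have t: "transpose i (Suc i) (Suc (Suc i)) = Suc (Suc i)" "transpose (Suc i) (Suc (Suc i)) i = i"
    by (auto simp: transpose_def)
  show "braid_op (cable r [Sig i, Sig (i + 1), Sig i]) = braid_op (cable r [Sig (i + 1), Sig i, Sig (i + 1)])"
    unfolding cable3 braid_op_simps braid_op_cable_Sig
    using assms sg.X_yang_baxter[of "offset r i" "r i" "r (Suc i)" "r (Suc (Suc i))"]
    by (simp add: offset_transpose t offset_Suc mult.assoc)
qed (simp add: writhe_def)

lemma word_equiv_ctx: "word_equiv x y \<Longrightarrow> word_equiv (u @ x @ v) (u @ y @ v)"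
  by (auto simp: word_equiv_def strand_perm_append recolor_append cable_append writhe_def)

lemma S_bracket_trace:
  assumes "valid n w"
  shows "loop_value * S_bracket N n w = (\<Sum>f \<in> components n w \<rightarrow>\<^sub>E {0..N div 2}.
        (\<Prod>K\<in>components n w. (-1) ^ f K * of_nat ((N - f K) choose f K)) *
        ktr (offset (\<lambda>i. N - 2 * f (component w i)) (Suc n)) (braid_op (cable (\<lambda>i. N - 2 * f (component w i)) w)))"
proof -
  have "loop_value * kauffman_bracket (\<Sum>i=1..n. r i) (cable r w) = ktr (offset r (Suc n)) (braid_op (cable r w))" for r
    unfolding sum_offset by (rule kauffman_bracket_trace) (use cable_valid[OF assms, of r] in \<open>simp add: valid_def\<close>)
  then show ?thesis
    by (simp add: S_bracket_def Let_def sum_distrib_left mult.left_commute[of loop_value])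
qed

lemma word_equiv_S_bracket:
  assumes "word_equiv w w'" "valid n w" "valid n w'"
  shows "S_bracket N n w = S_bracket N n w'"
proof -
  have c: "component w = component w'" "components n w = components n w'"
    using assms(1) by (auto simp: word_equiv_def component_def components_def)
  have "loop_value * S_bracket N n w = loop_value * S_bracket N n w'"
    unfolding S_bracket_trace[OF assms(2)] S_bracket_trace[OF assms(3)] c
    using assms(1) by (simp add: word_equiv_def)
  then show ?thesis using loop_value_nonzero by simp
qed

lemma braid_step_equiv: "braid_step n w w' \<Longrightarrow> word_equiv w w' \<and> (valid n w \<longleftrightarrow> valid n w')"
proof (induction rule: braid_step.induct)
  case (cancel_right i u v)
  then show ?case using word_equiv_ctx[OF word_equiv_cancel[of i], of u v] by auto
next
  case (cancel_left i u v)
  then show ?case using word_equiv_ctx[OF word_equiv_cancel'[of i], of u v] by auto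
next
  case (far_comm i j u v)
  then show ?case using word_equiv_ctx[OF word_equiv_far[of i j], of u v] by auto
next
  case (braid_rel i u v)
  then show ?case using word_equiv_ctx[OF word_equiv_braid[of i], of u v] by auto
qed

lemma braid_eq_colored_jones:
  assumes "braid_eq n w w'" "valid n w'"
  shows "colored_jones k n w = colored_jones k n w'"
proof -
  have "word_equiv w w' \<and> (valid n w \<longleftrightarrow> valid n w')"
    using assms(1) unfolding braid_eq_def
  proof (induction rule: equivclp_induct)
    case (step y z)
    then have "word_equiv y z \<and> (valid n y \<longleftrightarrow> valid n z)"
      using braid_step_equiv[of n y z] braid_step_equiv[of n z y] by (auto simp: word_equiv_def)
    then show ?case using step by (auto simp: word_equiv_def)
  qed (simp add: word_equiv_def)
  then have "S_bracket N n w = S_bracket N n w'" "writhe w = writhe w'" for N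
    using word_equiv_S_bracket[of w w' n] assms(2) by (auto simp: word_equiv_def)
  then show ?thesis by (simp add: colored_jones_def Let_def)
qed

subsection \<open>Jones--Wenzl projectors\<close>

abbreviation "kcu \<equiv> cup kauff_cup"
abbreviation "kca \<equiv> cap kauff_cap"

section \<open>Caps and cups passing through crossings\<close>

lemma sg_eq: "sg i = scal A_var + scal (inverse A_var) * kU i"
  by (simp add: sg_def)

lemma ca_sg_near: "i + 2 \<le> j \<Longrightarrow> kca j * sg i = sg i * kca j"
  using kauff.ca_U_near[of i j] by (simp add: sg_eq algebra_simps scal_left scal_comm)
lemma ca_sg_far: "i \<le> j \<Longrightarrow> kca i * sg (j + 2) = sg j * kca i"
  using kauff.ca_U_far[of i j] by (simp add: sg_eq algebra_simps scal_left scal_comm)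
lemma sg_cu_near: "i + 2 \<le> j \<Longrightarrow> sg i * kcu j = kcu j * sg i"
  using kauff.U_cu_near[of i j] by (simp add: sg_eq algebra_simps scal_left scal_comm)
lemma sg_cu_far: "i \<le> j \<Longrightarrow> sg (j + 2) * kcu i = kcu i * sg j"
  using kauff.U_cu_far[of i j] by (simp add: sg_eq algebra_simps scal_left scal_comm)

lemma ap_kca_zz: "ap (kca j) (ap (kU (Suc j)) v) = ap (kca (Suc j)) v"
proof -
  have "kca j * kU (Suc j) = kca (Suc j)"
    by (simp add: kauff.U_def mult.assoc[symmetric] kauff.ca_Suc_cu)
  from arg_cong[OF this, of "\<lambda>F. ap F v"] show ?thesis by simp
qed
lemma ap_kca_zz': "ap (kca (Suc j)) (ap (kU j) v) = ap (kca j) v"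
proof -
  have "kca (Suc j) * kU j = kca j"
    by (simp add: kauff.U_def mult.assoc[symmetric] kauff.ca_cu_Suc)
  from arg_cong[OF this, of "\<lambda>F. ap F v"] show ?thesis by simp
qed
lemma ap_kca_loop: "ap (kca j) (ap (kU j) v) = (\<lambda>x. loop_value * ap (kca j) v x)"
proof -
  have "kca j * kU j = scal loop_value * kca j"
    by (simp add: kauff.U_def mult.assoc[symmetric] kauff.ca_cu_loop)
  from arg_cong[OF this, of "\<lambda>F. ap F v"] show ?thesis by (simp add: fun_eq_iff)
qed
lemma ap_kcu_zz: "ap (kU (Suc j)) (ap (kcu j) v) = ap (kcu (Suc j)) v"
proof -
  have "kU (Suc j) * kcu j = kcu (Suc j)"
    by (simp add: kauff.U_def mult.assoc kauff.ca_cu_Suc)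
  from arg_cong[OF this, of "\<lambda>F. ap F v"] show ?thesis by simp
qed
lemma ap_kcu_zz': "ap (kU j) (ap (kcu (Suc j)) v) = ap (kcu j) v"
proof -
  have "kU j * kcu (Suc j) = kcu j"
    by (simp add: kauff.U_def mult.assoc kauff.ca_Suc_cu)
  from arg_cong[OF this, of "\<lambda>F. ap F v"] show ?thesis by simp
qed
lemma ap_kcu_loop: "ap (kU j) (ap (kcu j) v) = (\<lambda>x. loop_value * ap (kcu j) v x)"
proof -
  have "kU j * kcu j = scal loop_value * kcu j"
    by (simp add: kauff.U_def mult.assoc kauff.ca_cu_loop scal_comm)
  from arg_cong[OF this, of "\<lambda>F. ap F v"] show ?thesis by (simp add: fun_eq_iff)
qed

text \<open>A strand passes completely across a cap. No power of \<open>A\<close> appears because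
  this is a regular isotopy; only kinks contribute a factor.\<close>

lemma ca_sg_sg: "kca j * (sg (Suc j) * sg j) = kca (Suc j)"
  by (rule linear_op_eqI, simp only: ap_times ap_sg ap_fun_add ap_fun_scale ap_kca_zz ap_kca_zz' ap_kca_loop loop_rel)
     (simp add: algebra_simps A_inv)
lemma ca_sg_sg': "kca (Suc j) * (sg j * sg (Suc j)) = kca j"
  by (rule linear_op_eqI, simp only: ap_times ap_sg ap_fun_add ap_fun_scale ap_kca_zz ap_kca_zz' ap_kca_loop loop_rel)
     (simp add: algebra_simps A_inv)
lemma sg_sg_cu: "sg j * sg (Suc j) * kcu j = kcu (Suc j)"
  by (rule linear_op_eqI, simp only: ap_times ap_sg ap_fun_add ap_fun_scale ap_kcu_zz ap_kcu_zz' ap_kcu_loop loop_rel)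
     (simp add: algebra_simps A_inv)
lemma sg_sg_cu': "sg (Suc j) * sg j * kcu (Suc j) = kcu j"
  by (rule linear_op_eqI, simp only: ap_times ap_sg ap_fun_add ap_fun_scale ap_kcu_zz ap_kcu_zz' ap_kcu_loop loop_rel)
     (simp add: algebra_simps A_inv)

lemma ca_dn_near: "k + a + 1 \<le> l \<Longrightarrow> kca l * sg.dn k a = sg.dn k a * kca l"
proof (induction a)
  case (Suc a)
  have "kca l * sg (k + a) = sg (k + a) * kca l" by (rule ca_sg_near) (use Suc.prems in simp)
  then have "kca l * sg.dn k (Suc a) = sg (k + a) * (kca l * sg.dn k a)"
    by (simp add: sg.dn_Suc mult.assoc[symmetric])
  then show ?case using Suc by (simp add: sg.dn_Suc mult.assoc)
qed simp

lemma ca_dn_far: "l \<le> k \<Longrightarrow> kca l * sg.dn (k + 2) a = sg.dn k a * kca l"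
proof (induction a)
  case (Suc a)
  have "kca l * sg (k + a + 2) = sg (k + a) * kca l" by (rule ca_sg_far) (use Suc.prems in simp)
  then have "kca l * sg.dn (k + 2) (Suc a) = sg (k + a) * (kca l * sg.dn (k + 2) a)"
    by (simp add: sg.dn_Suc mult.assoc[symmetric] add_ac)
  then show ?case using Suc by (simp add: sg.dn_Suc mult.assoc)
qed simp

text \<open>The cap joins two of the parallel strands, so their two crossings with the moving strand
  disappear; the cap reappears one place further right because the moving strand has passed to its
  left.\<close>

lemma ca_dn: "k \<le> j \<Longrightarrow> j + 1 < k + a \<Longrightarrow> kca j * sg.dn k a = sg.dn k (a - 2) * kca (Suc j)"
proof (induction a)
  case (Suc a)
  show ?case
  proof (cases "j + 1 < k + a")
    case True
    then obtain a' where a': "a = Suc (Suc a')" using Suc.prems by (cases a; cases "a - 1") auto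
    have "kca j * sg (k + a' + 2) = sg (k + a') * kca j" by (rule ca_sg_far) (use True a' in simp)
    then have "kca j * sg.dn k (Suc a) = sg (k + a') * (kca j * sg.dn k a)"
      using a' by (simp add: sg.dn_Suc[of k "Suc (Suc a')"] mult.assoc[symmetric])
    also have "kca j * sg.dn k a = sg.dn k a' * kca (Suc j)" using Suc.IH True Suc.prems a' by simp
    finally show ?thesis using a' by (simp add: sg.dn_Suc[of k a'] mult.assoc)
  next
    case False
    then have ka: "k + a = Suc j" using Suc.prems by simp
    then obtain a' where a': "a = Suc a'" using Suc.prems by (cases a) auto
    then have j: "k + a' = j" using ka by simp
    have "kca j * sg.dn k (Suc a) = kca j * (sg (Suc j) * sg j) * sg.dn k a'"
      using a' j by (simp add: sg.dn_Suc[of k "Suc a'"] sg.dn_Suc[of k a'] mult.assoc)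
    also have "\<dots> = kca (Suc j) * sg.dn k a'" by (simp only: ca_sg_sg)
    also have "\<dots> = sg.dn k a' * kca (Suc j)" by (rule ca_dn_near) (use j in simp)
    finally show ?thesis using a' by simp
  qed
qed simp

lemma ca_dn2: "kca (k + a) * (sg.dn k a * sg.dn (Suc k) a) = kca k"
proof (induction a)
  case (Suc a)
  let ?p = "sg (k + a)" and ?q = "sg (Suc (k + a))"
  have c: "?q * sg.dn k a = sg.dn k a * ?q" by (rule sg.comm_dn) simp
  have "kca (k + Suc a) * (sg.dn k (Suc a) * sg.dn (Suc k) (Suc a))
      = kca (Suc (k + a)) * ?p * (sg.dn k a * ?q) * sg.dn (Suc k) a"
    by (simp add: sg.dn_Suc mult.assoc)
  also have "\<dots> = (kca (Suc (k + a)) * (?p * ?q)) * (sg.dn k a * sg.dn (Suc k) a)"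
    by (simp only: c[symmetric] mult.assoc)
  also have "\<dots> = kca k" unfolding ca_sg_sg' Suc.IH ..
  finally show ?case .
qed simp

lemma ca_X_near: "d + a + b + 1 \<le> l \<Longrightarrow> kca l * sg.X d a b = sg.X d a b * kca l"
proof (induction b)
  case (Suc b)
  have e: "kca l * sg.dn (Suc (d + b)) a = sg.dn (Suc (d + b)) a * kca l" by (rule ca_dn_near) (use Suc.prems in simp)
  have "kca l * sg.X d a b = sg.X d a b * kca l" using Suc by simp
  then have "kca l * sg.X d a (Suc b) = sg.X d a b * (kca l * sg.dn (Suc (d + b)) a)"
    by (simp add: mult.assoc[symmetric])
  then show ?case unfolding e by (simp add: mult.assoc)
qed simp

lemma ca_X_far: "l \<le> d + 1 \<Longrightarrow> kca l * sg.X (d + 2) a b = sg.X d a b * kca l"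
proof (induction b)
  case (Suc b)
  have e: "kca l * sg.dn (Suc (d + b) + 2) a = sg.dn (Suc (d + b)) a * kca l" by (rule ca_dn_far) (use Suc.prems in simp)
  have "kca l * sg.X (d + 2) a (Suc b) = (kca l * sg.X (d + 2) a b) * sg.dn (Suc (d + b) + 2) a"
    by (simp add: mult.assoc)
  also have "\<dots> = sg.X d a b * (kca l * sg.dn (Suc (d + b) + 2) a)"
    using Suc by (simp add: mult.assoc)
  finally show ?case unfolding e by (simp add: mult.assoc)
qed simp

lemma ca_X_left: "1 \<le> j \<Longrightarrow> j < a \<Longrightarrow> kca (d + j) * sg.X d a b = sg.X d (a - 2) b * kca (d + b + j)"
proof (induction b)
  case (Suc b)
  have e: "kca (d + b + j) * sg.dn (Suc (d + b)) a = sg.dn (Suc (d + b)) (a - 2) * kca (Suc (d + b + j))"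
    by (rule ca_dn) (use Suc.prems in auto)
  have "kca (d + j) * sg.X d a (Suc b) = (kca (d + j) * sg.X d a b) * sg.dn (Suc (d + b)) a"
    by (simp add: mult.assoc)
  also have "\<dots> = sg.X d (a - 2) b * (kca (d + b + j) * sg.dn (Suc (d + b)) a)"
    using Suc by (simp add: mult.assoc)
  finally show ?case unfolding e by (simp add: mult.assoc)
qed simp

lemma ca_X_right:
  assumes "1 \<le> j" "j < b" shows "kca (d + a + j) * sg.X d a b = sg.X d a (b - 2) * kca (d + j)"
proof -
  let ?P = "sg.X d a (j - 1)" and ?M = "sg.dn (d + j) a * sg.dn (Suc (d + j)) a" and ?R = "sg.X (d + j + 1) a (b - j - 1)"
  have 1: "kca (d + a + j) * ?P = ?P * kca (d + a + j)" by (rule ca_X_near) (use assms in auto)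
  have 2: "kca (d + a + j) * ?M = kca (d + j)" using ca_dn2[of "d + j" a] by (simp add: add_ac)
  have 3: "kca (d + j) * ?R = sg.X (d + (j - 1)) a (b - j - 1) * kca (d + j)"
    using ca_X_far[of "d + j" "d + (j - 1)" a "b - j - 1"] assms by simp
  have "kca (d + a + j) * sg.X d a b = (kca (d + a + j) * ?P) * ?M * ?R" unfolding sg.X_split[OF assms] by (simp only: mult.assoc)
  also have "\<dots> = ?P * (kca (d + a + j) * ?M) * ?R" by (simp only: 1 mult.assoc)
  also have "\<dots> = ?P * (kca (d + j) * ?R)" by (simp only: 2 mult.assoc)
  also have "\<dots> = (?P * sg.X (d + (j - 1)) a (b - j - 1)) * kca (d + j)" by (simp only: 3 mult.assoc)
  also have "?P * sg.X (d + (j - 1)) a (b - j - 1) = sg.X d a (b - 2)"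
    using sg.X_add[of d a "j - 1" "b - j - 1"] assms by (simp add: numeral_2_eq_2)
  finally show ?thesis .
qed

text \<open>The hook is an affine function of the crossing, \<open>U = A * (sg - A)\<close>.\<close>

lemma U_sg_intertwine: "sg i * Z = Z * sg j \<Longrightarrow> kU i * Z = Z * kU j"
proof -
  assume a: "sg i * Z = Z * sg j"
  have e: "kU k = scal A_var * (sg k - scal A_var)" for k
    by (simp add: sg_eq mult.assoc[symmetric] scal_mult[symmetric])
  have "kU i * Z = scal A_var * (sg i * Z - scal A_var * Z)" by (simp only: e left_diff_distrib mult.assoc)
  also have "\<dots> = scal A_var * (Z * sg j - Z * scal A_var)" by (simp only: a scal_comm[of Z])
  also have "\<dots> = Z * kU j" by (simp only: e right_diff_distrib scal_left)
  finally show ?thesis .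
qed

text \<open>The quotient \<open>[a] / [a + 1]\<close> of quantum integers. It enters the recursion
  of \<open>jw\<close> with a positive sign because the loop value is \<open>- [2]\<close>.\<close>

definition jw_coeff :: "nat \<Rightarrow> ratfun" where
  "jw_coeff a = t_half * (1 - t_var ^ a) / (1 - t_var ^ Suc a)"

text \<open>Wenzl's recursion for the projector on the strands \<open>d + 1\<close> to
  \<open>d + a\<close>. Its coefficient vanishes for \<open>a = 0\<close>, so the projector on one
  strand is the identity.\<close>

fun jw :: "nat \<Rightarrow> nat \<Rightarrow> ratfun linear_op" where
  "jw d 0 = 1"
| "jw d (Suc a) = jw d a + scal (jw_coeff a) * (jw d a * kU (d + a) * jw d a)"

lemma jw_coeff_0 [simp]: "jw_coeff 0 = 0" by (simp add: jw_coeff_def)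

text \<open>This is \<open>[2] * [a + 1] = [a] + [a + 2]\<close>. The factor
  \<open>loop_value + jw_coeff a\<close> is the scalar produced by closing the last strand of the
  projector on \<open>a + 1\<close> strands.\<close>

lemma jw_coeff_Suc: "jw_coeff (Suc a) * (loop_value + jw_coeff a) = -1"
proof -
  define s x y where "s = t_half" and "x = 1 - t_var ^ Suc a" and "y = 1 - t_var ^ Suc (Suc a)"
  have nz: "s \<noteq> 0" "x \<noteq> 0" "y \<noteq> 0"
    using one_minus_t_power_nonzero[of a] one_minus_t_power_nonzero[of "Suc a"] by (auto simp: s_def x_def y_def t_half_eq)
  have t: "t_var = s * s" by (simp add: s_def t_var_half power2_eq_square)
  have "A_var ^ 2 * s = 1" by (simp add: s_def t_half_eq power_mult_distrib[symmetric])
  then have l: "loop_value * s = - (1 + t_var)" unfolding loop_value_eq by (simp add: algebra_simps)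
  have "jw_coeff a * x = s * (1 - t_var ^ a)"
    using nz by (simp only: jw_coeff_def x_def[symmetric] s_def[symmetric]) simp
  moreover have "(loop_value + jw_coeff a) * (s * x) = (loop_value * s) * x + s * (jw_coeff a * x)"
    by (simp add: algebra_simps)
  ultimately have "(loop_value + jw_coeff a) * (s * x) = (loop_value * s) * x + s * s * (1 - t_var ^ a)"
    by (simp only: mult.assoc)
  also have "\<dots> = - y" unfolding l t[symmetric] x_def y_def by (simp add: algebra_simps)
  finally have e: "(loop_value + jw_coeff a) * (s * x) = - y" .
  have "jw_coeff (Suc a) = s * x / y" by (simp add: jw_coeff_def s_def x_def y_def)
  then have "jw_coeff (Suc a) * (loop_value + jw_coeff a) = ((loop_value + jw_coeff a) * (s * x)) / y" by simp
  then show ?thesis unfolding e using nz by simp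
qed

text \<open>The projector is a polynomial in the hooks of its range, so it passes through any
  operator that carries these hooks to those of another range.\<close>

lemma jw_intertwine:
  assumes "\<And>j. 1 \<le> j \<Longrightarrow> j < a \<Longrightarrow> kU (d + j) * Z = Z * kU (d' + j)"
  shows "jw d a * Z = Z * jw d' a"
  using assms
proof (induction a)
  case (Suc a)
  then have IH: "jw d a * Z = Z * jw d' a" by simp
  have "jw d a * kU (d + a) * jw d a * Z = Z * (jw d' a * kU (d' + a) * jw d' a)" if "a \<ge> 1"
  proof -
    have U: "kU (d + a) * Z = Z * kU (d' + a)" using Suc.prems that by simp
    have "jw d a * kU (d + a) * jw d a * Z = jw d a * kU (d + a) * (jw d a * Z)" by (simp only: mult.assoc)
    also have "\<dots> = jw d a * (kU (d + a) * Z) * jw d' a" by (simp only: IH mult.assoc)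
    also have "\<dots> = (jw d a * Z) * kU (d' + a) * jw d' a" by (simp only: U mult.assoc)
    also have "\<dots> = Z * (jw d' a * kU (d' + a) * jw d' a)" by (simp only: IH mult.assoc)
    finally show ?thesis .
  qed
  then show ?case using IH by (cases "a = 0") (simp_all add: distrib_left distrib_right scal_left mult.assoc)
qed simp

lemma jw_absorb_left: "(\<And>j. 1 \<le> j \<Longrightarrow> j < a \<Longrightarrow> kU (d + j) * Z = 0) \<Longrightarrow> jw d a * Z = Z"
proof (induction a)
  case (Suc a)
  then have IH: "jw d a * Z = Z" by simp
  have "kU (d + a) * Z = 0" if "a \<ge> 1" using Suc.prems that by simp
  then show ?case using IH by (cases "a = 0") (simp_all add: distrib_right mult.assoc)
qed simp

lemma jw_absorb_right: "(\<And>j. 1 \<le> j \<Longrightarrow> j < a \<Longrightarrow> Z * kU (d + j) = 0) \<Longrightarrow> Z * jw d a = Z"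
proof (induction a)
  case (Suc a)
  then have IH: "Z * jw d a = Z" by simp
  have U: "Z * kU (d + a) = 0" if "a \<ge> 1" using Suc.prems that by simp
  have "Z * (jw d a * kU (d + a) * jw d a) = (Z * jw d a) * kU (d + a) * jw d a" by (simp only: mult.assoc)
  then show ?case using IH U by (cases "a = 0") (simp_all add: distrib_left scal_left)
qed simp

lemma jw_ca: "jw d a * kca l = kca l * jw d a" if "d + a + 1 \<le> l"
  by (rule jw_intertwine) (use that kauff.ca_U_near in force)
lemma jw_cu: "jw d a * kcu l = kcu l * jw d a" if "d + a + 1 \<le> l"
  by (rule jw_intertwine) (use that kauff.U_cu_near in force)
lemma jw_U: "jw d a * kU l = kU l * jw d a" if "d + a + 1 \<le> l"
  by (rule jw_intertwine) (use that kauff.U_far in force)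

text \<open>Annihilation and partial trace need each other in the induction: the new hook is killed
  because the scalar of the partial trace cancels the recursion coefficient, and the next partial
  trace uses idempotence, which rests on annihilation. The cup at \<open>d + a\<close> joins the
  last strand of the projector to a spare strand, so cap, projector and cup together form the
  partial trace over that last strand.\<close>

lemma jw_main:
  "(\<forall>j. 1 \<le> j \<and> j < a \<longrightarrow> kU (d + j) * jw d a = 0 \<and> jw d a * kU (d + j) = 0) \<and>
   (a \<ge> 1 \<longrightarrow> kca (d + a) * jw d a * kcu (d + a) = scal (loop_value + jw_coeff (a - 1)) * jw d (a - 1))"
proof (induction a)
  case (Suc a)
  let ?J = "jw d a" and ?U = "kU (d + a)" and ?J' = "jw d (a - 1)"
  have kill: "kU (d + j) * ?J = 0" "?J * kU (d + j) = 0" if "1 \<le> j" "j < a" for j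
    using Suc that by auto
  have idem: "?J * ?J = ?J" by (rule jw_absorb_left) (rule kill)
  have new: "?U * jw d (Suc a) = 0" "jw d (Suc a) * ?U = 0" if a: "a \<ge> 1"
  proof -
    have JU: "?J' * ?U = ?U * ?J'" by (rule jw_U) (use a in simp)
    have Jca: "?J' * kca (d + a) = kca (d + a) * ?J'" by (rule jw_ca) (use a in simp)
    have J'J: "?J' * ?J = ?J" "?J * ?J' = ?J"
      by (rule jw_absorb_left jw_absorb_right; use kill in simp)+
    have tr: "kca (d + a) * ?J * kcu (d + a) = scal (loop_value + jw_coeff (a - 1)) * ?J'" using Suc a by simp
    have "?U * ?J * ?U = kcu (d + a) * (kca (d + a) * ?J * kcu (d + a)) * kca (d + a)"
      by (simp only: kauff.U_def mult.assoc)
    also have "\<dots> = scal (loop_value + jw_coeff (a - 1)) * (kcu (d + a) * (?J' * kca (d + a)))"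
      unfolding tr by (simp only: scal_left mult.assoc)
    also have "\<dots> = scal (loop_value + jw_coeff (a - 1)) * (?U * ?J')"
      unfolding Jca by (simp only: kauff.U_def mult.assoc)
    finally have UJU: "?U * ?J * ?U = scal (loop_value + jw_coeff (a - 1)) * (?U * ?J')" .
    have c: "scal (jw_coeff a) * (scal (loop_value + jw_coeff (a - 1)) * Z) = - Z" for Z
      using jw_coeff_Suc[of "a - 1"] a by (simp add: mult.assoc[symmetric] scal_mult[symmetric] scal_uminus)
    have "?U * jw d (Suc a) = ?U * ?J + scal (jw_coeff a) * ((?U * ?J * ?U) * ?J)"
      by (simp add: distrib_left scal_left mult.assoc)
    also have "\<dots> = ?U * ?J + - (?U * (?J' * ?J))" unfolding UJU by (simp only: mult.assoc c)
    also have "\<dots> = 0" by (simp only: J'J add.right_inverse)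
    finally show "?U * jw d (Suc a) = 0" .
    have "jw d (Suc a) * ?U = ?J * ?U + ?J * (scal (jw_coeff a) * (?U * ?J * ?U))"
      by (simp add: distrib_right scal_left mult.assoc)
    also have "\<dots> = ?J * ?U + ?J * (- (?J' * ?U))" unfolding UJU c JU ..
    also have "\<dots> = ?J * ?U - (?J * ?J') * ?U" by (simp add: mult.assoc)
    also have "\<dots> = 0" by (simp only: J'J diff_self)
    finally show "jw d (Suc a) * ?U = 0" .
  qed
  have old: "kU (d + j) * jw d (Suc a) = 0" "jw d (Suc a) * kU (d + j) = 0" if "1 \<le> j" "j < a" for j
  proof -
    have "kU (d + j) * (?J * ?U * ?J) = 0"
      using kill[OF that] by (simp add: mult.assoc[symmetric])
    then show "kU (d + j) * jw d (Suc a) = 0"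
      using kill[OF that] by (simp add: distrib_left scal_left)
    show "jw d (Suc a) * kU (d + j) = 0"
      using kill[OF that] by (simp add: distrib_right mult.assoc)
  qed
  have 1: "kca (Suc (d + a)) * ?J = ?J * kca (Suc (d + a))" by (rule jw_ca[symmetric]) simp
  have 2: "?J * kcu (Suc (d + a)) = kcu (Suc (d + a)) * ?J" by (rule jw_cu) simp
  have "kca (Suc (d + a)) * ?J * kcu (Suc (d + a)) = ?J * (kca (Suc (d + a)) * kcu (Suc (d + a)))"
    by (simp only: 1 mult.assoc)
  also have "\<dots> = scal loop_value * ?J" by (simp add: kauff.ca_cu_loop scal_comm)
  finally have t1: "kca (Suc (d + a)) * ?J * kcu (Suc (d + a)) = scal loop_value * ?J" .
  have "kca (Suc (d + a)) * (?J * ?U * ?J) * kcu (Suc (d + a)) = (kca (Suc (d + a)) * ?J) * ?U * (?J * kcu (Suc (d + a)))"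
    by (simp only: mult.assoc)
  also have "\<dots> = ?J * ((kca (Suc (d + a)) * kcu (d + a)) * (kca (d + a) * kcu (Suc (d + a)))) * ?J"
    by (simp only: 1 2 kauff.U_def mult.assoc)
  also have "\<dots> = ?J" by (simp add: kauff.ca_cu_Suc kauff.ca_Suc_cu idem)
  finally have t2: "kca (Suc (d + a)) * (?J * ?U * ?J) * kcu (Suc (d + a)) = ?J" .
  have "kca (Suc (d + a)) * jw d (Suc a) * kcu (Suc (d + a)) =
     kca (Suc (d + a)) * ?J * kcu (Suc (d + a)) + scal (jw_coeff a) * (kca (Suc (d + a)) * (?J * ?U * ?J) * kcu (Suc (d + a)))"
    by (simp only: jw.simps distrib_left distrib_right scal_left mult.assoc)
  also have "\<dots> = scal (loop_value + jw_coeff a) * ?J" unfolding t1 t2 by (simp add: scal_add distrib_right)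
  finally have "kca (Suc (d + a)) * jw d (Suc a) * kcu (Suc (d + a)) = scal (loop_value + jw_coeff a) * ?J" .
  then show ?case using new old by (auto simp: less_Suc_eq simp del: jw.simps)
qed simp

lemma U_jw: "1 \<le> j \<Longrightarrow> j < a \<Longrightarrow> kU (d + j) * jw d a = 0"
  and jw_U_zero: "1 \<le> j \<Longrightarrow> j < a \<Longrightarrow> jw d a * kU (d + j) = 0"
  using jw_main by blast+

lemma jw_trace: "a \<ge> 1 \<Longrightarrow> kca (d + a) * jw d a * kcu (d + a) = scal (loop_value + jw_coeff (a - 1)) * jw d (a - 1)"
  using jw_main by blast

lemma jw_idem: "jw d a * jw d a = jw d a"
  by (rule jw_absorb_left) (rule U_jw)

lemma hom_jw: "d + a \<le> m \<Longrightarrow> hom kauff_weight m m (jw d a)"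
proof (induction a)
  case (Suc a)
  then have J: "hom kauff_weight m m (jw d a)" by simp
  have "hom kauff_weight m m (kU (d + a))" if "a \<ge> 1" by (rule kauff.hom_U) (use that Suc.prems in auto)
  then show ?case using J by (cases "a = 0") (auto intro!: hom_add hom_mult hom_scal)
qed (simp add: hom_1)

subsection \<open>Fusion\<close>

text \<open>Moving the cap \<open>jw_cap\<close> once around a component shows that a component which carries the
  projector on \<open>a\<close> of its \<open>a + b + 1\<close> parallel strands satisfies the Chebyshev recursion. Hence
  \<open>S\<^sub>N\<close> of a component amounts to inserting the projector on \<open>N\<close> strands.\<close>

definition dec_color :: "(nat \<Rightarrow> nat) \<Rightarrow> nat \<Rightarrow> nat \<Rightarrow> nat" where
  "dec_color r i = r(i := r i - 2)"

lemma dec_color_simps [simp]: "dec_color r i i = r i - 2" "j \<noteq> i \<Longrightarrow> dec_color r i j = r j"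
  by (simp_all add: dec_color_def)

lemma offset_dec_color: "1 \<le> i \<Longrightarrow> 2 \<le> r i \<Longrightarrow> offset (dec_color r i) j = (if i < j then offset r j - 2 else offset r j)"
proof (induction j)
  case (Suc j)
  show ?case
  proof (cases "j = 0")
    case False
    define r' where "r' = dec_color r i"
    have r': "r' i = r i - 2" "\<And>j. j \<noteq> i \<Longrightarrow> r' j = r j" by (simp_all add: r'_def)
    have "offset r' (Suc j) = offset r' j + r' j" "offset r (Suc j) = offset r j + r j"
      using False by (simp_all add: offset_Suc)
    moreover have "2 \<le> offset r j" if "i < j"
      using offset_Suc_le[of i j r] that Suc.prems by simp
    moreover have "offset r' j = (if i < j then offset r j - 2 else offset r j)" using Suc by (simp add: r'_def)
    ultimately have "offset r' (Suc j) = (if i < Suc j then offset r (Suc j) - 2 else offset r (Suc j))"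
      using r' Suc.prems by (cases "i < j"; cases "i = j") auto
    then show ?thesis by (simp only: r'_def)
  qed (use Suc.prems in \<open>simp add: offset_def\<close>)
qed (simp add: offset_def)

lemma dec_color_transpose: "dec_color r i \<circ> transpose k (Suc k) = dec_color (r \<circ> transpose k (Suc k)) (transpose k (Suc k) i)"
  by (rule ext) (simp add: dec_color_def, metis transpose_involutory)

abbreviation cable_op :: "(nat \<Rightarrow> nat) \<Rightarrow> nat list \<Rightarrow> ratfun linear_op" where
  "cable_op r b \<equiv> braid_op (cable r (map Sig b))"

lemma cable_op_Cons: "cable_op r (k # b) = sg.X (offset r k) (r k) (r (Suc k)) * cable_op (r \<circ> transpose k (Suc k)) b"
proof -
  have "cable r (map Sig (k # b)) = cable r [Sig k] @ cable (r \<circ> transpose k (Suc k)) (map Sig b)"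
    using cable_Cons[of r "Sig k" "map Sig b"] by simp
  then show ?thesis by (simp only: braid_op_simps braid_op_cable_Sig)
qed

lemma cable_op_Nil [simp]: "cable_op r [] = 1"
  by simp

text \<open>The four cases are the positions of the capped strand relative to the crossing at
  \<open>k\<close>: left of it, its left strand, its right strand, right of it.\<close>

lemma ca_crossing:
  assumes k: "1 \<le> k" and i: "1 \<le> i" and a: "1 \<le> a" "a < r i"
  shows "kca (offset r i + a) * sg.X (offset r k) (r k) (r (Suc k)) =
    sg.X (offset (dec_color r i) k) (dec_color r i k) (dec_color r i (Suc k)) *
    kca (offset (r \<circ> transpose k (Suc k)) (transpose k (Suc k) i) + a)"
proof -
  have od: "offset (dec_color r i) k = (if i < k then offset r k - 2 else offset r k)" using offset_dec_color[of i r k] i a by simp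
  note ot = offset_transpose[OF k, of r]
  consider "i < k" | "i = k" | "i = Suc k" | "Suc k < i" by linarith
  then show ?thesis
  proof cases
    case 1
    then have "offset r i + r i \<le> offset r k" using offset_Suc_le i by simp
    then obtain d where d: "offset r k = d + 2" "offset r i + a \<le> d + 1"
      using a by (intro that[of "offset r k - 2"]) auto
    have t: "transpose k (Suc k) i = i" using 1 by (simp add: transpose_def)
    show ?thesis using ca_X_far[OF d(2), of "r k" "r (Suc k)"] 1 by (simp add: od d(1) t ot)
  next
    case 2
    then show ?thesis using ca_X_left[of a "r k" "offset r k" "r (Suc k)"] a od by (simp add: ot)
  next
    case 3
    then show ?thesis using ca_X_right[of a "r (Suc k)" "offset r k" "r k"] a k od by (simp add: ot offset_Suc)
  next
    case 4
    have t: "transpose k (Suc k) i = i" using 4 by (simp add: transpose_def)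
    have "offset r k + r k + r (Suc k) \<le> offset r i"
      using offset_Suc_le[of "Suc k" i r] offset_Suc[of k r] 4 k by simp
    then show ?thesis using ca_X_near[of "offset r k" "r k" "r (Suc k)" "offset r i + a"] 4 a by (simp add: od t ot)
  qed
qed

lemma U_crossing:
  assumes k: "1 \<le> k" and i: "1 \<le> i" and a: "1 \<le> a" "a < r i"
  shows "kU (offset r i + a) * sg.X (offset r k) (r k) (r (Suc k)) =
    sg.X (offset r k) (r k) (r (Suc k)) * kU (offset (r \<circ> transpose k (Suc k)) (transpose k (Suc k) i) + a)"
proof (rule U_sg_intertwine)
  note ot = offset_transpose[OF k, of r]
  consider "i < k" | "i = k" | "i = Suc k" | "Suc k < i" by linarith
  then show "sg (offset r i + a) * sg.X (offset r k) (r k) (r (Suc k)) =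
    sg.X (offset r k) (r k) (r (Suc k)) * sg (offset (r \<circ> transpose k (Suc k)) (transpose k (Suc k) i) + a)"
  proof cases
    case 1
    then have "offset r i + r i \<le> offset r k" using offset_Suc_le i by simp
    then show ?thesis using sg.comm_X[of "offset r i + a" "offset r k" "r k" "r (Suc k)"] 1 a
      by (simp add: transpose_def ot)
  next
    case 2
    then show ?thesis using sg.X_slide_left[of a "r k" "offset r k" "r (Suc k)"] a by (simp add: ot)
  next
    case 3
    then show ?thesis using sg.X_slide_right[of a "r (Suc k)" "offset r k" "r k"] a k by (simp add: ot offset_Suc)
  next
    case 4
    have "offset r k + r k + r (Suc k) \<le> offset r i"
      using offset_Suc_le[of "Suc k" i r] offset_Suc[of k r] 4 k by simp
    then show ?thesis using sg.comm_X[of "offset r i + a" "offset r k" "r k" "r (Suc k)"] 4 a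
      by (simp add: transpose_def ot)
  qed
qed

abbreviation perm :: "nat list \<Rightarrow> nat \<Rightarrow> nat" where
  "perm b \<equiv> strand_perm (map Sig b)"
abbreviation recolor_pos :: "(nat \<Rightarrow> nat) \<Rightarrow> nat list \<Rightarrow> nat \<Rightarrow> nat" where
  "recolor_pos r b \<equiv> recolor r (map Sig b)"

lemma transpose_pos: "1 \<le> k \<Longrightarrow> 1 \<le> i \<Longrightarrow> 1 \<le> transpose k (Suc k) i"
  by (auto simp: transpose_def)

lemma ca_cable_op:
  assumes "set b \<subseteq> {1..<n}" "1 \<le> i" "1 \<le> a" "a < r i"
  shows "kca (offset r i + a) * cable_op r b = cable_op (dec_color r i) b * kca (offset (recolor_pos r b) (perm b i) + a)"
  using assms
proof (induction b arbitrary: r i)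
  case (Cons k b)
  let ?t = "transpose k (Suc k)"
  have k: "1 \<le> k" using Cons.prems by auto
  have IH: "kca (offset (r \<circ> ?t) (?t i) + a) * cable_op (r \<circ> ?t) b =
      cable_op (dec_color (r \<circ> ?t) (?t i)) b * kca (offset (recolor_pos (r \<circ> ?t) b) (perm b (?t i)) + a)"
    by (rule Cons.IH) (use Cons.prems transpose_pos[OF k] in auto)
  have "kca (offset r i + a) * cable_op r (k # b) =
     (kca (offset r i + a) * sg.X (offset r k) (r k) (r (Suc k))) * cable_op (r \<circ> ?t) b"
    by (simp only: cable_op_Cons mult.assoc)
  also have "\<dots> = sg.X (offset (dec_color r i) k) (dec_color r i k) (dec_color r i (Suc k)) * (kca (offset (r \<circ> ?t) (?t i) + a) * cable_op (r \<circ> ?t) b)"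
    using ca_crossing[OF k, of i a r] Cons.prems by (simp only: mult.assoc)
  also have "\<dots> = cable_op (dec_color r i) (k # b) * kca (offset (recolor_pos r (k # b)) (perm (k # b) i) + a)"
    unfolding IH cable_op_Cons[of "dec_color r i"] dec_color_transpose by (simp add: mult.assoc)
  finally show ?case .
qed simp

lemma jw_cable_op:
  assumes "set b \<subseteq> {1..<n}" "1 \<le> i" "a \<le> r i"
  shows "jw (offset r i) a * cable_op r b = cable_op r b * jw (offset (recolor_pos r b) (perm b i)) a"
  using assms
proof (induction b arbitrary: r i)
  case (Cons k b)
  let ?t = "transpose k (Suc k)"
  have k: "1 \<le> k" using Cons.prems by auto
  have IH: "jw (offset (r \<circ> ?t) (?t i)) a * cable_op (r \<circ> ?t) b =
      cable_op (r \<circ> ?t) b * jw (offset (recolor_pos (r \<circ> ?t) b) (perm b (?t i))) a"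
    by (rule Cons.IH) (use Cons.prems transpose_pos[OF k] in auto)
  have 1: "jw (offset r i) a * sg.X (offset r k) (r k) (r (Suc k)) =
      sg.X (offset r k) (r k) (r (Suc k)) * jw (offset (r \<circ> ?t) (?t i)) a"
    by (rule jw_intertwine) (use U_crossing[OF k] Cons.prems in auto)
  have "jw (offset r i) a * cable_op r (k # b) = (jw (offset r i) a * sg.X (offset r k) (r k) (r (Suc k))) * cable_op (r \<circ> ?t) b"
    by (simp only: cable_op_Cons mult.assoc)
  also have "\<dots> = sg.X (offset r k) (r k) (r (Suc k)) * (jw (offset (r \<circ> ?t) (?t i)) a * cable_op (r \<circ> ?t) b)"
    by (simp only: 1 mult.assoc)
  also have "\<dots> = cable_op r (k # b) * jw (offset (recolor_pos r (k # b)) (perm (k # b) i)) a"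
    unfolding IH cable_op_Cons by (simp add: mult.assoc)
  finally show ?case .
qed simp

text \<open>The two halves of the correction term in the recursion of \<open>jw\<close>:
  \<open>jw_cup\<close> times \<open>jw_cap\<close> is the hook between two copies of the projector.
  A cap moving around a component thus takes its projector along.\<close>

definition jw_cap :: "(nat \<Rightarrow> nat) \<Rightarrow> nat \<Rightarrow> nat \<Rightarrow> ratfun linear_op" where
  "jw_cap r i a = kca (offset r i + a) * jw (offset r i) a"
definition jw_cup :: "(nat \<Rightarrow> nat) \<Rightarrow> nat \<Rightarrow> nat \<Rightarrow> ratfun linear_op" where
  "jw_cup r i a = jw (offset r i) a * kcu (offset r i + a)"

lemma jw_cap_cable_op:
  assumes "set b \<subseteq> {1..<n}" "1 \<le> i" "1 \<le> a" "a < r i"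
  shows "jw_cap r i a * cable_op r b = cable_op (dec_color r i) b * jw_cap (recolor_pos r b) (perm b i) a"
proof -
  have 1: "jw (offset r i) a * cable_op r b = cable_op r b * jw (offset (recolor_pos r b) (perm b i)) a"
    by (rule jw_cable_op) (use assms in auto)
  have 2: "kca (offset r i + a) * cable_op r b = cable_op (dec_color r i) b * kca (offset (recolor_pos r b) (perm b i) + a)"
    by (rule ca_cable_op) (use assms in auto)
  have "jw_cap r i a * cable_op r b = (kca (offset r i + a) * cable_op r b) * jw (offset (recolor_pos r b) (perm b i)) a"
    unfolding jw_cap_def mult.assoc 1 ..
  then show ?thesis unfolding 2 jw_cap_def by (simp only: mult.assoc)
qed

lemma ca_jw_other:
  assumes "i \<noteq> j" "1 \<le> i" "1 \<le> j" "1 \<le> a" "a < r i" "a' \<le> r j"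
  shows "kca (offset r i + a) * jw (offset r j) a' = jw (offset (dec_color r i) j) a' * kca (offset r i + a)"
proof (cases "j < i")
  case True
  then have "offset r j + r j \<le> offset r i" using offset_Suc_le assms by simp
  then show ?thesis using assms True offset_dec_color[of i r j] by (simp add: jw_ca)
next
  case False
  then have le: "offset r i + r i \<le> offset r j" using offset_Suc_le assms by simp
  have "jw (offset (dec_color r i) j) a' * kca (offset r i + a) = kca (offset r i + a) * jw (offset r j) a'"
  proof (rule jw_intertwine)
    fix l assume l: "1 \<le> l" "l < a'"
    have "offset (dec_color r i) j + 2 = offset r j" using offset_dec_color[of i r j] False assms le by simp
    moreover have "offset r i + a \<le> offset (dec_color r i) j + l" using calculation le l assms by simp
    ultimately show "kU (offset (dec_color r i) j + l) * kca (offset r i + a) = kca (offset r i + a) * kU (offset r j + l)"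
      using kauff.ca_U_far[of "offset r i + a" "offset (dec_color r i) j + l"] by (simp add: add_ac)
  qed
  then show ?thesis by simp
qed

lemma cu_jw_other:
  assumes "i \<noteq> j" "1 \<le> i" "1 \<le> j" "1 \<le> a" "a < r i" "a' \<le> r j"
  shows "jw (offset r j) a' * kcu (offset r i + a) = kcu (offset r i + a) * jw (offset (dec_color r i) j) a'"
proof (cases "j < i")
  case True
  then have "offset r j + r j \<le> offset r i" using offset_Suc_le assms by simp
  then show ?thesis using assms True offset_dec_color[of i r j] by (simp add: jw_cu)
next
  case False
  then have le: "offset r i + r i \<le> offset r j" using offset_Suc_le assms by simp
  show ?thesis
  proof (rule jw_intertwine)
    fix l assume l: "1 \<le> l" "l < a'"
    have "offset (dec_color r i) j + 2 = offset r j" using offset_dec_color[of i r j] False assms le by simp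
    moreover have "offset r i + a \<le> offset (dec_color r i) j + l" using calculation le l assms by simp
    ultimately show "kU (offset r j + l) * kcu (offset r i + a) = kcu (offset r i + a) * kU (offset (dec_color r i) j + l)"
      using kauff.U_cu_far[of "offset r i + a" "offset (dec_color r i) j + l"] by (simp add: add_ac)
  qed
qed

lemma jw_jw_other:
  assumes "i \<noteq> j" "1 \<le> i" "1 \<le> j" "a \<le> r i" "a' \<le> r j"
  shows "jw (offset r i) a * jw (offset r j) a' = jw (offset r j) a' * jw (offset r i) a"
proof -
  have *: "jw (offset r i) a * jw (offset r j) a' = jw (offset r j) a' * jw (offset r i) a"
    if "i < j" "1 \<le> i" "a \<le> r i" for i j a a'
  proof (rule jw_intertwine)
    fix l assume "1 \<le> l" "l < a"
    moreover have "offset r i + r i \<le> offset r j" using offset_Suc_le that by simp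
    ultimately have "offset r i + l + 2 \<le> offset r j + 1" using that by simp
    then show "kU (offset r i + l) * jw (offset r j) a' = jw (offset r j) a' * kU (offset r i + l)"
      using kauff.U_far[of "offset r i + l"] by (intro jw_intertwine[symmetric]) simp
  qed
  show ?thesis using *[of i j a a'] *[of j i a' a] assms by (cases "i < j") auto
qed

lemma ca_cu_other:
  assumes "i \<noteq> j" "1 \<le> i" "1 \<le> j" "1 \<le> a" "a < r i" "a < r j"
  shows "kca (offset r i + a) * kcu (offset r j + a) = kcu (offset (dec_color r i) j + a) * kca (offset (dec_color r j) i + a)"
proof (cases "i < j")
  case True
  then have le: "offset r i + r i \<le> offset r j" using offset_Suc_le assms by simp
  have 1: "offset (dec_color r i) j + 2 = offset r j" using offset_dec_color[of i r j] True assms le by simp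
  have 2: "offset (dec_color r j) i = offset r i" using offset_dec_color[of j r i] True assms by simp
  have "kca (offset r i + a) * kcu ((offset (dec_color r i) j + a) + 2) = kcu (offset (dec_color r i) j + a) * kca (offset r i + a)"
    by (rule cap_cup_far') (use 1 le assms in simp)
  moreover have "(offset (dec_color r i) j + a) + 2 = offset r j + a" using 1 by simp
  ultimately show ?thesis by (simp only: 2)
next
  case False
  then have le: "offset r j + r j \<le> offset r i" using offset_Suc_le assms by simp
  have 1: "offset (dec_color r j) i + 2 = offset r i" using offset_dec_color[of j r i] False assms le by simp
  have 2: "offset (dec_color r i) j = offset r j" using offset_dec_color[of i r j] False assms by simp
  have "kca (offset r i + a) * kcu (offset r j + a) = kcu (offset r j + a) * kca (offset r i + a - 2)"
    by (rule cap_cup_far) (use le assms in simp)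
  moreover have "offset r i + a - 2 = offset (dec_color r j) i + a" using 1 by simp
  ultimately show ?thesis using 2 by simp
qed

lemma jw_cap_jw_cup_other:
  assumes "i \<noteq> j" "1 \<le> i" "1 \<le> j" "1 \<le> a" "a < r i" "a < r j"
  shows "jw_cap r i a * jw_cup r j a = jw_cup (dec_color r i) j a * jw_cap (dec_color r j) i a"
proof -
  have J: "jw (offset r i) a * jw (offset r j) a = jw (offset r j) a * jw (offset r i) a"
    by (rule jw_jw_other) (use assms in auto)
  have 1: "jw (offset r i) a * kcu (offset r j + a) = kcu (offset r j + a) * jw (offset (dec_color r j) i) a"
    by (rule cu_jw_other) (use assms in auto)
  have 2: "kca (offset r i + a) * jw (offset r j) a = jw (offset (dec_color r i) j) a * kca (offset r i + a)"
    by (rule ca_jw_other) (use assms in auto)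
  have "jw_cap r i a * jw_cup r j a = kca (offset r i + a) * (jw (offset r i) a * jw (offset r j) a) * kcu (offset r j + a)"
    by (simp only: jw_cap_def jw_cup_def mult.assoc)
  also have "\<dots> = (kca (offset r i + a) * jw (offset r j) a) * (jw (offset r i) a * kcu (offset r j + a))"
    unfolding J by (simp only: mult.assoc)
  also have "\<dots> = jw (offset (dec_color r i) j) a * (kca (offset r i + a) * kcu (offset r j + a)) * jw (offset (dec_color r j) i) a"
    unfolding 1 2 by (simp only: mult.assoc)
  also have "kca (offset r i + a) * kcu (offset r j + a) = kcu (offset (dec_color r i) j + a) * kca (offset (dec_color r j) i + a)"
    by (rule ca_cu_other) (use assms in auto)
  finally show ?thesis by (simp only: jw_cap_def jw_cup_def mult.assoc)
qed

lemma jw_cap_jw_cup_same: "1 \<le> a \<Longrightarrow> jw_cap r i a * jw_cup r i a = scal (loop_value + jw_coeff (a - 1)) * jw (offset r i) (a - 1)"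
  using jw_trace[of a "offset r i"] unfolding jw_cap_def jw_cup_def
  by (metis jw_idem mult.assoc)

definition jw_prod :: "(nat \<times> nat) list \<Rightarrow> (nat \<Rightarrow> nat) \<Rightarrow> ratfun linear_op" where
  "jw_prod L r = prod_list (map (\<lambda>(i, a). jw (offset r i) a) L)"

lemma jw_prod_simps [simp]: "jw_prod [] r = 1" "jw_prod ((i, a) # L) r = jw (offset r i) a * jw_prod L r"
  "jw_prod (L @ L') r = jw_prod L r * jw_prod L' r"
  by (simp_all add: jw_prod_def)

lemma jw_cap_jw_prod:
  assumes "1 \<le> i" "1 \<le> a" "a < r i" "\<And>j a'. (j, a') \<in> set L \<Longrightarrow> 1 \<le> j \<and> j \<noteq> i \<and> a' \<le> r j"
  shows "jw_cap r i a * jw_prod L r = jw_prod L (dec_color r i) * jw_cap r i a"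
  using assms(4)
proof (induction L)
  case (Cons p L)
  obtain j a' where p: "p = (j, a')" by (cases p)
  have j: "1 \<le> j" "j \<noteq> i" "a' \<le> r j" using Cons.prems p by auto
  have J: "jw (offset r i) a * jw (offset r j) a' = jw (offset r j) a' * jw (offset r i) a"
    by (rule jw_jw_other) (use assms j in auto)
  have C: "kca (offset r i + a) * jw (offset r j) a' = jw (offset (dec_color r i) j) a' * kca (offset r i + a)"
    by (rule ca_jw_other) (use assms j in auto)
  have "jw_cap r i a * jw (offset r j) a' = kca (offset r i + a) * (jw (offset r i) a * jw (offset r j) a')"
    by (simp only: jw_cap_def mult.assoc)
  also have "\<dots> = (kca (offset r i + a) * jw (offset r j) a') * jw (offset r i) a" unfolding J by (simp only: mult.assoc)
  also have "\<dots> = jw (offset (dec_color r i) j) a' * jw_cap r i a" unfolding C by (simp only: jw_cap_def mult.assoc)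
  finally have 1: "jw_cap r i a * jw (offset r j) a' = jw (offset (dec_color r i) j) a' * jw_cap r i a" .
  have 2: "jw_cap r i a * jw_prod L r = jw_prod L (dec_color r i) * jw_cap r i a" using Cons by auto
  have "jw_cap r i a * jw_prod (p # L) r = (jw_cap r i a * jw (offset r j) a') * jw_prod L r"
    by (simp only: p jw_prod_simps mult.assoc)
  also have "\<dots> = jw_prod (p # L) (dec_color r i) * jw_cap r i a" unfolding 1 mult.assoc 2 by (simp only: p jw_prod_simps mult.assoc)
  finally show ?case .
qed simp

lemma hom_cable_op:
  assumes "set b \<subseteq> {1..<n}" shows "hom kauff_weight (offset r (Suc n)) (offset r (Suc n)) (cable_op r b)"
proof -
  have "valid (offset r (Suc n)) (cable r (map Sig b))" by (rule cable_valid) (use assms in \<open>simp add: valid_map\<close>)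
  moreover have "hom kauff_weight m m (braid_op w)" if "valid m w" for m w
    using that
  proof (induction w)
    case (Cons x w)
    then have "hom kauff_weight m m (kU (letter_index x))" by (intro kauff.hom_U) auto
    then show ?case using Cons by (cases x) (auto intro!: hom_mult hom_add hom_scal)
  qed (simp add: hom_1)
  ultimately show ?thesis by blast
qed

lemma hom_jw_prod:
  assumes "\<And>j a'. (j, a') \<in> set L \<Longrightarrow> 1 \<le> j \<and> j \<le> n \<and> a' \<le> r j"
  shows "hom kauff_weight (offset r (Suc n)) (offset r (Suc n)) (jw_prod L r)"
  using assms
proof (induction L)
  case (Cons p L)
  obtain j a' where p: "p = (j, a')" by (cases p)
  have "1 \<le> j \<and> j \<le> n \<and> a' \<le> r j" using Cons.prems[of j a'] p by simp
  then have "offset r j + r j \<le> offset r (Suc n)" using offset_Suc_le[of j "Suc n" r] by auto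
  then have "offset r j + a' \<le> offset r (Suc n)" using Cons.prems[of j a'] p by force
  then have "hom kauff_weight (offset r (Suc n)) (offset r (Suc n)) (jw (offset r j) a')" by (rule hom_jw)
  then show ?case using Cons p by (auto intro!: hom_mult)
qed (simp add: hom_1)

lemma offset_dec_color_total:
  assumes "1 \<le> i" "i \<le> n" "2 \<le> r i"
  shows "offset r (Suc n) = offset (dec_color r i) (Suc n) + 2"
  using offset_dec_color[of i r "Suc n"] offset_Suc_le[of i "Suc n" r] assms by simp

lemma hom_jw_cap:
  assumes "1 \<le> i" "i \<le> n" "1 \<le> a" "a < r i"
  shows "hom kauff_weight (offset r (Suc n)) (offset (dec_color r i) (Suc n)) (jw_cap r i a)"
proof -
  have le: "offset r i + r i \<le> offset r (Suc n)" using offset_Suc_le[of i "Suc n" r] assms by auto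
  have e: "offset r (Suc n) = offset (dec_color r i) (Suc n) + 2" by (rule offset_dec_color_total) (use assms in auto)
  show ?thesis unfolding jw_cap_def
    by (rule hom_mult[OF hom_jw]; (unfold e)?; (rule kauff.hom_ca)?) (use le e assms in auto)
qed

lemma hom_jw_cup:
  assumes "1 \<le> i" "i \<le> n" "1 \<le> a" "a < r i"
  shows "hom kauff_weight (offset (dec_color r i) (Suc n)) (offset r (Suc n)) (jw_cup r i a)"
proof -
  have le: "offset r i + r i \<le> offset r (Suc n)" using offset_Suc_le[of i "Suc n" r] assms by auto
  have e: "offset r (Suc n) = offset (dec_color r i) (Suc n) + 2" by (rule offset_dec_color_total) (use assms in auto)
  have "hom kauff_weight (offset (dec_color r i) (Suc n)) (offset r (Suc n)) (kcu (offset r i + a))"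
    unfolding e by (rule kauff.hom_cu) (use le e assms in auto)
  moreover have "hom kauff_weight (offset r (Suc n)) (offset r (Suc n)) (jw (offset r i) a)"
    by (rule hom_jw) (use le assms in auto)
  ultimately show ?thesis unfolding jw_cup_def by (rule hom_mult)
qed


lemma bij_perm: "bij (strand_perm w)"
proof (induction w)
  case (Cons x w)
  show ?case unfolding strand_perm.simps by (rule bij_comp[OF bij_transpose Cons])
qed (simp only: strand_perm.simps bij_id)

lemma perm_range: "valid n w \<Longrightarrow> i \<in> {1..n} \<Longrightarrow> strand_perm w i \<in> {1..n}"
  by (induction w arbitrary: i) (auto simp: transpose_def)

definition dec_colors :: "(nat \<Rightarrow> nat) \<Rightarrow> nat set \<Rightarrow> nat \<Rightarrow> nat" where
  "dec_colors r M i = (if i \<in> M then r i - 2 else r i)"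

lemma dec_color_dec_colors: "i \<notin> M \<Longrightarrow> dec_color (dec_colors r M) i = dec_colors r (insert i M)"
  by (auto simp: dec_color_def dec_colors_def fun_eq_iff)

lemma recolor_pos_dec_colors:
  assumes "\<And>i. r (perm b i) = r i"
  shows "recolor_pos (dec_colors r M) b = dec_colors r (perm b ` M)"
proof
  fix j
  obtain i where j: "j = perm b i" using bij_perm[of "map Sig b"] by (metis bij_pointE)
  have "perm b i \<in> perm b ` M \<longleftrightarrow> i \<in> M"
    using bij_is_inj[OF bij_perm] by (simp add: inj_image_mem_iff)
  then show "recolor_pos (dec_colors r M) b j = dec_colors r (perm b ` M) j"
    using recolor_perm[of "dec_colors r M" "map Sig b" i] by (simp add: j dec_colors_def assms)
qed

lemma orbit_cycle:
  fixes n :: nat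
  assumes "valid n w" "i \<in> {1..n}"
  obtains k where "k \<ge> 1" "(strand_perm w ^^ k) i = i"
    "inj_on (\<lambda>l. (strand_perm w ^^ l) i) {0..<k}" "orbit (strand_perm w) i = (\<lambda>l. (strand_perm w ^^ l) i) ` {0..<k}"
proof -
  let ?p = "strand_perm w"
  have iter: "(?p ^^ l) i \<in> {1..n}" for l by (induction l) (use assms perm_range in auto)
  have "\<not> inj_on (\<lambda>l. (?p ^^ l) i) {0..n}"
  proof
    assume inj: "inj_on (\<lambda>l. (?p ^^ l) i) {0..n}"
    have "(\<lambda>l. (?p ^^ l) i) ` {0..n} \<subseteq> {1..n}" using iter by blast
    from card_inj_on_le[OF inj this] show False by simp
  qed
  then obtain u v where "u \<noteq> v" "(?p ^^ u) i = (?p ^^ v) i"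
    unfolding inj_on_def by blast
  then obtain l l' where l: "l < l'" "(?p ^^ l) i = (?p ^^ l') i"
    by (cases "u < v") (use that[of u v] that[of v u] in auto)
  have inj: "inj (?p ^^ l)" using bij_is_inj[OF bij_perm] by (rule inj_fn)
  have "?p ^^ l' = ?p ^^ l \<circ> ?p ^^ (l' - l)"
    using l(1) funpow_add[of l "l' - l" ?p] by simp
  then have "(?p ^^ l) ((?p ^^ (l' - l)) i) = (?p ^^ l) i" using l(2) by simp
  then have fix_i: "(?p ^^ (l' - l)) i = i" by (rule injD[OF inj])
  have "\<exists>k. i = (?p ^^ k) i \<and> 0 < k"
    by (rule exI[of _ "l' - l"]) (use l(1) fix_i in simp)
  then have orb: "i \<in> orbit ?p i" unfolding orbit_altdef by (rule CollectI)
  show thesis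
  proof (rule that)
    show "1 \<le> funpow_dist1 ?p i i" by simp
    show "(?p ^^ funpow_dist1 ?p i i) i = i" by (rule funpow_dist1_prop[OF orb])
    show "inj_on (\<lambda>l. (?p ^^ l) i) {0..<funpow_dist1 ?p i i}" by (rule inj_on_funpow_dist1[OF orb])
    show "orbit ?p i = (\<lambda>l. (?p ^^ l) i) ` {0..<funpow_dist1 ?p i i}" by (rule orbit_conv_funpow_dist1[OF orb])
  qed
qed

text \<open>The cap starts next to its cup at \<open>i0\<close>, runs through the braid, returns to
  the top by cyclicity of the trace, and passes the projectors in \<open>L\<close> and, while it
  sits on another strand, the cup. After one tour of the cycle of \<open>i0\<close> it meets the cup
  again, and the pair becomes a partial trace of the projector. Every position visited has lost two
  parallel strands, which gives the coloring \<open>r'\<close>.\<close>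

lemma fusion_cycle:
  assumes hb: "set b \<subseteq> {1..<n}" and inv: "\<And>i. r (perm b i) = r i"
    and i0: "i0 \<in> {1..n}" and a: "1 \<le> a" "a < r i0"
    and L: "\<And>j a'. (j, a') \<in> set L \<Longrightarrow> j \<in> {1..n} \<and> j \<notin> orbit (perm b) i0 \<and> a' \<le> r j"
  defines "r' \<equiv> dec_colors r (orbit (perm b) i0)"
  shows "ktr (offset r (Suc n)) (jw_prod L r * (jw_cup r i0 a * jw_cap r i0 a) * cable_op r b) =
     (loop_value + jw_coeff (a - 1)) * ktr (offset r' (Suc n)) (jw_prod L r' * jw (offset r' i0) (a - 1) * cable_op r' b)"
proof -
  let ?p = "perm b" and ?K = "orbit (perm b) i0"
  have val: "valid n (map Sig b)" using hb by (simp add: valid_map)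
  obtain k where k: "k \<ge> 1" "(?p ^^ k) i0 = i0" "inj_on (\<lambda>l. (?p ^^ l) i0) {0..<k}"
    "?K = (\<lambda>l. (?p ^^ l) i0) ` {0..<k}"
    by (rule orbit_cycle[OF val i0])
  define x where "x l = (?p ^^ l) i0" for l
  have x0: "x 0 = i0" and xS: "x (Suc l) = ?p (x l)" and xk: "x k = i0" for l
    using k by (simp_all add: x_def)
  have xinj: "x l = x l' \<longleftrightarrow> l = l'" if "l < k" "l' < k" for l l'
    using k(3) that unfolding x_def inj_on_def by auto
  have xK: "x ` {0..<k} = ?K" using k(4) by (simp add: x_def)
  have xr: "x l \<in> {1..n}" "r (x l) = r i0" for l
    by (induction l) (use i0 perm_range[OF val] inv in \<open>auto simp: x0 xS\<close>)
  have sh: "?p ` x ` {0..<l} = x ` {1..l}" for l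
  proof -
    have "?p ` x ` {0..<l} = (\<lambda>l. x (Suc l)) ` {0..<l}" by (simp add: image_image xS)
    also have "\<dots> = x ` Suc ` {0..<l}" by (simp only: image_image)
    also have "Suc ` {0..<l} = {1..l}" by (simp add: atLeastLessThanSuc_atLeastAtMost)
    finally show ?thesis .
  qed
  \<comment> \<open>The colorings at the two ends of the cabled braid after \<open>l\<close>
    passages of the cap: at the upper end \<open>x 0\<close> to \<open>x (l - 1)\<close> are
    reduced, at the lower end \<open>x 1\<close> to \<open>x l\<close>.\<close>
  define A B where "A l = dec_colors r (x ` {0..<l})" and "B l = dec_colors r (x ` {1..l})" for l
  have xl_notin: "x l \<notin> x ` {0..<l}" if "l < k" for l
    using that xinj by fastforce
  have xS_notin: "x (Suc l) \<notin> x ` {1..l}" if "l < k" for l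
  proof (cases "Suc l = k")
    case True
    then have x0': "x (Suc l) = x 0" by (simp add: xk x0)
    show ?thesis
    proof
      assume "x (Suc l) \<in> x ` {1..l}"
      then obtain l' where "x 0 = x l'" "1 \<le> l'" "l' \<le> l" unfolding x0' by auto
      then show False using xinj[of 0 l'] that by simp
    qed
  next
    case False
    then have lk: "Suc l < k" using that by simp
    show ?thesis
    proof
      assume "x (Suc l) \<in> x ` {1..l}"
      then obtain l' where "x (Suc l) = x l'" "1 \<le> l'" "l' \<le> l" by auto
      then show False using xinj[OF lk, of l'] that by simp
    qed
  qed
  have i0_notin: "i0 \<notin> x ` {1..l}" if "l < k" for l
  proof
    assume "i0 \<in> x ` {1..l}"
    then obtain l' where "x 0 = x l'" "1 \<le> l'" "l' \<le> l" unfolding x0[symmetric] by auto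
    then show False using xinj[of 0 l'] that by simp
  qed
  have decA: "dec_color (A l) (x l) = A (Suc l)" if "l < k" for l
    using dec_color_dec_colors[OF xl_notin[OF that], of r] by (simp add: A_def atLeast0_lessThan_Suc)
  have decB: "dec_color (B l) (x (Suc l)) = B (Suc l)" if "l < k" for l
    using dec_color_dec_colors[OF xS_notin[OF that], of r] by (simp add: B_def atLeastAtMostSuc_conv)
  have "insert 0 {1..l} = {0..<Suc l}" for l by auto
  then have "insert i0 (x ` {1..l}) = x ` {0..<Suc l}" for l by (metis image_insert x0)
  then have decB0: "dec_color (B l) i0 = A (Suc l)" if "l < k" for l
    using dec_color_dec_colors[OF i0_notin[OF that], of r] by (simp add: A_def B_def)
  have recA: "recolor_pos (A l) b = B l" for l
  proof -
    have "recolor_pos (dec_colors r M) b = dec_colors r (?p ` M)" for M by (rule recolor_pos_dec_colors) (rule inv)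
    then show ?thesis by (simp only: A_def B_def sh)
  qed
  have Axl: "A l (x l) = r i0" if "l < k" for l using xl_notin[OF that] xr by (simp add: A_def dec_colors_def)
  have BxS: "B l (x (Suc l)) = r i0" if "l < k" for l using xS_notin[OF that] xr by (simp add: B_def dec_colors_def)
  have Bi0: "B l i0 = r i0" if "l < k" for l using i0_notin[OF that] by (simp add: B_def dec_colors_def)
  have xinK: "x l \<in> ?K" if "l \<le> k" for l
  proof (cases "l = k")
    case True
    then have "x l = x 0" by (simp add: xk x0)
    then show ?thesis using xK k(1) by auto
  next
    case False
    then show ?thesis using xK that by auto
  qed
  have LB: "j \<in> {1..n} \<and> j \<notin> ?K \<and> a' \<le> B l j" if "(j, a') \<in> set L" "l \<le> k" for j a' l
  proof -
    have "j \<notin> x ` {1..l}" using L[OF that(1)] xinK that(2) by auto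
    then show ?thesis using L[OF that(1)] by (simp add: B_def dec_colors_def)
  qed
  let ?d = "\<lambda>\<rho>. offset \<rho> (Suc n)"
  have dimAB: "?d (A (Suc l)) = ?d (B (Suc l))" if "l < k" for l
    using offset_dec_color_total[of i0 n "B l"] offset_dec_color_total[of "x (Suc l)" n "B l"] xr[of "Suc l"] i0 a
    by (simp add: decB0[OF that] decB[OF that] Bi0[OF that] BxS[OF that])
  \<comment> \<open>In \<open>T l\<close> the cap stands right above the braid, in
    \<open>C l\<close> it has passed the braid and the projectors and meets the cup.
    \<open>TC\<close> is sliding and cyclicity, \<open>CT\<close> the exchange of cap and cup on
    different strands.\<close>
  define T where "T l = ktr (?d (B l)) (jw_prod L (B l) * jw_cup (B l) i0 a * (jw_cap (A l) (x l) a * cable_op (A l) b))" for l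
  define C where "C l = ktr (?d (A (Suc l))) (jw_prod L (B (Suc l)) * (jw_cap (B l) (x (Suc l)) a * jw_cup (B l) i0 a) * cable_op (A (Suc l)) b)" for l
  have TC: "T l = C l" if l: "l < k" for l
  proof -
    have v: "jw_cap (A l) (x l) a * cable_op (A l) b = cable_op (A (Suc l)) b * jw_cap (B l) (x (Suc l)) a"
      using jw_cap_cable_op[OF hb, of "x l" a "A l"] xr[of l] a by (simp add: decA[OF l] recA xS Axl[OF l])
    have hv: "hom kauff_weight (?d (B l)) (?d (A (Suc l))) (jw_cap (B l) (x (Suc l)) a)"
      using hom_jw_cap[of "x (Suc l)" n a "B l"] xr[of "Suc l"] a l
      by (simp add: BxS decB dimAB)
    have hu: "hom kauff_weight (?d (A (Suc l))) (?d (B l)) (jw_cup (B l) i0 a)"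
      using hom_jw_cup[of i0 n a "B l"] i0 a l by (simp add: Bi0 decB0)
    have hQ: "hom kauff_weight (?d (B l)) (?d (B l)) (jw_prod L (B l))"
      by (rule hom_jw_prod) (use LB[of _ _ l] l in force)
    have hF: "hom kauff_weight (?d (A (Suc l))) (?d (B l)) (jw_prod L (B l) * jw_cup (B l) i0 a * cable_op (A (Suc l)) b)"
      by (intro hom_mult[OF hom_cable_op[OF hb]] hom_mult[OF hu] hQ)
    have Q: "jw_cap (B l) (x (Suc l)) a * jw_prod L (B l) = jw_prod L (B (Suc l)) * jw_cap (B l) (x (Suc l)) a"
      unfolding decB[OF l, symmetric]
    proof (rule jw_cap_jw_prod)
      fix j a' assume j: "(j, a') \<in> set L"
      show "1 \<le> j \<and> j \<noteq> x (Suc l) \<and> a' \<le> B l j"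
        using LB[OF j, of l] xinK[of "Suc l"] l by auto
    qed (use xr[of "Suc l"] a BxS[OF l] in auto)
    have "T l = ktr (?d (B l)) ((jw_prod L (B l) * jw_cup (B l) i0 a * cable_op (A (Suc l)) b) * jw_cap (B l) (x (Suc l)) a)"
      unfolding T_def v by (simp only: mult.assoc)
    also have "\<dots> = ktr (?d (A (Suc l))) (jw_cap (B l) (x (Suc l)) a * (jw_prod L (B l) * jw_cup (B l) i0 a * cable_op (A (Suc l)) b))"
      by (rule Tr_comm[OF hF hv])
    also have "jw_cap (B l) (x (Suc l)) a * (jw_prod L (B l) * jw_cup (B l) i0 a * cable_op (A (Suc l)) b)
      = (jw_cap (B l) (x (Suc l)) a * jw_prod L (B l)) * jw_cup (B l) i0 a * cable_op (A (Suc l)) b"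
      by (simp only: mult.assoc)
    also have "\<dots> = jw_prod L (B (Suc l)) * (jw_cap (B l) (x (Suc l)) a * jw_cup (B l) i0 a) * cable_op (A (Suc l)) b"
      unfolding Q by (simp only: mult.assoc)
    finally show ?thesis unfolding C_def .
  qed
  have CT: "C l = T (Suc l)" if l: "Suc l < k" for l
  proof -
    have lk: "l < k" using l by simp
    have ne: "x (Suc l) \<noteq> i0" using xinj[of "Suc l" 0] l x0 by auto
    have "jw_cap (B l) (x (Suc l)) a * jw_cup (B l) i0 a = jw_cup (B (Suc l)) i0 a * jw_cap (A (Suc l)) (x (Suc l)) a"
      using jw_cap_jw_cup_other[OF ne, of a "B l"] xr[of "Suc l"] i0 a
      by (simp add: BxS[OF lk] Bi0[OF lk] decB[OF lk] decB0[OF lk])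
    then show ?thesis unfolding C_def T_def dimAB[OF lk] by (simp only: mult.assoc)
  qed
  have T0: "T l = T 0" if "l < k" for l
    using that
  proof (induction l)
    case (Suc l)
    then show ?case using TC[of l] CT[of l] by simp
  qed simp
  obtain m where m: "k = Suc m" using k(1) by (cases k) auto
  have mk: "m < k" using m by simp
  have Ak: "A (Suc m) = r'" using xK by (simp add: A_def r'_def m)
  have Bk: "B (Suc m) = r'"
  proof -
    have "x ` {1..k} = x ` {0..<k}"
    proof (intro equalityI subsetI)
      fix y assume "y \<in> x ` {1..k}"
      then show "y \<in> x ` {0..<k}" using xinK xK by auto
    next
      fix y assume "y \<in> x ` {0..<k}"
      then obtain l where l: "y = x l" "l < k" by auto
      show "y \<in> x ` {1..k}"
      proof (cases "l = 0")
        case True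
        then have "y = x k" using l x0 xk by simp
        then show ?thesis using k(1) by auto
      qed (use l in auto)
    qed
    then show ?thesis using xK by (simp add: B_def r'_def m)
  qed
  have offi0: "offset (B m) i0 = offset r' i0"
    using offset_dec_color[of i0 "B m" i0] decB0[OF mk] Bi0[OF mk] i0 a by (simp add: Ak)
  have "ktr (offset r (Suc n)) (jw_prod L r * (jw_cup r i0 a * jw_cap r i0 a) * cable_op r b) = T 0"
  proof -
    have "A 0 = r" "B 0 = r" by (simp_all add: A_def B_def dec_colors_def fun_eq_iff)
    then show ?thesis by (simp only: T_def x0 mult.assoc)
  qed
  also have "\<dots> = C m" using T0[OF mk] TC[OF mk] by simp
  also have "\<dots> = (loop_value + jw_coeff (a - 1)) * ktr (offset r' (Suc n)) (jw_prod L r' * jw (offset r' i0) (a - 1) * cable_op r' b)"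
  proof -
    have "x (Suc m) = i0" using xk m by simp
    then have "jw_cap (B m) (x (Suc m)) a * jw_cup (B m) i0 a = scal (loop_value + jw_coeff (a - 1)) * jw (offset r' i0) (a - 1)"
      using jw_cap_jw_cup_same[OF a(1), of "B m" i0] by (simp add: offi0)
    then show ?thesis unfolding C_def Ak Bk by (simp only: scal_left mult.assoc Tr_scal)
  qed
  finally show ?thesis .
qed

text \<open>The recursion of \<open>jw\<close> adds a correction term, which
  \<open>fusion_cycle\<close> turns into a trace with the projector on \<open>a - 1\<close> strands
  on a component with two strands fewer. The scalar of the partial trace and the recursion
  coefficient multiply to -1 by \<open>jw_coeff_Suc\<close>.\<close>

lemma fusion_step:
  assumes hb: "set b \<subseteq> {1..<n}" and inv: "\<And>i. r (perm b i) = r i"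
    and i0: "i0 \<in> {1..n}" and a: "a < r i0"
    and L: "\<And>j a'. (j, a') \<in> set L \<Longrightarrow> j \<in> {1..n} \<and> j \<notin> orbit (perm b) i0 \<and> a' \<le> r j"
  defines "r' \<equiv> dec_colors r (orbit (perm b) i0)"
  shows "ktr (offset r (Suc n)) (jw_prod (L @ [(i0, Suc a)]) r * cable_op r b) =
     ktr (offset r (Suc n)) (jw_prod (L @ [(i0, a)]) r * cable_op r b) -
     (if a = 0 then 0 else ktr (offset r' (Suc n)) (jw_prod (L @ [(i0, a - 1)]) r' * cable_op r' b))"
proof (cases "a = 0")
  case False
  have e: "jw (offset r i0) a * kU (offset r i0 + a) * jw (offset r i0) a = jw_cup r i0 a * jw_cap r i0 a"
    by (simp only: jw_cup_def jw_cap_def kauff.U_def mult.assoc)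
  have j: "jw_coeff a * (loop_value + jw_coeff (a - 1)) = -1" using jw_coeff_Suc[of "a - 1"] False by simp
  have "jw_prod (L @ [(i0, Suc a)]) r * cable_op r b = jw_prod (L @ [(i0, a)]) r * cable_op r b +
     scal (jw_coeff a) * (jw_prod L r * (jw_cup r i0 a * jw_cap r i0 a) * cable_op r b)"
    unfolding jw_prod_simps jw.simps e by (simp only: distrib_left distrib_right scal_left mult.assoc mult_1_right)
  then have "ktr (offset r (Suc n)) (jw_prod (L @ [(i0, Suc a)]) r * cable_op r b) =
      ktr (offset r (Suc n)) (jw_prod (L @ [(i0, a)]) r * cable_op r b) +
      jw_coeff a * ktr (offset r (Suc n)) (jw_prod L r * (jw_cup r i0 a * jw_cap r i0 a) * cable_op r b)"
    by (simp only: Tr_add Tr_scal)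
  also have "ktr (offset r (Suc n)) (jw_prod L r * (jw_cup r i0 a * jw_cap r i0 a) * cable_op r b) =
     (loop_value + jw_coeff (a - 1)) * ktr (offset r' (Suc n)) (jw_prod L r' * jw (offset r' i0) (a - 1) * cable_op r' b)"
    unfolding r'_def by (rule fusion_cycle[OF hb inv i0 _ a L]) (use False in auto)
  also have "jw_coeff a * \<dots> = - ktr (offset r' (Suc n)) (jw_prod (L @ [(i0, a - 1)]) r' * cable_op r' b)"
    by (simp only: mult.assoc[symmetric] j) (simp add: mult.assoc)
  finally show ?thesis using False by simp
qed simp

text \<open>\<open>F a b\<close> stands for a component with a projector on \<open>a\<close> strands
  next to \<open>b\<close> free ones. The assumption is the Chebyshev recursion
  \<open>S (a + 1) = x * S a - S (a - 1)\<close>, and the binomial coefficients arise from Pascal's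
  rule.\<close>

lemma chebyshev_sum:
  fixes F :: "nat \<Rightarrow> nat \<Rightarrow> 'a::comm_ring_1"
  assumes "\<And>a b. F (Suc a) b = F a (Suc b) - (if a = 0 then 0 else F (a - 1) b)"
  shows "F a b = (\<Sum>j=0..a. (-1) ^ j * of_nat ((a - j) choose j) * F 0 (b + a - 2 * j))"
proof (induction a arbitrary: b rule: less_induct)
  case (less a)
  show ?case
  proof (cases a)
    case 0 then show ?thesis by simp
  next
    case (Suc a1)
    show ?thesis
    proof (cases a1)
      case 0
      then show ?thesis using Suc assms[of 0 b] by simp
    next
      case (Suc a2)
      let ?f = "\<lambda>j. F 0 (b + a - 2 * j)"
      have 1: "F a1 (Suc b) = (\<Sum>j=0..a1. (-1) ^ j * of_nat ((a1 - j) choose j) * ?f j)"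
        using less.IH[of a1 "Suc b"] \<open>a = Suc a1\<close> by simp
      have 2: "F a2 b = (\<Sum>j=0..a2. (-1) ^ j * of_nat ((a2 - j) choose j) * ?f (Suc j))"
        using less.IH[of a2 b] \<open>a = Suc a1\<close> Suc by simp
      have p: "((a1 - j) choose Suc j) = ((a2 - j) choose j) + ((a2 - j) choose Suc j)" if "j \<le> a2" for j
        using that Suc by (simp add: Suc_diff_le)
      have "(\<Sum>j=0..a. (-1) ^ j * of_nat ((a - j) choose j) * ?f j) =
          ?f 0 + (\<Sum>j=0..a1. (-1) ^ Suc j * of_nat ((a1 - j) choose Suc j) * ?f (Suc j))"
        unfolding \<open>a = Suc a1\<close> by (subst sum.atLeast0_atMost_Suc_shift) simp
      also have "(\<Sum>j=0..a1. (-1) ^ Suc j * of_nat ((a1 - j) choose Suc j) * ?f (Suc j)) =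
          (\<Sum>j=0..a2. (-1) ^ Suc j * of_nat ((a1 - j) choose Suc j) * ?f (Suc j))"
        unfolding Suc by simp
      also have "\<dots> = (\<Sum>j=0..a2. (-1) ^ Suc j * of_nat ((a2 - j) choose Suc j) * ?f (Suc j)) - F a2 b"
        unfolding 2 sum_subtractf[symmetric]
        by (rule sum.cong) (simp_all add: p algebra_simps)
      also have "?f 0 + \<dots> = F a1 (Suc b) - F a2 b"
      proof -
        have "F a1 (Suc b) = ?f 0 + (\<Sum>j=0..a2. (-1) ^ Suc j * of_nat ((a2 - j) choose Suc j) * ?f (Suc j))"
          unfolding 1 unfolding Suc by (subst sum.atLeast0_atMost_Suc_shift) simp
        then show ?thesis by simp
      qed
      also have "\<dots> = F a b" using assms[of a1 b] \<open>a = Suc a1\<close> Suc by simp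
      finally show ?thesis by simp
    qed
  qed
qed

lemma chebyshev_sum_half:
  fixes F :: "nat \<Rightarrow> nat \<Rightarrow> 'a::comm_ring_1"
  assumes "\<And>a b. F (Suc a) b = F a (Suc b) - (if a = 0 then 0 else F (a - 1) b)"
  shows "F a 0 = (\<Sum>j\<in>{0..a div 2}. (-1) ^ j * of_nat ((a - j) choose j) * F 0 (a - 2 * j))"
proof -
  have "F a 0 = (\<Sum>j=0..a. (-1) ^ j * of_nat ((a - j) choose j) * F 0 (a - 2 * j))"
    using chebyshev_sum[of F a 0] assms by simp
  also have "\<dots> = (\<Sum>j\<in>{0..a div 2}. (-1) ^ j * of_nat ((a - j) choose j) * F 0 (a - 2 * j))"
  proof (rule sum.mono_neutral_right)
    show "\<forall>j\<in>{0..a} - {0..a div 2}. (-1) ^ j * of_nat ((a - j) choose j) * F 0 (a - 2 * j) = 0"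
    proof
      fix j assume "j \<in> {0..a} - {0..a div 2}"
      then have "(a - j) choose j = 0" by (intro binomial_eq_0) auto
      then show "(-1) ^ j * of_nat ((a - j) choose j) * F 0 (a - 2 * j) = 0"
        by (simp only: of_nat_0 mult_zero_right mult_zero_left)
    qed
  qed auto
  finally show ?thesis .
qed

text \<open>\<open>orbit\<close> requires at least one application of the map, so the point must be
  periodic; positions outside \<open>1, \<dots>, n\<close> are fixed.\<close>

lemma self_in_orbit:
  assumes "valid n w" shows "i \<in> orbit (strand_perm w) i"
proof (cases "i \<in> {1..n}")
  case True
  obtain k where "k \<ge> 1" "(strand_perm w ^^ k) i = i"
    by (rule orbit_cycle[OF assms True])
  then have "\<exists>k. i = (strand_perm w ^^ k) i \<and> 0 < k" by (intro exI[of _ k]) auto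
  then show ?thesis unfolding orbit_altdef by (rule CollectI)
next
  case False
  have "strand_perm w i = i"
    using assms False by (induction w) (auto simp: transpose_def)
  then show ?thesis using orbit.base[of "strand_perm w" i] by simp
qed

lemma component_perm:
  assumes "valid n w" shows "component w (strand_perm w i) = component w i"
  unfolding component_def
proof (intro equalityI subsetI)
  fix y assume "y \<in> orbit (strand_perm w) (strand_perm w i)"
  then show "y \<in> orbit (strand_perm w) i"
    by induction (auto intro: orbit.intros)
next
  fix y assume "y \<in> orbit (strand_perm w) i"
  then show "y \<in> orbit (strand_perm w) (strand_perm w i)"
    by induction (auto intro: orbit.intros self_in_orbit[OF assms])
qed

lemma in_component_iff:
  assumes "valid n w" shows "j \<in> component w i \<longleftrightarrow> component w j = component w i"
proof
  assume "j \<in> component w i"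
  then have "j \<in> orbit (strand_perm w) i" by (simp add: component_def)
  then show "component w j = component w i"
    by induction (simp_all add: component_perm[OF assms])
next
  assume "component w j = component w i"
  then show "j \<in> component w i" using self_in_orbit[OF assms, of j] by (simp add: component_def)
qed

lemma sum_PiE_insert:
  assumes "K \<notin> M"
  shows "(\<Sum>f \<in> insert K M \<rightarrow>\<^sub>E D. g f) = (\<Sum>x\<in>D. \<Sum>f \<in> M \<rightarrow>\<^sub>E D. g (f(K := x)))"
proof -
  have "inj_on (\<lambda>(y, h). h(K := y)) (D \<times> (M \<rightarrow>\<^sub>E D))"
    using inj_combinator[OF assms, of "\<lambda>_. D"] .
  then have "(\<Sum>f \<in> insert K M \<rightarrow>\<^sub>E D. g f) = (\<Sum>(x, f)\<in>D \<times> (M \<rightarrow>\<^sub>E D). g (f(K := x)))"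
    unfolding PiE_insert_eq by (subst sum.reindex) (auto simp: case_prod_unfold)
  then show ?thesis by (simp add: sum.cartesian_product)
qed

definition colored_trace :: "nat \<Rightarrow> nat list \<Rightarrow> (nat \<times> nat) list \<Rightarrow> (nat \<Rightarrow> nat) \<Rightarrow> ratfun" where
  "colored_trace n b L r = ktr (offset r (Suc n)) (jw_prod L r * cable_op r b)"

text \<open>Applied to the numbers of projected and of free strands on one component, the Chebyshev
  formula replaces the whole sum by the projector on all \<open>N\<close> strands at the single
  position \<open>i0\<close>.\<close>

lemma fusion_component:
  assumes hb: "set b \<subseteq> {1..<n}" and inv: "\<And>i. r (perm b i) = r i"
    and i0: "i0 \<in> {1..n}"
    and L: "\<And>j a'. (j, a') \<in> set L \<Longrightarrow> j \<in> {1..n} \<and> component (map Sig b) j \<noteq> component (map Sig b) i0 \<and> a' \<le> r j"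
  defines "\<rho> \<equiv> \<lambda>c i. if component (map Sig b) i = component (map Sig b) i0 then c else r i"
  shows "(\<Sum>x\<in>{0..N div 2}. (-1) ^ x * of_nat ((N - x) choose x) * colored_trace n b L (\<rho> (N - 2 * x))) =
    colored_trace n b (L @ [(i0, N)]) (\<rho> N)"
proof -
  have val: "valid n (map Sig b)" using hb by (simp add: valid_map)
  have orb: "orbit (perm b) i0 = component (map Sig b) i0" by (simp add: component_def)
  define F where "F a c = colored_trace n b (L @ [(i0, a)]) (\<rho> (c + a))" for a c
  have "F (Suc a) c = F a (Suc c) - (if a = 0 then 0 else F (a - 1) c)" for a c
  proof -
    have d: "dec_colors (\<rho> (c + Suc a)) (orbit (perm b) i0) = \<rho> (c + Suc a - 2)"
      unfolding orb by (rule ext) (simp add: dec_colors_def \<rho>_def in_component_iff[OF val])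
    have "colored_trace n b (L @ [(i0, Suc a)]) (\<rho> (c + Suc a)) = colored_trace n b (L @ [(i0, a)]) (\<rho> (c + Suc a)) -
      (if a = 0 then 0 else colored_trace n b (L @ [(i0, a - 1)]) (\<rho> (c + Suc a - 2)))"
      unfolding colored_trace_def d[symmetric]
    proof (rule fusion_step[OF hb _ i0])
      show "\<rho> (c + Suc a) (perm b i) = \<rho> (c + Suc a) i" for i
        by (simp add: \<rho>_def inv component_perm[OF val])
      show "a < \<rho> (c + Suc a) i0" by (simp add: \<rho>_def)
      fix j a' assume j: "(j, a') \<in> set L"
      show "j \<in> {1..n} \<and> j \<notin> orbit (perm b) i0 \<and> a' \<le> \<rho> (c + Suc a) j"
        using L[OF j] unfolding orb by (auto simp: \<rho>_def in_component_iff[OF val])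
    qed
    moreover have "c + Suc a - 2 = c + (a - 1)" if "a \<noteq> 0" using that by simp
    ultimately show ?thesis unfolding F_def by (cases "a = 0") simp_all
  qed
  from chebyshev_sum_half[of F, OF this, of N]
  show ?thesis by (simp add: F_def colored_trace_def)
qed

text \<open>Components are treated one at a time. \<open>Ks\<close> lists those still to be summed,
  \<open>L\<close> the projectors already inserted, and \<open>r\<close> fixes the colors of the
  components not in \<open>Ks\<close>.\<close>

lemma fusion_sum:
  assumes hb: "set b \<subseteq> {1..<n}" and inv: "\<And>i. r (perm b i) = r i"
    and Ks: "distinct Ks" "\<And>K. K \<in> set Ks \<Longrightarrow> rep K \<in> {1..n} \<and> component (map Sig b) (rep K) = K"
    and L: "\<And>j a'. (j, a') \<in> set L \<Longrightarrow> j \<in> {1..n} \<and> component (map Sig b) j \<notin> set Ks \<and> a' \<le> r j"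
  shows "(\<Sum>f\<in>set Ks \<rightarrow>\<^sub>E {0..N div 2}. (\<Prod>K\<in>set Ks. (-1) ^ f K * of_nat ((N - f K) choose f K)) *
      colored_trace n b L (\<lambda>i. if component (map Sig b) i \<in> set Ks then N - 2 * f (component (map Sig b) i) else r i)) =
    colored_trace n b (L @ rev (map (\<lambda>K. (rep K, N)) Ks)) (\<lambda>i. if component (map Sig b) i \<in> set Ks then N else r i)"
  using inv Ks L
proof (induction Ks arbitrary: r)
  case Nil
  show ?case by simp
next
  case (Cons K Ks)
  let ?c = "component (map Sig b)" and ?D = "{0..N div 2}"
  let ?co = "\<lambda>x. (-1) ^ x * of_nat ((N - x) choose x) :: ratfun"
  have val: "valid n (map Sig b)" using hb by (simp add: valid_map)
  have K: "K \<notin> set Ks" "distinct Ks" using Cons.prems by auto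
  define rx where "rx x i = (if ?c i = K then N - 2 * x else r i)" for x i
  define L' where "L' = L @ rev (map (\<lambda>K. (rep K, N)) Ks)"
  define \<rho> where "\<rho> c i = (if ?c i = ?c (rep K) then c else if ?c i \<in> set Ks then N else r i)" for c i
  have repK: "?c (rep K) = K" "rep K \<in> {1..n}" using Cons.prems(3)[of K] by auto
  have same_cell: "(\<Sum>f\<in>set Ks \<rightarrow>\<^sub>E ?D. (\<Prod>K\<in>set Ks. ?co (f K)) *
      colored_trace n b L (\<lambda>i. if ?c i \<in> set Ks then N - 2 * f (?c i) else rx x i)) =
      colored_trace n b L' (\<rho> (N - 2 * x))" for x
  proof -
    have "(\<Sum>f\<in>set Ks \<rightarrow>\<^sub>E ?D. (\<Prod>K\<in>set Ks. ?co (f K)) *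
        colored_trace n b L (\<lambda>i. if ?c i \<in> set Ks then N - 2 * f (?c i) else rx x i)) =
        colored_trace n b L' (\<lambda>i. if ?c i \<in> set Ks then N else rx x i)"
      unfolding L'_def
    proof (rule Cons.IH[OF _ K(2)])
      show "rx x (perm b i) = rx x i" for i using Cons.prems(1) by (simp add: rx_def component_perm[OF val])
      show "rep K' \<in> {1..n} \<and> ?c (rep K') = K'" if "K' \<in> set Ks" for K' using Cons.prems(3)[of K'] that by simp
      show "j \<in> {1..n} \<and> ?c j \<notin> set Ks \<and> a' \<le> rx x j" if "(j, a') \<in> set L" for j a'
        using Cons.prems(4)[OF that] by (simp add: rx_def)
    qed
    also have "(\<lambda>i. if ?c i \<in> set Ks then N else rx x i) = \<rho> (N - 2 * x)"
      by (rule ext) (use K in \<open>auto simp: rx_def \<rho>_def repK\<close>)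
    finally show ?thesis .
  qed
  have "(\<Sum>f\<in>set (K # Ks) \<rightarrow>\<^sub>E ?D. (\<Prod>K\<in>set (K # Ks). ?co (f K)) *
      colored_trace n b L (\<lambda>i. if ?c i \<in> set (K # Ks) then N - 2 * f (?c i) else r i)) =
    (\<Sum>x\<in>?D. \<Sum>f\<in>set Ks \<rightarrow>\<^sub>E ?D. (\<Prod>K'\<in>set (K # Ks). ?co ((f(K := x)) K')) *
      colored_trace n b L (\<lambda>i. if ?c i \<in> set (K # Ks) then N - 2 * (f(K := x)) (?c i) else r i))"
    unfolding list.set sum_PiE_insert[OF K(1)] ..
  also have "\<dots> = (\<Sum>x\<in>?D. ?co x * (\<Sum>f\<in>set Ks \<rightarrow>\<^sub>E ?D. (\<Prod>K\<in>set Ks. ?co (f K)) *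
      colored_trace n b L (\<lambda>i. if ?c i \<in> set Ks then N - 2 * f (?c i) else rx x i)))"
    unfolding sum_distrib_left
  proof (intro sum.cong refl)
    fix x and f :: "nat set \<Rightarrow> nat"
    have "(\<Prod>K'\<in>set (K # Ks). ?co ((f(K := x)) K')) = ?co x * (\<Prod>K'\<in>set Ks. ?co ((f(K := x)) K'))"
      using K by simp
    also have "(\<Prod>K'\<in>set Ks. ?co ((f(K := x)) K')) = (\<Prod>K'\<in>set Ks. ?co (f K'))"
      by (rule prod.cong) (use K in auto)
    finally have p: "(\<Prod>K'\<in>set (K # Ks). ?co ((f(K := x)) K')) = ?co x * (\<Prod>K'\<in>set Ks. ?co (f K'))" .
    have q: "(\<lambda>i. if ?c i \<in> set (K # Ks) then N - 2 * (f(K := x)) (?c i) else r i) =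
       (\<lambda>i. if ?c i \<in> set Ks then N - 2 * f (?c i) else rx x i)"
      by (rule ext) (use K in \<open>auto simp: rx_def\<close>)
    show "(\<Prod>K'\<in>set (K # Ks). ?co ((f(K := x)) K')) *
        colored_trace n b L (\<lambda>i. if ?c i \<in> set (K # Ks) then N - 2 * (f(K := x)) (?c i) else r i) =
      ?co x * ((\<Prod>K\<in>set Ks. ?co (f K)) * colored_trace n b L (\<lambda>i. if ?c i \<in> set Ks then N - 2 * f (?c i) else rx x i))"
      unfolding p q by (simp only: mult.assoc)
  qed
  also have "\<dots> = (\<Sum>x\<in>?D. ?co x * colored_trace n b L' (\<rho> (N - 2 * x)))"
    unfolding same_cell ..
  also have "\<dots> = colored_trace n b (L' @ [(rep K, N)]) (\<rho> N)"
    unfolding \<rho>_def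
  proof (rule fusion_component[OF hb _ repK(2)])
    show "(if ?c (perm b i) \<in> set Ks then N else r (perm b i)) = (if ?c i \<in> set Ks then N else r i)" for i
      using Cons.prems(1) by (simp add: component_perm[OF val])
    fix j a' assume j: "(j, a') \<in> set L'"
    show "j \<in> {1..n} \<and> ?c j \<noteq> ?c (rep K) \<and> a' \<le> (if ?c j \<in> set Ks then N else r j)"
    proof (cases "(j, a') \<in> set L")
      case True
      then show ?thesis using Cons.prems(4)[OF True] by (auto simp: repK)
    next
      case False
      then obtain K' where "K' \<in> set Ks" "j = rep K'" "a' = N" using j by (auto simp: L'_def)
      then show ?thesis using Cons.prems(3)[of K'] K by (auto simp: repK)
    qed
  qed
  also have "\<rho> N = (\<lambda>i. if ?c i \<in> set (K # Ks) then N else r i)"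
    by (rule ext) (auto simp: \<rho>_def repK)
  finally show ?case by (simp add: L'_def)
qed

lemma offset_cong: "(\<And>i. i \<in> {1..n} \<Longrightarrow> r i = r' i) \<Longrightarrow> k \<le> Suc n \<Longrightarrow> offset r k = offset r' k"
  unfolding offset_def by (rule sum.cong) auto

lemma cable_cong:
  "valid n w \<Longrightarrow> (\<And>i. i \<in> {1..n} \<Longrightarrow> r i = r' i) \<Longrightarrow> cable r w = cable r' w"
proof (induction w arbitrary: r r')
  case (Cons x w)
  let ?t = "transpose (letter_index x) (letter_index x + 1)"
  have "(r \<circ> ?t) i = (r' \<circ> ?t) i" if "i \<in> {1..n}" for i
    using that Cons.prems by (auto simp: transpose_def)
  then have 1: "cable (r \<circ> ?t) w = cable (r' \<circ> ?t) w" by (intro Cons.IH) (use Cons.prems in auto)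
  have "offset r (letter_index x) = offset r' (letter_index x)"
    by (rule offset_cong[of n]) (use Cons.prems in auto)
  then have "cable_indices r (letter_index x) = cable_indices r' (letter_index x)"
    using Cons.prems by (simp add: cable_indices_offset)
  then have "cable r [x] = cable r' [x]" by (cases x) simp_all
  then show ?case using 1 by (simp only: cable_Cons[of _ x w])
qed simp

section \<open>Cables with \<open>N\<close> strands throughout, with a projector on every
  cell\<close>

lemma offset_const: "offset (\<lambda>_. N) i = (i - 1) * N"
  by (simp add: offset_def)

definition jw_cell :: "nat \<Rightarrow> nat \<Rightarrow> ratfun linear_op" where "jw_cell N i = jw ((i - 1) * N) N"

definition jw_cells :: "nat \<Rightarrow> nat list \<Rightarrow> ratfun linear_op" where "jw_cells N L = prod_list (map (jw_cell N) L)"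

lemma jw_cells_simps [simp]: "jw_cells N [] = 1" "jw_cells N (i # L) = jw_cell N i * jw_cells N L" "jw_cells N (L @ L') = jw_cells N L * jw_cells N L'"
  by (simp_all add: jw_cells_def)

lemma jw_cell_comm: "1 \<le> i \<Longrightarrow> 1 \<le> j \<Longrightarrow> jw_cell N i * jw_cell N j = jw_cell N j * jw_cell N i"
  using jw_jw_other[of i j N "\<lambda>_. N" N] by (cases "i = j") (simp_all add: jw_cell_def offset_const)

lemma jw_cell_jw_cells_comm: "1 \<le> i \<Longrightarrow> set L \<subseteq> {1..} \<Longrightarrow> jw_cell N i * jw_cells N L = jw_cells N L * jw_cell N i"
proof (induction L)
  case (Cons j L)
  have "jw_cell N i * jw_cells N (j # L) = (jw_cell N i * jw_cell N j) * jw_cells N L" by (simp add: mult.assoc)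
  also have "\<dots> = jw_cell N j * (jw_cell N i * jw_cells N L)" using jw_cell_comm[of i j N] Cons.prems by (simp add: mult.assoc)
  also have "\<dots> = jw_cells N (j # L) * jw_cell N i" using Cons by (simp add: mult.assoc)
  finally show ?case .
qed simp

lemma jw_cell_absorb: "i \<in> set L \<Longrightarrow> set L \<subseteq> {1..} \<Longrightarrow> jw_cell N i * jw_cells N L = jw_cells N L"
proof (induction L)
  case (Cons j L)
  show ?case
  proof (cases "i = j")
    case True
    then show ?thesis by (simp add: mult.assoc[symmetric]) (simp add: jw_cell_def jw_idem)
  next
    case False
    have "1 \<le> i" using Cons.prems by auto
    then have "jw_cell N i * jw_cell N j = jw_cell N j * jw_cell N i" using Cons.prems by (intro jw_cell_comm) auto
    then have "jw_cell N i * jw_cells N (j # L) = jw_cell N j * (jw_cell N i * jw_cells N L)"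
      by (simp add: mult.assoc[symmetric])
    then show ?thesis using Cons False by simp
  qed
qed simp

lemma jw_cells_absorb: "set L \<subseteq> set L' \<Longrightarrow> set L' \<subseteq> {1..} \<Longrightarrow> jw_cells N L * jw_cells N L' = jw_cells N L'"
  by (induction L) (simp_all add: mult.assoc jw_cell_absorb)

lemma jw_cells_comm: "set L \<subseteq> {1..} \<Longrightarrow> set L' \<subseteq> {1..} \<Longrightarrow> jw_cells N L * jw_cells N L' = jw_cells N L' * jw_cells N L"
proof (induction L)
  case (Cons i L)
  have "jw_cells N (i # L) * jw_cells N L' = jw_cell N i * (jw_cells N L' * jw_cells N L)" using Cons by (simp add: mult.assoc)
  also have "\<dots> = (jw_cell N i * jw_cells N L') * jw_cells N L" by (simp only: mult.assoc)
  also have "\<dots> = jw_cells N L' * jw_cells N (i # L)" using jw_cell_jw_cells_comm[of i L' N] Cons.prems by (simp add: mult.assoc)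
  finally show ?case .
qed simp

lemma jw_cells_set_eq:
  assumes "set L = set L'" "set L \<subseteq> {1..}" shows "jw_cells N L = jw_cells N L'"
proof -
  have "jw_cells N L = jw_cells N L' * jw_cells N L" using assms by (simp add: jw_cells_absorb)
  also have "\<dots> = jw_cells N L * jw_cells N L'" by (rule jw_cells_comm) (use assms in auto)
  also have "\<dots> = jw_cells N L'" using assms by (simp add: jw_cells_absorb)
  finally show ?thesis .
qed

lemma recolor_pos_const: "recolor_pos (\<lambda>_. N) b = (\<lambda>_. N)"
  by (induction b) (simp_all add: comp_def)

lemma jw_cells_cable_op:
  assumes "set b \<subseteq> {1..<n}" "set L \<subseteq> {1..}"
  shows "jw_cells N L * cable_op (\<lambda>_. N) b = cable_op (\<lambda>_. N) b * jw_cells N (map (perm b) L)"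
  using assms(2)
proof (induction L)
  case (Cons i L)
  have 1: "jw_cell N i * cable_op (\<lambda>_. N) b = cable_op (\<lambda>_. N) b * jw_cell N (perm b i)"
    using jw_cable_op[OF assms(1), of i N "\<lambda>_. N"] Cons.prems by (simp add: jw_cell_def offset_const recolor_pos_const)
  have "jw_cells N (i # L) * cable_op (\<lambda>_. N) b = jw_cell N i * (cable_op (\<lambda>_. N) b * jw_cells N (map (perm b) L))"
    using Cons by (simp add: mult.assoc)
  also have "\<dots> = (jw_cell N i * cable_op (\<lambda>_. N) b) * jw_cells N (map (perm b) L)" by (simp only: mult.assoc)
  finally show ?case unfolding 1 by (simp add: mult.assoc)
qed simp

lemma hom_jw_cells: "set L \<subseteq> {1..n} \<Longrightarrow> hom kauff_weight (n * N) (n * N) (jw_cells N L)"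
proof (induction L)
  case (Cons i L)
  have "(i - 1) * N + N \<le> n * N" using Cons.prems by (cases i) (auto simp: add.commute[of "_ * N" N] mult_Suc[symmetric] simp del: mult_Suc intro!: mult_le_mono1)
  then have "hom kauff_weight (n * N) (n * N) (jw_cell N i)" unfolding jw_cell_def by (rule hom_jw)
  then show ?case using Cons by (auto intro!: hom_mult)
qed (simp add: hom_1)

lemma hom_cable_op_const: "set b \<subseteq> {1..<n} \<Longrightarrow> hom kauff_weight (n * N) (n * N) (cable_op (\<lambda>_. N) b)"
  using hom_cable_op[of b n "\<lambda>_. N"] by (simp add: offset_const)

text \<open>The projectors are idempotent, so they can be doubled; one copy is pushed through the
  braid to the images of the strands and brought back by cyclicity.\<close>

lemma trace_spread:
  assumes hb: "set b \<subseteq> {1..<n}" and L: "set L \<subseteq> {1..n}"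
  shows "ktr (n * N) (jw_cells N L * cable_op (\<lambda>_. N) b) = ktr (n * N) (jw_cells N (map (perm b) L @ L) * cable_op (\<lambda>_. N) b)"
proof -
  let ?X = "cable_op (\<lambda>_. N) b"
  have val: "valid n (map Sig b)" using hb by (simp add: valid_map)
  have L1: "set L \<subseteq> {1..}" using L by auto
  have L': "set (map (perm b) L) \<subseteq> {1..n}" using L perm_range[OF val] by auto
  have "jw_cells N L * ?X = jw_cells N L * (jw_cells N L * ?X)" using jw_cells_absorb[of L L] L1 by (simp add: mult.assoc[symmetric])
  also have "\<dots> = jw_cells N L * (?X * jw_cells N (map (perm b) L))" by (simp only: jw_cells_cable_op[OF hb L1])
  also have "\<dots> = (jw_cells N L * ?X) * jw_cells N (map (perm b) L)" by (simp only: mult.assoc)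
  finally have "ktr (n * N) (jw_cells N L * ?X) = ktr (n * N) ((jw_cells N L * ?X) * jw_cells N (map (perm b) L))" by simp
  also have "\<dots> = ktr (n * N) (jw_cells N (map (perm b) L) * (jw_cells N L * ?X))"
    by (rule Tr_comm[OF hom_mult[OF hom_cable_op_const[OF hb] hom_jw_cells[OF L]] hom_jw_cells[OF L']])
  finally show ?thesis by (simp add: mult.assoc)
qed

text \<open>Repeated spreading carries the projectors along the orbits until every strand of every
  component has one; commuting idempotents depend only on the set of their positions.\<close>

lemma trace_spread_all:
  assumes hb: "set b \<subseteq> {1..<n}" and L: "set L \<subseteq> {1..n}"
    and cover: "\<And>i. i \<in> {1..n} \<Longrightarrow> \<exists>j\<in>set L. component (map Sig b) i = component (map Sig b) j"
  shows "ktr (n * N) (jw_cells N L * cable_op (\<lambda>_. N) b) = ktr (n * N) (jw_cells N [1..<Suc n] * cable_op (\<lambda>_. N) b)"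
proof -
  have val: "valid n (map Sig b)" using hb by (simp add: valid_map)
  define M where "M k = ((\<lambda>L. map (perm b) L @ L) ^^ k) L" for k
  have M: "set (M k) \<subseteq> {1..n} \<and> ktr (n * N) (jw_cells N L * cable_op (\<lambda>_. N) b) = ktr (n * N) (jw_cells N (M k) * cable_op (\<lambda>_. N) b)" for k
  proof (induction k)
    case 0 then show ?case using L by (simp add: M_def)
  next
    case (Suc k)
    have "M (Suc k) = map (perm b) (M k) @ M k" by (simp add: M_def)
    then show ?case using Suc trace_spread[OF hb, of "M k" N] perm_range[OF val] by auto
  qed
  have mono: "set (M k) \<subseteq> set (M (k + l))" for k l
    by (induction l) (auto simp: M_def)
  have "\<exists>k. i \<in> set (M k)" if i: "i \<in> {1..n}" for i
  proof -
    obtain j where j: "j \<in> set L" "component (map Sig b) i = component (map Sig b) j" using cover[OF i] by blast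
    then have "i \<in> orbit (perm b) j" using in_component_iff[OF val, of i j] by (simp add: component_def)
    then show ?thesis
    proof induction
      case base
      have "perm b j \<in> set (M 1)" using j by (simp add: M_def)
      then show ?case by blast
    next
      case (step y)
      then obtain k where "y \<in> set (M k)" by blast
      then have "perm b y \<in> set (M (Suc k))" by (simp add: M_def)
      then show ?case by blast
    qed
  qed
  then obtain k where k: "\<And>i. i \<in> {1..n} \<Longrightarrow> i \<in> set (M (k i))" by metis
  define m where "m = (\<Sum>i\<in>{1..n}. k i)"
  have "{1..n} \<subseteq> set (M m)"
  proof
    fix i assume i: "i \<in> {1..n}"
    then have "k i \<le> m" unfolding m_def by (intro member_le_sum) auto
    then show "i \<in> set (M m)" using k[OF i] mono[of "k i" "m - k i"] by auto
  qed
  moreover have Mm: "set (M m) \<subseteq> {1..n}" using M by blast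
  ultimately have "set (M m) = set [1..<Suc n]" by (simp only: set_upt atLeastLessThanSuc_atLeastAtMost)
  then have "jw_cells N (M m) = jw_cells N [1..<Suc n]" by (rule jw_cells_set_eq) (use Mm in auto)
  moreover have "ktr (n * N) (jw_cells N L * cable_op (\<lambda>_. N) b) = ktr (n * N) (jw_cells N (M m) * cable_op (\<lambda>_. N) b)"
    using M by blast
  ultimately show ?thesis by (simp only:)
qed

lemma S_bracket_projected:
  assumes hb: "set b \<subseteq> {1..<n}"
  shows "loop_value * S_bracket N n (map Sig b) = ktr (n * N) (jw_cells N [1..<Suc n] * cable_op (\<lambda>_. N) b)"
proof -
  let ?w = "map Sig b" and ?c = "component (map Sig b)"
  have val: "valid n ?w" using hb by (simp add: valid_map)
  obtain Ks where Ks: "set Ks = components n ?w" "distinct Ks"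
  proof -
    have "finite (components n ?w)" by (simp add: components_def)
    from finite_distinct_list[OF this] show ?thesis using that by blast
  qed
  define rep where "rep K = (SOME i. i \<in> {1..n} \<and> ?c i = K)" for K
  have rep: "rep K \<in> {1..n} \<and> ?c (rep K) = K" if "K \<in> set Ks" for K
  proof -
    have "\<exists>i. i \<in> {1..n} \<and> ?c i = K" using that unfolding Ks(1) components_def by blast
    then show ?thesis unfolding rep_def by (rule someI_ex)
  qed
  \<comment> \<open>Functions in the extensional product are \<open>undefined\<close> off the
    components, so this is the color that \<open>S_bracket\<close> assigns to positions outside
    \<open>1, \<dots>, n\<close>.\<close>
  let ?u = "N - 2 * undefined"
  let ?r = "\<lambda>i. if ?c i \<in> set Ks then N else ?u"
  let ?L = "rev (map (\<lambda>K. (rep K, N)) Ks)"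
  have "loop_value * S_bracket N n ?w = (\<Sum>f\<in>set Ks \<rightarrow>\<^sub>E {0..N div 2}. (\<Prod>K\<in>set Ks. (-1) ^ f K * of_nat ((N - f K) choose f K)) *
      colored_trace n b [] (\<lambda>i. if ?c i \<in> set Ks then N - 2 * f (?c i) else ?u))"
    unfolding S_bracket_trace[OF val] Ks(1)[symmetric]
  proof (rule sum.cong[OF refl])
    fix f assume f: "f \<in> set Ks \<rightarrow>\<^sub>E {0..N div 2}"
    have eq: "(\<lambda>i. N - 2 * f (?c i)) = (\<lambda>i. if ?c i \<in> set Ks then N - 2 * f (?c i) else ?u)"
    proof
      fix i
      show "N - 2 * f (?c i) = (if ?c i \<in> set Ks then N - 2 * f (?c i) else ?u)"
      proof (cases "?c i \<in> set Ks")
        case False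
        then show ?thesis using PiE_arb[OF f False] by (simp only: if_False)
      next
        case True
        then show ?thesis by (simp only: if_True)
      qed
    qed
    show "(\<Prod>K\<in>set Ks. (-1) ^ f K * of_nat ((N - f K) choose f K)) *
        ktr (offset (\<lambda>i. N - 2 * f (?c i)) (Suc n)) (braid_op (cable (\<lambda>i. N - 2 * f (?c i)) ?w)) =
        (\<Prod>K\<in>set Ks. (-1) ^ f K * of_nat ((N - f K) choose f K)) *
        colored_trace n b [] (\<lambda>i. if ?c i \<in> set Ks then N - 2 * f (?c i) else ?u)"
      unfolding colored_trace_def jw_prod_simps mult_1_left
      by (rule arg_cong[where f = "\<lambda>r. _ * ktr (offset r (Suc n)) (cable_op r b)", OF eq])
  qed
  also have "\<dots> = colored_trace n b ([] @ ?L) ?r"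
    by (rule fusion_sum[OF hb _ Ks(2)]) (use rep in auto)
  also have "\<dots> = colored_trace n b ?L (\<lambda>_. N)"
  proof -
    have e: "?r i = N" if "i \<in> {1..n}" for i using that Ks by (auto simp: components_def)
    have o: "offset ?r k = offset (\<lambda>_. N) k" if "k \<le> Suc n" for k by (rule offset_cong[of n]) (use e that in auto)
    have "cable ?r ?w = cable (\<lambda>_. N) ?w" by (rule cable_cong[OF val]) (use e in auto)
    moreover have "jw_prod ?L ?r = jw_prod ?L (\<lambda>_. N)"
      unfolding jw_prod_def
    proof (rule arg_cong[of _ _ prod_list], rule map_cong[OF refl])
      fix z assume "z \<in> set ?L"
      then obtain K where K: "K \<in> set Ks" "z = (rep K, N)" by auto
      have "offset ?r (rep K) = offset (\<lambda>_. N) (rep K)" by (rule o) (use rep[OF K(1)] in simp)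
      then show "(case z of (i, a) \<Rightarrow> jw (offset ?r i) a) = (case z of (i, a) \<Rightarrow> jw (offset (\<lambda>_. N) i) a)"
        unfolding K(2) prod.case by (simp only:)
    qed
    ultimately show ?thesis by (simp only: colored_trace_def append_Nil o[OF order_refl])
  qed
  also have "\<dots> = ktr (n * N) (jw_cells N (rev (map rep Ks)) * cable_op (\<lambda>_. N) b)"
    by (simp add: colored_trace_def jw_prod_def jw_cells_def jw_cell_def offset_const rev_map comp_def)
  also have "\<dots> = ktr (n * N) (jw_cells N [1..<Suc n] * cable_op (\<lambda>_. N) b)"
  proof (rule trace_spread_all[OF hb])
    show "set (rev (map rep Ks)) \<subseteq> {1..n}" using rep by auto
    fix i assume "i \<in> {1..n}"
    then have "?c i \<in> set Ks" using Ks by (simp add: components_def)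
    then show "\<exists>j\<in>set (rev (map rep Ks)). ?c i = ?c j" using rep by (intro bexI[of _ "rep (?c i)"]) auto
  qed
  finally show ?thesis .
qed

subsection \<open>The full twist\<close>

declare upt_Suc [simp del]

lemma kU_jw_sg: "1 \<le> j \<Longrightarrow> j < a \<Longrightarrow> sg (d + j) * jw d a = scal A_var * jw d a"
  by (simp add: sg_eq distrib_right mult.assoc U_jw)

lemma jw_sg: "1 \<le> j \<Longrightarrow> j < a \<Longrightarrow> jw d a * sg (d + j) = scal A_var * jw d a"
proof -
  assume "1 \<le> j" "j < a"
  then have z: "jw d a * kU (d + j) = 0" by (rule jw_U_zero)
  have "jw d a * sg (d + j) = jw d a * scal A_var + scal (inverse A_var) * (jw d a * kU (d + j))"
    unfolding sg_eq distrib_left by (simp only: scal_left)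
  also have "\<dots> = scal A_var * jw d a" unfolding z by (simp add: scal_comm[of "jw d a"])
  finally show ?thesis .
qed

lemma W_eigen_left:
  assumes "\<And>j. j \<in> set h \<Longrightarrow> sg j * Z = scal A_var * Z"
  shows "sg.W h * Z = scal (A_var ^ length h) * Z"
  using assms
proof (induction h)
  case (Cons j h)
  have "sg.W (j # h) * Z = sg j * (sg.W h * Z)" by (simp add: mult.assoc)
  also have "sg.W h * Z = scal (A_var ^ length h) * Z" using Cons by simp
  also have "sg j * (scal (A_var ^ length h) * Z) = scal (A_var ^ length h) * (sg j * Z)" by (rule scal_left)
  also have "\<dots> = scal (A_var ^ length h * A_var) * Z" using Cons.prems by (simp add: scal_mult mult.assoc)
  finally show ?case by (simp add: mult.commute)
qed simp

lemma W_eigen_right: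
  assumes "\<And>j. j \<in> set h \<Longrightarrow> Z * sg j = scal A_var * Z"
  shows "Z * sg.W h = scal (A_var ^ length h) * Z"
  using assms
proof (induction h)
  case (Cons j h)
  have "Z * sg.W (j # h) = (Z * sg j) * sg.W h" by (simp add: mult.assoc)
  also have "\<dots> = scal A_var * (Z * sg.W h)" using Cons.prems by (simp add: mult.assoc)
  finally show ?case using Cons by (simp add: scal_mult mult.assoc)
qed simp

lemma power_eigen_right: "Z * F = scal k * Z \<Longrightarrow> Z * F ^ j = scal (k ^ j) * Z"
proof (induction j)
  case (Suc j)
  have "Z * F ^ Suc j = (Z * F) * F ^ j" by (simp add: mult.assoc)
  also have "\<dots> = scal k * (Z * F ^ j)" using Suc by (simp add: mult.assoc)
  finally show ?case using Suc by (simp add: scal_mult mult.assoc)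
qed simp

lemma power_eigen_left: "F * Z = scal k * Z \<Longrightarrow> F ^ j * Z = scal (k ^ j) * Z"
proof (induction j)
  case (Suc j)
  have "F ^ Suc j * Z = F * (F ^ j * Z)" by (simp add: mult.assoc)
  also have "F ^ j * Z = scal (k ^ j) * Z" using Suc by simp
  also have "F * (scal (k ^ j) * Z) = scal (k ^ j) * (F * Z)" by (rule scal_left)
  also have "\<dots> = scal (k ^ j * k) * Z" using Suc by (simp add: scal_mult mult.assoc)
  finally show ?case by (simp add: mult.commute)
qed simp

lemma cable_op_append_const: "cable_op (\<lambda>_. N) (u @ v) = cable_op (\<lambda>_. N) u * cable_op (\<lambda>_. N) v"
  by (simp add: cable_append recolor_pos_const)

text \<open>The Coxeter element carries the first strand across all others; in the cable the first
  \<open>N\<close> strands cross the remaining \<open>k * N\<close> as one block.\<close>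

lemma cable_op_coxeter: "cable_op (\<lambda>_. N) [1..<Suc k] = sg.X 0 N (k * N)"
proof (induction k)
  case (Suc k)
  have "cable_op (\<lambda>_. N) [Suc k] = sg.X (k * N) N N" using cable_op_Cons[of "\<lambda>_. N" "Suc k" "[]"] by (simp add: offset_const)
  moreover have "[1..<Suc (Suc k)] = [1..<Suc k] @ [Suc k]" by (simp add: upt_Suc)
  ultimately have "cable_op (\<lambda>_. N) [1..<Suc (Suc k)] = sg.X 0 N (k * N) * sg.X (k * N) N N"
    using Suc by (simp only: cable_op_append_const)
  also have "\<dots> = sg.X 0 N (Suc k * N)" using sg.X_add[of 0 N "k * N" N] by (simp add: add.commute)
  finally show ?case .
qed simp

lemma cable_op_full_twist: "cable_op (\<lambda>_. N) (concat (replicate k u)) = cable_op (\<lambda>_. N) u ^ k"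
  by (induction k) (simp_all add: cable_op_append_const del: map_append)

lemma jw_cells_all_cable_op:
  assumes "set b \<subseteq> {1..<n}"
  shows "jw_cells N [1..<Suc n] * cable_op (\<lambda>_. N) b = cable_op (\<lambda>_. N) b * jw_cells N [1..<Suc n]"
proof -
  have val: "valid n (map Sig b)" using assms by (simp add: valid_map)
  have sub: "perm b ` {1..n} \<subseteq> {1..n}" using perm_range[OF val] by blast
  have "perm b ` {1..n} = {1..n}"
    using sub by (rule card_subset_eq[rotated]) (simp_all add: card_image inj_on_subset[OF bij_is_inj[OF bij_perm]])
  then have "jw_cells N (map (perm b) [1..<Suc n]) = jw_cells N [1..<Suc n]"
    by (intro jw_cells_set_eq) (simp_all only: set_map set_upt atLeastLessThanSuc_atLeastAtMost, auto)
  moreover have "set [1..<Suc n] \<subseteq> {1..}" by auto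
  ultimately show ?thesis using jw_cells_cable_op[OF assms] by metis
qed

lemma jw_cells_first:
  assumes "n \<ge> 1" "1 \<le> j" "j < N"
  shows "jw_cells N [1..<Suc n] * sg j = scal A_var * jw_cells N [1..<Suc n]"
proof -
  let ?P = "jw_cells N [1..<Suc n]"
  have s: "set [1..<Suc n] \<subseteq> {1..}" by auto
  have "jw_cell N 1 * ?P = ?P" by (rule jw_cell_absorb[OF _ s]) (use assms in auto)
  moreover have "jw_cell N 1 * ?P = ?P * jw_cell N 1" by (rule jw_cell_jw_cells_comm[OF _ s]) simp
  ultimately have e: "?P = ?P * jw 0 N" by (simp only: jw_cell_def) simp
  have "?P * sg j = ?P * (jw 0 N * sg (0 + j))" by (subst e) (simp add: mult.assoc)
  also have "\<dots> = scal A_var * (?P * jw 0 N)" unfolding jw_sg[OF assms(2,3)] by (simp only: scal_left)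
  finally show ?thesis using e by simp
qed

text \<open>The full twist on \<open>n * N\<close> strands is the \<open>n\<close>-th power of the
  \<open>N\<close>-th power of the Coxeter element. Each of these \<open>n\<close> factors is, by
  \<open>up_power\<close>, the full twist on the first cell times the cabled Coxeter element; the
  projector of that cell turns the former into \<open>A ^ ((N - 1) * N)\<close>, and
  \<open>?P\<close> commutes with the latter.\<close>

lemma jw_cells_full_twist:
  assumes "n \<ge> 1"
  shows "scal (A_var ^ ((N - 1) * (n * N))) * (jw_cells N [1..<Suc n] * cable_op (\<lambda>_. N) [1..<n] ^ n) =
    jw_cells N [1..<Suc n] * sg.up 1 (n * N - 1) ^ (n * N)"
proof (cases "N = 0")
  case True
  have "sg.X d 0 M = 1" for d M by (induction M) (simp_all)
  then have "cable_op (\<lambda>_. N) [1..<n] = 1" using cable_op_coxeter[of N "n - 1"] assms True by simp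
  then show ?thesis using True by simp
next
  case False
  let ?P = "jw_cells N [1..<Suc n]" and ?Y = "cable_op (\<lambda>_. N) [1..<n]"
  have Y: "?Y = sg.X 0 N ((n - 1) * N)" using cable_op_coxeter[of N "n - 1"] assms by simp
  have "n * N - 1 = N - 1 + (n - 1) * N"
    using assms False by (cases n; cases N) (simp_all)
  then have C: "sg.up 1 (n * N - 1) ^ N = sg.up 1 (N - 1) ^ N * ?Y"
    using sg.up_power[of N N "(n - 1) * N"] Y by simp
  have "?P * sg.up 1 (N - 1) = scal (A_var ^ length [1..<1 + (N - 1)]) * ?P"
    unfolding sg.up_def
  proof (rule W_eigen_right)
    fix j assume "j \<in> set [1..<1 + (N - 1)]"
    then show "?P * sg j = scal A_var * ?P" by (intro jw_cells_first[OF assms]) auto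
  qed
  then have PN: "?P * sg.up 1 (N - 1) ^ N = scal ((A_var ^ (N - 1)) ^ N) * ?P"
    by (intro power_eigen_right) (simp only: length_upt add_diff_cancel_left')
  define q where "q = (A_var ^ (N - 1)) ^ N"
  have PC: "?P * sg.up 1 (n * N - 1) ^ N = scal q * (?P * ?Y)"
    unfolding C mult.assoc[symmetric] PN q_def by (simp only: mult.assoc)
  have "set [1..<n] \<subseteq> {1..<n}" by auto
  from jw_cells_all_cable_op[OF this] have PY: "?P * ?Y = ?Y * ?P" .
  have PYk: "?P * ?Y ^ k = ?Y ^ k * ?P" for k
  proof (induction k)
    case (Suc k)
    have "?P * ?Y ^ Suc k = (?P * ?Y) * ?Y ^ k" by (simp add: mult.assoc)
    also have "\<dots> = ?Y * (?P * ?Y ^ k)" unfolding PY by (simp only: mult.assoc)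
    finally show ?case using Suc by (simp add: mult.assoc)
  qed simp
  have "?P * (sg.up 1 (n * N - 1) ^ N) ^ k = scal (q ^ k) * (?P * ?Y ^ k)" for k
  proof (induction k)
    case (Suc k)
    let ?C = "sg.up 1 (n * N - 1) ^ N"
    have "?P * ?C ^ Suc k = (?P * ?C ^ k) * ?C" by (simp add: power_Suc2 mult.assoc del: power_Suc)
    also have "\<dots> = scal (q ^ k) * (?Y ^ k * (?P * ?C))" unfolding Suc PYk by (simp only: mult.assoc)
    also have "?Y ^ k * (?P * ?C) = ?Y ^ k * (scal q * (?P * ?Y))" by (simp only: PC)
    also have "\<dots> = scal q * (?Y ^ k * (?P * ?Y))" by (rule scal_left)
    also have "?Y ^ k * (?P * ?Y) = (?Y ^ k * ?P) * ?Y" by (simp only: mult.assoc)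
    also have "\<dots> = ?P * ?Y ^ Suc k" by (simp only: PYk[symmetric] mult.assoc power_Suc2)
    also have "scal (q ^ k) * (scal q * (?P * ?Y ^ Suc k)) = scal (q ^ Suc k) * (?P * ?Y ^ Suc k)"
      by (simp only: scal_mult power_Suc2 mult.assoc)
    finally show ?case .
  qed simp
  from this[of n] show ?thesis by (simp add: q_def power_mult[symmetric] mult_ac)
qed

section \<open>A cup passing through the full twist\<close>

lemma sg_up_cu_far: "i \<le> k \<Longrightarrow> sg.up (k + 2) a * kcu i = kcu i * sg.up k a"
proof (induction a)
  case (Suc a)
  have "sg (k + 2 + a) * kcu i = kcu i * sg (k + a)"
    using sg_cu_far[of i "k + a"] Suc.prems by (simp add: add_ac)
  then have "sg.up (k + 2) (Suc a) * kcu i = sg.up (k + 2) a * (kcu i * sg (k + a))"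
    by (simp only: sg.up_Suc mult.assoc)
  also have "\<dots> = (sg.up (k + 2) a * kcu i) * sg (k + a)" by (simp only: mult.assoc)
  also have "sg.up (k + 2) a * kcu i = kcu i * sg.up k a" using Suc by simp
  finally show ?case by (simp only: sg.up_Suc mult.assoc)
qed simp

lemma sg_up_cu_near: "k + a + 1 \<le> i \<Longrightarrow> sg.up k a * kcu i = kcu i * sg.up k a"
proof (induction a)
  case (Suc a)
  have "sg (k + a) * kcu i = kcu i * sg (k + a)" by (rule sg_cu_near) (use Suc.prems in simp)
  then have "sg.up k (Suc a) * kcu i = (sg.up k a * kcu i) * sg (k + a)"
    by (simp add: sg.up_Suc mult.assoc)
  then show ?case using Suc by (simp add: sg.up_Suc mult.assoc)
qed simp

text \<open>A Coxeter element moves the cup one place to the right; the crossings \<open>i\<close>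
  and \<open>i + 1\<close> are absorbed, which leaves the Coxeter element on two strands
  fewer.\<close>

lemma coxeter_cu:
  assumes "1 \<le> i" "i + 2 \<le> m"
  shows "sg.up 1 (m - 1) * kcu i = kcu (Suc i) * sg.up 1 (m - 3)"
proof -
  obtain a where a: "m = i + 2 + a" using assms le_Suc_ex by blast
  obtain j where j: "i = Suc j" using assms by (cases i) auto
  have "m - 1 = j + (2 + a)" using a j by simp
  then have "sg.up 1 (m - 1) = sg.up 1 j * (sg.up i 2 * sg.up (i + 2) a)"
    using sg.up_add[of 1 j "2 + a"] sg.up_add[of i 2 a] j by simp
  also have "sg.up i 2 = sg i * sg (Suc i)" by (simp add: numeral_2_eq_2 sg.up_Suc)
  finally have "sg.up 1 (m - 1) * kcu i = sg.up 1 j * (sg i * sg (Suc i)) * (sg.up (i + 2) a * kcu i)"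
    by (simp only: mult.assoc)
  also have "sg.up (i + 2) a * kcu i = kcu i * sg.up i a" by (rule sg_up_cu_far) simp
  also have "sg.up 1 j * (sg i * sg (Suc i)) * (kcu i * sg.up i a) = sg.up 1 j * (sg i * sg (Suc i) * kcu i) * sg.up i a"
    by (simp only: mult.assoc)
  also have "\<dots> = (sg.up 1 j * kcu (Suc i)) * sg.up i a" by (simp only: sg_sg_cu)
  also have "sg.up 1 j * kcu (Suc i) = kcu (Suc i) * sg.up 1 j" by (rule sg_up_cu_near) (use j in simp)
  also have "kcu (Suc i) * sg.up 1 j * sg.up i a = kcu (Suc i) * sg.up 1 (m - 3)"
    using sg.up_add[of 1 j a] a j by (simp add: mult.assoc)
  finally show ?thesis .
qed

lemma coxeter_power_cu:
  assumes "1 \<le> i" "i + 1 + k \<le> m"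
  shows "sg.up 1 (m - 1) ^ k * kcu i = kcu (i + k) * sg.up 1 (m - 3) ^ k"
  using assms(2)
proof (induction k)
  case (Suc k)
  have "sg.up 1 (m - 1) ^ Suc k * kcu i = sg.up 1 (m - 1) * (sg.up 1 (m - 1) ^ k * kcu i)"
    by (simp only: power_Suc mult.assoc)
  also have "\<dots> = (sg.up 1 (m - 1) * kcu (i + k)) * sg.up 1 (m - 3) ^ k"
    using Suc by (simp add: mult.assoc)
  also have "sg.up 1 (m - 1) * kcu (i + k) = kcu (Suc (i + k)) * sg.up 1 (m - 3)"
    by (rule coxeter_cu) (use assms Suc.prems in auto)
  finally show ?case by (simp add: mult.assoc)
qed simp

lemma sg_cu: "sg i * kcu i = scal (- (inverse A_var ^ 3)) * kcu i"
  by (rule linear_op_eqI, simp only: ap_times ap_scal ap_sg ap_fun_add ap_fun_scale ap_kcu_loop loop_rel)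
     (simp add: algebra_simps A_inv power3_eq_cube)

lemma coxeter_slide: "1 \<le> l \<Longrightarrow> l < a \<Longrightarrow> sg.up 1 a * sg l = sg (Suc l) * sg.up 1 a"
proof (induction a)
  case (Suc a)
  show ?case
  proof (cases "l < a")
    case True
    have "sg.up 1 (Suc a) * sg l = sg.up 1 a * (sg (Suc a) * sg l)" by (simp add: sg.up_Suc mult.assoc)
    also have "sg (Suc a) * sg l = sg l * sg (Suc a)" using sg.far[of l "Suc a"] True by simp
    also have "sg.up 1 a * (sg l * sg (Suc a)) = (sg.up 1 a * sg l) * sg (Suc a)" by (simp only: mult.assoc)
    also have "\<dots> = sg (Suc l) * sg.up 1 (Suc a)" using Suc True by (simp add: sg.up_Suc mult.assoc)
    finally show ?thesis .
  next
    case False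
    then have l: "l = a" using Suc.prems by simp
    obtain a' where a': "a = Suc a'" using Suc.prems l by (cases a) auto
    have c: "sg (Suc a) * sg.up 1 a' = sg.up 1 a' * sg (Suc a)" by (rule sg.comm_up) (use a' in simp)
    have "sg.up 1 (Suc a) * sg l = sg.up 1 a' * (sg a * sg (Suc a) * sg a)"
      using a' l by (simp add: sg.up_Suc mult.assoc)
    also have "sg a * sg (Suc a) * sg a = sg (Suc a) * sg a * sg (Suc a)" by (rule sg.yb)
    also have "sg.up 1 a' * (sg (Suc a) * sg a * sg (Suc a)) = (sg.up 1 a' * sg (Suc a)) * sg a * sg (Suc a)"
      by (simp only: mult.assoc)
    also have "\<dots> = sg (Suc l) * sg.up 1 (Suc a)"
      unfolding c[symmetric] using a' l by (simp add: sg.up_Suc mult.assoc)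
    finally show ?thesis .
  qed
qed simp

lemma coxeter_slide_up: "e < a \<Longrightarrow> sg.up 1 a * sg.up 1 e = sg.up 2 e * sg.up 1 a"
proof (induction e)
  case (Suc e)
  have "sg.up 1 a * sg.up 1 (Suc e) = (sg.up 1 a * sg.up 1 e) * sg (Suc e)" by (simp add: sg.up_Suc mult.assoc)
  also have "\<dots> = sg.up 2 e * (sg.up 1 a * sg (Suc e))" using Suc by (simp add: mult.assoc)
  also have "sg.up 1 a * sg (Suc e) = sg (Suc (Suc e)) * sg.up 1 a" by (rule coxeter_slide) (use Suc.prems in auto)
  finally show ?case by (simp add: sg.up_Suc mult.assoc)
qed simp

lemma up_up_cu: "sg.up 2 k * sg.up 1 k * kcu (Suc k) = kcu 1"
proof (induction k)
  case (Suc k)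
  have c: "sg (k + 2) * sg.up 1 k = sg.up 1 k * sg (k + 2)" by (rule sg.comm_up) simp
  have "sg.up 2 (Suc k) * sg.up 1 (Suc k) * kcu (Suc (Suc k)) = sg.up 2 k * (sg (k + 2) * sg.up 1 k) * (sg (Suc k) * kcu (Suc (Suc k)))"
    by (simp add: sg.up_Suc mult.assoc)
  also have "\<dots> = sg.up 2 k * sg.up 1 k * (sg (Suc (Suc k)) * sg (Suc k) * kcu (Suc (Suc k)))"
    unfolding c by (simp add: mult.assoc)
  also have "\<dots> = kcu 1" unfolding sg_sg_cu' by (rule Suc.IH)
  finally show ?case .
qed simp

text \<open>At the right end the cup cannot move further, and two Coxeter elements carry it around
  to position 1. Each of them produces one kink, of value \<open>- (inverse A_var ^ 3)\<close>,
  which explains the exponent 6.\<close>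

lemma coxeter_sq_cu:
  assumes "m \<ge> 2"
  shows "sg.up 1 (m - 1) ^ 2 * kcu (m - 1) = scal (inverse A_var ^ 6) * kcu 1"
proof -
  obtain k where k: "m = Suc (Suc k)" using assms by (intro that[of "m - 2"]) auto
  let ?C = "sg.up 1 (Suc k)" and ?q = "- (inverse A_var ^ 3)"
  have 1: "?C * kcu (Suc k) = scal ?q * (sg.up 1 k * kcu (Suc k))"
    by (simp add: sg.up_Suc mult.assoc sg_cu scal_left)
  have "?C ^ 2 * kcu (Suc k) = ?C * (?C * kcu (Suc k))" by (simp add: power2_eq_square mult.assoc)
  also have "\<dots> = scal ?q * ((?C * sg.up 1 k) * kcu (Suc k))" unfolding 1 by (simp only: scal_left mult.assoc)
  also have "?C * sg.up 1 k = sg.up 2 k * ?C" by (rule coxeter_slide_up) simp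
  also have "sg.up 2 k * ?C * kcu (Suc k) = sg.up 2 k * (?C * kcu (Suc k))" by (rule mult.assoc)
  also have "\<dots> = scal ?q * (sg.up 2 k * (sg.up 1 k * kcu (Suc k)))" unfolding 1 by (rule scal_left)
  also have "sg.up 2 k * (sg.up 1 k * kcu (Suc k)) = sg.up 2 k * sg.up 1 k * kcu (Suc k)" by (simp only: mult.assoc)
  also have "sg.up 2 k * sg.up 1 k * kcu (Suc k) = kcu 1" by (rule up_up_cu)
  also have "scal ?q * (scal ?q * kcu 1) = scal (?q * ?q) * kcu 1" by (simp only: scal_mult mult.assoc)
  also have "?q * ?q = inverse A_var ^ 6" by (simp add: power_add[symmetric])
  finally show ?thesis using k by simp
qed

text \<open>The \<open>m\<close> Coxeter elements split into \<open>m - 1 - i\<close> steps to the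
  right end, two steps around it, and \<open>i - 1\<close> steps back to \<open>i\<close>. All but
  the two at the end leave a Coxeter element on \<open>m - 2\<close> strands, and these
  \<open>m - 2\<close> elements again form a full twist.\<close>

lemma full_twist_cu:
  assumes "1 \<le> i" "i < m"
  shows "sg.up 1 (m - 1) ^ m * kcu i = scal (inverse A_var ^ 6) * (kcu i * sg.up 1 (m - 3) ^ (m - 2))"
proof -
  let ?C = "sg.up 1 (m - 1)" and ?D = "sg.up 1 (m - 3)"
  have m: "m = (i - 1) + (2 + (m - 1 - i))" using assms by simp
  have "?C ^ m = ?C ^ (i - 1) * (?C ^ 2 * ?C ^ (m - 1 - i))" by (subst (2) m) (simp only: power_add)
  then have "?C ^ m * kcu i = ?C ^ (i - 1) * (?C ^ 2 * (?C ^ (m - 1 - i) * kcu i))" by (simp only: mult.assoc)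
  also have "?C ^ (m - 1 - i) * kcu i = kcu (m - 1) * ?D ^ (m - 1 - i)"
    using coxeter_power_cu[of i "m - 1 - i" m] assms by simp
  also have "?C ^ (i - 1) * (?C ^ 2 * (kcu (m - 1) * ?D ^ (m - 1 - i))) = ?C ^ (i - 1) * (?C ^ 2 * kcu (m - 1)) * ?D ^ (m - 1 - i)"
    by (simp only: mult.assoc)
  also have "?C ^ 2 * kcu (m - 1) = scal (inverse A_var ^ 6) * kcu 1" by (rule coxeter_sq_cu) (use assms in simp)
  also have "?C ^ (i - 1) * (scal (inverse A_var ^ 6) * kcu 1) * ?D ^ (m - 1 - i) = scal (inverse A_var ^ 6) * ((?C ^ (i - 1) * kcu 1) * ?D ^ (m - 1 - i))"
    by (simp only: scal_left mult.assoc)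
  also have "?C ^ (i - 1) * kcu 1 = kcu i * ?D ^ (i - 1)"
    using coxeter_power_cu[of 1 "i - 1" m] assms by simp
  also have "kcu i * ?D ^ (i - 1) * ?D ^ (m - 1 - i) = kcu i * ?D ^ (m - 2)"
    using assms by (simp add: mult.assoc power_add[symmetric])
  finally show ?thesis .
qed

lemma inert_add: "inert k F \<Longrightarrow> inert k G \<Longrightarrow> inert k (F + G)" by (simp add: inert_def)
lemma inert_scal: "inert k (scal l)" by (simp add: inert_def)

lemma inert_jw: "d + a < k \<Longrightarrow> inert k (jw d a)"
  by (induction a) (auto intro!: inert_1 inert_add inert_mult inert_scal kauff.inert_U)

text \<open>The value is \<open>(-1) ^ a\<close> times the quantum integer \<open>[a + 1]\<close>,
  written so that the sum starts with 1. The three-term recursion is \<open>fusion_step\<close> for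
  the trivial braid on one strand.\<close>

lemma ktr_jw: "ktr a (jw 0 a) = (- (A_var ^ 2)) ^ a * (\<Sum>j\<le>a. t_var ^ j)"
proof (induction a rule: less_induct)
  case (less a)
  show ?case
  proof (cases a)
    case 0
    then show ?thesis by (simp add: Tr_def states_0 weight_def point_fun_def)
  next
    case (Suc a')
    have l: "ktr (Suc a') (jw 0 a') = loop_value * ktr a' (jw 0 a')"
      unfolding Tr_ptr1 by (simp add: Tr_def kauff.ptr1_inert[OF inert_jw] sum_distrib_left mult_ac)
    have orb: "orbit (perm []) 1 = {1}" by (auto simp: orbit_altdef)
    have "dec_colors (\<lambda>_. Suc a') {1} 1 = a' - 1" by (simp add: dec_colors_def)
    then have o: "offset (dec_colors (\<lambda>_. Suc a') {1}) (Suc 1) = a' - 1" "offset (dec_colors (\<lambda>_. Suc a') {1}) 1 = 0"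
      by (simp_all add: offset_def)
    have "ktr (offset (\<lambda>_. Suc a') (Suc 1)) (jw_prod ([] @ [(1, Suc a')]) (\<lambda>_. Suc a') * cable_op (\<lambda>_. Suc a') []) =
      ktr (offset (\<lambda>_. Suc a') (Suc 1)) (jw_prod ([] @ [(1, a')]) (\<lambda>_. Suc a') * cable_op (\<lambda>_. Suc a') []) -
      (if a' = 0 then 0 else ktr (offset (dec_colors (\<lambda>_. Suc a') (orbit (perm []) 1)) (Suc 1))
         (jw_prod ([] @ [(1, a' - 1)]) (dec_colors (\<lambda>_. Suc a') (orbit (perm []) 1)) * cable_op (dec_colors (\<lambda>_. Suc a') (orbit (perm []) 1)) []))"
      by (rule fusion_step) auto
    then have rec: "ktr (Suc a') (jw 0 (Suc a')) = ktr (Suc a') (jw 0 a') - (if a' = 0 then 0 else ktr (a' - 1) (jw 0 (a' - 1)))"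
      unfolding orb cable_op_Nil append_Nil jw_prod_simps mult_1_right o offset_const by (simp del: jw.simps)
    have A4: "A_var ^ 4 * t_var = 1" by (simp add: t_var_eq power_mult_distrib[symmetric])
    show ?thesis
    proof (cases a')
      case 0
      then show ?thesis using rec l less.IH[of 0] Suc by (simp add: loop_value_eq del: jw.simps)
    next
      case (Suc a'')
      have IH: "ktr a' (jw 0 a') = (- (A_var ^ 2)) ^ a' * (\<Sum>j\<le>a'. t_var ^ j)"
        "ktr a'' (jw 0 a'') = (- (A_var ^ 2)) ^ a'' * (\<Sum>j\<le>a''. t_var ^ j)"
        using less.IH[of a'] less.IH[of a''] \<open>a = Suc a'\<close> Suc by (simp_all del: jw.simps)
      have p: "(- (A_var ^ 2)) ^ a'' = (- (A_var ^ 2)) ^ Suc a' * t_var"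
      proof -
        have "(- (A_var ^ 2)) ^ Suc a' * t_var = (- (A_var ^ 2)) ^ a'' * (A_var ^ 4 * t_var)"
          unfolding Suc by (simp add: power_add[symmetric] mult_ac)
        then show ?thesis unfolding A4 by simp
      qed
      have "ktr (Suc a') (jw 0 (Suc a')) = (- (A_var ^ 2)) ^ Suc a' * ((1 + t_var) * (\<Sum>j\<le>a'. t_var ^ j) - t_var * (\<Sum>j\<le>a''. t_var ^ j))"
      proof -
        have alg: "(x * (1 + t)) * (y * u) - (x * y * t) * v = (x * y) * ((1 + t) * u - t * v)" for x t y u v :: ratfun
          by (simp add: algebra_simps)
        have "ktr (Suc a') (jw 0 (Suc a')) = ktr (Suc a') (jw 0 a') - ktr a'' (jw 0 a'')"
          unfolding rec using Suc by (simp del: jw.simps)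
        then show ?thesis unfolding l IH loop_value_eq p power_Suc alg .
      qed
      also have "(1 + t_var) * (\<Sum>j\<le>a'. t_var ^ j) - t_var * (\<Sum>j\<le>a''. t_var ^ j) = (\<Sum>j\<le>Suc a'. t_var ^ j)"
        unfolding Suc by (simp add: algebra_simps)
      finally show ?thesis using \<open>a = Suc a'\<close> by simp
    qed
  qed
qed

subsection \<open>The trace up to order \<open>t ^ (n * N + 1)\<close>\<close>

text \<open>Matrix entries between states \<open>x\<close> and \<open>y\<close> lie in the local ring up to a factor \<open>t_half\<close>, which is
  present iff the sum of the marked positions of \<open>x\<close> and \<open>y\<close> has the wrong parity. On the diagonal the
  two parities agree, so that no half-integral powers of \<open>t\<close> survive in the trace.\<close>

definition position_sum :: "nat \<Rightarrow> state \<Rightarrow> nat" where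
  "position_sum m x = (\<Sum>j\<in>{1..<Suc m}. if x j then j else 0)"

text \<open>Marked positions behind the deleted pair move by two, so only the deleted ones change
  the parity.\<close>

lemma position_sum_del:
  assumes "1 \<le> i" "i \<le> Suc m"
  shows "position_sum (m + 2) x mod 2 = (position_sum m (del i x) + (if x i then i else 0) + (if x (Suc i) then Suc i else 0)) mod 2"
proof -
  let ?f = "\<lambda>j. if x j then j else 0" and ?g = "\<lambda>j. if del i x j then j else 0"
  have "position_sum (m + 2) x = sum ?f {1..<i} + sum ?f {i..<m + 3}"
    unfolding position_sum_def using assms by (subst sum.atLeastLessThan_concat) (auto simp: numeral_3_eq_3)
  also have "sum ?f {i..<m + 3} = ?f i + (?f (Suc i) + sum ?f {i+2..<(Suc m)+2})"
    using assms by (subst sum.atLeast_Suc_lessThan, simp, subst sum.atLeast_Suc_lessThan) (auto simp: numeral_3_eq_3)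
  also have "sum ?f {i+2..<(Suc m)+2} = (\<Sum>j\<in>{i..<Suc m}. ?g j + 2 * (if del i x j then 1 else 0))"
    by (subst sum.shift_bounds_nat_ivl) (auto simp: del_def intro!: sum.cong)
  also have "\<dots> = sum ?g {i..<Suc m} + 2 * (\<Sum>j\<in>{i..<Suc m}. if del i x j then 1 else 0)"
    by (simp only: sum.distrib sum_distrib_left)
  also have "sum ?f {1..<i} = sum ?g {1..<i}"
    by (auto simp: del_def intro!: sum.cong)
  also have "sum ?g {1..<i} + (?f i + (?f (Suc i) + (sum ?g {i..<Suc m} + 2 * (\<Sum>j\<in>{i..<Suc m}. if del i x j then 1 else 0))))
    = (sum ?g {1..<i} + sum ?g {i..<Suc m}) + ?f i + ?f (Suc i) + 2 * (\<Sum>j\<in>{i..<Suc m}. if del i x j then 1 else 0)"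
    by (simp only: add_ac)
  also have "sum ?g {1..<i} + sum ?g {i..<Suc m} = position_sum m (del i x)"
    unfolding position_sum_def using assms by (subst sum.atLeastLessThan_concat) auto
  finally show ?thesis by simp
qed

definition graded :: "nat \<Rightarrow> ratfun \<Rightarrow> bool" where
  "graded k z \<longleftrightarrow> (\<exists>u. t_local u \<and> z = t_half ^ (k mod 2) * u)"

lemma graded_cong: "k mod 2 = l mod 2 \<Longrightarrow> graded k z \<longleftrightarrow> graded l z"
  by (simp add: graded_def)

lemma graded_0 [simp]: "graded k 0"
  unfolding graded_def by (rule exI[of _ 0]) simp

lemma graded_even: "even k \<Longrightarrow> graded k z \<longleftrightarrow> t_local z"
  by (simp add: graded_def even_iff_mod_2_eq_zero)

lemma graded_add: assumes "graded k z" "graded k w" shows "graded k (z + w)"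
proof -
  obtain u v where "t_local u" "z = t_half ^ (k mod 2) * u" "t_local v" "w = t_half ^ (k mod 2) * v"
    using assms by (auto simp: graded_def)
  then show ?thesis unfolding graded_def by (intro exI[of _ "u + v"]) (auto simp: t_local_add algebra_simps)
qed

lemma graded_uminus: "graded k z \<Longrightarrow> graded k (- z)"
  unfolding graded_def using t_local_uminus by (metis mult_minus_right)

lemma graded_sum: "(\<And>i. i \<in> I \<Longrightarrow> graded k (f i)) \<Longrightarrow> graded k (sum f I)"
  by (induction I rule: infinite_finite_induct) (auto intro: graded_add)

lemma graded_mult: assumes "graded k z" "graded l w" shows "graded (k + l) (z * w)"
proof -
  obtain u v where uv: "t_local u" "z = t_half ^ (k mod 2) * u" "t_local v" "w = t_half ^ (l mod 2) * v"
    using assms by (auto simp: graded_def)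
  have e: "z * w = t_half ^ (k mod 2 + l mod 2) * (u * v)" using uv by (simp add: power_add mult_ac)
  show ?thesis
  proof (cases "odd k \<and> odd l")
    case True
    then have "k mod 2 = 1" "l mod 2 = 1" "(k + l) mod 2 = 0" by presburger+
    then have "z * w = t_half ^ ((k + l) mod 2) * (t_var * (u * v))"
      using e by (simp add: t_var_half power2_eq_square mult.assoc)
    then show ?thesis unfolding graded_def using uv by (intro exI[of _ "t_var * (u * v)"]) (auto intro!: t_local_mult)
  next
    case False
    then have "k mod 2 + l mod 2 = (k + l) mod 2" by presburger
    then show ?thesis unfolding graded_def using uv e by (intro exI[of _ "u * v"]) (auto intro!: t_local_mult)
  qed
qed

text \<open>The shift \<open>e\<close> accounts for cups and caps, whose entries are graded only up
  to the parity of their index; for a cup and a cap at the same index the shifts cancel modulo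
  2.\<close>

definition graded_op :: "nat \<Rightarrow> nat \<Rightarrow> nat \<Rightarrow> ratfun linear_op \<Rightarrow> bool" where
  "graded_op m n e F \<longleftrightarrow> hom kauff_weight m n F \<and> (\<forall>x\<in>states n. \<forall>y\<in>states m. graded (position_sum n x + position_sum m y + e) (ap F (point_fun y) x))"

lemma graded_op_hom: "graded_op m n e F \<Longrightarrow> hom kauff_weight m n F"
  by (simp add: graded_op_def)

lemma graded_op_cong: "e mod 2 = e' mod 2 \<Longrightarrow> graded_op m n e F \<Longrightarrow> graded_op m n e' F"
  unfolding graded_op_def using graded_cong by (metis mod_add_right_eq)

lemma graded_op_add: "graded_op m n e F \<Longrightarrow> graded_op m n e G \<Longrightarrow> graded_op m n e (F + G)"
  by (auto simp: graded_op_def hom_add graded_add)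

lemma graded_op_uminus: "graded_op m n e F \<Longrightarrow> graded_op m n e (- F)"
  by (auto simp: graded_op_def hom_uminus graded_uminus)

lemma graded_op_0: "graded_op m n e 0"
  by (auto simp: graded_op_def hom_0)

lemma graded_op_mult:
  assumes G: "graded_op l m e G" and F: "graded_op m n e' F"
  shows "graded_op l n (e + e') (F * G)"
  unfolding graded_op_def
proof (intro conjI ballI)
  show "hom kauff_weight l n (F * G)" using assms by (auto simp: graded_op_def intro: hom_mult)
  fix x y assume x: "x \<in> states n" and y: "y \<in> states l"
  have "ap (F * G) (point_fun y) x = (\<Sum>z\<in>states m. ap G (point_fun y) z * ap F (point_fun z) x)"
    using hom_expand[OF graded_op_hom[OF F] x, of "ap G (point_fun y)"] by simp
  also have "graded (position_sum n x + position_sum l y + (e + e')) \<dots>"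
  proof (rule graded_sum)
    fix z assume z: "z \<in> states m"
    have "graded ((position_sum m z + position_sum l y + e) + (position_sum n x + position_sum m z + e')) (ap G (point_fun y) z * ap F (point_fun z) x)"
      by (rule graded_mult) (use F G x y z in \<open>auto simp: graded_op_def\<close>)
    moreover have "((position_sum m z + position_sum l y + e) + (position_sum n x + position_sum m z + e')) mod 2 = (position_sum n x + position_sum l y + (e + e')) mod 2"
      by presburger
    ultimately show "graded (position_sum n x + position_sum l y + (e + e')) (ap G (point_fun y) z * ap F (point_fun z) x)"
      using graded_cong by blast
  qed
  finally show "graded (position_sum n x + position_sum l y + (e + e')) (ap (F * G) (point_fun y) x)" .
qed

lemma graded_op_mult_even: "graded_op m m 0 F \<Longrightarrow> graded_op m m 0 G \<Longrightarrow> graded_op m m 0 (F * G)"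
  using graded_op_mult[of m m 0 G m 0 F] by simp

lemma graded_op_scal: "t_local k \<Longrightarrow> graded_op m m 0 (scal k)"
  by (auto simp: graded_op_def hom_scal point_fun_def graded_even)

lemma graded_op_1: "graded_op m m 0 1"
  using graded_op_scal[of 1] by simp

lemma graded_op_prod_list: "(\<And>F. F \<in> set Fs \<Longrightarrow> graded_op m m 0 F) \<Longrightarrow> graded_op m m 0 (prod_list Fs)"
  by (induction Fs) (auto intro: graded_op_1 graded_op_mult_even)

lemma graded_op_power: "graded_op m m 0 F \<Longrightarrow> graded_op m m 0 (F ^ k)"
  by (induction k) (auto intro: graded_op_1 graded_op_mult_even)

text \<open>Division by \<open>A\<close> leaves the entries \<open>1\<close>, \<open>-1\<close> and
  plus or minus \<open>t_half\<close>, which are regular at \<open>t = 0\<close>. A crossing becomes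
  \<open>A * (1 + norm_U i)\<close>, so all powers of \<open>A\<close> can be collected in
  front.\<close>

definition norm_cup :: "nat \<Rightarrow> ratfun linear_op" where "norm_cup i = scal (inverse A_var) * kcu i"
definition norm_cap :: "nat \<Rightarrow> ratfun linear_op" where "norm_cap i = scal (inverse A_var) * kca i"
definition norm_U :: "nat \<Rightarrow> ratfun linear_op" where "norm_U i = scal t_half * kU i"

lemma norm_U_eq: "norm_U i = norm_cup i * norm_cap i"
proof -
  have "norm_cup i * norm_cap i = scal (inverse A_var) * (kcu i * (scal (inverse A_var) * kca i))"
    by (simp only: norm_cup_def norm_cap_def mult.assoc)
  also have "kcu i * (scal (inverse A_var) * kca i) = scal (inverse A_var) * (kcu i * kca i)" by (rule scal_left)
  finally show ?thesis by (simp add: norm_U_def kauff.U_def t_half_eq power2_eq_square scal_mult mult.assoc)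
qed

lemma t_local_m1: "t_local (-1)" by (rule t_local_uminus) simp

lemma inverse_A_sq: "inverse A_var * inverse A_var = t_half"
  by (simp add: t_half_eq power2_eq_square)

lemma mod2_even: "p mod 2 = (q + c) mod 2 \<Longrightarrow> even (p + q + c)" "p mod 2 = (q + c) mod 2 \<Longrightarrow> even (q + p + c)"
  for p q c :: nat
  by presburger+
lemma mod2_odd: "p mod 2 = (q + c) mod 2 \<Longrightarrow> (p + q + Suc c) mod 2 = 1" "p mod 2 = (q + c) mod 2 \<Longrightarrow> (q + p + Suc c) mod 2 = 1"
  for p q c :: nat
  by presburger+

text \<open>The entry 1 marks position \<open>i + 1\<close> and the entry \<open>- t_half\<close>
  marks position \<open>i\<close>, so the parity of the marked positions predicts the half power;
  the shift \<open>Suc i\<close> makes the first case even.\<close>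

lemma graded_op_norm_cup:
  assumes "1 \<le> i" "i \<le> Suc m"
  shows "graded_op m (m + 2) (Suc i) (norm_cup i)"
  unfolding graded_op_def
proof (intro conjI ballI)
  show "hom kauff_weight m (m + 2) (norm_cup i)" unfolding norm_cup_def
    by (rule hom_mult[OF kauff.hom_cu[OF assms] hom_scal])
  fix x y assume "x \<in> states (m + 2)" "y \<in> states m"
  show "graded (position_sum (m + 2) x + position_sum m y + Suc i) (ap (norm_cup i) (point_fun y) x)"
  proof (cases "y = del i x")
    case False
    then show ?thesis by (simp add: norm_cup_def ap_cup point_fun_def)
  next
    case True
    have e: "ap (norm_cup i) (point_fun y) x = inverse A_var * kauff_cup (x i) (x (Suc i))"
      using True by (simp add: norm_cup_def ap_cup point_fun_def)
    consider "x i = x (Suc i)" | "\<not> x i" "x (Suc i)" | "x i" "\<not> x (Suc i)" by blast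
    then show ?thesis
    proof cases
      case 1
      then show ?thesis unfolding e by (simp add: kauff_cup_def)
    next
      case 2
      have v: "inverse A_var * kauff_cup (x i) (x (Suc i)) = 1" using 2 by (simp add: kauff_cup_def)
      have "position_sum (m + 2) x mod 2 = (position_sum m y + Suc i) mod 2" using position_sum_del[OF assms, of x] 2 True by simp
      then have "even (position_sum (m + 2) x + position_sum m y + Suc i)" by (rule mod2_even)
      then show ?thesis unfolding e v by (simp only: graded_even t_local_1)
    next
      case 3
      have v: "inverse A_var * kauff_cup (x i) (x (Suc i)) = t_half * (-1)"
        using 3 by (simp add: kauff_cup_def inverse_A_sq)
      have "position_sum (m + 2) x mod 2 = (position_sum m y + i) mod 2" using position_sum_del[OF assms, of x] 3 True by simp
      then have "(position_sum (m + 2) x + position_sum m y + Suc i) mod 2 = 1" by (rule mod2_odd)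
      then show ?thesis unfolding e v graded_def using t_local_m1 by (intro exI[of _ "-1"]) simp
    qed
  qed
qed

lemma graded_op_norm_cap:
  assumes "1 \<le> i" "i \<le> Suc m"
  shows "graded_op (m + 2) m (Suc i) (norm_cap i)"
  unfolding graded_op_def
proof (intro conjI ballI)
  show "hom kauff_weight (m + 2) m (norm_cap i)" unfolding norm_cap_def
    by (rule hom_mult[OF kauff.hom_ca[OF assms] hom_scal])
  fix x y assume "x \<in> states m" "y \<in> states (m + 2)"
  have e: "ap (norm_cap i) (point_fun y) x = inverse A_var * kauff_cap False True * point_fun y (ins i False True x)
      + inverse A_var * kauff_cap True False * point_fun y (ins i True False x)"
    by (simp add: norm_cap_def ap_cap sum_bool kauff_cap_def algebra_simps)
  have v1: "inverse A_var * kauff_cap False True = -1" by (simp add: kauff_cap_def)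
  have v2: "inverse A_var * kauff_cap True False = t_half * 1" by (simp add: kauff_cap_def inverse_A_sq)
  show "graded (position_sum m x + position_sum (m + 2) y + Suc i) (ap (norm_cap i) (point_fun y) x)"
    unfolding e v1 v2
  proof (rule graded_add)
    show "graded (position_sum m x + position_sum (m + 2) y + Suc i) (- 1 * point_fun y (ins i False True x))"
    proof (cases "ins i False True x = y")
      case True
      have "position_sum (m + 2) y mod 2 = (position_sum m x + Suc i) mod 2" using position_sum_del[OF assms, of y] True by auto
      then have "even (position_sum m x + position_sum (m + 2) y + Suc i)" by (rule mod2_even)
      then show ?thesis using True by (simp add: point_fun_def graded_even t_local_m1)
    qed (simp add: point_fun_def)
    show "graded (position_sum m x + position_sum (m + 2) y + Suc i) (t_half * 1 * point_fun y (ins i True False x))"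
    proof (cases "ins i True False x = y")
      case True
      have "position_sum (m + 2) y mod 2 = (position_sum m x + i) mod 2" using position_sum_del[OF assms, of y] True by auto
      then have "(position_sum m x + position_sum (m + 2) y + Suc i) mod 2 = 1" by (rule mod2_odd)
      then show ?thesis using True unfolding graded_def by (intro exI[of _ 1]) (simp add: point_fun_def)
    qed (simp add: point_fun_def)
  qed
qed

lemma graded_op_norm_U:
  assumes "1 \<le> i" "i < m" shows "graded_op m m 0 (norm_U i)"
proof -
  obtain k where k: "m = k + 2" using assms by (intro that[of "m - 2"]) auto
  have "graded_op (k + 2) (k + 2) (Suc i + Suc i) (norm_cup i * norm_cap i)"
    by (rule graded_op_mult[OF graded_op_norm_cap graded_op_norm_cup]) (use assms k in auto)
  then have "graded_op (k + 2) (k + 2) 0 (norm_cup i * norm_cap i)" by (rule graded_op_cong[rotated]) simp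
  then show ?thesis by (simp only: k norm_U_eq)
qed

definition norm_word :: "nat list \<Rightarrow> ratfun linear_op" where "norm_word h = prod_list (map (\<lambda>i. 1 + norm_U i) h)"

lemma graded_op_norm_word: "set h \<subseteq> {1..<m} \<Longrightarrow> graded_op m m 0 (norm_word h)"
  unfolding norm_word_def by (rule graded_op_prod_list) (force intro!: graded_op_add graded_op_1 graded_op_norm_U)

lemma sg_norm_U: "sg i = scal A_var * (1 + norm_U i)"
proof -
  have "A_var * t_half = inverse A_var" by (simp add: t_half_eq power2_eq_square A_inv)
  then have "scal A_var * norm_U i = scal (inverse A_var) * kU i"
    by (simp add: norm_U_def mult.assoc[symmetric] scal_mult[symmetric])
  then show ?thesis by (simp add: sg_eq distrib_left)
qed

lemma sg_W_norm_word: "sg.W h = scal (A_var ^ length h) * norm_word h"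
proof (induction h)
  case (Cons i h)
  have "sg.W (i # h) = sg i * (scal (A_var ^ length h) * norm_word h)" by (simp add: Cons)
  also have "\<dots> = scal (A_var ^ length h) * (sg i * norm_word h)" by (rule scal_left)
  also have "sg i * norm_word h = scal A_var * norm_word (i # h)" by (simp add: sg_norm_U norm_word_def mult.assoc)
  finally show ?case by (simp add: scal_mult[symmetric] mult.assoc[symmetric] mult.commute)
qed (simp add: norm_word_def)

lemma scal_power_mult: "(scal k * F) ^ j = scal (k ^ j) * F ^ j"
proof (induction j)
  case (Suc j)
  have "(scal k * F) ^ Suc j = scal k * (F * (scal (k ^ j) * F ^ j))" by (simp add: Suc mult.assoc)
  also have "F * (scal (k ^ j) * F ^ j) = scal (k ^ j) * (F * F ^ j)" by (rule scal_left)
  finally show ?case by (simp add: scal_mult mult.assoc)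
qed simp

lemma cable_op_const_W:
  assumes "set b \<subseteq> {1..<n}"
  shows "\<exists>h. set h \<subseteq> {1..<n * N} \<and> length h = N\<^sup>2 * length b \<and> cable_op (\<lambda>_. N) b = sg.W h"
  using assms
proof (induction b)
  case (Cons k b)
  then obtain h where h: "set h \<subseteq> {1..<n * N}" "length h = N\<^sup>2 * length b" "cable_op (\<lambda>_. N) b = sg.W h" by auto
  let ?B = "block_crossing ((k - 1) * N) N N"
  have len: "length (block_crossing d a c) = a * c" for d a c
    by (induction c) (auto simp: block_crossing_def upt_Suc)
  obtain k' where k': "k = Suc k'" using Cons.prems by (cases k) auto
  have "k' + 2 \<le> n" using Cons.prems k' by simp
  then have "(k' + 2) * N \<le> n * N" by (rule mult_le_mono1)
  then have "(k - 1) * N + N + N \<le> n * N" using k' by (simp add: algebra_simps)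
  then have "set ?B \<subseteq> {1..<n * N}" using set_block_crossing[of "(k - 1) * N" N N] by fastforce
  moreover have "cable_op (\<lambda>_. N) (k # b) = sg.W (?B @ h)"
    unfolding cable_op_Cons sg.W_simps sg.W_block h(3)[symmetric] by (simp add: offset_const comp_def)
  ultimately show ?case using h len[of "(k - 1) * N" N N]
    by (intro exI[of _ "?B @ h"]) (auto simp: power2_eq_square algebra_simps)
qed (auto intro!: exI[of _ "[]"])

definition norm_coeff :: "nat \<Rightarrow> ratfun" where "norm_coeff a = (1 - t_var ^ a) / (1 - t_var ^ Suc a)"

lemma t_local_norm_coeff: "t_local (norm_coeff a)"
proof -
  have "norm_coeff a = (1 - t_var ^ a) * (1 / (1 - t_var ^ Suc a))" by (simp add: norm_coeff_def)
  moreover have "t_local \<dots>"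
    by (rule t_local_mult[OF t_local_diff[OF t_local_1 t_local_power[OF t_local_t]] t_local_inverse])
  ultimately show ?thesis by simp
qed

lemma jw_Suc_norm_U: "jw d (Suc a) = jw d a + scal (norm_coeff a) * (jw d a * norm_U (d + a) * jw d a)"
proof -
  have "jw_coeff a = norm_coeff a * t_half" by (simp add: jw_coeff_def norm_coeff_def)
  moreover have "jw d a * norm_U (d + a) * jw d a = scal t_half * (jw d a * kU (d + a) * jw d a)"
    unfolding norm_U_def scal_left by (simp only: mult.assoc)
  ultimately show ?thesis by (simp add: scal_mult mult.assoc)
qed

lemma graded_op_jw: "d + a \<le> m \<Longrightarrow> graded_op m m 0 (jw d a)"
proof (induction a)
  case (Suc a)
  then have J: "graded_op m m 0 (jw d a)" by simp
  show ?case
  proof (cases "d + a = 0")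
    case True
    then show ?thesis using J by simp
  next
    case False
    then have "graded_op m m 0 (norm_U (d + a))" using Suc.prems by (intro graded_op_norm_U) auto
    then show ?thesis unfolding jw_Suc_norm_U using J
      by (intro graded_op_add graded_op_mult_even graded_op_scal t_local_norm_coeff)
  qed
qed (simp add: graded_op_1)

text \<open>The hooks have to stand on the left, where the full twist meets their cups. In the step
  the new projector is \<open>?J + ?J * Z\<close> with \<open>Z\<close> beginning in the new hook,
  and \<open>?J * Z\<close> is rewritten by the expansion of 1 already obtained, so that every
  correction term again begins with a hook.\<close>

lemma jw_expand:
  "a \<le> m \<Longrightarrow> \<exists>X. (\<forall>i. graded_op m m 0 (X i)) \<and> 1 = jw 0 a + (\<Sum>i\<in>{1..<a}. norm_U i * X i)"
proof (induction a)
  case 0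
  show ?case by (rule exI[of _ "\<lambda>_. 0"]) (simp add: graded_op_0)
next
  case (Suc a)
  then obtain X where X: "\<And>i. graded_op m m 0 (X i)" "1 = jw 0 a + (\<Sum>i\<in>{1..<a}. norm_U i * X i)" by auto
  show ?case
  proof (cases "a = 0")
    case True
    then show ?thesis by (intro exI[of _ "\<lambda>_. 0"]) (simp add: graded_op_0)
  next
    case False
    let ?J = "jw 0 a" and ?E = "norm_U a"
    define Z where "Z = scal (norm_coeff a) * (?E * ?J)"
    have Z: "graded_op m m 0 Z" unfolding Z_def using False Suc.prems
      by (intro graded_op_mult_even graded_op_scal t_local_norm_coeff graded_op_norm_U graded_op_jw) auto
    have Jz: "jw 0 (Suc a) = ?J + ?J * Z"
      unfolding jw_Suc_norm_U Z_def scal_left[of ?J] by (simp add: mult.assoc)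
    have "Z = ?J * Z + (\<Sum>i\<in>{1..<a}. norm_U i * X i) * Z"
      using arg_cong[OF X(2), of "\<lambda>F. F * Z"] by (simp add: distrib_right)
    then have JZ: "?J * Z = Z - (\<Sum>i\<in>{1..<a}. norm_U i * (X i * Z))"
      by (simp add: sum_distrib_right mult.assoc eq_diff_eq)
    define X' where "X' i = (if i = a then - (scal (norm_coeff a) * ?J) else X i + X i * Z)" for i
    have "graded_op m m 0 (X' i)" for i
      unfolding X'_def using X(1) Z Suc.prems
      by (auto intro!: graded_op_add graded_op_mult_even graded_op_uminus graded_op_scal t_local_norm_coeff graded_op_jw)
    moreover have "1 = jw 0 (Suc a) + (\<Sum>i\<in>{1..<Suc a}. norm_U i * X' i)"
    proof -
      have "(\<Sum>i\<in>{1..<Suc a}. norm_U i * X' i) = (\<Sum>i\<in>{1..<a}. norm_U i * X' i) + norm_U a * X' a"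
        using False by simp
      also have "(\<Sum>i\<in>{1..<a}. norm_U i * X' i) = (\<Sum>i\<in>{1..<a}. norm_U i * X i) + (\<Sum>i\<in>{1..<a}. norm_U i * (X i * Z))"
        unfolding sum.distrib[symmetric] by (rule sum.cong) (auto simp: X'_def distrib_left)
      also have "norm_U a * X' a = - Z" by (simp add: X'_def Z_def scal_left)
      finally have s: "(\<Sum>i\<in>{1..<Suc a}. norm_U i * X' i) = (\<Sum>i\<in>{1..<a}. norm_U i * X i) + (\<Sum>i\<in>{1..<a}. norm_U i * (X i * Z)) + - Z" .
      show ?thesis unfolding s Jz JZ by (subst X(2)) (simp add: algebra_simps)
    qed
    ultimately show ?thesis by blast
  qed
qed

lemma weight_kauff_weight: "weight kauff_weight m x = (- (A_var ^ 2)) ^ m * t_var ^ card {i\<in>{1..m}. x i}"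
proof -
  have "weight kauff_weight m x = (\<Prod>i=1..m. - (A_var ^ 2)) * (\<Prod>i=1..m. if x i then t_var else 1)"
    unfolding weight_def kauff_weight_def by (rule prod.distrib)
  also have "(\<Prod>i=1..m. if x i then t_var else 1) = t_var ^ card {i\<in>{1..m}. x i}"
    by (subst prod.If_cases) (auto simp: Int_def conj_commute)
  finally show ?thesis by simp
qed

text \<open>Up to the unit in front, a state has weight \<open>t\<close> to the number of its marked
  positions. The empty state is excluded by the vanishing entry, so one factor \<open>t\<close>
  splits off; diagonal entries lie in the local ring because the parity of a state is counted
  twice.\<close>

lemma graded_op_trace:
  assumes F: "graded_op m m 0 F" and z: "ap F (point_fun (\<lambda>_. False)) (\<lambda>_. False) = 0"
  shows "\<exists>y. t_local y \<and> ktr m F = (- (A_var ^ 2)) ^ m * (t_var * y)"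
proof -
  define f where "f x = (if x = (\<lambda>_. False) then 0 else t_var ^ (card {i\<in>{1..m}. x i} - 1) * ap F (point_fun x) x)" for x
  have "t_local (f x)" if "x \<in> states m" for x
  proof -
    have "graded (position_sum m x + position_sum m x + 0) (ap F (point_fun x) x)" using F that by (auto simp: graded_op_def)
    then have "t_local (ap F (point_fun x) x)" by (subst (asm) graded_even) auto
    then show ?thesis by (auto simp: f_def intro!: t_local_mult t_local_power)
  qed
  moreover have "weight kauff_weight m x * ap F (point_fun x) x = (- (A_var ^ 2)) ^ m * (t_var * f x)" if x: "x \<in> states m" for x
  proof (cases "x = (\<lambda>_. False)")
    case True
    then show ?thesis using z by (simp add: f_def)
  next
    case False
    then obtain i where "x i" by auto
    then have "i \<in> {i\<in>{1..m}. x i}" using x by (auto simp: states_def)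
    then have "card {i\<in>{1..m}. x i} > 0" by (subst card_gt_0_iff) auto
    then obtain k where "card {i\<in>{1..m}. x i} = Suc k" using gr0_implies_Suc by blast
    then have "t_var ^ card {i\<in>{1..m}. x i} = t_var * t_var ^ (card {i\<in>{1..m}. x i} - 1)"
      by (simp only: power_Suc diff_Suc_1)
    then show ?thesis unfolding weight_kauff_weight using False by (simp add: f_def mult_ac)
  qed
  ultimately show ?thesis unfolding Tr_def
    by (intro exI[of _ "\<Sum>x\<in>states m. f x"]) (auto simp: sum_distrib_left intro!: t_local_sum)
qed


lemma jw_absorb_jw: "d + a \<le> m \<Longrightarrow> jw 0 m * jw d a = jw 0 m"
  by (rule jw_absorb_right) (use jw_U_zero[of _ m 0] in simp)

lemma block_le: "1 \<le> i \<Longrightarrow> i \<le> n \<Longrightarrow> (i - 1) * N + N \<le> n * N" for i n N :: nat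
  using mult_le_mono1[of i n N] by (cases i) simp_all

lemma jw_absorb_jw_cells: "set L \<subseteq> {1..n} \<Longrightarrow> jw 0 (n * N) * jw_cells N L = jw 0 (n * N)"
proof (induction L)
  case (Cons i L)
  have "jw 0 (n * N) * jw_cell N i = jw 0 (n * N)"
    unfolding jw_cell_def by (rule jw_absorb_jw) (rule block_le; use Cons.prems in auto)
  then show ?case using Cons by (simp add: mult.assoc[symmetric])
qed simp

lemma graded_op_jw_cells: "set L \<subseteq> {1..n} \<Longrightarrow> graded_op (n * N) (n * N) 0 (jw_cells N L)"
proof (induction L)
  case (Cons i L)
  have "graded_op (n * N) (n * N) 0 (jw_cell N i)"
    unfolding jw_cell_def by (rule graded_op_jw) (rule block_le; use Cons.prems in auto)
  then show ?case using Cons by (auto intro: graded_op_mult_even)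
qed (simp add: graded_op_1)

text \<open>The scalar rests on \<open>(m - 1) * m + 6 = (m - 3) * (m - 2) + 4 * m\<close>: the 6 is
  due to the two kinks, \<open>(m - 3) * (m - 2)\<close> counts the crossings of the smaller full
  twist, and \<open>4 * m\<close> powers of \<open>1/A\<close> make \<open>t ^ m\<close>.\<close>

lemma full_twist_norm_U:
  assumes "1 \<le> i" "i < m"
  shows "sg.up 1 (m - 1) ^ m * norm_U i =
    scal (A_var ^ ((m - 1) * m) * t_var ^ m) * (norm_cup i * norm_word [1..<1 + (m - 3)] ^ (m - 2) * norm_cap i)"
proof -
  let ?C = "sg.up 1 (m - 1)" and ?g = "norm_word [1..<1 + (m - 3)] ^ (m - 2)"
  let ?q = "inverse A_var ^ 6" and ?r = "(A_var ^ (m - 3)) ^ (m - 2)"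
  have D: "sg.up 1 (m - 3) ^ (m - 2) = scal ?r * ?g"
    unfolding sg.up_def sg_W_norm_word scal_power_mult by simp
  have "?C ^ m * kcu i = scal ?q * (kcu i * (scal ?r * ?g))"
    unfolding full_twist_cu[OF assms] D ..
  also have "kcu i * (scal ?r * ?g) = scal ?r * (kcu i * ?g)" by (rule scal_left)
  finally have 1: "?C ^ m * kcu i = scal (?q * ?r) * (kcu i * ?g)" by (simp only: scal_mult mult.assoc)
  have "?C ^ m * norm_cup i = scal (inverse A_var) * (?C ^ m * kcu i)" unfolding norm_cup_def by (rule scal_left)
  also have "\<dots> = scal (inverse A_var * (?q * ?r)) * (kcu i * ?g)" unfolding 1 by (simp only: scal_mult mult.assoc)
  also have "inverse A_var * (?q * ?r) = (?q * ?r) * inverse A_var" by (rule mult.commute)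
  also have "scal ((?q * ?r) * inverse A_var) * (kcu i * ?g) = scal (?q * ?r) * (norm_cup i * ?g)"
    unfolding norm_cup_def scal_mult[of "?q * ?r" "inverse A_var"] by (simp only: mult.assoc)
  finally have 2: "?C ^ m * norm_cup i = scal (?q * ?r) * (norm_cup i * ?g)" .
  have "?q * ?r = A_var ^ ((m - 1) * m) * t_var ^ m"
  proof -
    obtain k where k: "m = k + 2" using assms by (intro that[of "m - 2"]) auto
    \<comment> \<open>For \<open>m = 2\<close> the truncated \<open>m - 3\<close> is multiplied by
      \<open>m - 2 = 0\<close>, so the identity holds there too.\<close>
    have e: "(m - 1) * m + 6 = (m - 3) * (m - 2) + 4 * m"
      unfolding k by (cases k) (simp_all add: algebra_simps)
    have "A_var ^ ((m - 1) * m + 6) * t_var ^ m = ?r"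
      unfolding e by (simp add: power_add t_var_eq power_mult power_mult_distrib[symmetric] mult.assoc)
    then have "(A_var ^ ((m - 1) * m) * t_var ^ m) * A_var ^ 6 = ?r" by (simp add: power_add mult_ac)
    then have "?q * ?r = (A_var ^ ((m - 1) * m) * t_var ^ m) * (A_var ^ 6 * ?q)" by (simp add: mult_ac)
    then show ?thesis by (simp add: power_mult_distrib[symmetric])
  qed
  then show ?thesis unfolding norm_U_eq mult.assoc[symmetric] 2 by (simp only: mult.assoc)
qed

text \<open>After cyclic rotation the identity is inserted behind the full twist in the form of
  \<open>jw_expand\<close>. The summand with \<open>?J\<close> absorbs the braid and the projectors
  and leaves the trace of \<open>?J\<close>; the others carry \<open>t ^ m\<close> from
  \<open>full_twist_norm_U\<close> and one more \<open>t\<close> from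
  \<open>graded_op_trace\<close>.\<close>

lemma projected_trace_estimate:
  assumes n: "n \<ge> 1" and hb: "set b \<subseteq> {1..<n}"
  shows "\<exists>y. t_local y \<and> ktr (n * N) (jw_cells N [1..<Suc n] * cable_op (\<lambda>_. N) (concat (replicate n [1..<n]) @ b)) =
    A_var ^ (N\<^sup>2 * (n * (n - 1) + length b)) * ((- (A_var ^ 2)) ^ (n * N) * ((\<Sum>j\<le>n * N. t_var ^ j) + t_var ^ (n * N + 1) * y))"
proof -
  define m where "m = n * N"
  let ?P = "jw_cells N [1..<Suc n]" and ?Y = "cable_op (\<lambda>_. N) [1..<n]" and ?G = "cable_op (\<lambda>_. N) b"
  let ?C = "sg.up 1 (m - 1)" and ?J = "jw 0 m"
  define T where "T = ktr m (?P * cable_op (\<lambda>_. N) (concat (replicate n [1..<n]) @ b))"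
  have s: "set [1..<Suc n] \<subseteq> {1..n}" by auto
  have hP: "hom kauff_weight m m ?P" unfolding m_def by (rule hom_jw_cells[OF s])
  have hG: "hom kauff_weight m m ?G" unfolding m_def by (rule hom_cable_op_const[OF hb])
  obtain h where h: "set h \<subseteq> {1..<m}" "length h = N\<^sup>2 * length b" "?G = sg.W h"
    using cable_op_const_W[OF hb, of N] unfolding m_def by blast
  let ?L = "A_var ^ (N\<^sup>2 * length b)"
  have G: "?G = scal ?L * norm_word h" unfolding h(3) sg_W_norm_word h(2) ..
  have "hom kauff_weight m m (sg i)" if "1 \<le> i" "i < m" for i
    unfolding sg_eq by (intro hom_add hom_scal hom_mult[OF kauff.hom_U[OF that] hom_scal])
  then have hC: "hom kauff_weight m m (?C ^ m)"
    unfolding sg.up_def sg.W_def by (intro hom_power hom_prod_list) auto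
  have "scal (A_var ^ ((N - 1) * m)) * (?P * cable_op (\<lambda>_. N) (concat (replicate n [1..<n]) @ b))
      = (scal (A_var ^ ((N - 1) * m)) * (?P * ?Y ^ n)) * ?G"
    unfolding cable_op_append_const cable_op_full_twist by (simp only: mult.assoc)
  also have "\<dots> = ?P * (?C ^ m * ?G)"
    using jw_cells_full_twist[OF n, of N] by (simp only: m_def mult.assoc)
  finally have "A_var ^ ((N - 1) * m) * T = ktr m (?P * (?C ^ m * ?G))"
    unfolding T_def by (metis Tr_scal)
  also have "\<dots> = ktr m ((?C ^ m * ?G) * ?P)" by (rule Tr_comm[OF hP hom_mult[OF hG hC], symmetric, THEN sym])
  finally have T1: "A_var ^ ((N - 1) * m) * T = ktr m ((?C ^ m * ?G) * ?P)" .
  obtain X where X: "\<And>i. graded_op m m 0 (X i)" "1 = ?J + (\<Sum>i\<in>{1..<m}. norm_U i * X i)"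
    using jw_expand[of m m] by blast
  define R where "R i = norm_cup i * norm_word [1..<1 + (m - 3)] ^ (m - 2) * norm_cap i * (X i * (norm_word h * ?P))" for i
  have "(?C ^ m * ?G) * ?P = ?C ^ m * (1 * (?G * ?P))" by (simp add: mult.assoc)
  also have "\<dots> = ?C ^ m * ?J * (?G * ?P) + (\<Sum>i\<in>{1..<m}. ?C ^ m * norm_U i * (X i * (?G * ?P)))"
    by (subst X(2)) (simp add: distrib_left distrib_right sum_distrib_left sum_distrib_right mult.assoc)
  also have "?C ^ m * ?J * (?G * ?P) = scal (A_var ^ ((m - 1) * m) * ?L) * ?J"
  proof -
    have "?C * ?J = scal (A_var ^ length [1..<1 + (m - 1)]) * ?J"
      unfolding sg.up_def
    proof (rule W_eigen_left)
      fix j assume "j \<in> set [1..<1 + (m - 1)]"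
      then have "1 \<le> j" "j < m" by auto
      then show "sg j * ?J = scal A_var * ?J" using kU_jw_sg[of j m 0] by simp
    qed
    then have CJ: "?C ^ m * ?J = scal ((A_var ^ (m - 1)) ^ m) * ?J" by (intro power_eigen_left) simp
    have "?J * sg.W h = scal (A_var ^ length h) * ?J"
    proof (rule W_eigen_right)
      fix j assume "j \<in> set h"
      then show "?J * sg j = scal A_var * ?J" using jw_sg[of j m 0] h(1) by auto
    qed
    then have JG: "?J * ?G = scal ?L * ?J" by (simp only: h)
    have JP: "?J * ?P = ?J" unfolding m_def by (rule jw_absorb_jw_cells[OF s])
    have "?C ^ m * ?J * (?G * ?P) = scal ((A_var ^ (m - 1)) ^ m) * ((?J * ?G) * ?P)"
      unfolding CJ by (simp only: mult.assoc)
    also have "\<dots> = scal ((A_var ^ (m - 1)) ^ m) * (scal ?L * ?J)" unfolding JG mult.assoc JP ..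
    finally show ?thesis by (simp only: scal_mult mult.assoc power_mult)
  qed
  also have "(\<Sum>i\<in>{1..<m}. ?C ^ m * norm_U i * (X i * (?G * ?P))) =
      (\<Sum>i\<in>{1..<m}. scal (A_var ^ ((m - 1) * m) * t_var ^ m * ?L) * R i)"
  proof (rule sum.cong[OF refl])
    fix i assume i: "i \<in> {1..<m}"
    have XG: "X i * (?G * ?P) = scal ?L * (X i * (norm_word h * ?P))"
      unfolding G mult.assoc by (rule scal_left)
    have "?C ^ m * norm_U i * (X i * (?G * ?P)) = scal (A_var ^ ((m - 1) * m) * t_var ^ m) *
        ((norm_cup i * norm_word [1..<1 + (m - 3)] ^ (m - 2) * norm_cap i) * (scal ?L * (X i * (norm_word h * ?P))))"
      using full_twist_norm_U[of i m] i unfolding XG by (simp only: atLeastLessThan_iff mult.assoc)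
    also have "(norm_cup i * norm_word [1..<1 + (m - 3)] ^ (m - 2) * norm_cap i) * (scal ?L * (X i * (norm_word h * ?P))) = scal ?L * R i"
      unfolding R_def by (rule scal_left)
    finally show "?C ^ m * norm_U i * (X i * (?G * ?P)) = scal (A_var ^ ((m - 1) * m) * t_var ^ m * ?L) * R i"
      by (simp only: scal_mult mult.assoc)
  qed
  finally have exp: "(?C ^ m * ?G) * ?P = scal (A_var ^ ((m - 1) * m) * ?L) * ?J +
      (\<Sum>i\<in>{1..<m}. scal (A_var ^ ((m - 1) * m) * t_var ^ m * ?L) * R i)" .
  have "\<exists>y. t_local y \<and> ktr m (R i) = (- (A_var ^ 2)) ^ m * (t_var * y)" if i: "i \<in> {1..<m}" for i
  proof (rule graded_op_trace)
    obtain k where k: "m = k + 2" using i by (intro that[of "m - 2"]) auto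
    have "graded_op (k + 2) (k + 2) (Suc i + Suc i) (norm_cup i * norm_word [1..<1 + (m - 3)] ^ (m - 2) * norm_cap i)"
    proof (rule graded_op_mult[OF graded_op_norm_cap])
      have "graded_op k k 0 (norm_word [1..<1 + (m - 3)] ^ (m - 2))"
        by (intro graded_op_power graded_op_norm_word) (use k in auto)
      then show "graded_op k (k + 2) (Suc i) (norm_cup i * norm_word [1..<1 + (m - 3)] ^ (m - 2))"
        using graded_op_mult[of k k 0 _ "k + 2" "Suc i" "norm_cup i"] graded_op_norm_cup[of i k] i k by simp
    qed (use i k in auto)
    then have g0: "graded_op m m 0 (norm_cup i * norm_word [1..<1 + (m - 3)] ^ (m - 2) * norm_cap i)"
      unfolding k by (rule graded_op_cong[rotated]) simp
    have gP: "graded_op m m 0 ?P" unfolding m_def by (rule graded_op_jw_cells[OF s])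
    show "graded_op m m 0 (R i)"
      unfolding R_def
      by (rule graded_op_mult_even[OF g0 graded_op_mult_even[OF X(1) graded_op_mult_even[OF graded_op_norm_word[OF h(1)] gP]]])
    \<comment> \<open>\<open>R i\<close> begins with a cup, whose entry at two equal signs is
      zero.\<close>
    show "ap (R i) (point_fun (\<lambda>_. False)) (\<lambda>_. False) = 0"
      unfolding R_def norm_cup_def mult.assoc by (simp add: ap_cup kauff_cup_def)
  qed
  then obtain y where y: "\<And>i. i \<in> {1..<m} \<Longrightarrow> t_local (y i)"
    "\<And>i. i \<in> {1..<m} \<Longrightarrow> ktr m (R i) = (- (A_var ^ 2)) ^ m * (t_var * y i)" by metis
  define q where "q = (A_var ^ ((m - 1) * m) * ?L) * (- (A_var ^ 2)) ^ m"
  have "A_var ^ ((N - 1) * m) * T = A_var ^ ((m - 1) * m) * ?L * ktr m ?J + (\<Sum>i\<in>{1..<m}. A_var ^ ((m - 1) * m) * t_var ^ m * ?L * ktr m (R i))"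
    unfolding T1 exp Tr_add Tr_sum Tr_scal ..
  also have "A_var ^ ((m - 1) * m) * ?L * ktr m ?J = q * (\<Sum>j\<le>m. t_var ^ j)"
    unfolding ktr_jw q_def by (simp only: mult.assoc)
  also have "(\<Sum>i\<in>{1..<m}. A_var ^ ((m - 1) * m) * t_var ^ m * ?L * ktr m (R i)) = (\<Sum>i\<in>{1..<m}. q * (t_var ^ (m + 1) * y i))"
    by (rule sum.cong[OF refl]) (simp add: y(2) q_def mult_ac)
  also have "\<dots> = q * (t_var ^ (m + 1) * (\<Sum>i\<in>{1..<m}. y i))" by (simp only: sum_distrib_left)
  finally have fin: "A_var ^ ((N - 1) * m) * T = q * ((\<Sum>j\<le>m. t_var ^ j) + t_var ^ (m + 1) * (\<Sum>i\<in>{1..<m}. y i))"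
    by (simp only: distrib_left)
  \<comment> \<open>The crossings of the full twist on \<open>m\<close> strands are those inside the
    cells, \<open>(N - 1) * m\<close>, and those of the cabled full twist; so the auxiliary power
    \<open>A ^ ((N - 1) * m)\<close> cancels.\<close>
  have "(m - 1) * m = (N - 1) * m + N\<^sup>2 * (n * (n - 1))"
  proof (cases "N = 0")
    case False
    obtain n' where n': "n = Suc n'" using n by (cases n) auto
    obtain N' where N': "N = Suc N'" using False by (cases N) auto
    have "m - 1 = (N - 1) + n' * N" by (simp add: m_def n' N')
    then have "(m - 1) * m = (N - 1) * m + n' * N * m" by (simp add: distrib_right)
    moreover have "n' * N * m = N\<^sup>2 * (n * (n - 1))"
      by (simp add: m_def n' power2_eq_square algebra_simps)
    ultimately show ?thesis by simp
  qed (simp add: m_def)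
  then have "A_var ^ ((m - 1) * m) * ?L = A_var ^ ((N - 1) * m) * A_var ^ (N\<^sup>2 * (n * (n - 1) + length b))"
    by (simp only: power_add distrib_left mult.assoc)
  then have "A_var ^ ((N - 1) * m) * T = A_var ^ ((N - 1) * m) * (A_var ^ (N\<^sup>2 * (n * (n - 1) + length b)) *
      ((- (A_var ^ 2)) ^ m * ((\<Sum>j\<le>m. t_var ^ j) + t_var ^ (m + 1) * (\<Sum>i\<in>{1..<m}. y i))))"
    unfolding fin q_def by (simp only: mult.assoc)
  then have "T = A_var ^ (N\<^sup>2 * (n * (n - 1) + length b)) *
      ((- (A_var ^ 2)) ^ m * ((\<Sum>j\<le>m. t_var ^ j) + t_var ^ (m + 1) * (\<Sum>i\<in>{1..<m}. y i)))"
    by simp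
  moreover have "t_local (\<Sum>i\<in>{1..<m}. y i)" by (rule t_local_sum) (rule y(1))
  ultimately show ?thesis unfolding T_def m_def by blast
qed

subsection \<open>A Laurent basis of the image of the projectors\<close>

lemma ca_jw: "1 \<le> j \<Longrightarrow> j < a \<Longrightarrow> kca (d + j) * jw d a = 0"
proof -
  assume "1 \<le> j" "j < a"
  then have z: "kU (d + j) * jw d a = 0" by (rule U_jw)
  have "kca (Suc (d + j)) * kU (d + j) = kca (d + j)"
    by (simp add: kauff.U_def mult.assoc[symmetric] kauff.ca_cu_Suc)
  then have "kca (d + j) * jw d a = kca (Suc (d + j)) * (kU (d + j) * jw d a)" by (simp add: mult.assoc[symmetric])
  then show ?thesis by (simp add: z)
qed

text \<open>A cell consists of the \<open>N\<close> parallel strands of one strand of the braid. A vector in the image of the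
  projectors is determined by its values on the states that are sorted in each cell, because
  exchanging two adjacent signs in a cell multiplies the value by a power of \<open>t_half\<close>.\<close>

definition same_cell :: "nat \<Rightarrow> nat \<Rightarrow> bool" where
  "same_cell N i \<longleftrightarrow> 1 \<le> i \<and> (i - 1) div N = i div N"

lemma innerI: "1 \<le> j \<Longrightarrow> j < N \<Longrightarrow> same_cell N (k * N + j)"
proof -
  assume "1 \<le> j" "j < N"
  then obtain q where q: "j = Suc q" "Suc q < N" by (cases j) auto
  have "(k * N + q) div N = k" using q by simp
  moreover have "(k * N + j) div N = k" using \<open>j < N\<close> by simp
  moreover have "k * N + j - 1 = k * N + q" using q by simp
  ultimately show ?thesis using \<open>1 \<le> j\<close> unfolding same_cell_def by simp
qed

definition cell_count :: "nat \<Rightarrow> nat \<Rightarrow> state \<Rightarrow> nat \<Rightarrow> nat" where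
  "cell_count N m x k = card {j\<in>{1..m}. (j - 1) div N = k \<and> x j}"

text \<open>Within each cell the marked positions are moved to the front; their number is
  kept.\<close>

definition cell_sort :: "nat \<Rightarrow> nat \<Rightarrow> state \<Rightarrow> state" where
  "cell_sort N m x i \<longleftrightarrow> i \<in> {1..m} \<and> (i - 1) mod N < cell_count N m x ((i - 1) div N)"

lemma cell_sort_states: "cell_sort N m x \<in> states m"
  by (auto simp: states_def cell_sort_def)

lemma downward_closed:
  assumes "finite D" "\<And>p. Suc p \<in> D \<Longrightarrow> p \<in> D"
  shows "D = {..<card D}"
proof -
  define k where "k = (LEAST p. p \<notin> D)"
  have ex: "\<exists>p. p \<notin> D" using assms(1) by (meson ex_new_if_finite infinite_UNIV_nat)
  have k: "k \<notin> D" unfolding k_def by (rule LeastI_ex[OF ex])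
  have lt: "p \<in> D" if "p < k" for p using that not_less_Least unfolding k_def by blast
  have ge: "k + l \<notin> D" for l
    by (induction l) (use k assms(2) in auto)
  have "D = {..<k}"
  proof (intro equalityI subsetI)
    fix p assume "p \<in> D"
    then show "p \<in> {..<k}" using ge[of "p - k"] by (cases "p < k") auto
  qed (use lt in auto)
  then show ?thesis by (metis card_lessThan)
qed

lemma cell_sort_sorted:
  assumes N: "N \<ge> 1" and x: "x \<in> states (n * N)"
    and no: "\<And>i. same_cell N i \<Longrightarrow> i < n * N \<Longrightarrow> x (Suc i) \<Longrightarrow> x i"
  shows "cell_sort N (n * N) x = x"
proof
  fix i
  show "cell_sort N (n * N) x i = x i"
  proof (cases "i \<in> {1..n * N}")
    case False
    then show ?thesis using x by (auto simp: cell_sort_def states_def)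
  next
    case True
    define k where "k = (i - 1) div N"
    have "i - 1 < n * N" using True by auto
    then have "k < n" unfolding k_def by (simp add: less_mult_imp_div_less)
    then have le: "k * N + N \<le> n * N" using mult_le_mono1[of "Suc k" n N] by simp
    define D where "D = {p. p < N \<and> x (k * N + p + 1)}"
    have fin: "finite D" by (simp add: D_def)
    have down: "p \<in> D" if "Suc p \<in> D" for p
    proof -
      have p: "Suc p < N" "x (Suc (k * N + p + 1))" using that by (simp_all add: D_def)
      have "same_cell N (k * N + p + 1)" using innerI[of "p + 1" N k] p by simp
      then have "x (k * N + p + 1)" by (rule no) (use p le in auto)
      then show ?thesis using p by (simp add: D_def)
    qed
    have "{j\<in>{1..n * N}. (j - 1) div N = k \<and> x j} = (\<lambda>p. k * N + p + 1) ` D"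
    proof (intro equalityI subsetI)
      fix j assume j: "j \<in> {j\<in>{1..n * N}. (j - 1) div N = k \<and> x j}"
      then have "k * N + (j - 1) mod N = j - 1" using div_mult_mod_eq[of "j - 1" N] by simp
      then have e: "j = k * N + (j - 1) mod N + 1" using j by simp
      then have "(j - 1) mod N \<in> D" using j N by (simp add: D_def)
      then show "j \<in> (\<lambda>p. k * N + p + 1) ` D" using e by blast
    next
      fix j assume "j \<in> (\<lambda>p. k * N + p + 1) ` D"
      then show "j \<in> {j\<in>{1..n * N}. (j - 1) div N = k \<and> x j}" using le N by (auto simp: D_def)
    qed
    then have c: "cell_count N (n * N) x k = card D"
      unfolding cell_count_def by (simp add: card_image inj_on_def)
    have e: "i = k * N + (i - 1) mod N + 1" using div_mult_mod_eq[of "i - 1" N] True by (simp add: k_def)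
    have D: "p \<in> D \<longleftrightarrow> p < card D" for p using downward_closed[OF fin down] by (metis lessThan_iff)
    have "cell_sort N (n * N) x i \<longleftrightarrow> (i - 1) mod N \<in> D"
      unfolding cell_sort_def k_def[symmetric] c D using True by simp
    also have "\<dots> \<longleftrightarrow> x i" using e N by (simp add: D_def)
    finally show ?thesis .
  qed
qed

lemma card_swap:
  assumes "finite M" "Suc i \<in> M" "i \<notin> M"
  shows "card (insert i (M - {Suc i})) = card M"
  using assms by (metis card_Suc_Diff1 card_insert_disjoint finite_Diff DiffD1)

lemma cell_count_swap:
  assumes "same_cell N i" "1 \<le> i" "i < m" "\<not> x i" "x (Suc i)"
  shows "cell_count N m (x(i := True, Suc i := False)) = cell_count N m x"
proof
  fix k
  let ?M = "{j\<in>{1..m}. (j - 1) div N = k \<and> x j}"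
  show "cell_count N m (x(i := True, Suc i := False)) k = cell_count N m x k"
  proof (cases "i div N = k")
    case True
    have e: "{j\<in>{1..m}. (j - 1) div N = k \<and> (x(i := True, Suc i := False)) j} = insert i (?M - {Suc i})"
      using assms True by (auto simp: same_cell_def)
    show ?thesis unfolding cell_count_def e by (rule card_swap) (use assms True in \<open>auto simp: same_cell_def\<close>)
  next
    case False
    have "{j\<in>{1..m}. (j - 1) div N = k \<and> (x(i := True, Suc i := False)) j} = ?M"
      using assms False by (auto simp: same_cell_def)
    then show ?thesis by (simp add: cell_count_def)
  qed
qed

lemma cell_sort_swap:
  assumes "same_cell N i" "1 \<le> i" "i < m" "\<not> x i" "x (Suc i)"
  shows "cell_sort N m (x(i := True, Suc i := False)) = cell_sort N m x"
  using cell_count_swap[OF assms] by (auto simp: cell_sort_def fun_eq_iff)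

lemma position_sum_swap:
  assumes "1 \<le> i" "i < m" "\<not> x i" "x (Suc i)"
  shows "position_sum m x = Suc (position_sum m (x(i := True, Suc i := False)))"
proof -
  let ?y = "x(i := True, Suc i := False)"
  have s: "{1..<Suc m} = insert i (insert (Suc i) ({1..<Suc m} - {i, Suc i}))" using assms by auto
  have "(\<Sum>j\<in>{1..<Suc m} - {i, Suc i}. if x j then j else 0) = (\<Sum>j\<in>{1..<Suc m} - {i, Suc i}. if ?y j then j else 0)"
    by (rule sum.cong) auto
  then show ?thesis unfolding position_sum_def
    by (subst (1 2) s) (use assms in simp)
qed

text \<open>The condition that all caps inside a cell annihilate \<open>f\<close>, solved for one
  value: a cap reads \<open>- A\<close> times the value at the signs \<open>False, True\<close> plus
  \<open>1/A\<close> times the value at \<open>True, False\<close>.\<close>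

definition cap_killed :: "nat \<Rightarrow> nat \<Rightarrow> (state \<Rightarrow> ratfun) \<Rightarrow> bool" where
  "cap_killed N m f \<longleftrightarrow> (\<forall>i x. same_cell N i \<and> i < m \<and> x \<in> states m \<and> \<not> x i \<and> x (Suc i) \<longrightarrow>
     f x = t_half * f (x(i := True, Suc i := False)))"

lemma t_half_nonzero [simp]: "t_half \<noteq> 0"
  by (simp add: t_half_eq)

text \<open>Each exchange moves a mark one place to the left, costs a factor \<open>t_half\<close>
  and lowers \<open>position_sum\<close> by one, so the accumulated power is the difference of the
  two position sums. The equation is multiplied out to avoid a subtraction.\<close>

lemma cap_killed_cell_sort:
  assumes N: "N \<ge> 1" and f: "cap_killed N (n * N) f" and x: "x \<in> states (n * N)"
  shows "f x * t_half ^ position_sum (n * N) (cell_sort N (n * N) x) = t_half ^ position_sum (n * N) x * f (cell_sort N (n * N) x)"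
  using x
proof (induction "position_sum (n * N) x" arbitrary: x)
  case 0
  have "cell_sort N (n * N) x = x"
  proof (rule cell_sort_sorted[OF N 0(2)])
    fix i assume i: "same_cell N i" "i < n * N" "x (Suc i)"
    show "x i"
    proof (rule ccontr)
      assume "\<not> x i"
      then show False using position_sum_swap[of i "n * N" x] i 0(1) by (simp add: same_cell_def)
    qed
  qed
  then show ?case by (simp add: mult.commute)
next
  case (Suc p)
  show ?case
  proof (cases "\<exists>i. same_cell N i \<and> i < n * N \<and> x (Suc i) \<and> \<not> x i")
    case False
    then have "cell_sort N (n * N) x = x" by (intro cell_sort_sorted[OF N Suc(3)]) blast
    then show ?thesis by (simp add: mult.commute)
  next
    case True
    then obtain i where i: "same_cell N i" "i < n * N" "x (Suc i)" "\<not> x i" by blast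
    have i1: "1 \<le> i" using i by (simp add: same_cell_def)
    define y where "y = x(i := True, Suc i := False)"
    have y: "y \<in> states (n * N)" using Suc(3) i i1 by (auto simp: y_def states_def)
    have p: "position_sum (n * N) x = Suc (position_sum (n * N) y)" unfolding y_def by (rule position_sum_swap) (use i i1 in auto)
    have s: "cell_sort N (n * N) y = cell_sort N (n * N) x" unfolding y_def by (rule cell_sort_swap) (use i i1 in auto)
    have fx: "f x = t_half * f y" unfolding y_def using f i Suc(3) by (auto simp: cap_killed_def)
    have "f y * t_half ^ position_sum (n * N) (cell_sort N (n * N) y) = t_half ^ position_sum (n * N) y * f (cell_sort N (n * N) y)"
      by (rule Suc(1)) (use p Suc(2) y in auto)
    then show ?thesis unfolding fx p s by (simp add: mult.assoc)
  qed
qed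

text \<open>For a sorted state \<open>r\<close>, the annihilated function with value 1 at
  \<open>r\<close> and 0 at the other sorted states. Its values are powers of \<open>t_half\<close>,
  hence Laurent, although the projectors have denominators.\<close>

definition basis_fun :: "nat \<Rightarrow> nat \<Rightarrow> state \<Rightarrow> state \<Rightarrow> ratfun" where
  "basis_fun N m r x = (if cell_sort N m x = r then t_half ^ position_sum m x / t_half ^ position_sum m r else 0)"

lemma cap_killed_basis: "cap_killed N m (basis_fun N m r)"
  unfolding cap_killed_def
proof (intro allI impI)
  fix i x assume a: "same_cell N i \<and> i < m \<and> x \<in> states m \<and> \<not> x i \<and> x (Suc i)"
  then have i1: "1 \<le> i" by (simp add: same_cell_def)
  show "basis_fun N m r x = t_half * basis_fun N m r (x(i := True, Suc i := False))"
    using cell_sort_swap[of N i m x] position_sum_swap[of i m x] a i1 by (simp add: basis_fun_def)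
qed

definition sorted_states :: "nat \<Rightarrow> nat \<Rightarrow> state set" where
  "sorted_states N m = {r \<in> states m. cell_sort N m r = r}"

lemma finite_sorted [simp]: "finite (sorted_states N m)"
  by (simp add: sorted_states_def)

lemma cell_sort_idem:
  assumes N: "N \<ge> 1"
  shows "cell_sort N (n * N) (cell_sort N (n * N) x) = cell_sort N (n * N) x"
proof (rule cell_sort_sorted[OF N cell_sort_states])
  fix i assume i: "same_cell N i" "i < n * N" "cell_sort N (n * N) x (Suc i)"
  then have "(i - 1) div N = i div N" "1 \<le> i" by (auto simp: same_cell_def)
  moreover have "(i - 1) mod N \<le> i mod N"
  proof -
    have "i - 1 = (i - 1) div N * N + (i - 1) mod N" "i = i div N * N + i mod N" by simp_all
    moreover have "(i - 1) div N * N = i div N * N" using \<open>(i - 1) div N = i div N\<close> by simp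
    ultimately show ?thesis by linarith
  qed
  ultimately show "cell_sort N (n * N) x i" using i by (auto simp: cell_sort_def)
qed

lemma cap_killed_expand:
  assumes N: "N \<ge> 1" and f: "cap_killed N (n * N) f" and x: "x \<in> states (n * N)"
  shows "f x = (\<Sum>r\<in>sorted_states N (n * N). f r * basis_fun N (n * N) r x)"
proof -
  let ?r = "cell_sort N (n * N) x"
  have "?r \<in> sorted_states N (n * N)" using cell_sort_states cell_sort_idem[OF N] by (simp add: sorted_states_def)
  moreover have "(\<Sum>r\<in>sorted_states N (n * N). f r * basis_fun N (n * N) r x) =
      (\<Sum>r\<in>sorted_states N (n * N). if ?r = r then f r * (t_half ^ position_sum (n * N) x / t_half ^ position_sum (n * N) r) else 0)"
    by (rule sum.cong[OF refl]) (simp only: basis_fun_def mult_zero_right if_distrib[of "(*) (f _)"])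
  ultimately have "(\<Sum>r\<in>sorted_states N (n * N). f r * basis_fun N (n * N) r x) =
      f ?r * (t_half ^ position_sum (n * N) x / t_half ^ position_sum (n * N) ?r)"
    by (simp only: sum.delta'[OF finite_sorted] if_True sum.delta[OF finite_sorted])
  also have "\<dots> = t_half ^ position_sum (n * N) x * f ?r / t_half ^ position_sum (n * N) ?r"
    by (simp only: times_divide_eq_right mult.commute)
  also have "\<dots> = f x"
    unfolding cap_killed_cell_sort[OF N f x, symmetric] by (rule nonzero_mult_div_cancel_right) (rule power_not_zero[OF t_half_nonzero])
  finally show ?thesis ..
qed

lemma cap_killed_iff_ca:
  assumes "1 \<le> i" "i < m" "x \<in> states m" "\<not> x i" "x (Suc i)" "ap (kca i) f (del i x) = 0"
  shows "f x = t_half * f (x(i := True, Suc i := False))"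
proof -
  have x: "x(i := False, Suc i := True) = x" using assms by (auto simp: fun_eq_iff)
  have "ap (kca i) f (del i x) = - A_var * f x + inverse A_var * f (x(i := True, Suc i := False))"
    unfolding ap_cap ins_fun_upd by (simp add: sum_bool kauff_cap_def x)
  then have "A_var * f x = inverse A_var * f (x(i := True, Suc i := False))" using assms by simp
  then have "inverse A_var * (A_var * f x) = inverse A_var * (inverse A_var * f (x(i := True, Suc i := False)))" by simp
  then show ?thesis by (simp add: A_inv t_half_eq power2_eq_square mult.assoc)
qed

lemma same_cell_cell:
  assumes "N \<ge> 1" "same_cell N i"
  shows "\<exists>k j. i = k * N + j \<and> 1 \<le> j \<and> j < N \<and> k = (i - 1) div N"
proof -
  let ?k = "(i - 1) div N"
  have 1: "1 \<le> i" "i div N = ?k" using assms by (auto simp: same_cell_def)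
  have "i = ?k * N + i mod N" using div_mult_mod_eq[of i N] 1 by simp
  moreover have "i - 1 = ?k * N + (i - 1) mod N" by simp
  then have "1 \<le> i mod N" using calculation 1 by linarith
  moreover have "i mod N < N" using assms by simp
  ultimately show ?thesis by blast
qed

text \<open>A cap inside a cell is killed by the projector of that cell. With
  \<open>jw_cells_fixes\<close> this identifies the image of the projectors, on
  \<open>states (n * N)\<close>, with the functions satisfying \<open>cap_killed\<close>.\<close>

lemma jw_cells_cap_killed:
  assumes N: "N \<ge> 1" shows "cap_killed N (n * N) (ap (jw_cells N [1..<Suc n]) v)"
  unfolding cap_killed_def
proof (intro allI impI)
  fix i x assume a: "same_cell N i \<and> i < n * N \<and> x \<in> states (n * N) \<and> \<not> x i \<and> x (Suc i)"
  obtain k j where kj: "i = k * N + j" "1 \<le> j" "j < N" "k = (i - 1) div N" using same_cell_cell[OF N] a by blast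
  have "i - 1 < n * N" using a by auto
  then have k: "k < n" unfolding kj(4) by (simp add: less_mult_imp_div_less)
  have "jw_cell N (Suc k) * jw_cells N [1..<Suc n] = jw_cells N [1..<Suc n]"
    by (rule jw_cell_absorb) (use k in auto)
  then have "kca i * jw_cells N [1..<Suc n] = (kca (k * N + j) * jw (k * N) N) * jw_cells N [1..<Suc n]"
    unfolding kj(1) by (simp add: jw_cell_def mult.assoc)
  then have "kca i * jw_cells N [1..<Suc n] = 0" using ca_jw[OF kj(2,3)] by simp
  from arg_cong[OF this, of "\<lambda>F. ap F v (del i x)"]
  show "ap (jw_cells N [1..<Suc n]) v x = t_half * ap (jw_cells N [1..<Suc n]) v (x(i := True, Suc i := False))"
    by (intro cap_killed_iff_ca) (use a in \<open>auto simp: same_cell_def\<close>)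
qed

lemma jw_fixes:
  assumes "d + a \<le> m" "\<And>j y. 1 \<le> j \<Longrightarrow> j < a \<Longrightarrow> y \<in> states m \<Longrightarrow> ap (kU (d + j)) v y = 0" "x \<in> states m"
  shows "ap (jw d a) v x = v x"
  using assms
proof (induction a arbitrary: x)
  case (Suc a)
  have IH: "ap (jw d a) v y = v y" if "y \<in> states m" for y using Suc that by simp
  have "ap (jw d a * kU (d + a) * jw d a) v x = 0" if "a \<ge> 1"
  proof -
    have hU: "hom kauff_weight m m (kU (d + a))" by (rule kauff.hom_U) (use that Suc.prems in auto)
    have "ap (kU (d + a)) (ap (jw d a) v) y = 0" if "y \<in> states m" for y
      using hom_eq[OF hU IH that] Suc.prems(2)[OF \<open>a \<ge> 1\<close> _ that] by simp
    then show ?thesis using hom_eq[OF hom_jw, of d a m _ "\<lambda>_. 0" x] Suc.prems by simp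
  qed
  then show ?case using IH[OF Suc.prems(3)] by (cases "a = 0") simp_all
qed simp

lemma cap_killed_U:
  assumes "cap_killed N m f" "same_cell N i" "i < m" "y \<in> states m"
  shows "ap (kU i) f y = 0"
proof -
  let ?z = "y(i := False, Suc i := True)"
  have i1: "1 \<le> i" using assms by (simp add: same_cell_def)
  have z: "?z \<in> states m" using assms i1 by (auto simp: states_def)
  have "?z(i := True, Suc i := False) = y(i := True, Suc i := False)" by (auto simp: fun_eq_iff)
  then have "f ?z = t_half * f (y(i := True, Suc i := False))"
    using assms z unfolding cap_killed_def by (metis fun_upd_other fun_upd_same n_not_Suc_n)
  moreover have "inverse A_var * z = A_var * (t_half * z)" for z
    by (simp add: t_half_eq power2_eq_square mult.assoc A_inv)
  ultimately show ?thesis unfolding kauff.ap_U by (simp add: sum_bool kauff_cap_def)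
qed

lemma jw_cells_fixes:
  assumes N: "N \<ge> 1" and f: "cap_killed N (n * N) f" and x: "x \<in> states (n * N)" and L: "set L \<subseteq> {1..n}"
  shows "ap (jw_cells N L) f x = f x"
  using L x
proof (induction L arbitrary: x)
  case (Cons i L)
  have le: "(i - 1) * N + N \<le> n * N" by (rule block_le) (use Cons.prems in auto)
  have "hom kauff_weight (n * N) (n * N) (jw_cell N i)" unfolding jw_cell_def by (rule hom_jw[OF le])
  then have "ap (jw_cell N i) (ap (jw_cells N L) f) x = ap (jw_cell N i) f x"
    by (rule hom_eq) (use Cons in auto)
  also have "\<dots> = f x" unfolding jw_cell_def
  proof (rule jw_fixes[OF le _ Cons.prems(2)])
    fix j y assume j: "1 \<le> j" "j < N" "y \<in> states (n * N)"
    have "same_cell N ((i - 1) * N + j)" using j by (intro innerI)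
    then show "ap (kU ((i - 1) * N + j)) f y = 0" by (rule cap_killed_U[OF f]) (use j le in auto)
  qed
  finally show ?case by simp
qed simp

text \<open>The trace of \<open>P * X\<close> is the trace of \<open>X\<close> on the image of
  \<open>P\<close>, here computed in the basis \<open>basis_fun\<close>, so that no projector
  remains on the right. \<open>B\<close> and \<open>\<nu>\<close> depend only on the sorted state
  and therefore act diagonally on this basis.\<close>

lemma projected_trace_basis:
  fixes \<nu> :: "state \<Rightarrow> ratfun"
  assumes N: "N \<ge> 1" and X: "hom kauff_weight (n * N) (n * N) X"
    and com: "jw_cells N [1..<Suc n] * X = X * jw_cells N [1..<Suc n]"
    and B: "\<And>x. x \<in> states (n * N) \<Longrightarrow> x \<in> B \<longleftrightarrow> cell_sort N (n * N) x \<in> B"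
    and \<nu>: "\<And>x. x \<in> states (n * N) \<Longrightarrow> \<nu> x = \<nu> (cell_sort N (n * N) x)"
  shows "(\<Sum>x\<in>states (n * N) \<inter> B. \<nu> x * ap (jw_cells N [1..<Suc n] * X) (point_fun x) x) =
    (\<Sum>r\<in>sorted_states N (n * N) \<inter> B. \<nu> r * ap X (basis_fun N (n * N) r) r)"
proof -
  define m where "m = n * N"
  define P where "P = jw_cells N [1..<Suc n]"
  define R where "R = sorted_states N m"
  let ?I = "basis_fun N m"
  have s: "set [1..<Suc n] \<subseteq> {1..n}" by auto
  have hP: "hom kauff_weight m m P" unfolding m_def P_def by (rule hom_jw_cells[OF s])
  have hX: "hom kauff_weight m m X" using X by (simp add: m_def)
  have com': "P * X = X * P" using com by (simp add: P_def)
  have finR: "finite R" by (simp add: R_def)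
  have RS: "r \<in> states m" "cell_sort N m r = r" if "r \<in> R" for r using that by (auto simp: R_def sorted_states_def)
  have exp: "f x = (\<Sum>r\<in>R. f r * ?I r x)" if "cap_killed N m f" "x \<in> states m" for f x
    unfolding m_def R_def by (rule cap_killed_expand[OF N that[unfolded m_def]])
  have PI: "ap P (?I r) x = ?I r x" if "x \<in> states m" for r x
    unfolding m_def P_def by (rule jw_cells_fixes[OF N cap_killed_basis that[unfolded m_def] s])
  have kP: "cap_killed N m (ap P v)" for v unfolding m_def P_def by (rule jw_cells_cap_killed[OF N])
  have Id: "?I r' r = (if r = r' then 1 else 0)" if "r \<in> R" for r r'
    using RS[OF that] by (simp add: basis_fun_def)
  \<comment> \<open>\<open>X\<close> commutes with \<open>P\<close>, so it preserves the image of
    \<open>P\<close> and its values on the basis expand in the basis again.\<close>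
  have XI: "ap X (?I r) x = (\<Sum>r'\<in>R. ap X (?I r) r' * ?I r' x)" if "x \<in> states m" for r x
  proof -
    have e: "ap X (?I r) y = ap P (ap X (?I r)) y" if "y \<in> states m" for y
    proof -
      have "ap X (?I r) y = ap X (ap P (?I r)) y" by (rule hom_eq[OF hX]) (use PI that in auto)
      also have "\<dots> = ap (X * P) (?I r) y" by simp
      also have "\<dots> = ap P (ap X (?I r)) y" by (simp only: com'[symmetric] ap_times)
      finally show ?thesis .
    qed
    have "ap X (?I r) x = (\<Sum>r'\<in>R. ap P (ap X (?I r)) r' * ?I r' x)"
      by (subst e[OF that]) (rule exp[OF kP that])
    also have "\<dots> = (\<Sum>r'\<in>R. ap X (?I r) r' * ?I r' x)"
      by (rule sum.cong[OF refl]) (simp only: e[OF RS(1), symmetric])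
    finally show ?thesis .
  qed
  have main: "ap (P * X) (point_fun x) x = (\<Sum>r\<in>R. \<Sum>r'\<in>R. ap X (?I r) r' * (?I r' x * ap P (point_fun x) r))" if x: "x \<in> states m" for x
  proof -
    have "ap (P * X) (point_fun x) x = ap X (ap P (point_fun x)) x" unfolding com' by simp
    also have "\<dots> = ap X (\<lambda>y. \<Sum>r\<in>R. ap P (point_fun x) r * ?I r y) x"
      by (rule hom_eq[OF hX _ x]) (rule exp[OF kP])
    also have "\<dots> = (\<Sum>r\<in>R. ap P (point_fun x) r * ap X (?I r) x)" by (simp add: ap_sum ap_scale)
    also have "\<dots> = (\<Sum>r\<in>R. \<Sum>r'\<in>R. ap X (?I r) r' * (?I r' x * ap P (point_fun x) r))"
      unfolding XI[OF x] by (simp add: sum_distrib_left mult_ac)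
    finally show ?thesis .
  qed
  \<comment> \<open>Summing over \<open>x\<close> against \<open>?I r'\<close> applies
    \<open>P\<close> to a basis function, which it fixes; a Kronecker delta remains.\<close>
  have same_cell_sum: "(\<Sum>x\<in>states m \<inter> B. \<nu> x * (?I r' x * ap P (point_fun x) r)) = (if r = r' \<and> r' \<in> B then \<nu> r' else 0)"
    if r: "r \<in> R" "r' \<in> R" for r r'
  proof -
    have "(\<Sum>x\<in>states m \<inter> B. \<nu> x * (?I r' x * ap P (point_fun x) r)) =
        (\<Sum>x\<in>states m. (if x \<in> B then \<nu> x * ?I r' x else 0) * ap P (point_fun x) r)"
      by (subst sum.inter_restrict[OF finite_states], rule sum.cong[OF refl], simp add: mult.assoc)
    also have "\<dots> = (\<Sum>x\<in>states m. (if r' \<in> B then \<nu> r' else 0) * (?I r' x * ap P (point_fun x) r))"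
    proof (rule sum.cong[OF refl])
      fix x assume x: "x \<in> states m"
      show "(if x \<in> B then \<nu> x * ?I r' x else 0) * ap P (point_fun x) r = (if r' \<in> B then \<nu> r' else 0) * (?I r' x * ap P (point_fun x) r)"
      proof (cases "cell_sort N m x = r'")
        case True
        then show ?thesis using B[of x] \<nu>[of x] x by (simp add: m_def)
      next
        case False
        then have z: "?I r' x = 0" by (simp add: basis_fun_def)
        show ?thesis unfolding z by simp
      qed
    qed
    also have "\<dots> = (if r' \<in> B then \<nu> r' else 0) * ap P (?I r') r"
      unfolding sum_distrib_left[symmetric] hom_expand[OF hP RS(1)[OF r(1)], of "?I r'"] ..
    also have "ap P (?I r') r = (if r = r' then 1 else 0)" using PI[OF RS(1)[OF r(1)]] Id[OF r(1)] by simp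
    finally show ?thesis by auto
  qed
  have "(\<Sum>x\<in>states m \<inter> B. \<nu> x * ap (P * X) (point_fun x) x) =
      (\<Sum>x\<in>states m \<inter> B. \<Sum>r\<in>R. \<Sum>r'\<in>R. ap X (?I r) r' * (\<nu> x * (?I r' x * ap P (point_fun x) r)))"
  proof (rule sum.cong[OF refl])
    fix x assume "x \<in> states m \<inter> B"
    then have x: "x \<in> states m" by simp
    show "\<nu> x * ap (P * X) (point_fun x) x = (\<Sum>r\<in>R. \<Sum>r'\<in>R. ap X (?I r) r' * (\<nu> x * (?I r' x * ap P (point_fun x) r)))"
      unfolding main[OF x] sum_distrib_left by (simp only: mult.left_commute)
  qed
  also have "\<dots> = (\<Sum>r\<in>R. \<Sum>x\<in>states m \<inter> B. \<Sum>r'\<in>R. ap X (?I r) r' * (\<nu> x * (?I r' x * ap P (point_fun x) r)))"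
    by (rule sum.swap)
  also have "\<dots> = (\<Sum>r\<in>R. \<Sum>r'\<in>R. ap X (?I r) r' * (\<Sum>x\<in>states m \<inter> B. \<nu> x * (?I r' x * ap P (point_fun x) r)))"
    by (rule sum.cong[OF refl], subst sum.swap) (simp only: sum_distrib_left)
  also have "\<dots> = (\<Sum>r\<in>R. \<Sum>r'\<in>R. ap X (?I r) r' * (if r = r' \<and> r' \<in> B then \<nu> r' else 0))"
    by (intro sum.cong refl) (simp add: same_cell_sum)
  also have "\<dots> = (\<Sum>r\<in>R. if r \<in> B then \<nu> r * ap X (?I r) r else 0)"
  proof (rule sum.cong[OF refl])
    fix r assume r: "r \<in> R"
    have "(\<Sum>r'\<in>R. ap X (?I r) r' * (if r = r' \<and> r' \<in> B then \<nu> r' else 0))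
        = (\<Sum>r'\<in>R. if r = r' then ap X (?I r) r' * (if r' \<in> B then \<nu> r' else 0) else 0)"
      by (intro sum.cong refl) auto
    then show "(\<Sum>r'\<in>R. ap X (?I r) r' * (if r = r' \<and> r' \<in> B then \<nu> r' else 0)) = (if r \<in> B then \<nu> r * ap X (?I r) r else 0)"
      using r finR by (simp add: mult.commute)
  qed
  also have "\<dots> = (\<Sum>r\<in>R \<inter> B. \<nu> r * ap X (?I r) r)"
    by (rule sum.inter_restrict[OF finR, symmetric])
  finally show ?thesis by (simp add: m_def P_def R_def)
qed

subsection \<open>The partial trace\<close>

text \<open>Closing all strands except the first \<open>N\<close> gives a multiple of the projector on \<open>N\<close> strands. The
  factor is the trace divided by the trace of that projector, and can be read off as a single matrix
  entry, which is Laurent because it only involves the basis above.\<close>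

inductive tl_alg :: "nat \<Rightarrow> ratfun linear_op \<Rightarrow> bool" for m where
  tl_alg_0: "tl_alg m 0"
| tl_alg_step: "set h \<subseteq> {1..<m} \<Longrightarrow> tl_alg m F \<Longrightarrow> tl_alg m (scal k * kauff.U_word h + F)"

lemma tl_alg_word: "set h \<subseteq> {1..<m} \<Longrightarrow> tl_alg m (kauff.U_word h)"
  using tl_alg_step[OF _ tl_alg_0, of h m 1] by simp

lemma tl_alg_add: "tl_alg m F \<Longrightarrow> tl_alg m G \<Longrightarrow> tl_alg m (F + G)"
  by (induction rule: tl_alg.induct) (simp_all add: add.assoc tl_alg_step)

lemma tl_alg_scal: "tl_alg m F \<Longrightarrow> tl_alg m (scal l * F)"
proof (induction rule: tl_alg.induct)
  case (tl_alg_step h F k)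
  have "scal l * (scal k * kauff.U_word h + F) = scal (l * k) * kauff.U_word h + scal l * F"
    by (simp only: scal_mult distrib_left mult.assoc)
  then show ?case using tl_alg.tl_alg_step[OF tl_alg_step(1,3)] by simp
qed (simp add: tl_alg_0)

lemma tl_alg_word_mult: "tl_alg m F \<Longrightarrow> set h \<subseteq> {1..<m} \<Longrightarrow> tl_alg m (kauff.U_word h * F)"
proof (induction rule: tl_alg.induct)
  case (tl_alg_step h' F k)
  have "kauff.U_word h * (scal k * kauff.U_word h') = scal k * (kauff.U_word h * kauff.U_word h')" by (rule scal_left)
  then have "kauff.U_word h * (scal k * kauff.U_word h' + F) = scal k * kauff.U_word (h @ h') + kauff.U_word h * F"
    by (simp only: distrib_left kauff.U_word_simps)
  moreover have "set (h @ h') \<subseteq> {1..<m}" using tl_alg_step by simp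
  ultimately show ?case using tl_alg.tl_alg_step tl_alg_step by metis
qed (simp add: tl_alg_0)

lemma tl_alg_mult: "tl_alg m F \<Longrightarrow> tl_alg m G \<Longrightarrow> tl_alg m (F * G)"
proof (induction rule: tl_alg.induct)
  case (tl_alg_step h F k)
  have "tl_alg m (scal k * (kauff.U_word h * G))"
    by (intro tl_alg_scal tl_alg_word_mult tl_alg_step)
  then show ?case using tl_alg_step by (simp add: distrib_right mult.assoc tl_alg_add)
qed (simp add: tl_alg_0)

lemma tl_alg_1: "tl_alg m 1"
  using tl_alg_word[of "[]" m] by simp

lemma tl_alg_U: "1 \<le> i \<Longrightarrow> i < m \<Longrightarrow> tl_alg m (kU i)"
  using tl_alg_word[of "[i]" m] by simp

lemma tl_alg_sg: "1 \<le> i \<Longrightarrow> i < m \<Longrightarrow> tl_alg m (sg i)"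
  using tl_alg_add[OF tl_alg_scal[OF tl_alg_1, of m A_var] tl_alg_scal[OF tl_alg_U, of i m "inverse A_var"]]
  by (simp add: sg_eq)

lemma tl_alg_W: "set h \<subseteq> {1..<m} \<Longrightarrow> tl_alg m (sg.W h)"
  by (induction h) (simp_all add: tl_alg_1 tl_alg_mult tl_alg_sg)

lemma tl_alg_jw: "d + a \<le> m \<Longrightarrow> tl_alg m (jw d a)"
proof (induction a)
  case (Suc a)
  then have J: "tl_alg m (jw d a)" by simp
  show ?case
  proof (cases "a = 0")
    case True
    then show ?thesis by (simp add: tl_alg_1)
  next
    case False
    then have "tl_alg m (kU (d + a))" using Suc.prems by (intro tl_alg_U) auto
    then show ?thesis unfolding jw.simps by (intro tl_alg_add tl_alg_scal tl_alg_mult J)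
  qed
qed (simp add: tl_alg_1)

lemma tl_alg_jw_cells: "set L \<subseteq> {1..n} \<Longrightarrow> tl_alg (n * N) (jw_cells N L)"
proof (induction L)
  case (Cons i L)
  have "(i - 1) * N + N \<le> n * N" by (rule block_le) (use Cons.prems in auto)
  then have "tl_alg (n * N) (jw_cell N i)" unfolding jw_cell_def by (rule tl_alg_jw)
  then show ?case using Cons by (simp add: tl_alg_mult)
qed (simp add: tl_alg_1)

text \<open>By \<open>tl_close\<close> the closure of a word is a power of the loop value times a
  word on the remaining strands, and this extends linearly. Equality is claimed on
  \<open>states N\<close>, where the closed positions are \<open>False\<close>.\<close>

lemma tl_alg_ptr:
  assumes "tl_alg (N + d) F"
  shows "\<exists>Z. tl_alg N Z \<and> (\<forall>v. \<forall>x\<in>states N. ap (ptr kauff_weight N d F) v x = ap Z v x)"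
  using assms
proof (induction rule: tl_alg.induct)
  case tl_alg_0
  have "ptr kauff_weight N d 0 = 0" using ptr_scal[of kauff_weight N d 0 0] by simp
  then show ?case using tl_alg.tl_alg_0 by (metis ap_zero_op)
next
  case (tl_alg_step h F k)
  obtain Z where Z: "tl_alg N Z" "\<And>v x. x \<in> states N \<Longrightarrow> ap (ptr kauff_weight N d F) v x = ap Z v x"
    using tl_alg_step by blast
  obtain j h' where h': "tl_close N d h j h'" "set h' \<subseteq> {1..<N}" using tl_close_exists[OF tl_alg_step(1)] by blast
  have "ap (ptr kauff_weight N d (scal k * kauff.U_word h + F)) v x = ap (scal (k * loop_value ^ j) * kauff.U_word h' + Z) v x"
    if "x \<in> states N" for v x
    using kauff.tl_close_sound[OF h'(1) that] Z(2)[OF that] by (simp add: ptr_add ptr_scal mult.assoc)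
  then show ?case using tl_alg.tl_alg_step[OF h'(2) Z(1)] by blast
qed

text \<open>Every nonempty word begins with a hook, which the projector kills, so only the
  coefficients of the empty word survive.\<close>

lemma jw_tl_alg:
  assumes "tl_alg N Z" shows "\<exists>l. jw 0 N * Z = scal l * jw 0 N"
  using assms
proof (induction rule: tl_alg.induct)
  case tl_alg_0
  show ?case by (rule exI[of _ 0]) simp
next
  case (tl_alg_step h F k)
  obtain l where l: "jw 0 N * F = scal l * jw 0 N" using tl_alg_step by blast
  have e: "jw 0 N * (scal k * kauff.U_word h + F) = scal k * (jw 0 N * kauff.U_word h) + scal l * jw 0 N"
    unfolding distrib_left l by (simp only: scal_left)
  show ?case
  proof (cases h)
    case Nil
    have "jw 0 N * (scal k * kauff.U_word h + F) = scal (k + l) * jw 0 N"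
      unfolding e by (simp add: Nil scal_add distrib_right)
    then show ?thesis ..
  next
    case (Cons i h')
    then have "jw 0 N * kU i = 0" using jw_U_zero[of i N 0] tl_alg_step(1) by simp
    then have "jw 0 N * kauff.U_word h = 0" unfolding Cons by (simp add: mult.assoc[symmetric])
    then show ?thesis using e by auto
  qed
qed

lemma ptr1_inert_mult: "inert k F \<Longrightarrow> ptr1 \<mu> k (F * G) = F * ptr1 \<mu> k G"
proof (rule linear_op_eqI)
  fix v x assume F: "inert k F"
  let ?h = "\<lambda>b. ap G (\<lambda>z. if z k = b then v (z(k := False)) else 0)"
  have "ap (ptr1 \<mu> k (F * G)) v x = (\<Sum>b\<in>UNIV. \<mu> b * ap F (\<lambda>z. ?h b (z(k := b))) x)"
    unfolding ap_ptr1 ap_times using F by (simp add: inert_def)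
  also have "\<dots> = ap F (\<lambda>y. \<Sum>b\<in>UNIV. \<mu> b * ?h b (y(k := b))) x"
    by (simp only: ap_sum ap_scale)
  also have "(\<lambda>y. \<Sum>b\<in>UNIV. \<mu> b * ?h b (y(k := b))) = ap (ptr1 \<mu> k G) v"
    by (rule ext) (rule ap_ptr1[symmetric])
  finally show "ap (ptr1 \<mu> k (F * G)) v x = ap (F * ptr1 \<mu> k G) v x" by simp
qed

lemma ptr_inert_mult: "(\<And>k. N < k \<Longrightarrow> inert k F) \<Longrightarrow> ptr \<mu> N d (F * G) = F * ptr \<mu> N d G"
  by (induction d arbitrary: G) (simp_all add: ptr1_inert_mult)

text \<open>A Schur argument: the projector does not touch the closed strands, so the partial trace
  still absorbs it; being an element of the algebra on \<open>N\<close> strands, it is then a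
  multiple of the projector by \<open>jw_tl_alg\<close>.\<close>

lemma ptr_scalar:
  assumes W: "tl_alg (N + d) W" and J: "jw 0 N * W = W"
  shows "\<exists>l. \<forall>v. \<forall>x\<in>states N. ap (ptr kauff_weight N d W) v x = l * ap (jw 0 N) v x"
proof -
  obtain Z where Z: "tl_alg N Z" "\<And>v x. x \<in> states N \<Longrightarrow> ap (ptr kauff_weight N d W) v x = ap Z v x"
    using tl_alg_ptr[OF W] by blast
  obtain l where l: "jw 0 N * Z = scal l * jw 0 N" using jw_tl_alg[OF Z(1)] by blast
  have h: "hom kauff_weight N N (jw 0 N)" by (rule hom_jw) simp
  have "ap (ptr kauff_weight N d W) v x = l * ap (jw 0 N) v x" if x: "x \<in> states N" for v x
  proof -
    have "ptr kauff_weight N d W = jw 0 N * ptr kauff_weight N d W"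
      using ptr_inert_mult[of N "jw 0 N" kauff_weight d W] inert_jw[of 0 N] by (simp add: J)
    then have "ap (ptr kauff_weight N d W) v x = ap (jw 0 N) (ap (ptr kauff_weight N d W) v) x" by (metis ap_times)
    also have "\<dots> = ap (jw 0 N) (ap Z v) x" by (rule hom_eq[OF h _ x]) (rule Z(2))
    also have "\<dots> = ap (jw 0 N * Z) v x" by simp
    finally show ?thesis unfolding l by simp
  qed
  then show ?thesis by blast
qed

text \<open>An exchange-invariant function times \<open>t_half ^ position_sum\<close> satisfies
  \<open>cap_killed\<close>, so the sorting induction can be reused.\<close>

lemma swap_invariant:
  fixes f :: "state \<Rightarrow> ratfun"
  assumes N: "N \<ge> 1" and x: "x \<in> states (n * N)"
    and sw: "\<And>i x. same_cell N i \<Longrightarrow> 1 \<le> i \<Longrightarrow> i < n * N \<Longrightarrow> x \<in> states (n * N) \<Longrightarrow> \<not> x i \<Longrightarrow> x (Suc i) \<Longrightarrow>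
      f x = f (x(i := True, Suc i := False))"
  shows "f x = f (cell_sort N (n * N) x)"
proof -
  have "cap_killed N (n * N) (\<lambda>x. f x * t_half ^ position_sum (n * N) x)"
    unfolding cap_killed_def
  proof (intro allI impI)
    fix i x assume a: "same_cell N i \<and> i < n * N \<and> x \<in> states (n * N) \<and> \<not> x i \<and> x (Suc i)"
    then have i: "1 \<le> i" by (simp add: same_cell_def)
    have "f x = f (x(i := True, Suc i := False))" by (rule sw) (use a i in auto)
    moreover have "position_sum (n * N) x = Suc (position_sum (n * N) (x(i := True, Suc i := False)))"
      by (rule position_sum_swap) (use a i in auto)
    ultimately show "f x * t_half ^ position_sum (n * N) x =
        t_half * (f (x(i := True, Suc i := False)) * t_half ^ position_sum (n * N) (x(i := True, Suc i := False)))"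
      by (simp only: power_Suc mult.left_commute)
  qed
  from cap_killed_cell_sort[OF N this x] show ?thesis by simp
qed

lemma of_bool_inject: "(if p then 1 else 0 :: 'a::zero_neq_one) = (if q then 1 else 0) \<Longrightarrow> p \<longleftrightarrow> q"
  by (cases p; cases q) simp_all

lemma same_cell_cases: "same_cell N i \<Longrightarrow> i < N \<or> N < i"
  by (cases "i = N") (auto simp: same_cell_def)

lemma laurent_ap_U:
  assumes "\<And>x. laurent (v x)" shows "laurent (ap (kU i) v x)"
  unfolding kauff.ap_U sum_bool kauff_cup_def kauff_cap_def
  by (intro laurent_mult laurent_add) (simp_all add: assms laurent_uminus)

lemma laurent_ap_sg: "(\<And>x. laurent (v x)) \<Longrightarrow> laurent (ap (sg i) v x)"
  unfolding sg_eq ap_times ap_plus ap_scal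
  by (intro laurent_mult laurent_add laurent_ap_U laurent_A laurent_inverse_A)

lemma laurent_ap_W:
  assumes "\<And>x. laurent (v x)" shows "laurent (ap (sg.W h) v x)"
proof (induction h arbitrary: x)
  case (Cons i h)
  show ?case unfolding sg.W_simps ap_times by (intro laurent_ap_sg Cons)
qed (simp add: assms)

lemma laurent_basis_fun: "laurent (basis_fun N m r x)"
proof -
  have "t_half ^ a / t_half ^ c = t_half ^ a * (A_var ^ 2) ^ c" for a c
    by (simp add: t_half_eq field_simps)
  then show ?thesis unfolding basis_fun_def by (simp add: laurent_mult laurent_power)
qed

text \<open>\<open>l\<close> is the scalar of the partial trace over all cells but the first. The
  projector has entry 1 at the empty state, so \<open>l\<close> is the entry of the partial trace
  there: a weighted diagonal sum over states that are empty in the first cell, from which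
  \<open>projected_trace_basis\<close> removes the projectors.\<close>

lemma projected_trace_laurent:
  assumes n: "n \<ge> 1" and hb: "set b \<subseteq> {1..<n}"
  shows "\<exists>l. laurent l \<and> ktr (n * N) (jw_cells N [1..<Suc n] * cable_op (\<lambda>_. N) b) = l * ktr N (jw 0 N)"
proof -
  define P where "P = jw_cells N [1..<Suc n]"
  obtain h where h: "set h \<subseteq> {1..<n * N}" "cable_op (\<lambda>_. N) b = sg.W h" using cable_op_const_W[OF hb, of N] by blast
  have s: "set [1..<Suc n] \<subseteq> {1..n}" by auto
  define Y where "Y = P * sg.W h"
  show ?thesis
  proof (cases "N = 0")
    case True
    have "jw_cells 0 L = 1" for L by (induction L) (simp_all add: jw_cell_def)
    moreover have "h = []" using h True by (cases h) auto
    ultimately show ?thesis using True h by (intro exI[of _ 1]) simp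
  next
    case False
    then have N: "N \<ge> 1" by simp
    define d where "d = (n - 1) * N"
    have m: "n * N = N + d" using n by (cases n) (simp_all add: d_def)
    have PJ: "jw 0 N * P = P"
      using jw_cell_absorb[of 1 "[1..<Suc n]" N] n by (simp add: P_def jw_cell_def subset_eq)
    have Y: "tl_alg (N + d) Y"
      unfolding Y_def P_def m[symmetric] by (intro tl_alg_mult tl_alg_jw_cells[OF s] tl_alg_W h)
    have JY: "jw 0 N * Y = Y" unfolding Y_def mult.assoc[symmetric] PJ ..
    obtain l where l: "\<And>v x. x \<in> states N \<Longrightarrow> ap (ptr kauff_weight N d Y) v x = l * ap (jw 0 N) v x"
      using ptr_scalar[OF Y JY] by blast
    have "ktr (N + d) Y = ktr N (ptr kauff_weight N d Y)" by (rule Tr_ptr)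
    also have "\<dots> = l * ktr N (jw 0 N)"
      unfolding Tr_def sum_distrib_left by (rule sum.cong) (simp_all add: l mult.left_commute)
    finally have T: "ktr (n * N) Y = l * ktr N (jw 0 N)" unfolding m .
    let ?z = "\<lambda>_::nat. False" and ?B = "{x::state. \<forall>i\<le>N. \<not> x i}"
    define \<nu> where "\<nu> x = (\<Prod>i=Suc N..N + d. kauff_weight (x i))" for x
    have z: "?z \<in> states k" for k by (simp add: states_def)
    \<comment> \<open>Caps vanish on equal signs, so the empty state is annihilated by all hooks and
      its entry under the projector is 1.\<close>
    have kill: "ap (kU (0 + j)) (point_fun ?z) y = 0" if "1 \<le> j" for j and y :: state
    proof -
      have "point_fun ?z (y(j := p, Suc j := q)) = (0 :: ratfun)" if "p \<or> q" for p q
      proof -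
        have "?z \<noteq> y(j := p, Suc j := q)" using that by (metis fun_upd_apply n_not_Suc_n)
        then show ?thesis by (simp add: point_fun_def)
      qed
      then show ?thesis unfolding kauff.ap_U by (simp add: sum_bool kauff_cap_def)
    qed
    have "ap (jw 0 N) (point_fun ?z) ?z = (1::ratfun)"
      using jw_fixes[of 0 N N "point_fun ?z" ?z] kill z by (simp add: point_fun_def)
    then have "l = ap (ptr kauff_weight N d Y) (point_fun ?z) ?z" using l[OF z] by simp
    also have "\<dots> = (\<Sum>x | x \<in> states (N + d) \<and> (\<forall>i\<le>N. x i = ?z i). \<nu> x * ap Y (point_fun x) x)"
      unfolding \<nu>_def by (rule ptr_diag[OF z])
    also have "\<dots> = (\<Sum>x\<in>states (n * N) \<inter> ?B. \<nu> x * ap Y (point_fun x) x)"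
      unfolding m by (rule sum.cong) auto
    also have "\<dots> = (\<Sum>r\<in>sorted_states N (n * N) \<inter> ?B. \<nu> r * ap (sg.W h) (basis_fun N (n * N) r) r)"
      unfolding Y_def P_def
    proof (rule projected_trace_basis[OF N])
      show "hom kauff_weight (n * N) (n * N) (sg.W h)" using hom_cable_op_const[OF hb, of N] by (simp only: h(2))
      show "jw_cells N [1..<Suc n] * sg.W h = sg.W h * jw_cells N [1..<Suc n]"
        using jw_cells_all_cable_op[OF hb, of N] by (simp only: h(2))
      fix x assume x: "x \<in> states (n * N)"
      have "(if x \<in> ?B then 1 else 0 :: ratfun) = (if cell_sort N (n * N) x \<in> ?B then 1 else 0)"
      proof (rule swap_invariant[OF N x, of "\<lambda>x. if x \<in> ?B then 1 else 0"])
        fix i and x :: state assume i: "same_cell N i" "1 \<le> i" "\<not> x i" "x (Suc i)"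
        let ?y = "x(i := True, Suc i := False)"
        have "x \<in> ?B \<longleftrightarrow> ?y \<in> ?B"
        \<comment> \<open>An exchange inside the first cell takes place between two states outside
          \<open>?B\<close>; an exchange in another cell leaves the positions up to \<open>N\<close>
          alone.\<close>
        proof (cases "i < N")
          case True
          then have "x \<notin> ?B" using i(4) by (auto intro!: exI[of _ "Suc i"])
          moreover have "?y \<notin> ?B" using True by (auto intro!: exI[of _ i])
          ultimately show ?thesis by (simp only:)
        next
          case False
          then have "N < i" using same_cell_cases[OF i(1)] by simp
          then have "?y k = x k" if "k \<le> N" for k using that by simp
          then show ?thesis unfolding mem_Collect_eq by metis
        qed
        then show "(if x \<in> ?B then 1 else 0 :: ratfun) = (if ?y \<in> ?B then 1 else 0)" by (simp only:)
      qed
      then show "x \<in> ?B \<longleftrightarrow> cell_sort N (n * N) x \<in> ?B" by (rule of_bool_inject)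
      show "\<nu> x = \<nu> (cell_sort N (n * N) x)"
      proof (rule swap_invariant[OF N x])
        fix i and x :: state assume i: "same_cell N i" "1 \<le> i" "i < n * N" "\<not> x i" "x (Suc i)"
        let ?y = "x(i := True, Suc i := False)"
        show "\<nu> x = \<nu> ?y"
        proof (cases "i < N")
          case True
          then show ?thesis unfolding \<nu>_def by (intro prod.cong) auto
        next
          case False
          then have "N < i" using same_cell_cases[OF i(1)] by simp
          then have state: "{Suc N..N + d} = insert i (insert (Suc i) ({Suc N..N + d} - {i, Suc i}))"
            using i m by auto
          have "(\<Prod>k\<in>{Suc N..N + d} - {i, Suc i}. kauff_weight (x k)) = (\<Prod>k\<in>{Suc N..N + d} - {i, Suc i}. kauff_weight (?y k))"
            by (rule prod.cong) auto
          then show ?thesis unfolding \<nu>_def by (subst (1 2) state) (use i in simp)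
        qed
      qed
    qed
    finally have "l = (\<Sum>r\<in>sorted_states N (n * N) \<inter> ?B. \<nu> r * ap (sg.W h) (basis_fun N (n * N) r) r)" .
    moreover have "laurent (kauff_weight a)" for a
      unfolding kauff_weight_def by (intro laurent_mult laurent_uminus laurent_power laurent_A) simp
    ultimately have "laurent l"
      unfolding \<nu>_def by (auto intro!: laurent_sum laurent_mult laurent_prod laurent_ap_W laurent_basis_fun)
    then show ?thesis using T unfolding Y_def P_def h(2) by blast
  qed
qed

section \<open>Prefactors and the final formulas\<close>

lemma geometric_sum_atMost: "(\<Sum>j\<le>k. x ^ j) * (1 - x) = 1 - x ^ Suc k"
  for x :: "'a::comm_ring_1"
  using sum_gp_basic[of x k] by (simp only: mult.commute)

text \<open>The \<open>N\<^sup>2\<close> part of the framing factor cancels the unit collected from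
  the cabled crossings. What remains is \<open>t_half ^ (N * w)\<close> and, from the weights,
  \<open>t_half powi (- int (n * N))\<close>, where \<open>w - n = (n - 1)\<^sup>2 + c - 1\<close>.
  In the sign \<open>w\<close> may be replaced by \<open>c\<close> because
  \<open>n * (n - 1)\<close> is even.\<close>

lemma prefactor:
  fixes n c N :: nat
  assumes "n \<ge> 1"
  defines "w \<equiv> n * (n - 1) + c"
  shows "((-1) ^ N * A_var ^ (N\<^sup>2 + 2 * N)) powi (- int w) * (-1) ^ N *
      (A_var ^ (N\<^sup>2 * w) * (- (A_var ^ 2)) ^ (n * N)) =
    (-1) ^ (N * (n + c + 1)) * t_half powi (int N * ((int n - 1)\<^sup>2 + int c - 1))"
proof -
  define K where "K = A_var ^ (N\<^sup>2 * w)"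
  define e where "e = (n - 1)\<^sup>2 + c"
  have e: "(int n - 1)\<^sup>2 + int c - 1 = int e - 1" using assms(1) by (simp add: e_def of_nat_diff)
  have we: "w + 1 = n + e" using assms(1) by (cases n) (simp_all add: w_def e_def power2_eq_square)
  have eval_at: "even (n * (n - 1))" by (cases n) simp_all
  define s :: ratfun where "s = (-1) ^ N"
  have s: "s * s = 1" "s ^ k * s ^ k = 1" for k by (simp_all add: s_def power_mult_distrib[symmetric])
  have "((-1) ^ N * A_var ^ (N\<^sup>2 + 2 * N)) ^ w = s ^ w * (K * A_var ^ (2 * N * w))"
    by (simp add: s_def K_def power_mult_distrib power_mult[symmetric] power_add[symmetric] distrib_right)
  then have 1: "((-1) ^ N * A_var ^ (N\<^sup>2 + 2 * N)) powi (- int w) = inverse (s ^ w * (K * A_var ^ (2 * N * w)))"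
    by (simp add: power_int_minus)
  have "inverse (s ^ w) = s ^ w" by (rule inverse_unique) (rule s)
  then have 2: "((-1) ^ N * A_var ^ (N\<^sup>2 + 2 * N)) powi (- int w) * (-1) ^ N * (K * (- (A_var ^ 2)) ^ (n * N))
      = (s ^ w * s * s ^ n) * (inverse (A_var ^ (2 * N * w)) * A_var ^ (2 * n * N))"
    unfolding 1 by (simp add: K_def s_def power_minus[of "A_var ^ 2"] power_mult[symmetric] mult_ac)
  obtain k where k: "n * (n - 1) = k + k" using eval_at by (metis evenE mult_2)
  have "s ^ w = s ^ c" unfolding w_def power_add k s by simp
  then have 3: "s ^ w * s * s ^ n = (-1) ^ (N * (n + c + 1))"
    by (simp add: s_def power_mult[symmetric] power_add[symmetric] algebra_simps)
  have "t_half powi (int N * (int e - 1)) = t_half powi (int (N * w)) * t_half powi (- int (n * N))"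
  proof -
    have "int e - 1 = int w - int n" using we by linarith
    then have "int N * (int e - 1) = int N * (int w - int n)" by (simp only:)
    then have "int N * (int e - 1) = int (N * w) + - int (n * N)" by (simp add: right_diff_distrib)
    then show ?thesis by (simp only: power_int_add[OF disjI1[OF t_half_nonzero]])
  qed
  also have "\<dots> = inverse (A_var ^ (2 * N * w)) * A_var ^ (2 * n * N)"
    unfolding power_int_minus power_int_of_nat by (simp add: t_half_eq power_inverse power_mult[symmetric] mult_ac)
  finally show ?thesis using 2 3 unfolding e K_def by simp
qed

lemma quantum_int_eq:
  "quantum_int (N + 1) = t_half powi (- int N) * ((1 - t_var ^ (N + 1)) / (1 - t_var))"
proof -
  define u where "u = t_half"
  have u: "u \<noteq> 0" by (simp add: u_def)
  have t: "t_var = u ^ 2" by (simp add: u_def t_var_half)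
  have "1 - t_var \<noteq> 0" using one_minus_t_power_nonzero[of 0] by simp
  then have d: "1 - u ^ 2 \<noteq> 0" by (simp add: t)
  have 1: "u - inverse u = - (1 - u ^ 2) * inverse u" using u by (simp add: field_simps power2_eq_square)
  have 2: "u powi int (N + 1) - u powi (- int (N + 1)) = - (1 - (u ^ 2) ^ (N + 1)) * (inverse u * u powi (- int N))"
  proof -
    define a where "a = u ^ (N + 1)"
    have a: "a \<noteq> 0" using u by (simp add: a_def)
    have 2: "u powi int (N + 1) = a" "u powi (- int (N + 1)) = inverse a"
      unfolding a_def by (simp_all only: power_int_minus power_int_of_nat)
    have 3: "(u ^ 2) ^ (N + 1) = a * a"
      unfolding a_def by (metis power2_eq_square power_mult mult.commute)
    have 4: "u powi (- int N) = u * inverse a"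
      unfolding a_def using u by (simp add: power_int_minus field_simps)
    show ?thesis unfolding 2 3 4 using u a by (simp add: field_simps)
  qed
  have "quantum_int (N + 1) = (- (1 - (u ^ 2) ^ (N + 1)) * (inverse u * u powi (- int N))) / (- (1 - u ^ 2) * inverse u)"
    unfolding quantum_int_def u_def[symmetric] 1 2 ..
  also have "\<dots> = u powi (- int N) * ((1 - (u ^ 2) ^ (N + 1)) / (1 - u ^ 2))"
    using u d by (simp add: field_simps)
  finally show ?thesis by (simp only: t u_def)
qed

theorem theorem3:
  fixes n c N :: nat and b :: "nat list" and \<beta> \<beta>' :: braid_word
  assumes "n \<ge> 1"
    and "set b \<subseteq> {1..<n}" and "length b = c" and "\<beta>' = map Sig b"
    and "braid_eq n \<beta> (full_twist n @ \<beta>')"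
  shows "\<exists>p q q' :: int poly.
      colored_jones (N + 1) n \<beta> =
        (-1) ^ (N * (n + c + 1)) * t_half powi (int N * ((int n - 1)\<^sup>2 + int c - 1)) *
        ((1 + t_var ^ (n * N + 1) * at_t p) / (1 - t_var)) \<and>
      colored_jones (N + 1) n \<beta> =
        (-1) ^ (N * (n + c + 1)) * t_half powi (int N * ((int n - 1)\<^sup>2 + int c - 1)) *
        ((\<Sum>i=0..n * N. t_var ^ i) + t_var ^ (n * N + 1) * at_t q) \<and>
      colored_jones_normalized (N + 1) n \<beta> =
        (-1) ^ (N * (n + c + 1)) * t_half powi (int N * ((int n - 1)\<^sup>2 + int c)) *
        ((1 + t_var ^ (n * N + 1) * at_t p) / (1 - t_var ^ (N + 1))) \<and>
      colored_jones_normalized (N + 1) n \<beta> =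
        (-1) ^ (N * (n + c + 1)) * t_half powi (int N * ((int n - 1)\<^sup>2 + int c)) *
        ((\<Sum>i=0..n - 1. t_var ^ (i * (N + 1))) + t_var ^ (n * N + 1) * at_t q')"
proof -
  define B where "B = concat (replicate n [1..<n]) @ b"
  define w where "w = n * (n - 1) + c"
  define m where "m = n * N"
  define T where "T = ktr (n * N) (jw_cells N [1..<Suc n] * cable_op (\<lambda>_. N) B)"
  define K where "K = A_var ^ (N\<^sup>2 * w) * (- (A_var ^ 2)) ^ (n * N)"
  have K: "K \<noteq> 0" by (simp add: K_def)
  define V where "V = (-1) ^ (N * (n + c + 1)) * t_half powi (int N * ((int n - 1)\<^sup>2 + int c - 1))"
  \<comment> \<open>The invariant divided by the unit \<open>V\<close>; all four formulas reduce to
    statements about \<open>E\<close>.\<close>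
  define E where "E = T / K"
  have hB: "set B \<subseteq> {1..<n}" using assms(2) by (auto simp: B_def)
  have lenB: "length B = w"
    using assms(3) by (simp add: B_def w_def length_concat sum_list_replicate)
  have "full_twist n @ \<beta>' = map Sig B"
    by (simp add: full_twist_def B_def assms(4) map_concat map_replicate)
  then have J0: "colored_jones (N + 1) n \<beta> = colored_jones (N + 1) n (map Sig B)"
    using braid_eq_colored_jones[of n \<beta> "map Sig B"] assms(5) hB by (simp add: valid_map)
  have "sum_list (map (crossing_sign \<circ> Sig) B) = int (length B)" by (induction B) simp_all
  then have wr: "writhe (map Sig B) = int w" by (simp add: writhe_def lenB)
  have sgn: "(-1 :: ratfun) powi (int N - 1) * (A_var ^ 2 + A_var powi (-2)) = (-1) ^ N * loop_value"
    by (simp add: loop_value_def power_int_diff algebra_simps)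
  have "colored_jones (N + 1) n \<beta> = ((-1) ^ N * A_var ^ (N\<^sup>2 + 2 * N)) powi (- int w) *
      ((-1) powi (int N - 1) * (A_var ^ 2 + A_var powi (-2))) * S_bracket N n (map Sig B)"
    unfolding J0 unfolding colored_jones_def Let_def wr by (simp add: mult.assoc)
  also have "\<dots> = ((-1) ^ N * A_var ^ (N\<^sup>2 + 2 * N)) powi (- int w) * (-1) ^ N * (loop_value * S_bracket N n (map Sig B))"
    unfolding sgn by (simp only: mult.assoc)
  also have "loop_value * S_bracket N n (map Sig B) = K * E"
    unfolding S_bracket_projected[OF hB] T_def[symmetric] E_def using K by simp
  also have "((-1) ^ N * A_var ^ (N\<^sup>2 + 2 * N)) powi (- int w) * (-1) ^ N * (K * E) = V * E"
    unfolding mult.assoc[symmetric] V_def K_def w_def prefactor[OF assms(1), of N c, unfolded mult.assoc[symmetric]] ..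
  finally have J: "colored_jones (N + 1) n \<beta> = V * E" .
  obtain y where y: "t_local y" "T = A_var ^ (N\<^sup>2 * (n * (n - 1) + length b)) *
      ((- (A_var ^ 2)) ^ (n * N) * ((\<Sum>j\<le>n * N. t_var ^ j) + t_var ^ (n * N + 1) * y))"
    using projected_trace_estimate[OF assms(1,2), of N] unfolding T_def B_def by blast
  have E1: "E = (\<Sum>j\<le>m. t_var ^ j) + t_var ^ (m + 1) * y"
    unfolding E_def y(2) assms(3) w_def[symmetric] mult.assoc[symmetric] K_def[symmetric] m_def using K by simp
  obtain l where l: "laurent l" "T = l * ktr N (jw 0 N)"
    using projected_trace_laurent[OF assms(1) hB, of N] unfolding T_def by blast
  have tN: "1 - t_var ^ (N + 1) \<noteq> 0" using one_minus_t_power_nonzero[of N] by simp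
  have t1: "1 - t_var \<noteq> 0" using one_minus_t_power_nonzero[of 0] by simp
  have t0: "t_var \<noteq> 0" by (simp add: t_var_eq)
  have it: "inverse t_var = A_var ^ 4" by (simp add: t_var_eq power_inverse)
  \<comment> \<open>The trace divided by the trace of one projector, freed of units. It is Laurent
    because \<open>K\<close> is a unit, and \<open>E\<close> is \<open>F\<close> times
    \<open>1 + t + \<dots> + t ^ N\<close>.\<close>
  define F where "F = l * (- (A_var ^ 2)) ^ N / K"
  have "inverse K = inverse A_var ^ (N\<^sup>2 * w) * (- (inverse A_var ^ 2)) ^ (n * N)"
    by (simp add: K_def power_inverse power_minus[of "A_var ^ 2"] power_minus[of "inverse A_var ^ 2"]
        power_mult[symmetric] inverse_mult_distrib flip: power_inverse)
  then have "laurent (inverse K)"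
    by (simp only:) (intro laurent_mult laurent_power laurent_uminus laurent_inverse_A)
  then have lF: "laurent F"
    unfolding F_def divide_inverse by (intro laurent_mult l(1) laurent_power laurent_uminus laurent_A)
  have EF: "E = F * (\<Sum>j\<le>N. t_var ^ j)"
    unfolding E_def F_def l(2) ktr_jw by simp
  then have lE: "laurent E" by (simp only: EF) (intro laurent_mult lF laurent_sum laurent_power laurent_t)
  have inv_pow: "inverse t_var ^ k * (t_var ^ k * v) = v" for k v
    using t0 by (simp add: mult.assoc[symmetric] power_mult_distrib[symmetric])
  have lit: "laurent (inverse t_var ^ k)" for k unfolding it by (intro laurent_power laurent_A)
  \<comment> \<open>Solving for \<open>y\<close> divides only by a power of \<open>t\<close>, which
    is a unit among the Laurent polynomials.\<close>
  have "y = inverse t_var ^ (m + 1) * (E - (\<Sum>j\<le>m. t_var ^ j))"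
    unfolding E1 by (simp add: inv_pow del: power_Suc)
  then have "laurent y" by (simp only:) (intro laurent_mult lit laurent_diff lE laurent_sum laurent_power laurent_t)
  then obtain q where q: "y = eval_at t_var q" using laurent_t_local y(1) by blast
  \<comment> \<open>Multiplying \<open>E\<close> by \<open>1 - t\<close> telescopes the geometric
    sum to \<open>1 - t ^ (m + 1)\<close>; the last term is moved into \<open>p\<close>.\<close>
  define p where "p = q * [:1, -1:] - 1"
  have p: "at_t p = y * (1 - t_var) - 1"
    unfolding at_t_eval_at p_def q by (simp add: eval_at_diff eval_at_mult del: mult_pCons_right)
  have E2: "E * (1 - t_var) = 1 + t_var ^ (m + 1) * at_t p"
    unfolding E1 p distrib_right geometric_sum_atMost by (simp add: algebra_simps)
  then have E3: "E = (1 + t_var ^ (m + 1) * at_t p) / (1 - t_var)" using t1 by (simp add: field_simps)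
  define V' where "V' = (-1) ^ (N * (n + c + 1)) * t_half powi (int N * ((int n - 1)\<^sup>2 + int c))"
  have "int N * ((int n - 1)\<^sup>2 + int c) = int N * ((int n - 1)\<^sup>2 + int c - 1) + int N" by (simp add: algebra_simps)
  then have "V' = V * t_half powi int N" unfolding V_def V'_def by (simp only: power_int_add[OF disjI1[OF t_half_nonzero]] mult.assoc)
  then have V': "V = V' * t_half powi (- int N)" by (simp add: power_int_minus)
  have J': "colored_jones_normalized (N + 1) n \<beta> = V' * (E * (1 - t_var) / (1 - t_var ^ (N + 1)))"
    unfolding colored_jones_normalized_def J quantum_int_eq V' using t1 tN by (simp add: field_simps)
  \<comment> \<open>Since \<open>n * (N + 1) = (m + 1) + (n - 1)\<close>, completing 1 to the
    geometric sum in \<open>t ^ (N + 1)\<close> leaves the remainder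
    \<open>t ^ (m + 1) * t ^ (n - 1)\<close>. The denominator keeps \<open>z\<close> in the local
    ring; the Laurent property comes from \<open>F\<close>.\<close>
  define z where "z = (at_t p + t_var ^ (n - 1)) * (1 / (1 - t_var ^ Suc N))"
  have geo: "(\<Sum>i=0..n - 1. t_var ^ (i * (N + 1))) * (1 - t_var ^ (N + 1)) = 1 - t_var ^ (n * (N + 1))"
  proof -
    have "Suc (n - 1) = n" using assms(1) by simp
    then show ?thesis
      using geometric_sum_atMost[of "t_var ^ (N + 1)" "n - 1"]
      by (simp only: power_mult[symmetric] atMost_atLeast0 mult.commute[of "N + 1"])
  qed
  have zE: "E * (1 - t_var) / (1 - t_var ^ (N + 1)) = (\<Sum>i=0..n - 1. t_var ^ (i * (N + 1))) + t_var ^ (m + 1) * z"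
  proof -
    have "t_var ^ (n * (N + 1)) = t_var ^ (m + 1) * t_var ^ (n - 1)"
      unfolding power_add[symmetric]
      by (rule arg_cong[of _ _ "\<lambda>k. t_var ^ k"]) (use assms(1) in \<open>cases n, simp_all add: m_def\<close>)
    then have *: "E * (1 - t_var) = (\<Sum>i=0..n - 1. t_var ^ (i * (N + 1))) * (1 - t_var ^ (N + 1)) + t_var ^ (m + 1) * (at_t p + t_var ^ (n - 1))"
      unfolding geo E2 by (simp add: algebra_simps)
    have "(u * k + v * v') / k = u + v * (v' * (1 / k))" if "k \<noteq> 0" for u v v' k :: ratfun
      using that by (simp add: add_divide_distrib)
    from this[OF tN] show ?thesis unfolding * z_def Suc_eq_plus1 .
  qed
  have "E * (1 - t_var) / (1 - t_var ^ (N + 1)) = F"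
    unfolding EF mult.assoc geometric_sum_atMost using tN by simp
  then have "z = inverse t_var ^ (m + 1) * (F - (\<Sum>i=0..n - 1. t_var ^ (i * (N + 1))))"
    using zE by (simp add: inv_pow del: power_Suc)
  then have "laurent z" by (simp only:) (intro laurent_mult lit laurent_diff lF laurent_sum laurent_power laurent_t)
  moreover have "t_local z"
    unfolding z_def at_t_eval_at by (intro t_local_mult t_local_add t_local_eval_at t_local_power t_local_t t_local_inverse)
  ultimately obtain q' where q': "z = at_t q'" using laurent_t_local unfolding at_t_eval_at by blast
  show ?thesis
    unfolding V_def[symmetric] V'_def[symmetric] m_def[symmetric] J J'
  proof (intro exI conjI)
    show "V * E = V * ((1 + t_var ^ (m + 1) * at_t p) / (1 - t_var))" by (simp only: E3)
    show "V * E = V * ((\<Sum>i=0..m. t_var ^ i) + t_var ^ (m + 1) * at_t q)"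
      by (simp only: E1 q at_t_eval_at atMost_atLeast0)
    show "V' * (E * (1 - t_var) / (1 - t_var ^ (N + 1))) = V' * ((1 + t_var ^ (m + 1) * at_t p) / (1 - t_var ^ (N + 1)))"
      by (simp only: E2)
    show "V' * (E * (1 - t_var) / (1 - t_var ^ (N + 1))) =
        V' * ((\<Sum>i=0..n - 1. t_var ^ (i * (N + 1))) + t_var ^ (m + 1) * at_t q')"
      by (simp only: zE q')
  qed
qed

end
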